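(* $P\Gamma_M$ is a lattice in $\mathrm{PGL}_3(\mathbb{Q}_2)$ of covolume $1/21$ and is generated by $F_{21}$ and (the image of) $\beta_M$. It acts transitively on the vertices, on the edges, and on the $2$-simplices of the Bruhat-Tits building $\mathcal{B}$ of $\mathrm{PGL}_3(\mathbb{Q}_2)$, with (setwise) stabilizers isomorphic to $F_{21}$, $\mathbb{Z}/3$ and $\mathbb{Z}/3$ respectively.
   Context: A lattice in $\mathrm{PGL}_3(\mathbb{Q}_2)$ means a discrete subgroup of finite covolume. Haar measure on $\mathrm{PGL}_3(\mathbb{Q}_2)$ is scaled so that $\mathrm{PGL}_3(\mathbb{Z}_2)$ (the image of $\mathrm{GL}_3(\mathbb{Z}_2)$) has mass $1$; the covolume of $P\Gamma$ is the resulting measure of $\mathrm{PGL}_3(\mathbb{Q}_2)/P\Gamma$. The building $\mathcal{B}$ is the simplicial complex with one vertex for each $\mathbb{Z}_2$-lattice in $\mathbb{Q}_2^3$ (finitely generated $\mathbb{Z}_2$-submodule spanning $\mathbb{Q}_2^3$) up to scaling; two vertices are joined iff, after scaling, one of the lattices contains the other with index $2$; whenever three vertices are pairwise joined there is a $2$-simplex spanning them. Let $\lambda,\bar\lambda=(-1\pm\sqrt{-7})/2$, so $\lambda+\bar\lambda=-1$, $\lambda\bar\lambda=2$; let $\mathcal{O}=\mathbb{Z}+\lambda\mathbb{Z}$ be the ring of integers of $\mathbb{Q}(\sqrt{-7})=\mathbb{Q}(\lambda)$, and $\theta=\lambda-\bar\lambda=\sqrt{-7}$. Embed $\mathbb{Q}(\lambda)$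 in $\mathbb{Q}_2$ so that $\bar\lambda$ maps to a unit of $\mathbb{Z}_2$ and $\lambda$ to twice a unit. On $\mathbb{Q}(\lambda)^3$ use the Hermitian form $\langle x|y\rangle=\frac12\sum x_i\bar y_i$. Define $$L=\{(x_1,x_2,x_3)\in\mathcal{O}^3 : x_i\equiv x_j \bmod \bar\lambda \text{ for all } i,j,\ \text{and } x_1+x_2+x_3\equiv 0\bmod\lambda\},$$ $$M=\{x\in L:\langle x|s\rangle\equiv 0 \bmod \theta\},\qquad s=(\lambda,-\lambda^2,\lambda^3).$$ Let $M[\frac12]=M\otimes_{\mathcal{O}}\mathcal{O}[\frac12]\subseteq\mathbb{Q}(\lambda)^3$, let $\Gamma_{M}$ be the group of all $\mathcal{O}[\frac12]$-linear automorphisms of $M[\frac12]$ preserving $\langle\cdot|\cdot\rangle$, regarded as a subgroup of $\mathrm{GL}_3(\mathbb{Q}(\lambda))\subseteq\mathrm{GL}_3(\mathbb{Q}_2)$, and let $P\Gamma_{M}$ be its image in $\mathrm{PGL}_3(\mathbb{Q}_2)$ (equivalently its quotient by its center, which consists of scalars). $F_{21}$ denotes the nonabelian group of order $21$; the isometry group $\mathrm{Isom}\,M$ of $M$ over $\mathcal{O}$ is isomorphic to $\{\pm1\}\times F_{21}$, and the subgroup $F_{21}\subseteq P\Gamma_M$ in the statement is the image of $\mathrm{Isom}\,M$. The vectors $e_1=(-\bar\lambda^2,-\bar\lambda,0)$, $e_2=(\lambda,\lambda,\lambda)$, $e_3=(1,\lambda^2,-1)$ form an $\mathcal{O}$-basis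 of $M$ with $\langle e_i|e_i\rangle=3$ and $\langle e_i|e_j\rangle=\bar\lambda$ for $i<j$, and $\beta_M\in\Gamma_M$ is the linear map $e_1\mapsto e_2$, $e_2\mapsto e_3$, $e_3\mapsto(\lambda/\bar\lambda)e_1$. *)

theory Defs
  imports
    "HOL-Analysis.Analysis"
    "HOL-Computational_Algebra.Fraction_Field"
    "HOL-Algebra.Left_Coset"
    "HOL-Algebra.Group_Action"
    "HOL-Algebra.Generated_Groups"
    "HOL-Algebra.Elementary_Groups"
begin

section \<open>The ring of 2-adic integers and the field of 2-adic numbers\<close>

text \<open>The inverse limit of the rings of integers modulo \<open>2 ^ n\<close>, with canonical representatives.\<close>

typedef adic2_int = "{x :: nat \<Rightarrow> int. \<forall>n. x n = x (Suc n) mod 2 ^ n}"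
  by (rule exI[of _ "\<lambda>_. 0"]) simp

setup_lifting type_definition_adic2_int

lemma mod_2_power_Suc: "(a mod 2 ^ Suc n) mod 2 ^ n = (a mod 2 ^ n :: int)"
  by (simp add: mod_mod_cancel)

instantiation adic2_int :: comm_ring_1
begin

lift_definition zero_adic2_int :: adic2_int is "\<lambda>_. 0" by simp
lift_definition one_adic2_int :: adic2_int is "\<lambda>n. 1 mod 2 ^ n" by (simp only: mod_2_power_Suc)
lift_definition plus_adic2_int :: "adic2_int \<Rightarrow> adic2_int \<Rightarrow> adic2_int" is "\<lambda>x y n. (x n + y n) mod 2 ^ n"
  by (metis mod_add_eq mod_2_power_Suc)
lift_definition minus_adic2_int :: "adic2_int \<Rightarrow> adic2_int \<Rightarrow> adic2_int" is "\<lambda>x y n. (x n - y n) mod 2 ^ n"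
  by (metis mod_diff_eq mod_2_power_Suc)
lift_definition uminus_adic2_int :: "adic2_int \<Rightarrow> adic2_int" is "\<lambda>x n. (- x n) mod 2 ^ n"
  by (metis mod_minus_eq mod_2_power_Suc)
lift_definition times_adic2_int :: "adic2_int \<Rightarrow> adic2_int \<Rightarrow> adic2_int" is "\<lambda>x y n. (x n * y n) mod 2 ^ n"
  by (metis mod_mult_eq mod_2_power_Suc)

lemma adic2_int_rep_mod: "Rep_adic2_int x n mod 2 ^ n = Rep_adic2_int x n"
  using Rep_adic2_int[of x] by (metis (mono_tags, lifting) mem_Collect_eq mod_mod_trivial)

lemma adic2_int_rep_mod_le: "m \<le> n \<Longrightarrow> Rep_adic2_int x n mod 2 ^ m = Rep_adic2_int x m"
proof (induction n rule: dec_induct)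
  case base
  show ?case by (rule adic2_int_rep_mod)
next
  case (step n)
  have "Rep_adic2_int x (Suc n) mod 2 ^ m = (Rep_adic2_int x (Suc n) mod 2 ^ n) mod 2 ^ m"
    using step by (simp add: mod_mod_cancel le_imp_power_dvd)
  also have "Rep_adic2_int x (Suc n) mod 2 ^ n = Rep_adic2_int x n"
    using Rep_adic2_int[of x] by (metis (mono_tags, lifting) mem_Collect_eq)
  finally show ?case using step by simp
qed

lemma adic2_int_eqI: "(\<And>n. Rep_adic2_int x n = Rep_adic2_int y n) \<Longrightarrow> x = y"
  by (simp add: Rep_adic2_int_inject[symmetric] ext)

instance
proof
  fix a b c :: adic2_int
  show "a + b + c = a + (b + c)"
    by (rule adic2_int_eqI) (simp add: plus_adic2_int.rep_eq mod_simps add.assoc)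
  show "a + b = b + a"
    by (rule adic2_int_eqI) (simp add: plus_adic2_int.rep_eq add.commute)
  show "0 + a = a"
    by (rule adic2_int_eqI) (simp add: plus_adic2_int.rep_eq zero_adic2_int.rep_eq adic2_int_rep_mod)
  show "- a + a = 0"
    by (rule adic2_int_eqI) (simp add: plus_adic2_int.rep_eq zero_adic2_int.rep_eq uminus_adic2_int.rep_eq mod_simps)
  show "a - b = a + - b"
    by (rule adic2_int_eqI) (simp add: plus_adic2_int.rep_eq minus_adic2_int.rep_eq uminus_adic2_int.rep_eq mod_simps)
  show "a * b * c = a * (b * c)"
    by (rule adic2_int_eqI) (simp add: times_adic2_int.rep_eq mod_simps mult.assoc)
  show "a * b = b * a"
    by (rule adic2_int_eqI) (simp add: times_adic2_int.rep_eq mult.commute)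
  show "1 * a = a"
    by (rule adic2_int_eqI)
      (metis times_adic2_int.rep_eq one_adic2_int.rep_eq mod_mult_left_eq mult_1 adic2_int_rep_mod)
  show "(a + b) * c = a * c + b * c"
    by (rule adic2_int_eqI) (simp add: times_adic2_int.rep_eq plus_adic2_int.rep_eq mod_simps distrib_right)
  have "Rep_adic2_int 0 1 \<noteq> Rep_adic2_int 1 1"
    by (simp add: zero_adic2_int.rep_eq one_adic2_int.rep_eq)
  then show "(0 :: adic2_int) \<noteq> 1" by metis
qed

end

instance adic2_int :: idom
proof
  fix a b :: adic2_int
  assume "a \<noteq> 0" "b \<noteq> 0"
  then obtain m n where m: "Rep_adic2_int a m \<noteq> 0" and n: "Rep_adic2_int b n \<noteq> 0"
    by (metis adic2_int_eqI zero_adic2_int.rep_eq)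
  let ?x = "Rep_adic2_int a (m + n)" and ?y = "Rep_adic2_int b (m + n)"
  have "\<not> 2 ^ m dvd ?x" "\<not> 2 ^ n dvd ?y"
    using m n adic2_int_rep_mod_le[of m "m + n" a] adic2_int_rep_mod_le[of n "m + n" b]
    by (metis dvd_imp_mod_0 le_add1, metis dvd_imp_mod_0 le_add2)
  then have "\<not> 2 ^ (m + n) dvd ?x * ?y"
  proof -
    assume nx: "\<not> 2 ^ m dvd ?x" and ny: "\<not> 2 ^ n dvd ?y"
    have x0: "?x \<noteq> 0" and y0: "?y \<noteq> 0" using nx ny by auto
    have p: "prime_elem (2 :: int)" by (simp add: prime_imp_prime_elem)
    have "multiplicity 2 ?x < m" "multiplicity 2 ?y < n"
      using nx ny x0 y0 by (simp_all add: power_dvd_iff_le_multiplicity not_le)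
    then have "multiplicity 2 (?x * ?y) < m + n"
      using p x0 y0 by (simp add: prime_elem_multiplicity_mult_distrib)
    then show ?thesis using x0 y0 by (simp add: power_dvd_iff_le_multiplicity)
  qed
  then have "Rep_adic2_int (a * b) (m + n) \<noteq> 0"
    unfolding times_adic2_int.rep_eq by (metis mod_eq_0_iff_dvd)
  then show "a * b \<noteq> 0" by (metis zero_adic2_int.rep_eq)
qed

text \<open>The field of 2-adic numbers is a copy of the fraction field of \<open>adic2_int\<close>; it is a type of its own
  so that it can carry the 2-adic topology.\<close>

typedef adic2 = "UNIV :: adic2_int fract set" ..

setup_lifting type_definition_adic2

instantiation adic2 :: field
begin

lift_definition zero_adic2 :: adic2 is 0 .
lift_definition one_adic2 :: adic2 is 1 .
lift_definition plus_adic2 :: "adic2 \<Rightarrow> adic2 \<Rightarrow> adic2" is "(+)" .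
lift_definition minus_adic2 :: "adic2 \<Rightarrow> adic2 \<Rightarrow> adic2" is "(-)" .
lift_definition uminus_adic2 :: "adic2 \<Rightarrow> adic2" is uminus .
lift_definition times_adic2 :: "adic2 \<Rightarrow> adic2 \<Rightarrow> adic2" is "(*)" .
lift_definition inverse_adic2 :: "adic2 \<Rightarrow> adic2" is inverse .
lift_definition divide_adic2 :: "adic2 \<Rightarrow> adic2 \<Rightarrow> adic2" is "(/)" .

instance
proof
  fix a b c :: adic2
  show "a * b * c = a * (b * c)" by transfer (rule mult.assoc)
  show "a * b = b * a" by transfer (rule mult.commute)
  show "1 * a = a" by transfer (rule mult_1)
  show "a + b + c = a + (b + c)" by transfer (rule add.assoc)
  show "a + b = b + a" by transfer (rule add.commute)
  show "0 + a = a" by transfer (rule add_0)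
  show "- a + a = 0" by transfer (rule left_minus)
  show "a - b = a + - b" by transfer (rule diff_conv_add_uminus)
  show "(a + b) * c = a * c + b * c" by transfer (rule distrib_right)
  show "(0 :: adic2) \<noteq> 1" by transfer (rule zero_neq_one)
  show "a \<noteq> 0 \<Longrightarrow> inverse a * a = 1" by transfer (rule left_inverse)
  show "a div b = a * inverse b" by transfer (rule divide_inverse)
  show "inverse (0 :: adic2) = 0" by transfer (rule inverse_zero)
qed

end

definition of_adic2_int :: "adic2_int \<Rightarrow> adic2"
  where "of_adic2_int z = Abs_adic2 (Fract z 1)"

lemma of_adic2_int_add: "of_adic2_int (x + y) = of_adic2_int x + of_adic2_int y"
  unfolding of_adic2_int_def plus_adic2.abs_eq by simp

lemma of_adic2_int_mult: "of_adic2_int (x * y) = of_adic2_int x * of_adic2_int y"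
  unfolding of_adic2_int_def times_adic2.abs_eq by simp

lemma of_adic2_int_1: "of_adic2_int 1 = 1"
  unfolding of_adic2_int_def one_adic2_def One_fract_def ..

lemma of_nat_adic2_int_rep: "Rep_adic2_int (of_nat k) n = int k mod 2 ^ n"
proof (induction k)
  case 0
  then show ?case by (simp add: zero_adic2_int.rep_eq)
next
  case (Suc k)
  have "Rep_adic2_int (of_nat (Suc k)) n = (1 mod 2 ^ n + int k mod 2 ^ n) mod 2 ^ n"
    unfolding of_nat_Suc plus_adic2_int.rep_eq one_adic2_int.rep_eq Suc ..
  also have "\<dots> = int (Suc k) mod 2 ^ n" unfolding mod_add_eq by simp
  finally show ?case .
qed

instance adic2_int :: ring_char_0
proof
  show "inj (of_nat :: nat \<Rightarrow> adic2_int)"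
  proof (rule injI)
    fix k l :: nat
    assume "(of_nat k :: adic2_int) = of_nat l"
    then have eq: "int k mod 2 ^ (k + l) = int l mod 2 ^ (k + l)"
      by (metis of_nat_adic2_int_rep)
    have "k < 2 ^ (k + l)" "l < 2 ^ (k + l)"
      by (meson le_add1 le_add2 le_less_trans less_exp le_less_trans[OF le_add1 less_exp])+
    then have "int k < 2 ^ (k + l)" "int l < 2 ^ (k + l)"
      by (metis of_nat_less_iff of_nat_numeral of_nat_power)+
    then show "k = l" using eq by simp
  qed
qed

lemma of_adic2_int_inject: "of_adic2_int x = of_adic2_int y \<longleftrightarrow> x = y"
  by (simp add: of_adic2_int_def Abs_adic2_inject eq_fract)

lemma of_adic2_int_of_nat: "of_adic2_int (of_nat k) = of_nat k"
proof (induction k)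
  case 0
  show ?case
    by (metis add_cancel_right_right of_adic2_int_add of_nat_0)
next
  case (Suc k)
  then show ?case by (simp add: of_adic2_int_add of_adic2_int_1)
qed

instance adic2 :: field_char_0
proof
  show "inj (of_nat :: nat \<Rightarrow> adic2)"
    by (rule injI) (metis of_adic2_int_of_nat of_adic2_int_inject of_nat_eq_iff)
qed

instantiation adic2 :: topological_space
begin

definition open_adic2 :: "adic2 set \<Rightarrow> bool"
  where "open_adic2 U \<longleftrightarrow> (\<forall>x\<in>U. \<exists>n. \<forall>z. x + of_adic2_int (2 ^ n * z) \<in> U)"

instance
proof
  fix S T :: "adic2 set"
  assume S: "open S" and T: "open T"
  show "open (S \<inter> T)"
    unfolding open_adic2_def
  proof
    fix x assume x: "x \<in> S \<inter> T"
    obtain m where m: "\<And>z. x + of_adic2_int (2 ^ m * z) \<in> S"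
      using S x unfolding open_adic2_def by blast
    obtain n where n: "\<And>z. x + of_adic2_int (2 ^ n * z) \<in> T"
      using T x unfolding open_adic2_def by blast
    have "x + of_adic2_int (2 ^ (m + n) * z) \<in> S \<inter> T" for z
      using m[of "2 ^ n * z"] n[of "2 ^ m * z"] by (simp add: power_add mult_ac)
    then show "\<exists>n. \<forall>z. x + of_adic2_int (2 ^ n * z) \<in> S \<inter> T" by blast
  qed
next
  show "open (UNIV :: adic2 set)"
    by (simp add: open_adic2_def)
next
  fix K :: "adic2 set set"
  assume K: "\<forall>S\<in>K. open S"
  show "open (\<Union>K)"
    unfolding open_adic2_def
  proof
    fix x assume "x \<in> \<Union>K"
    then obtain S where S: "S \<in> K" "x \<in> S" by blast
    then obtain n where "\<forall>z. x + of_adic2_int (2 ^ n * z) \<in> S"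
      using K unfolding open_adic2_def by meson
    then show "\<exists>n. \<forall>z. x + of_adic2_int (2 ^ n * z) \<in> \<Union>K"
      using S(1) by (meson UnionI)
  qed
qed

end


section \<open>Lattices and covolumes in locally compact groups\<close>

text \<open>The quotient of \<open>X\<close> by a partition \<open>P\<close> of its underlying set: the preimage of
  \<open>U \<subseteq> P\<close> under the projection is \<open>\<Union>U\<close>.\<close>

definition quotient_topology :: "'a topology \<Rightarrow> 'a set set \<Rightarrow> 'a set topology"
  where "quotient_topology X P = topology (\<lambda>U. U \<subseteq> P \<and> openin X (\<Union>U))"

lemma openin_quotient_topology:
  assumes P: "disjoint P"
  shows "openin (quotient_topology X P) U \<longleftrightarrow> U \<subseteq> P \<and> openin X (\<Union>U)"
proof -
  have "\<Union>(S \<inter> T) = \<Union>S \<inter> \<Union>T" if "S \<subseteq> P" "T \<subseteq> P" for S T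
    proof
    show "\<Union>S \<inter> \<Union>T \<subseteq> \<Union>(S \<inter> T)"
      using that disjointD[OF P] by blast
  qed blast
  then have 1: "\<lbrakk>S \<subseteq> P \<and> openin X (\<Union>S); T \<subseteq> P \<and> openin X (\<Union>T)\<rbrakk>
      \<Longrightarrow> S \<inter> T \<subseteq> P \<and> openin X (\<Union>(S \<inter> T))" for S T
    by (metis openin_Int inf.coboundedI1)
  have 2: "\<Union>\<K> \<subseteq> P \<and> openin X (\<Union>(\<Union>\<K>))"
    if K: "\<forall>S\<in>\<K>. S \<subseteq> P \<and> openin X (\<Union>S)" for \<K>
  proof
    show "\<Union>\<K> \<subseteq> P" using K by blast
    have "\<Union>(\<Union>\<K>) = \<Union>(Union ` \<K>)" by blast
    moreover have "openin X (\<Union>(Union ` \<K>))" using K by blast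
    ultimately show "openin X (\<Union>(\<Union>\<K>))" by simp
  qed
  have "istopology (\<lambda>U. U \<subseteq> P \<and> openin X (\<Union>U))"
    unfolding istopology_def using 1 2 by blast
  then show ?thesis
    by (simp add: quotient_topology_def topology_inverse')
qed

definition borel_sets :: "'a topology \<Rightarrow> 'a set set"
  where "borel_sets X = sigma_sets (topspace X) {U. openin X U}"

definition haar_measure :: "('a, 'b) monoid_scheme \<Rightarrow> 'a topology \<Rightarrow> 'a measure \<Rightarrow> bool"
  where "haar_measure G X \<mu> \<longleftrightarrow>
    space \<mu> = carrier G \<and> sets \<mu> = borel_sets X \<and>
    (\<forall>g\<in>carrier G. \<forall>A\<in>sets \<mu>. emeasure \<mu> (g <#\<^bsub>G\<^esub> A) = emeasure \<mu> A) \<and>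
    (\<forall>K. compactin X K \<longrightarrow> emeasure \<mu> K < \<infinity>) \<and>
    (\<forall>A\<in>sets \<mu>. emeasure \<mu> A = (INF U\<in>{U. openin X U \<and> A \<subseteq> U}. emeasure \<mu> U)) \<and>
    (\<forall>U. openin X U \<longrightarrow> emeasure \<mu> U = (SUP K\<in>{K. compactin X K \<and> K \<subseteq> U}. emeasure \<mu> K)) \<and>
    emeasure \<mu> (carrier G) \<noteq> 0"

text \<open>The measure \<open>\<nu>\<close> that \<open>\<mu>\<close> induces on the space of left cosets of a discrete subgroup \<open>H\<close> is
  given by Weil's formula with the counting measure on \<open>H\<close>.\<close>

definition quotient_measure ::
    "('a, 'b) monoid_scheme \<Rightarrow> 'a topology \<Rightarrow> 'a measure \<Rightarrow> 'a set \<Rightarrow> 'a set measure \<Rightarrow> bool"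
  where "quotient_measure G X \<mu> H \<nu> \<longleftrightarrow>
    space \<nu> = lcosets\<^bsub>G\<^esub> H \<and>
    sets \<nu> = borel_sets (quotient_topology X (lcosets\<^bsub>G\<^esub> H)) \<and>
    (\<forall>A\<in>sets \<mu>. emeasure \<mu> A = (\<integral>\<^sup>+ C. emeasure (count_space C) (A \<inter> C) \<partial>\<nu>))"

definition has_covolume ::
    "('a, 'b) monoid_scheme \<Rightarrow> 'a topology \<Rightarrow> 'a measure \<Rightarrow> 'a set \<Rightarrow> ennreal \<Rightarrow> bool"
  where "has_covolume G X \<mu> H c \<longleftrightarrow>
    (\<exists>\<nu>. quotient_measure G X \<mu> H \<nu> \<and> emeasure \<nu> (lcosets\<^bsub>G\<^esub> H) = c)"

definition discrete_subgroup :: "('a, 'b) monoid_scheme \<Rightarrow> 'a topology \<Rightarrow> 'a set \<Rightarrow> bool"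
  where "discrete_subgroup G X H \<longleftrightarrow> subgroup H G \<and> subtopology X H = discrete_topology H"

definition lattice_subgroup ::
    "('a, 'b) monoid_scheme \<Rightarrow> 'a topology \<Rightarrow> 'a measure \<Rightarrow> 'a set \<Rightarrow> bool"
  where "lattice_subgroup G X \<mu> H \<longleftrightarrow>
    discrete_subgroup G X H \<and> (\<exists>c<\<infinity>. has_covolume G X \<mu> H c)"


section \<open>The group \<open>PGL\<^sub>3\<close> over the 2-adic numbers\<close>

definition GL3 :: "(adic2^3^3) monoid"
  where "GL3 = \<lparr>carrier = {A. invertible A}, mult = (**), one = mat 1\<rparr>"

definition scalars3 :: "(adic2^3^3) set"
  where "scalars3 = {mat c | c. c \<noteq> 0}"

definition PGL3 :: "(adic2^3^3) set monoid"
  where "PGL3 = GL3 Mod scalars3"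

definition to_PGL3 :: "adic2^3^3 \<Rightarrow> (adic2^3^3) set"
  where "to_PGL3 A = scalars3 #>\<^bsub>GL3\<^esub> A"

definition PGL3_topology :: "(adic2^3^3) set topology"
  where "PGL3_topology = quotient_topology (top_of_set (carrier GL3)) (carrier PGL3)"

definition PGL3_int :: "(adic2^3^3) set set"
  where "PGL3_int = {to_PGL3 (map_matrix of_adic2_int A) | A. invertible A}"


section \<open>The building\<close>

global_interpretation adic2_int_module: Modules.module "\<lambda>z (x :: adic2^3). of_adic2_int z *s x"
  by standard (simp_all add: of_adic2_int_add of_adic2_int_mult of_adic2_int_1
      vector_add_ldistrib vector_sadd_rdistrib vector_smult_assoc)

definition adic2_lattices :: "(adic2^3) set set"
  where "adic2_lattices =
    {L. (\<exists>S. finite S \<and> L = adic2_int_module.span S) \<and> vec.span L = UNIV}"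

definition homothety_class :: "(adic2^3) set \<Rightarrow> (adic2^3) set set"
  where "homothety_class L = {(\<lambda>x. c *s x) ` L | c. c \<noteq> 0}"

definition building_vertices :: "(adic2^3) set set set"
  where "building_vertices = homothety_class ` adic2_lattices"

definition contains_with_index_2 :: "'a :: ab_group_add set \<Rightarrow> 'a set \<Rightarrow> bool"
  where "contains_with_index_2 L L' \<longleftrightarrow> L' \<subseteq> L \<and> card ((\<lambda>x. (\<lambda>y. x + y) ` L') ` L) = 2"

definition joined :: "(adic2^3) set set \<Rightarrow> (adic2^3) set set \<Rightarrow> bool"
  where "joined v w \<longleftrightarrow>
    (\<exists>L\<in>v. \<exists>L'\<in>w. contains_with_index_2 L L' \<or> contains_with_index_2 L' L)"

definition building_simplices :: "nat \<Rightarrow> (adic2^3) set set set set"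
  where "building_simplices k =
    {\<sigma>. \<sigma> \<subseteq> building_vertices \<and> card \<sigma> = k + 1 \<and> pairwise joined \<sigma>}"

abbreviation building_edges :: "(adic2^3) set set set set"
  where "building_edges \<equiv> building_simplices 1"

abbreviation building_triangles :: "(adic2^3) set set set set"
  where "building_triangles \<equiv> building_simplices 2"

text \<open>Elements of \<open>PGL3\<close> and vertices are sets of representatives, so the action multiplies
  representatives.\<close>

definition vertex_map :: "(adic2^3^3) set \<Rightarrow> (adic2^3) set set \<Rightarrow> (adic2^3) set set"
  where "vertex_map g v = {(\<lambda>x. A *v x) ` L | A L. A \<in> g \<and> L \<in> v}"

definition vertex_action :: "(adic2^3^3) set \<Rightarrow> (adic2^3) set set \<Rightarrow> (adic2^3) set set"
  where "vertex_action g = (\<lambda>v\<in>building_vertices. vertex_map g v)"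

definition simplex_action ::
    "nat \<Rightarrow> (adic2^3^3) set \<Rightarrow> (adic2^3) set set set \<Rightarrow> (adic2^3) set set set"
  where "simplex_action k g = (\<lambda>\<sigma>\<in>building_simplices k. vertex_map g ` \<sigma>)"


section \<open>The Hermitian lattice \<open>M\<close>\<close>

definition lam :: complex
  where "lam = Complex (- 1 / 2) (sqrt 7 / 2)"

definition theta :: complex
  where "theta = lam - cnj lam"

definition Q_lam :: "complex set"
  where "Q_lam = {of_rat a + of_rat b * lam | a b. True}"

definition O_lam :: "complex set"
  where "O_lam = {of_int a + of_int b * lam | a b. True}"

definition cong_O :: "complex \<Rightarrow> complex \<Rightarrow> complex \<Rightarrow> bool"
  where "cong_O x y m \<longleftrightarrow> (\<exists>d\<in>O_lam. x - y = m * d)"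

definition herm :: "complex^3 \<Rightarrow> complex^3 \<Rightarrow> complex"
  where "herm x y = 1 / 2 * (\<Sum>i\<in>UNIV. x $ i * cnj (y $ i))"

definition L_lattice :: "(complex^3) set"
  where "L_lattice = {x. (\<forall>i. x $ i \<in> O_lam) \<and> (\<forall>i j. cong_O (x $ i) (x $ j) (cnj lam)) \<and>
    cong_O (x $ 1 + x $ 2 + x $ 3) 0 lam}"

definition s_vec :: "complex^3"
  where "s_vec = vector [lam, - (lam ^ 2), lam ^ 3]"

definition M_lattice :: "(complex^3) set"
  where "M_lattice = {x \<in> L_lattice. cong_O (herm x s_vec) 0 theta}"

definition M_half :: "(complex^3) set"
  where "M_half = {(1 / 2 ^ n) *s x | n x. x \<in> M_lattice}"

text \<open>The isometries of a module \<open>X\<close> that spans \<open>\<rat>(\<lambda>)\<^sup>3\<close>, each extended to a linear map of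
  \<open>\<rat>(\<lambda>)\<^sup>3\<close> and written as a matrix.\<close>

definition isometries :: "(complex^3) set \<Rightarrow> (complex^3^3) set"
  where "isometries X = {A. (\<forall>i j. A $ i $ j \<in> Q_lam) \<and> (\<lambda>x. A *v x) ` X = X \<and>
    (\<forall>x\<in>X. \<forall>y\<in>X. herm (A *v x) (A *v y) = herm x y)}"

definition e1 :: "complex^3"
  where "e1 = vector [- (cnj lam ^ 2), - cnj lam, 0]"

definition e2 :: "complex^3"
  where "e2 = vector [lam, lam, lam]"

definition e3 :: "complex^3"
  where "e3 = vector [1, lam ^ 2, - 1]"

definition beta_M :: "complex^3^3"
  where "beta_M = (THE B. B *v e1 = e2 \<and> B *v e2 = e3 \<and> B *v e3 = (lam / cnj lam) *s e1)"

lemma beta_M_exists_unique: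
  "\<exists>!B. B *v e1 = e2 \<and> B *v e2 = e3 \<and> B *v e3 = (lam / cnj lam) *s e1"
proof -
  define E :: "complex^3^3" where "E = transpose (vector [e1, e2, e3])"
  define F :: "complex^3^3" where "F = transpose (vector [e2, e3, (lam / cnj lam) *s e1])"
  have "det E \<noteq> 0" 
    unfolding det_3 E_def transpose_def e1_def e2_def e3_def 
    by (simp add: lam_def complex_eq_iff power2_eq_square algebra_simps)
  then have "invertible E" by (simp add: invertible_det_nz)
  have "(B *v e1 = e2 \<and> B *v e2 = e3 \<and> B *v e3 = (lam / cnj lam) *s e1) \<longleftrightarrow> B ** E = F" for B
    unfolding E_def F_def vec_eq_iff forall_3
    by (simp add: matrix_matrix_mult_def matrix_vector_mult_def transpose_def) blast
  moreover obtain E' where E': "E ** E' = mat 1" "E' ** E = mat 1"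
    using \<open>invertible E\<close> unfolding invertible_def by blast
  have "B ** E = F \<longleftrightarrow> B = F ** E'" for B
  proof
    assume "B ** E = F"
    then have "F ** E' = B ** (E ** E')" by (simp only: matrix_mul_assoc)
    then show "B = F ** E'" by (simp only: E' matrix_mul_rid)
  next
    assume "B = F ** E'"
    then have "B ** E = F ** (E' ** E)" by (simp only: matrix_mul_assoc)
    then show "B ** E = F" by (simp only: E' matrix_mul_rid)
  qed
  ultimately show ?thesis by simp
qed

definition adic2_embedding :: "(complex \<Rightarrow> adic2) \<Rightarrow> bool"
  where "adic2_embedding \<iota> \<longleftrightarrow>
    \<iota> 1 = 1 \<and>
    (\<forall>x\<in>Q_lam. \<forall>y\<in>Q_lam. \<iota> (x + y) = \<iota> x + \<iota> y \<and> \<iota> (x * y) = \<iota> x * \<iota> y) \<and>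
    (\<exists>u. u dvd 1 \<and> \<iota> (cnj lam) = of_adic2_int u) \<and>
    (\<exists>u. u dvd 1 \<and> \<iota> lam = 2 * of_adic2_int u)"

lemma lam_square: "lam * lam = - lam - 2"
  by (simp add: lam_def complex_eq_iff)

lemma cnj_lam: "cnj lam = - 1 - lam"
  by (simp add: lam_def complex_eq_iff)

lemma lam_root_exists:
  "\<exists>a :: int. even a \<and> 2 ^ n dvd a * a + a + 2"
proof (induction n)
  case 0
  show ?case by (rule exI[of _ 0]) simp
next
  case (Suc n)
  then obtain a k :: int where a: "even a" and k: "a * a + a + 2 = 2 ^ n * k" by (auto simp: dvd_def)
  show ?case
  proof (cases "n = 0 \<or> even k")
    case True
    then show ?thesis
    proof
      assume "n = 0"
      then show ?thesis by (intro exI[of _ 0]) simp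
    next
      assume "even k"
      then show ?thesis using a k by (intro exI[of _ a]) auto
    qed
  next
    case False
    then obtain m where n: "n = Suc m" by (cases n) auto
    have "(a + 2 ^ n) * (a + 2 ^ n) + (a + 2 ^ n) + 2 = 2 ^ n * (k + 2 * a + 1 + 2 ^ n)"
      using k by (simp add: algebra_simps)
    moreover have "even (k + 2 * a + 1 + 2 ^ n)" using False n by simp
    ultimately have "2 ^ Suc n dvd (a + 2 ^ n) * (a + 2 ^ n) + (a + 2 ^ n) + 2"
      by (metis mult_dvd_mono dvd_refl power_Suc2)
    moreover have "even (a + 2 ^ n)" using a n by simp
    ultimately show ?thesis by blast
  qed
qed

lemma lam_root_unique:
  fixes a b :: int
  assumes "even a" "even b" "2 ^ n dvd a * a + a + 2" "2 ^ n dvd b * b + b + 2"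
  shows "a mod 2 ^ n = b mod 2 ^ n"
proof -
  have "2 ^ n dvd (a * a + a + 2) - (b * b + b + 2)" using assms dvd_diff by blast
  also have "(a * a + a + 2) - (b * b + b + 2) = (a - b) * (a + b + 1)" by (simp add: algebra_simps)
  finally have "2 ^ n dvd (a - b) * (a + b + 1)" .
  moreover have "coprime (2 ^ n) (a + b + 1)" using assms by simp
  ultimately have "2 ^ n dvd a - b" using coprime_dvd_mult_left_iff by blast
  then show ?thesis by (simp add: mod_eq_dvd_iff)
qed

text \<open>By Hensel's lemma there is a 2-adic root of the minimal polynomial of \<open>\<lambda>\<close> that is twice a unit.\<close>

lemma adic2_lam_exists:
  "\<exists>y :: adic2_int. (2 * y) * (2 * y) + 2 * y + 2 = 0"
proof -
  obtain a :: "nat \<Rightarrow> int" where a: "\<And>n. even (a n)" "\<And>n. 2 ^ n dvd a n * a n + a n + 2"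
    using lam_root_exists by metis
  define y where "y = (\<lambda>n. (a (Suc n) div 2) mod 2 ^ n)"
  have "y n = y (Suc n) mod 2 ^ n" for n
  proof -
    have "2 ^ Suc n dvd a (Suc (Suc n)) * a (Suc (Suc n)) + a (Suc (Suc n)) + 2"
      by (meson a(2) dvd_trans le_imp_power_dvd le_SucI order_refl)
    then have "a (Suc (Suc n)) mod 2 ^ Suc n = a (Suc n) mod 2 ^ Suc n"
      using a(1) a(2)[of "Suc n"] by (intro lam_root_unique)
    then have "2 ^ Suc n dvd a (Suc (Suc n)) - a (Suc n)" by (simp only: mod_eq_dvd_iff)
    moreover have "a (Suc (Suc n)) - a (Suc n) = 2 * (a (Suc (Suc n)) div 2 - a (Suc n) div 2)"
      using a(1) by (simp add: algebra_simps)
    ultimately have "2 ^ n dvd a (Suc (Suc n)) div 2 - a (Suc n) div 2"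
      by (metis dvd_mult_cancel_left power_Suc zero_neq_numeral)
    then have "(a (Suc (Suc n)) div 2) mod 2 ^ n = (a (Suc n) div 2) mod 2 ^ n"
      by (simp only: mod_eq_dvd_iff)
    then show ?thesis by (simp only: y_def mod_2_power_Suc)
  qed
  then have "Rep_adic2_int (Abs_adic2_int y) = y"
    by (intro Abs_adic2_int_inverse CollectI allI)
  moreover have "Rep_adic2_int 2 n = 2 mod 2 ^ n" for n
    using of_nat_adic2_int_rep[of 2 n] by simp
  ultimately have "Rep_adic2_int (2 * Abs_adic2_int y) n = a (Suc n) mod 2 ^ n" for n
    using a(1)[of "Suc n"] by (simp add: times_adic2_int.rep_eq y_def mod_mult_eq)
  note r = this
  have "Rep_adic2_int ((2 * Abs_adic2_int y) * (2 * Abs_adic2_int y) + 2 * Abs_adic2_int y + 2) n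
     = (a (Suc n) * a (Suc n) + a (Suc n) + 2) mod 2 ^ n" for n
    unfolding plus_adic2_int.rep_eq times_adic2_int.rep_eq[of "2 * Abs_adic2_int y"] r
      \<open>\<And>n. Rep_adic2_int 2 n = 2 mod 2 ^ n\<close>
    by (simp only: mod_simps)
  moreover have "(a (Suc n) * a (Suc n) + a (Suc n) + 2) mod 2 ^ n = 0" for n
    by (meson a(2) dvd_trans le_imp_power_dvd le_SucI order_refl dvd_imp_mod_0)
  ultimately show ?thesis
    by (metis adic2_int_eqI zero_adic2_int.rep_eq)
qed

lemma Q_lam_unique:
  assumes "of_rat a + of_rat b * lam = of_rat c + of_rat d * lam"
  shows "a = c \<and> b = d"
proof -
  have r: "(of_rat q :: complex) = complex_of_real (of_rat q)" for q
    by (cases q) (simp add: of_rat_rat)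
  show ?thesis
    using assms by (auto simp: r lam_def complex_eq_iff)
qed

lemma adic2_embedding_exists: "\<exists>\<iota>. adic2_embedding \<iota>"
proof -
  obtain y :: adic2_int where y: "(2 * y) * (2 * y) + 2 * y + 2 = 0"
    using adic2_lam_exists by blast
  define r where "r = of_adic2_int (2 * y)"
  have "2 * (y * (- 1 - 2 * y)) - 2 * 1 = - ((2 * y) * (2 * y) + 2 * y + 2)" by (simp add: algebra_simps)
  then have "2 * (y * (- 1 - 2 * y)) = 2 * 1"
    unfolding y by (simp only: minus_zero eq_iff_diff_eq_0[symmetric])
  then have u: "y * (- 1 - 2 * y) = 1" by (simp only: mult_cancel_left) simp
  have two: "of_adic2_int 2 = 2" using of_adic2_int_of_nat[of 2] by simp
  have r2: "r * r = - r - 2"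
  proof -
    have "of_adic2_int ((2 * y) * (2 * y) + 2 * y + 2) = r * r + r + 2"
      by (simp only: of_adic2_int_add of_adic2_int_mult[of "2 * y"] two r_def)
    then have "r * r + r + 2 = 0" using y of_adic2_int_of_nat[of 0] by simp
    then show ?thesis by (simp add: algebra_simps add_eq_0_iff)
  qed
  define \<iota> where "\<iota> z = (THE w. \<exists>a b. z = of_rat a + of_rat b * lam \<and> w = of_rat a + of_rat b * r)" for z
  have i: "\<iota> (of_rat a + of_rat b * lam) = of_rat a + of_rat b * r" for a b
    unfolding \<iota>_def by (rule the_equality) (auto dest: Q_lam_unique)
  have add: "\<iota> (x + y) = \<iota> x + \<iota> y" and mult: "\<iota> (x * y) = \<iota> x * \<iota> y"
    if xy: "x \<in> Q_lam" "y \<in> Q_lam" for x y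
  proof -
    obtain a b c d where x: "x = of_rat a + of_rat b * lam" and y: "y = of_rat c + of_rat d * lam"
      using xy unfolding Q_lam_def by blast
    have sum: "x + y = of_rat (a + c) + of_rat (b + d) * lam"
      unfolding x y of_rat_add by (simp add: algebra_simps)
    have "\<iota> x + \<iota> y = of_rat (a + c) + of_rat (b + d) * r"
      unfolding x y i of_rat_add by (simp add: algebra_simps)
    then show "\<iota> (x + y) = \<iota> x + \<iota> y"
      unfolding sum i by simp
    have "x * y = of_rat a * of_rat c + (of_rat a * of_rat d + of_rat b * of_rat c) * lam
        + of_rat b * of_rat d * (lam * lam)"
      unfolding x y by (simp add: algebra_simps)
    also have "\<dots> = of_rat (a * c - 2 * (b * d)) + of_rat (a * d + b * c - b * d) * lam"
      unfolding lam_square of_rat_diff of_rat_add of_rat_mult by (simp add: algebra_simps)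
    finally have xy: "x * y = of_rat (a * c - 2 * (b * d)) + of_rat (a * d + b * c - b * d) * lam" .
    have "\<iota> x * \<iota> y = of_rat a * of_rat c + (of_rat a * of_rat d + of_rat b * of_rat c) * r
        + of_rat b * of_rat d * (r * r)"
      unfolding x y i by (simp add: algebra_simps)
    also have "\<dots> = of_rat (a * c - 2 * (b * d)) + of_rat (a * d + b * c - b * d) * r"
      unfolding r2 of_rat_diff of_rat_add of_rat_mult by (simp add: algebra_simps)
    finally show "\<iota> (x * y) = \<iota> x * \<iota> y"
      unfolding xy i by simp
  qed
  have one: "\<iota> 1 = 1" using i[of 1 0] by simp
  have l: "\<iota> lam = 2 * of_adic2_int y"
    using i[of 0 1] by (simp add: r_def of_adic2_int_mult two)
  have cl: "\<iota> (cnj lam) = of_adic2_int (- 1 - 2 * y)"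
  proof -
    have "of_adic2_int (- 1 - 2 * y) + (1 + r) = 0"
      using of_adic2_int_add[of "- 1 - 2 * y" "1 + 2 * y"] of_adic2_int_of_nat[of 0]
      by (simp add: of_adic2_int_add of_adic2_int_1 r_def)
    then have "of_adic2_int (- 1 - 2 * y) = - 1 - r"
      by (metis eq_neg_iff_add_eq_0 minus_add_distrib uminus_add_conv_diff diff_conv_add_uminus)
    moreover have c: "cnj lam = of_rat (- 1) + of_rat (- 1) * lam"
      by (simp add: cnj_lam)
    have "\<iota> (cnj lam) = of_rat (- 1) + of_rat (- 1) * r"
      unfolding c i ..
    ultimately show ?thesis by (simp add: of_rat_minus)
  qed
  have units: "y dvd 1" "- 1 - 2 * y dvd 1"
    using u by (metis dvd_triv_left, metis dvd_triv_right)
  have "adic2_embedding \<iota>"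
    unfolding adic2_embedding_def
  proof (intro conjI ballI)
    show "\<exists>u. u dvd 1 \<and> \<iota> (cnj lam) = of_adic2_int u"
      by (rule exI[of _ "- 1 - 2 * y"]) (rule conjI[OF units(2) cl])
    show "\<exists>u. u dvd 1 \<and> \<iota> lam = 2 * of_adic2_int u"
      by (rule exI[of _ y]) (rule conjI[OF units(1) l])
  qed (fact one | rule add mult; assumption)+
  then show ?thesis by (rule exI[of adic2_embedding])
qed

definition PGamma_M :: "(complex \<Rightarrow> adic2) \<Rightarrow> (adic2^3^3) set set"
  where "PGamma_M \<iota> = (\<lambda>A. to_PGL3 (map_matrix \<iota> A)) ` isometries M_half"

definition PIsom_M :: "(complex \<Rightarrow> adic2) \<Rightarrow> (adic2^3^3) set set"
  where "PIsom_M \<iota> = (\<lambda>A. to_PGL3 (map_matrix \<iota> A)) ` isometries M_lattice"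

text \<open>The nonabelian group of order 21, as the semidirect product of \<open>\<int>/7\<close> by \<open>\<int>/3\<close> in which the
  generator of \<open>\<int>/3\<close> acts as multiplication by 2.\<close>

definition F21 :: "(nat \<times> nat) monoid"
  where "F21 = \<lparr>carrier = {0..<7} \<times> {0..<3},
    mult = (\<lambda>(a, i) (b, j). ((a + 2 ^ i * b) mod 7, (i + j) mod 3)), one = (0, 0)\<rparr>"

end

theory Submission
  imports Defs
begin

text \<open>
  In the basis \<open>e\<^sub>1, e\<^sub>2, e\<^sub>3\<close> an element of \<open>P\<Gamma>\<^sub>M\<close> is a matrix over \<open>\<O>[1/2]\<close> preserving the Gram matrix,
  and the base vertex \<open>v\<^sub>0\<close> is the class of \<open>M\<close> at the place \<open>\<lambda>\<close>. If such a matrix fixes \<open>v\<^sub>0\<close>, then after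
  multiplication by a power of the norm-one scalar \<open>\<lambda>/\<lambda>\<close>-bar it is integral, together with its inverse,
  at \<open>\<lambda>\<close>; since the Gram matrix has the odd determinant 7, it is then also integral at the conjugate
  place and so lies in \<open>Isom M\<close>. The columns of an element of \<open>Isom M\<close> are vectors of norm 3, and a
  finite search leaves \<open>\<plusminus>\<sigma>\<^sup>a\<rho>\<^sup>i\<close> with \<open>\<sigma>\<close> of order 7 and \<open>\<rho>\<close> of order 3.

  The seven index-2 sublattices of \<open>M\<close> at \<open>\<lambda>\<close> correspond to the nonzero linear forms on \<open>(\<int>/2)\<^sup>3\<close>. The element \<open>\<sigma>\<close>
  permutes them cyclically and \<open>\<beta>\<close> maps \<open>M\<close> to one of them, so every lattice is reached up to scaling
  by words in \<open>\<sigma>\<close> and \<open>\<beta>\<close>. This gives transitivity on vertices and, with the vertex stabilizer, the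
  generation statement; it also gives transitivity on edges, with stabilizer \<open>\<langle>\<rho>\<rangle>\<close>. The element \<open>\<rho>\<close> permutes
  cyclically the three triangles on an edge and \<open>\<beta>\<close> rotates a triangle. No edge is flipped because the
  valuation of the determinant modulo 3 assigns types to the vertices.

  Finally \<open>P\<Gamma>\<^sub>M\<close> is generated by torsion elements, so its right translations preserve the Haar measure.
  As \<open>PGL\<^sub>3 = PGL\<^sub>3(\<int>\<^sub>2) P\<Gamma>\<^sub>M\<close>, the quotient has measure \<open>1/|P\<Gamma>\<^sub>M \<inter> PGL\<^sub>3(\<int>\<^sub>2)| = 1/21\<close>.
\<close>

text \<open>The constants come from the seventh cyclotomic field. Read e1, e2, e3 as 1, zeta, zeta^2
  with zeta + zeta^2 + zeta^4 = lam: then M is the ring Z[zeta] as a module over O, sigma is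
  multiplication by zeta and rho the Galois automorphism taking zeta to zeta^2. In the same basis
  beta is a cyclic shift with one entry replaced by the scalar lam / cnj lam. This scalar has norm
  1, so beta remains an isometry, but it has valuation 1 at lam, so beta moves the lattice to a
  sublattice of index 2. Two obstacles shape the measure-theoretic part. Haar measure is left
  invariant while the quotient consists of cosets g Gamma, so summation over a coset involves right
  translations. And PGL3 over the 2-adic integers fixes the class of the standard lattice instead of
  that of M; the two stabilizers are related by conjugation with an element of the group itself. On
  the building everything is reduced to valuations and parities: an index-2 sublattice is the kernel
  of a linear form modulo 2, so statements about neighbouring lattices become statements about seven
  triples of bits.\<close>

no_notation subset_mset (infix "<#" 50)

text \<open>Along an enumeration of an infinite index set the integral against counting measure
  becomes a series of measurable functions. It serves the sums over the countable group in Weil's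
  formula.\<close>

lemma borel_measurable_nn_integral_count_space:
  fixes f :: "'i \<Rightarrow> 'a \<Rightarrow> ennreal"
  assumes I: "countable I" and f: "\<And>i. i \<in> I \<Longrightarrow> f i \<in> borel_measurable M"
  shows "(\<lambda>x. \<integral>\<^sup>+i. f i x \<partial>count_space I) \<in> borel_measurable M"
proof (cases "finite I")
  case True
  then show ?thesis using f by (simp add: nn_integral_count_space_finite borel_measurable_sum)
next
  case False
  then have bij: "bij_betw (from_nat_into I) UNIV I" using I by (intro bij_betw_from_nat_into)
  have "(\<integral>\<^sup>+i. f i x \<partial>count_space I) = (\<Sum>n. f (from_nat_into I n) x)" for x
    using nn_integral_bij_count_space[OF bij, of "\<lambda>i. f i x"] by (simp add: nn_integral_count_space_nat)
  moreover have "from_nat_into I n \<in> I" for n using False by (intro from_nat_into) auto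
  ultimately show ?thesis using f by simp
qed

section \<open>Covolumes in groups with a countable filtration\<close>

text \<open>The left translates of the \<open>K n\<close> form a base of the topology.
  \<open>K_conj\<close> makes the chain compatible with right translation as well, and
  \<open>K_index\<close> plays the part of compactness of \<open>K 0\<close>. For congruence
  subgroups these axioms are elementary.\<close>

locale filtered_group = group G for G (structure) +
  fixes X :: "'a topology" and K :: "nat \<Rightarrow> 'a set"
  assumes K_subgroup: "subgroup (K n) G"
    and K_Suc: "K (Suc n) \<subseteq> K n"
    and openin_iff: "openin X U \<longleftrightarrow> U \<subseteq> carrier G \<and> (\<forall>g\<in>U. \<exists>n. g <# K n \<subseteq> U)"
    and K_conj: "g \<in> carrier G \<Longrightarrow> \<exists>m. \<forall>k\<in>K m. g \<otimes> k \<otimes> inv g \<in> K n"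
    and K_index: "finite ((\<lambda>k. k <# K n) ` K 0)"
begin

lemma K_sub: "K n \<subseteq> carrier G"
  using K_subgroup subgroup.subset by blast

lemma K_one: "\<one> \<in> K n"
  using K_subgroup subgroup.one_closed by blast

lemma K_mono: "m \<le> n \<Longrightarrow> K n \<subseteq> K m"
  by (rule lift_Suc_antimono_le[of K]) (use K_Suc in auto)

lemma topspace_X: "topspace X = carrier G"
proof -
  have "openin X (carrier G)"
    unfolding openin_iff using K_sub by (auto simp: l_coset_def)
  then show ?thesis
    using openin_iff[of "topspace X"] openin_subset[of X "carrier G"] by auto
qed

lemma mem_l_coset: "x \<in> g <# H \<longleftrightarrow> (\<exists>h\<in>H. x = g \<otimes> h)"
  by (auto simp: l_coset_def)

lemma l_coset_subset: "g \<in> carrier G \<Longrightarrow> g <# K n \<subseteq> carrier G"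
  using K_sub by (simp add: l_coset_subset_G)

lemma l_coset_eq:
  assumes "g \<in> carrier G" "x \<in> g <# K n"
  shows "x <# K n = g <# K n"
  using assms K_subgroup by (metis l_repr_independence)

lemma l_coset_self: "g \<in> carrier G \<Longrightarrow> g \<in> g <# K n"
  using K_subgroup by (simp add: lcos_self)

lemma openin_l_coset: "g \<in> carrier G \<Longrightarrow> openin X (g <# K n)"
  unfolding openin_iff using l_coset_subset l_coset_eq by blast

lemma K_eq_coset: "\<one> <# K n = K n"
  using K_sub by (simp add: lcos_mult_one)

lemma openin_K: "openin X (K n)"
  using openin_l_coset[of \<one> n] by (simp add: K_eq_coset)

lemma r_coset_mult: "A \<subseteq> carrier G \<Longrightarrow> g \<in> carrier G \<Longrightarrow> h \<in> carrier G \<Longrightarrow> A #> g #> h = A #> (g \<otimes> h)"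
  by (rule coset_mult_assoc)

lemma mem_r_coset_iff:
  assumes "A \<subseteq> carrier G" "g \<in> carrier G" "x \<in> carrier G"
  shows "x \<in> A #> g \<longleftrightarrow> x \<otimes> inv g \<in> A"
  using assms unfolding r_coset_def
  by (auto simp: m_assoc subset_iff) (metis inv_closed l_inv m_assoc r_one)

text \<open>The base consists of left cosets, so \<open>g\<close> has to be moved past
  \<open>k\<close>: in \<open>u \<otimes> g \<otimes> k\<close> the factor
  \<open>g \<otimes> k \<otimes> inv g\<close> lies in \<open>K n\<close> for \<open>k\<close> deep
  enough, and \<open>u <# K n\<close> absorbs it.\<close>

lemma openin_r_coset:
  assumes "openin X U" "g \<in> carrier G"
  shows "openin X (U #> g)"
  unfolding openin_iff
proof (intro conjI ballI)
  have U: "U \<subseteq> carrier G" using assms openin_iff by blast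
  then show Ug: "U #> g \<subseteq> carrier G" using assms by (simp add: r_coset_subset_G)
  fix x assume "x \<in> U #> g"
  then obtain u where u: "u \<in> U" "x = u \<otimes> g" by (auto simp: r_coset_def)
  obtain n where n: "u <# K n \<subseteq> U" using assms u unfolding openin_iff by blast
  obtain m where m: "\<forall>k\<in>K m. g \<otimes> k \<otimes> inv g \<in> K n" using K_conj assms by blast
  have "x <# K m \<subseteq> U #> g"
  proof
    fix y assume "y \<in> x <# K m"
    then obtain k where k: "k \<in> K m" "y = x \<otimes> k" by (auto simp: l_coset_def)
    have kc: "k \<in> carrier G" "u \<in> carrier G" "g \<in> carrier G" using k K_sub u U assms by auto
    have "y = (u \<otimes> (g \<otimes> k \<otimes> inv g)) \<otimes> g"
      using kc by (simp add: k u m_assoc)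
    moreover have "u \<otimes> (g \<otimes> k \<otimes> inv g) \<in> U"
      using m k n by (auto simp: l_coset_def)
    ultimately show "y \<in> U #> g" by (auto simp: r_coset_def)
  qed
  then show "\<exists>n. x <# K n \<subseteq> U #> g" by blast
qed

lemma lcosets_disjoint: "subgroup H G \<Longrightarrow> disjoint (lcosets H)"
  by (simp add: disjoint_def lcos_disjoint pairwise_def disjnt_def)

lemma lcosets_eq: "lcosets H = (\<lambda>g. g <# H) ` carrier G"
  by (auto simp: LCOSETS_def)

lemma openin_lcosets: "C \<in> lcosets (K n) \<Longrightarrow> openin X C"
  using openin_l_coset by (auto simp: lcosets_eq)

lemma disjoint_r_cosets:
  assumes I: "I \<subseteq> lcosets (K n)" and g: "g \<in> carrier G"
  shows "disjoint_family_on (\<lambda>C. C #> g) I"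
  unfolding disjoint_family_on_def
proof (intro ballI impI)
  fix C D assume CD: "C \<in> I" "D \<in> I" "C \<noteq> D"
  then have L: "C \<in> lcosets (K n)" "D \<in> lcosets (K n)" using I by auto
  then have sub: "C \<subseteq> carrier G" "D \<subseteq> carrier G" using openin_lcosets openin_iff by blast+
  have "C \<inter> D = {}"
    using lcos_disjoint[OF K_subgroup L] CD by blast
  then show "(C #> g) \<inter> (D #> g) = {}"
    using mem_r_coset_iff[OF sub(1) g] mem_r_coset_iff[OF sub(2) g] r_coset_subset_G[OF sub(1) g] by blast
qed

text \<open>A coset of \<open>K 0\<close> splits into finitely many cosets of \<open>K n\<close>, so
  countably many representatives modulo \<open>K 0\<close> suffice at every level.\<close>

lemma countable_lcosets_K:
  assumes "countable T" "T \<subseteq> carrier G" "\<And>g. g \<in> carrier G \<Longrightarrow> \<exists>t\<in>T. g \<in> t <# K 0"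
  shows "countable (lcosets (K n))"
proof (rule countable_subset)
  show "lcosets (K n) \<subseteq> (\<Union>t\<in>T. (\<lambda>C. t <# C) ` ((\<lambda>k. k <# K n) ` K 0))"
  proof
    fix C assume "C \<in> lcosets (K n)"
    then obtain g where g: "g \<in> carrier G" "C = g <# K n" by (auto simp: lcosets_eq)
    then obtain t k where t: "t \<in> T" "k \<in> K 0" "g = t \<otimes> k" using assms(3) by (fastforce simp: l_coset_def)
    then have "C = t <# (k <# K n)"
      using g assms(2) K_sub by (subst lcos_m_assoc) auto
    with t show "C \<in> (\<Union>t\<in>T. (\<lambda>C. t <# C) ` ((\<lambda>k. k <# K n) ` K 0))" by blast
  qed
  show "countable (\<Union>t\<in>T. (\<lambda>C. t <# C) ` ((\<lambda>k. k <# K n) ` K 0))"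
    using assms(1) by (rule countable_UN) (rule countable_finite[OF finite_imageI[OF K_index]])
qed

end

section \<open>The modular function and right translates of Haar measure\<close>

locale haar_filtered_group = filtered_group +
  fixes \<mu> :: "'a measure"
  assumes haar: "haar_measure G X \<mu>" and mass: "emeasure \<mu> (K 0) = 1"
    and countable_cosets: "countable (lcosets (K n))"
begin

lemma space_mu: "space \<mu> = carrier G"
  and sets_mu: "sets \<mu> = sigma_sets (carrier G) {U. openin X U}"
  and left_invariant: "g \<in> carrier G \<Longrightarrow> A \<in> sets \<mu> \<Longrightarrow> emeasure \<mu> (g <# A) = emeasure \<mu> A"
  and outer_regular: "A \<in> sets \<mu> \<Longrightarrow> emeasure \<mu> A = (INF U\<in>{U. openin X U \<and> A \<subseteq> U}. emeasure \<mu> U)"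
  using haar unfolding haar_measure_def borel_sets_def topspace_X by auto

lemma open_sets: "openin X U \<Longrightarrow> U \<in> sets \<mu>"
  unfolding sets_mu by auto

text \<open>As \<open>K 0\<close> has mass 1, this is the factor by which right translation by
  \<open>g\<close> scales the measure. Values lie in \<open>ennreal\<close>, so infinity has to be
  excluded where it matters.\<close>

definition modulus :: "'a \<Rightarrow> ennreal"
  where "modulus g = emeasure \<mu> (K 0 #> g)"

lemma l_coset_r_coset:
  assumes "A \<subseteq> carrier G" "g \<in> carrier G" "h \<in> carrier G"
  shows "(h <# A) #> g = h <# (A #> g)"
  using assms by (simp add: coset_assoc)

text \<open>\<open>K 0\<close> is a disjoint union of finitely many left cosets of
  \<open>K n\<close>, all of equal measure, and this persists after right translation because left
  translations commute with it. Comparing the count for \<open>g\<close> with the count for the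
  identity shows that every coset is scaled by the same factor as \<open>K 0\<close>.\<close>

lemma emeasure_coset_r_coset:
  assumes g: "g \<in> carrier G" and h: "h \<in> carrier G"
  shows "emeasure \<mu> ((h <# K n) #> g) = modulus g * emeasure \<mu> (h <# K n)"
proof -
  let ?I = "(\<lambda>k. k <# K n) ` K 0"
  have mult: "emeasure \<mu> (K 0 #> g') = of_nat (card ?I) * emeasure \<mu> (K n #> g')"
    if g': "g' \<in> carrier G" for g'
  proof -
    have "K 0 = \<Union>?I"
    proof
      show "K 0 \<subseteq> \<Union>?I" using l_coset_self K_sub by blast
      show "\<Union>?I \<subseteq> K 0"
        using K_mono[of 0 n] K_subgroup[of 0] by (auto simp: l_coset_def intro!: subgroup.m_closed)
    qed
    then have "K 0 #> g' = \<Union>?I #> g'" by simp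
    also have "\<Union>?I #> g' = (\<Union>C\<in>?I. C #> g')" by (auto simp: r_coset_def)
    also have "emeasure \<mu> \<dots> = (\<Sum>C\<in>?I. emeasure \<mu> (C #> g'))"
    proof (rule sum_emeasure[symmetric])
      show "finite ?I" by (rule K_index)
      show "(\<lambda>C. C #> g') ` ?I \<subseteq> sets \<mu>"
        using K_sub g' by (auto intro!: open_sets openin_r_coset openin_l_coset)
      show "disjoint_family_on (\<lambda>C. C #> g') ?I"
        using K_sub g' by (intro disjoint_r_cosets[of _ n]) (auto simp: lcosets_eq)
    qed
    also have "\<dots> = (\<Sum>C\<in>?I. emeasure \<mu> (K n #> g'))"
    proof (rule sum.cong[OF refl])
      fix C assume "C \<in> ?I"
      then obtain k where k: "k \<in> K 0" "C = k <# K n" by blast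
      then have "k \<in> carrier G" "C #> g' = k <# (K n #> g')"
        using K_sub[of n] K_sub[of 0] g' l_coset_r_coset[of "K n" g' k] by auto
      then show "emeasure \<mu> (C #> g') = emeasure \<mu> (K n #> g')"
        using g' by (simp add: left_invariant open_sets openin_r_coset openin_K)
    qed
    finally show ?thesis by simp
  qed
  \<comment> \<open>The same count without translation: the measure of \<open>K n\<close> is the
    reciprocal of its index in \<open>K 0\<close>.\<close>
  have n1: "of_nat (card ?I) * emeasure \<mu> (K n) = 1"
    using mult[of \<one>] mass K_sub by (simp add: coset_mult_one)
  have "emeasure \<mu> (K n #> g) = (of_nat (card ?I) * emeasure \<mu> (K n #> g)) * emeasure \<mu> (K n)"
    using n1 by (metis mult.commute mult.assoc mult.left_neutral)
  then have "emeasure \<mu> (K n #> g) = modulus g * emeasure \<mu> (K n)"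
    using mult[OF g] by (simp add: modulus_def)
  moreover have "emeasure \<mu> ((h <# K n) #> g) = emeasure \<mu> (K n #> g)"
    unfolding l_coset_r_coset[OF K_sub g h] using g h by (simp add: left_invariant open_sets openin_r_coset openin_K)
  moreover have "emeasure \<mu> (h <# K n) = emeasure \<mu> (K n)"
    using h by (simp add: left_invariant open_sets openin_K)
  ultimately show ?thesis by simp
qed

lemma r_coset_UN: "(\<Union>i\<in>I. A i) #> g = (\<Union>i\<in>I. A i #> g)"
  by (auto simp: r_coset_def)

text \<open>\<open>V n\<close> is the union of the cosets of \<open>K n\<close> inside
  \<open>U\<close>, a countable disjoint union of sets that scale correctly. Since \<open>U\<close>
  is open, \<open>V n\<close> increases to \<open>U\<close>, and continuity from below
  applies.\<close>

lemma emeasure_open_r_coset: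
  assumes U: "openin X U" and g: "g \<in> carrier G"
  shows "emeasure \<mu> (U #> g) = modulus g * emeasure \<mu> U"
proof -
  define F where "F n = {C \<in> lcosets (K n). C \<subseteq> U}" for n
  define V where "V n = \<Union>(F n)" for n
  have Fc: "C \<in> F n \<Longrightarrow> \<exists>h\<in>carrier G. C = h <# K n" for C n
    by (auto simp: F_def lcosets_eq)
  \<comment> \<open>Stated for every \<open>g'\<close> so that the translate by \<open>g\<close>
    and, with \<open>\<one>\<close>, the set itself are covered by one computation.\<close>
  have meas: "emeasure \<mu> (V n #> g') = (\<integral>\<^sup>+C. emeasure \<mu> (C #> g') \<partial>count_space (F n))"
    if g': "g' \<in> carrier G" for n g'
  proof -
    have "V n #> g' = (\<Union>C\<in>F n. C #> g')" unfolding V_def by (auto simp: r_coset_def)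
    moreover have "emeasure \<mu> (\<Union>C\<in>F n. C #> g') = (\<integral>\<^sup>+C. emeasure \<mu> (C #> g') \<partial>count_space (F n))"
    proof (rule emeasure_UN_countable)
      show "countable (F n)" unfolding F_def using countable_cosets by (rule countable_subset[rotated]) auto
      show "\<And>C. C \<in> F n \<Longrightarrow> C #> g' \<in> sets \<mu>"
        using g' openin_lcosets[of _ n] openin_r_coset open_sets by (auto simp: F_def)
      show "disjoint_family_on (\<lambda>C. C #> g') (F n)"
        using g' by (intro disjoint_r_cosets[of _ n]) (auto simp: F_def)
    qed
    ultimately show ?thesis by simp
  qed
  have sub: "C \<in> F n \<Longrightarrow> C \<subseteq> carrier G" for C n
    using Fc l_coset_subset by blast
  have step: "emeasure \<mu> (V n #> g) = modulus g * emeasure \<mu> (V n)" for n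
  proof -
    have "emeasure \<mu> (V n #> g) = (\<integral>\<^sup>+C. modulus g * emeasure \<mu> (C #> \<one>) \<partial>count_space (F n))"
      unfolding meas[OF g]
    proof (rule nn_integral_cong)
      fix C assume "C \<in> space (count_space (F n))"
      then have C: "C \<in> F n" by simp
      then obtain h where "h \<in> carrier G" "C = h <# K n" using Fc by blast
      then show "emeasure \<mu> (C #> g) = modulus g * emeasure \<mu> (C #> \<one>)"
        using sub[OF C] emeasure_coset_r_coset[OF g] by (simp add: coset_mult_one)
    qed
    also have "\<dots> = modulus g * (\<integral>\<^sup>+C. emeasure \<mu> (C #> \<one>) \<partial>count_space (F n))"
      by (rule nn_integral_cmult) simp
    also have "\<dots> = modulus g * emeasure \<mu> (V n #> \<one>)" by (simp add: meas)
    also have "V n #> \<one> = V n"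
      using sub by (intro coset_mult_one) (auto simp: V_def)
    finally show ?thesis .
  qed
  have V_sets: "openin X (V n)" for n
    unfolding V_def by (rule openin_Union) (auto simp: F_def intro: openin_lcosets)
  have inc: "incseq V"
  proof (rule incseq_SucI, rule subsetI)
    fix n x assume "x \<in> V n"
    then obtain C where C: "C \<in> F n" "x \<in> C" by (auto simp: V_def)
    then obtain h where h: "h \<in> carrier G" "C = h <# K n" using Fc by blast
    then have x: "x \<in> carrier G" "C = x <# K n" using C l_coset_eq l_coset_subset by blast+
    then have "x <# K (Suc n) \<subseteq> C" using K_Suc[of n] by (auto simp: l_coset_def)
    then have "x <# K (Suc n) \<in> F (Suc n)" using C x by (auto simp: F_def lcosets_eq)
    then show "x \<in> V (Suc n)" using x l_coset_self by (auto simp: V_def)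
  qed
  have UV: "U = (\<Union>n. V n)"
  proof
    show "U \<subseteq> (\<Union>n. V n)"
    proof
      fix x assume x: "x \<in> U"
      then obtain n where n: "x <# K n \<subseteq> U" "x \<in> carrier G" using U openin_iff by blast
      then have "x <# K n \<in> F n" by (auto simp: F_def lcosets_eq)
      then show "x \<in> (\<Union>n. V n)" using l_coset_self n by (auto simp: V_def)
    qed
  qed (auto simp: V_def F_def)
  have "emeasure \<mu> (U #> g) = emeasure \<mu> (\<Union>n. V n #> g)"
    unfolding UV r_coset_UN ..
  also have "\<dots> = (SUP n. emeasure \<mu> (V n #> g))"
  proof (rule SUP_emeasure_incseq[symmetric])
    show "range (\<lambda>n. V n #> g) \<subseteq> sets \<mu>" using V_sets g by (auto intro: open_sets openin_r_coset)
    show "incseq (\<lambda>n. V n #> g)"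
      using inc unfolding incseq_def r_coset_def by blast
  qed
  also have "\<dots> = modulus g * (SUP n. emeasure \<mu> (V n))"
    unfolding step by (rule SUP_mult_left_ennreal[symmetric])
  also have "(SUP n. emeasure \<mu> (V n)) = emeasure \<mu> U"
    unfolding UV using V_sets inc by (intro SUP_emeasure_incseq) (auto intro: open_sets)
  finally show ?thesis .
qed

lemma modulus_one: "modulus \<one> = 1"
  using mass K_sub by (simp add: modulus_def coset_mult_one)

lemma modulus_mult:
  assumes "g \<in> carrier G" "h \<in> carrier G"
  shows "modulus (g \<otimes> h) = modulus g * modulus h"
proof -
  have "modulus (g \<otimes> h) = emeasure \<mu> (K 0 #> g #> h)"
    using assms K_sub by (simp add: modulus_def r_coset_mult)
  also have "\<dots> = modulus h * emeasure \<mu> (K 0 #> g)"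
    using assms by (intro emeasure_open_r_coset openin_r_coset openin_K)
  finally show ?thesis by (simp add: modulus_def mult.commute)
qed

lemma power_eq_1_iff_nonneg: "0 \<le> r \<Longrightarrow> 0 < n \<Longrightarrow> r ^ n = (1 :: real) \<longleftrightarrow> r = 1"
  using power_eq_iff_eq_base[of n r 1] by simp

text \<open>Multiplicativity makes the n-th power of the modulus equal to 1; a finite nonnegative
  value with this property is 1, and infinity is ruled out because its powers stay infinite.\<close>

lemma modulus_torsion:
  assumes g: "g \<in> carrier G" and n: "0 < n" "g [^] (n :: nat) = \<one>"
  shows "modulus g = 1"
proof -
  have "modulus (g [^] m) = modulus g ^ m" for m :: nat
    using g by (induction m) (simp_all add: modulus_one modulus_mult mult.commute)
  then have *: "modulus g ^ n = 1" using n modulus_one by metis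
  show ?thesis
  proof (cases "modulus g")
    case (real r)
    then have "r ^ n = 1"
      using * by (simp add: ennreal_power flip: ennreal_1)
    then show ?thesis using real n by (simp add: power_eq_1_iff_nonneg)
  next
    case top
    then show ?thesis using * n by (simp add: top_power_ennreal power_0_left)
  qed
qed

text \<open>Torsion elements have modulus 1, and the property passes to products. For an inverse the
  modulus is evaluated at \<open>s \<otimes> inv s\<close>.\<close>

lemma modulus_generate:
  assumes "S \<subseteq> carrier G" "\<And>s. s \<in> S \<Longrightarrow> \<exists>n>0. s [^] (n :: nat) = \<one>" "g \<in> generate G S"
  shows "modulus g = 1"
  using assms(3)
proof induction
  case one
  show ?case by (rule modulus_one)
next
  case (incl s)
  then show ?case using assms modulus_torsion by blast
next
  case (inv s)
  then have s: "modulus s = 1" "s \<in> carrier G" using assms modulus_torsion by blast+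
  then have "modulus (s \<otimes> inv s) = modulus (inv s)" by (subst modulus_mult) auto
  then show ?case using s by (simp add: modulus_one)
next
  case (eng g h)
  then show ?case using generate_in_carrier[OF assms(1)] by (simp add: modulus_mult)
qed

lemma r_translate_measurable:
  assumes g: "g \<in> carrier G"
  shows "(\<lambda>x. x \<otimes> g) \<in> measurable \<mu> \<mu>"
proof (rule measurable_sigma_sets[OF sets_mu])
  show "{U. openin X U} \<subseteq> Pow (carrier G)" using openin_iff by blast
  show "(\<lambda>x. x \<otimes> g) \<in> space \<mu> \<rightarrow> carrier G" using g by (auto simp: space_mu)
  fix U assume U: "U \<in> {U. openin X U}"
  then have "U \<subseteq> carrier G" using openin_iff by blast
  then have "(\<lambda>x. x \<otimes> g) -` U \<inter> space \<mu> = U #> inv g"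
    using g mem_r_coset_iff[of U "inv g"] r_coset_subset_G[of U "inv g"] by (auto simp: space_mu)
  then show "(\<lambda>x. x \<otimes> g) -` U \<inter> space \<mu> \<in> sets \<mu>"
    using U g by (auto intro!: open_sets openin_r_coset)
qed

lemma r_coset_vimage:
  assumes "A \<subseteq> carrier G" "g \<in> carrier G"
  shows "A #> g = (\<lambda>x. x \<otimes> inv g) -` A \<inter> carrier G"
  using assms mem_r_coset_iff[of A g] r_coset_subset_G[of A g] by auto

text \<open>Outer regularity reduces Borel sets to open ones but yields only one inequality; the
  other is the same inequality for \<open>inv g\<close> and the translated set.\<close>

lemma right_invariant:
  assumes g: "g \<in> carrier G" "modulus g = 1" and A: "A \<in> sets \<mu>"
  shows "A #> g \<in> sets \<mu>" "emeasure \<mu> (A #> g) = emeasure \<mu> A"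
proof -
  have Ac: "A \<subseteq> carrier G" using A sets.sets_into_space space_mu by blast
  then show Ag: "A #> g \<in> sets \<mu>"
    using measurable_sets[OF r_translate_measurable[of "inv g"] A] g by (simp add: r_coset_vimage space_mu)
  have inv1: "modulus (inv g) = 1"
    using modulus_mult[of g "inv g"] g by (simp add: modulus_one)
  have le: "emeasure \<mu> (B #> h) \<le> emeasure \<mu> B"
    if B: "B \<in> sets \<mu>" "B #> h \<in> sets \<mu>" "h \<in> carrier G" "modulus h = 1" for B h
    unfolding outer_regular[OF B(1)]
  proof (rule INF_greatest)
    fix U assume U: "U \<in> {U. openin X U \<and> B \<subseteq> U}"
    then have "emeasure \<mu> (B #> h) \<le> emeasure \<mu> (U #> h)"
      using B by (intro emeasure_mono open_sets openin_r_coset) (auto simp: r_coset_def)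
    also have "\<dots> = emeasure \<mu> U" using U B emeasure_open_r_coset by simp
    finally show "emeasure \<mu> (B #> h) \<le> emeasure \<mu> U" .
  qed
  have cancel: "A #> g #> inv g = A" using Ac g by (simp add: r_coset_mult coset_mult_one)
  show "emeasure \<mu> (A #> g) = emeasure \<mu> A"
    using le[OF A Ag g] le[of "A #> g" "inv g"] A Ag g inv1 cancel by (simp add: antisym)
qed

end

section \<open>The quotient by a discrete subgroup and Weil's formula\<close>

text \<open>By \<open>cover\<close>, \<open>K 0\<close> meets every left coset of
  \<open>\<Gamma>\<close>; so it is a fundamental domain up to the finite overlap measured by
  \<open>\<Gamma> \<inter> K 0\<close>.\<close>

locale haar_filtered_group_lattice = haar_filtered_group +
  fixes \<Gamma> :: "'a set"
  assumes Gamma: "subgroup \<Gamma> G" "countable \<Gamma>" "\<gamma> \<in> \<Gamma> \<Longrightarrow> modulus \<gamma> = 1"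
    and cover: "g \<in> carrier G \<Longrightarrow> \<exists>\<gamma>\<in>\<Gamma>. g \<otimes> \<gamma> \<in> K 0"
    and finite_Gamma_K: "finite (\<Gamma> \<inter> K 0)"
    and discrete_Gamma: "\<exists>n. \<Gamma> \<inter> K n = {\<one>}"
begin

definition "q = card (\<Gamma> \<inter> K 0)"

lemma q_pos: "q > 0"
  unfolding q_def using finite_Gamma_K K_one subgroup.one_closed[OF Gamma(1)]
  by (auto simp: card_gt_0_iff)

lemma Gamma_carrier: "\<gamma> \<in> \<Gamma> \<Longrightarrow> \<gamma> \<in> carrier G"
  using Gamma(1) by (rule subgroup.mem_carrier)

text \<open>If \<open>K n\<close> meets \<open>\<Gamma>\<close> trivially, then
  \<open>\<gamma> <# K n\<close> isolates \<open>\<gamma>\<close>. Points of \<open>\<Gamma>\<close>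
  are therefore open, and so is every subset.\<close>

lemma discrete: "discrete_subgroup G X \<Gamma>"
  unfolding discrete_subgroup_def
proof (rule conjI[OF Gamma(1)])
  obtain n where n: "\<Gamma> \<inter> K n = {\<one>}" using discrete_Gamma by blast
  have "openin (subtopology X \<Gamma>) {\<gamma>}" if \<gamma>: "\<gamma> \<in> \<Gamma>" for \<gamma>
  proof -
    have "{\<gamma>} = (\<gamma> <# K n) \<inter> \<Gamma>"
    proof (intro equalityI subsetI)
      fix x assume x: "x \<in> (\<gamma> <# K n) \<inter> \<Gamma>"
      then obtain k where k: "k \<in> K n" "x = \<gamma> \<otimes> k" by (auto simp: l_coset_def)
      then have "k = inv \<gamma> \<otimes> x" using Gamma_carrier[OF \<gamma>] K_sub by (simp add: inv_solve_left subset_iff)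
      then have "k \<in> \<Gamma>" using x \<gamma> subgroup.m_closed[OF Gamma(1)] subgroup.m_inv_closed[OF Gamma(1)] by simp
      then have "k = \<one>" using n k by blast
      then show "x \<in> {\<gamma>}" using k Gamma_carrier[OF \<gamma>] by simp
    qed (use \<gamma> Gamma_carrier l_coset_self in auto)
    then show ?thesis
      using openin_l_coset[OF Gamma_carrier[OF \<gamma>]] by (auto simp: openin_subtopology)
  qed
  then have "openin (subtopology X \<Gamma>) T" if "T \<subseteq> \<Gamma>" for T
    using that openin_Union[of "(\<lambda>\<gamma>. {\<gamma>}) ` T" "subtopology X \<Gamma>"] by (auto simp: subset_iff)
  moreover have "topspace (subtopology X \<Gamma>) = \<Gamma>"
    using Gamma_carrier by (auto simp: topspace_X)
  ultimately show "subtopology X \<Gamma> = discrete_topology \<Gamma>"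
    using discrete_topology_unique[of \<Gamma> "subtopology X \<Gamma>"]
    by (metis openin_subset topology_eq openin_discrete_topology)
qed

abbreviation "proj g \<equiv> g <# \<Gamma>"
abbreviation "Q \<equiv> quotient_topology X (lcosets \<Gamma>)"

lemma openin_Q: "openin Q U \<longleftrightarrow> U \<subseteq> lcosets \<Gamma> \<and> openin X (\<Union>U)"
  by (rule openin_quotient_topology) (rule lcosets_disjoint[OF Gamma(1)])

lemma proj_self: "g \<in> carrier G \<Longrightarrow> g \<in> proj g"
  using Gamma(1) by (rule lcos_self[rotated])

lemma proj_eq: "g \<in> carrier G \<Longrightarrow> x \<in> proj g \<Longrightarrow> proj x = proj g"
  using Gamma(1) by (metis l_repr_independence)

lemma proj_subset: "g \<in> carrier G \<Longrightarrow> proj g \<subseteq> carrier G"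
  using Gamma_carrier by (auto simp: l_coset_def)

lemma l_cancel_carrier:
  "x \<otimes> y = x \<otimes> z \<Longrightarrow> x \<in> carrier G \<Longrightarrow> y \<in> carrier G \<Longrightarrow> z \<in> carrier G \<Longrightarrow> y = z"
  by simp

lemma Union_lcosets: "\<Union>(lcosets \<Gamma>) = carrier G"
  using Gamma(1) by (rule lcosets_part_G)

lemma topspace_Q: "topspace Q = lcosets \<Gamma>"
proof -
  have "openin Q (lcosets \<Gamma>)"
    unfolding openin_Q Union_lcosets using openin_topspace[of X] by (simp add: topspace_X)
  then show ?thesis using openin_Q[of "topspace Q"] openin_subset by blast
qed

lemma borel_Q: "borel_sets Q = sigma_sets (lcosets \<Gamma>) {U. openin Q U}"
  by (simp add: borel_sets_def topspace_Q)

lemma Union_vimage: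
  assumes "U \<subseteq> lcosets \<Gamma>"
  shows "\<Union>U = {g \<in> carrier G. proj g \<in> U}"
proof (intro equalityI subsetI)
  fix x assume "x \<in> \<Union>U"
  then obtain C where C: "C \<in> U" "x \<in> C" by blast
  then obtain g where "g \<in> carrier G" "C = proj g" using assms by (auto simp: lcosets_eq)
  then have "x \<in> carrier G" "proj x = C" using C proj_eq proj_subset by blast+
  then show "x \<in> {g \<in> carrier G. proj g \<in> U}" using C by simp
next
  fix x assume "x \<in> {g \<in> carrier G. proj g \<in> U}"
  then show "x \<in> \<Union>U" using proj_self by blast
qed

text \<open>Right translates of open sets are open, so this form of the saturation makes the
  projection an open map.\<close>

lemma Union_proj:
  assumes "W \<subseteq> carrier G"
  shows "\<Union>(proj ` W) = (\<Union>\<gamma>\<in>\<Gamma>. W #> \<gamma>)"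
  by (auto simp: l_coset_def r_coset_def)

interpretation SQ: sigma_algebra "lcosets \<Gamma>" "borel_sets Q"
  unfolding borel_Q by (rule sigma_algebra_sigma_sets) (auto simp: openin_Q)

lemma open_proj: "openin X W \<Longrightarrow> proj ` W \<in> borel_sets Q"
proof -
  assume W: "openin X W"
  then have Wc: "W \<subseteq> carrier G" using openin_iff by blast
  have "openin X (\<Union>\<gamma>\<in>\<Gamma>. W #> \<gamma>)"
    by (rule openin_Union) (use W Gamma_carrier openin_r_coset in blast)
  then have "openin Q (proj ` W)"
    unfolding openin_Q Union_proj[OF Wc] using Wc by (auto simp: lcosets_eq)
  then show ?thesis unfolding borel_Q by auto
qed

text \<open>The projection is injective on small cosets, so there it maps Borel sets to Borel sets.\<close>

lemma proj_small_borel: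
  assumes n: "\<Gamma> \<inter> K n = {\<one>}" and h: "h \<in> carrier G" and T: "T \<in> sets \<mu>"
  shows "proj ` ((h <# K n) \<inter> T) \<in> borel_sets Q"
proof -
  let ?V = "h <# K n"
  have inj: "inj_on proj ?V"
  proof (rule inj_onI)
    fix x y assume x: "x \<in> ?V" and y: "y \<in> ?V" and xy: "proj x = proj y"
    have c: "x \<in> carrier G" "y \<in> carrier G" using x y l_coset_subset h by blast+
    then have "y \<in> proj x" using proj_self xy by blast
    then obtain \<gamma> where \<gamma>: "\<gamma> \<in> \<Gamma>" "y = x \<otimes> \<gamma>" by (auto simp: l_coset_def)
    have "y \<in> x <# K n" using x y l_coset_eq[OF h] by blast
    then obtain k where k: "k \<in> K n" "y = x \<otimes> k" by (auto simp: l_coset_def)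
    then have "k = \<gamma>" using \<gamma> c Gamma_carrier K_sub by (metis l_cancel_carrier subset_iff)
    then have "\<gamma> = \<one>" using k \<gamma> n by blast
    then show "x = y" using \<gamma> c by simp
  qed
  have V: "openin X ?V" using h by (rule openin_l_coset)
  have Vc: "?V \<subseteq> carrier G" using h by (rule l_coset_subset)
  show ?thesis using T unfolding sets_mu
  proof induction
    case (Basic T)
    then show ?case using V by (auto intro!: open_proj)
  next
    case Empty
    show ?case by simp
  next
    case (Compl T)
    have "?V \<inter> (carrier G - T) = ?V - (?V \<inter> T)" using Vc by auto
    then have "proj ` (?V \<inter> (carrier G - T)) = proj ` ?V - proj ` (?V \<inter> T)"
      using inj_on_image_set_diff[OF inj, of ?V "?V \<inter> T"] by auto
    then show ?case using SQ.Diff[OF open_proj[OF V] Compl(2)] by simp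
  next
    case (Union T)
    have "proj ` (?V \<inter> (\<Union>i. T i)) = (\<Union>i. proj ` (?V \<inter> T i))" by blast
    moreover have "(\<Union>i. proj ` (?V \<inter> T i)) \<in> borel_sets Q"
      by (rule SQ.countable_nat_UN) (use Union in blast)
    ultimately show ?case by simp
  qed
qed

text \<open>The quotient carries the Borel algebra of its own topology, whereas measurability is
  decided upstairs; the two notions agree. In the hard direction the preimage is cut along the
  countably many cosets of a small \<open>K n\<close>, on each of which the projection preserves
  Borel sets.\<close>

lemma borel_Q_iff: "U \<in> borel_sets Q \<longleftrightarrow> U \<subseteq> lcosets \<Gamma> \<and> \<Union>U \<in> sets \<mu>"
proof
  assume "U \<in> borel_sets Q"
  then show "U \<subseteq> lcosets \<Gamma> \<and> \<Union>U \<in> sets \<mu>"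
    unfolding borel_Q
  proof induction
    case (Basic U)
    then show ?case by (auto simp: openin_Q open_sets)
  next
    case Empty
    show ?case by simp
  next
    case (Compl U)
    have "\<Union>(lcosets \<Gamma> - U) = carrier G - \<Union>U"
      using Compl by (subst (1 2) Union_vimage) (auto simp: lcosets_eq)
    then show ?case using Compl sets.compl_sets[of "\<Union>U" \<mu>] by (simp add: space_mu)
  next
    case (Union U)
    have "\<Union>(\<Union>i. U i) = (\<Union>i. \<Union>(U i))" by blast
    moreover have "(\<Union>i. \<Union>(U i)) \<in> sets \<mu>" using Union by (intro sets.countable_UN) auto
    moreover have "(\<Union>i. U i) \<subseteq> lcosets \<Gamma>" using Union by blast
    ultimately show ?case by simp
  qed
next
  assume U: "U \<subseteq> lcosets \<Gamma> \<and> \<Union>U \<in> sets \<mu>"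
  obtain n where n: "\<Gamma> \<inter> K n = {\<one>}" using discrete_Gamma by blast
  have "U = (\<Union>V\<in>lcosets (K n). proj ` (V \<inter> \<Union>U))"
  proof (intro equalityI subsetI)
    fix C assume C: "C \<in> U"
    then obtain g where g: "g \<in> carrier G" "C = proj g" using U by (auto simp: lcosets_eq)
    then have "g \<in> \<Union>U" "g \<in> g <# K n" using C proj_self l_coset_self by auto
    then show "C \<in> (\<Union>V\<in>lcosets (K n). proj ` (V \<inter> \<Union>U))" using g by (auto simp: lcosets_eq)
  next
    fix C assume "C \<in> (\<Union>V\<in>lcosets (K n). proj ` (V \<inter> \<Union>U))"
    then obtain g where g: "g \<in> \<Union>U" "C = proj g" by blast
    then show "C \<in> U" using U Union_vimage[of U] by blast
  qed
  moreover have "(\<Union>V\<in>lcosets (K n). proj ` (V \<inter> \<Union>U)) \<in> borel_sets Q"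
  proof (rule SQ.countable_UN'[OF countable_cosets])
    show "(\<lambda>V. proj ` (V \<inter> \<Union>U)) ` (lcosets (K n)) \<subseteq> borel_sets Q"
      using proj_small_borel[OF n] U unfolding lcosets_eq[of "K n"] by blast
  qed
  ultimately show "U \<in> borel_sets Q" by simp
qed

text \<open>Only the measurable space matters here; it is the target of the image measure
  below.\<close>

definition "NQ = sigma (lcosets \<Gamma>) {U. openin Q U}"

lemma space_NQ: "space NQ = lcosets \<Gamma>"
  unfolding NQ_def by (rule space_measure_of) (auto simp: openin_Q)

lemma sets_NQ: "sets NQ = borel_sets Q"
  unfolding NQ_def borel_Q by (rule sets_measure_of) (auto simp: openin_Q)

lemma proj_measurable: "proj \<in> measurable \<mu> NQ"
proof (rule measurableI)
  fix U assume "U \<in> sets NQ"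
  then have U: "U \<subseteq> lcosets \<Gamma>" "\<Union>U \<in> sets \<mu>" by (auto simp: sets_NQ borel_Q_iff)
  have "proj -` U \<inter> space \<mu> = \<Union>U" using Union_vimage[OF U(1)] by (auto simp: space_mu)
  then show "proj -` U \<inter> space \<mu> \<in> sets \<mu>" using U by simp
qed (auto simp: space_NQ space_mu lcosets_eq)

lemma measurable_NQ_I:
  fixes f :: "'a set \<Rightarrow> 'c :: topological_space"
  assumes "(\<lambda>x. f (proj x)) \<in> borel_measurable \<mu>"
  shows "f \<in> borel_measurable NQ"
proof (rule measurableI)
  fix B :: "'c set" assume B: "B \<in> sets borel"
  let ?U = "f -` B \<inter> space NQ"
  have "\<Union>?U = (\<lambda>x. f (proj x)) -` B \<inter> space \<mu>"
    by (subst Union_vimage) (auto simp: space_NQ space_mu lcosets_eq)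
  then show "?U \<in> sets NQ"
    using measurable_sets[OF assms B] by (auto simp: sets_NQ borel_Q_iff space_NQ)
qed simp

text \<open>The image of Haar measure on \<open>K 0\<close>, divided by \<open>q\<close> because
  \<open>K 0\<close> meets each left coset of \<open>\<Gamma>\<close> in exactly \<open>q\<close>
  points.\<close>

definition "\<nu> = scale_measure (1 / of_nat q) (distr (density \<mu> (indicator (K 0))) NQ proj)"

lemma K0_sets: "K 0 \<in> sets \<mu>"
  by (intro open_sets openin_K)

lemma count_coset:
  assumes x: "x \<in> carrier G" and A: "A \<subseteq> carrier G"
  shows "emeasure (count_space (proj x)) (A \<inter> proj x) = (\<integral>\<^sup>+\<gamma>. indicator A (x \<otimes> \<gamma>) \<partial>count_space \<Gamma>)"
proof -
  have "emeasure (count_space (proj x)) (A \<inter> proj x) = (\<integral>\<^sup>+y. indicator A y \<partial>count_space (proj x))"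
    by (subst nn_integral_indicator[symmetric]) (simp, rule nn_integral_cong, simp add: indicator_def)
  also have "\<dots> = (\<integral>\<^sup>+\<gamma>. indicator A (x \<otimes> \<gamma>) \<partial>count_space \<Gamma>)"
  proof (rule nn_integral_bij_count_space[symmetric])
    show "bij_betw (\<lambda>\<gamma>. x \<otimes> \<gamma>) \<Gamma> (proj x)"
      using x Gamma_carrier by (auto simp: bij_betw_def l_coset_def inj_on_def)
  qed
  finally show ?thesis .
qed

lemma translate_indicator_measurable:
  assumes "A \<in> sets \<mu>" "\<gamma> \<in> \<Gamma>"
  shows "(\<lambda>x. indicator A (x \<otimes> \<gamma>) :: ennreal) \<in> borel_measurable \<mu>"
  using measurable_compose[OF r_translate_measurable[OF Gamma_carrier[OF assms(2)]] borel_measurable_indicator[OF assms(1)]] .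

lemma l_inv_cancel: "x \<in> carrier G \<Longrightarrow> y \<in> carrier G \<Longrightarrow> inv x \<otimes> (x \<otimes> y) = y"
  by (simp flip: m_assoc)

text \<open>With \<open>x \<otimes> \<gamma>0\<close> in \<open>K 0\<close>, substituting
  \<open>inv (\<gamma>0 \<otimes> \<gamma>)\<close> for \<open>\<gamma>\<close> turns the condition
  into \<open>\<gamma> \<in> K 0\<close>, which no longer involves \<open>x\<close>.\<close>

lemma count_translates:
  assumes x: "x \<in> carrier G"
  shows "(\<integral>\<^sup>+\<gamma>. indicator (K 0) (x \<otimes> inv \<gamma>) \<partial>count_space \<Gamma>) = of_nat q"
proof -
  obtain \<gamma>0 where \<gamma>0: "\<gamma>0 \<in> \<Gamma>" "x \<otimes> \<gamma>0 \<in> K 0" using cover[OF x] by blast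
  note c = x Gamma_carrier
  have bij: "bij_betw (\<lambda>\<gamma>. inv (\<gamma>0 \<otimes> \<gamma>)) \<Gamma> \<Gamma>"
    by (rule bij_betw_byWitness[where f' = "\<lambda>\<gamma>. inv \<gamma>0 \<otimes> inv \<gamma>"])
       (use \<gamma>0 Gamma subgroup.m_closed[OF Gamma(1)] subgroup.m_inv_closed[OF Gamma(1)] Gamma_carrier
         in \<open>auto simp: inv_mult_group m_assoc l_inv_cancel\<close>)
  have "(\<integral>\<^sup>+\<gamma>. indicator (K 0) (x \<otimes> inv \<gamma>) \<partial>count_space \<Gamma>)
      = (\<integral>\<^sup>+\<gamma>. indicator (K 0) (x \<otimes> inv (inv (\<gamma>0 \<otimes> \<gamma>))) \<partial>count_space \<Gamma>)"
    by (rule nn_integral_bij_count_space[OF bij, symmetric])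
  also have "\<dots> = (\<integral>\<^sup>+\<gamma>. indicator (\<Gamma> \<inter> K 0) \<gamma> \<partial>count_space \<Gamma>)"
  proof (rule nn_integral_cong)
    fix \<gamma> assume "\<gamma> \<in> space (count_space \<Gamma>)"
    then have \<gamma>: "\<gamma> \<in> \<Gamma>" by simp
    have eq: "x \<otimes> inv (inv (\<gamma>0 \<otimes> \<gamma>)) = (x \<otimes> \<gamma>0) \<otimes> \<gamma>" using \<gamma> \<gamma>0 c by (simp add: m_assoc)
    have "(x \<otimes> \<gamma>0) \<otimes> \<gamma> \<in> K 0 \<longleftrightarrow> \<gamma> \<in> K 0"
    proof
      assume "(x \<otimes> \<gamma>0) \<otimes> \<gamma> \<in> K 0"
      then have "inv (x \<otimes> \<gamma>0) \<otimes> ((x \<otimes> \<gamma>0) \<otimes> \<gamma>) \<in> K 0"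
        using \<gamma>0 K_subgroup subgroup.m_closed subgroup.m_inv_closed by metis
      moreover have "inv (x \<otimes> \<gamma>0) \<otimes> ((x \<otimes> \<gamma>0) \<otimes> \<gamma>) = \<gamma>"
        using \<gamma> \<gamma>0 c by (intro l_inv_cancel) auto
      ultimately show "\<gamma> \<in> K 0" by simp
    qed (use \<gamma>0 K_subgroup subgroup.m_closed in metis)
    then show "indicator (K 0) (x \<otimes> inv (inv (\<gamma>0 \<otimes> \<gamma>))) = (indicator (\<Gamma> \<inter> K 0) \<gamma> :: ennreal)"
      using \<gamma> unfolding eq by (auto simp: indicator_def)
  qed
  also have "\<dots> = of_nat q"
    using finite_Gamma_K by (simp add: q_def)
  finally show ?thesis .
qed

text \<open>Integrate the coset count over \<open>K 0\<close>, exchange sum and integral, shift each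
  term by \<open>\<gamma>\<close> using right invariance, and exchange back. The inner sum is now
  the count of translates in \<open>K 0\<close>, namely \<open>q\<close>, which cancels the
  normalization.\<close>

lemma quotient_nu: "quotient_measure G X \<mu> \<Gamma> \<nu>"
  unfolding quotient_measure_def
proof (intro conjI ballI)
  show "space \<nu> = lcosets \<Gamma>" by (simp add: \<nu>_def space_NQ space_scale_measure)
  show "sets \<nu> = borel_sets Q" by (simp add: \<nu>_def sets_NQ)
  fix A assume A: "A \<in> sets \<mu>"
  then have Ac: "A \<subseteq> carrier G" using sets.sets_into_space space_mu by blast
  define f where "f C = emeasure (count_space C) (A \<inter> C)" for C
  have f: "f (proj x) = (\<integral>\<^sup>+\<gamma>. indicator A (x \<otimes> \<gamma>) \<partial>count_space \<Gamma>)" if "x \<in> carrier G" for x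
    unfolding f_def using that Ac by (rule count_coset)
  have ind_meas: "(\<lambda>x. indicator A (x \<otimes> \<gamma>) :: ennreal) \<in> borel_measurable \<mu>" if "\<gamma> \<in> \<Gamma>" for \<gamma>
    using A that by (rule translate_indicator_measurable)
  have sum_meas: "(\<lambda>x. \<integral>\<^sup>+\<gamma>. indicator A (x \<otimes> \<gamma>) \<partial>count_space \<Gamma>) \<in> borel_measurable \<mu>"
    using Gamma(2) ind_meas by (intro borel_measurable_nn_integral_count_space) auto
  have fp: "(\<lambda>x. f (proj x)) \<in> borel_measurable \<mu>"
    using sum_meas by (rule measurable_cong[THEN iffD1, rotated]) (simp add: f space_mu)
  then have fm: "f \<in> borel_measurable NQ" by (rule measurable_NQ_I)
  have pm: "proj \<in> measurable (density \<mu> (indicator (K 0))) NQ"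
    using proj_measurable by simp
  have "(\<integral>\<^sup>+C. f C \<partial>\<nu>) = 1 / of_nat q * (\<integral>\<^sup>+x. indicator (K 0) x * f (proj x) \<partial>\<mu>)"
    unfolding \<nu>_def using fm pm fp K0_sets
    by (simp add: nn_integral_scale_measure nn_integral_distr nn_integral_density)
  also have "(\<integral>\<^sup>+x. indicator (K 0) x * f (proj x) \<partial>\<mu>)
      = (\<integral>\<^sup>+x. (\<integral>\<^sup>+\<gamma>. indicator (K 0) x * indicator A (x \<otimes> \<gamma>) \<partial>count_space \<Gamma>) \<partial>\<mu>)"
    by (rule nn_integral_cong) (simp add: f space_mu nn_integral_cmult)
  also have "\<dots> = (\<integral>\<^sup>+\<gamma>. (\<integral>\<^sup>+x. indicator (K 0) x * indicator A (x \<otimes> \<gamma>) \<partial>\<mu>) \<partial>count_space \<Gamma>)"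
    using Gamma(2) K0_sets ind_meas by (intro nn_integral_count_space_nn_integral) auto
  also have "\<dots> = (\<integral>\<^sup>+\<gamma>. (\<integral>\<^sup>+x. indicator A x * indicator (K 0) (x \<otimes> inv \<gamma>) \<partial>\<mu>) \<partial>count_space \<Gamma>)"
  proof (rule nn_integral_cong)
    fix \<gamma> assume "\<gamma> \<in> space (count_space \<Gamma>)"
    then have \<gamma>: "\<gamma> \<in> \<Gamma>" "\<gamma> \<in> carrier G" "inv \<gamma> \<in> \<Gamma>"
      using Gamma_carrier subgroup.m_inv_closed[OF Gamma(1)] by auto
    \<comment> \<open>The set where both indicators are 1; its right translate by
      \<open>\<gamma>\<close> is the corresponding set after the substitution.\<close>
    let ?B = "K 0 \<inter> (A #> inv \<gamma>)"
    have Ai: "A #> inv \<gamma> \<in> sets \<mu>" using A \<gamma> Gamma(3) by (intro right_invariant) auto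
    have B: "?B \<in> sets \<mu>" using K0_sets Ai by auto
    have "(\<integral>\<^sup>+x. indicator (K 0) x * indicator A (x \<otimes> \<gamma>) \<partial>\<mu>) = (\<integral>\<^sup>+x. indicator ?B x \<partial>\<mu>)"
      using mem_r_coset_iff[OF Ac, of "inv \<gamma>"] \<gamma>
      by (intro nn_integral_cong) (auto simp: indicator_def space_mu)
    also have "\<dots> = emeasure \<mu> ?B" using B by simp
    also have "\<dots> = emeasure \<mu> (?B #> \<gamma>)" using right_invariant(2)[OF \<gamma>(2) Gamma(3)[OF \<gamma>(1)] B] by simp
    also have "\<dots> = (\<integral>\<^sup>+x. indicator (?B #> \<gamma>) x \<partial>\<mu>)"
      using right_invariant(1)[OF \<gamma>(2) Gamma(3)[OF \<gamma>(1)] B] by simp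
    also have "\<dots> = (\<integral>\<^sup>+x. indicator A x * indicator (K 0) (x \<otimes> inv \<gamma>) \<partial>\<mu>)"
    proof (rule nn_integral_cong)
      fix x assume "x \<in> space \<mu>"
      then have x: "x \<in> carrier G" by (simp add: space_mu)
      have "x \<in> ?B #> \<gamma> \<longleftrightarrow> x \<otimes> inv \<gamma> \<in> ?B"
        using x \<gamma> K_sub by (intro mem_r_coset_iff) auto
      also have "\<dots> \<longleftrightarrow> x \<otimes> inv \<gamma> \<in> K 0 \<and> x \<in> A"
        using mem_r_coset_iff[OF Ac, of "inv \<gamma>" "x \<otimes> inv \<gamma>"] x \<gamma> by (auto simp: m_assoc)
      finally show "indicator (?B #> \<gamma>) x = (indicator A x * indicator (K 0) (x \<otimes> inv \<gamma>) :: ennreal)"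
        by (auto simp: indicator_def)
    qed
    finally show "(\<integral>\<^sup>+x. indicator (K 0) x * indicator A (x \<otimes> \<gamma>) \<partial>\<mu>)
      = (\<integral>\<^sup>+x. indicator A x * indicator (K 0) (x \<otimes> inv \<gamma>) \<partial>\<mu>)" .
  qed
  also have "\<dots> = (\<integral>\<^sup>+x. (\<integral>\<^sup>+\<gamma>. indicator A x * indicator (K 0) (x \<otimes> inv \<gamma>) \<partial>count_space \<Gamma>) \<partial>\<mu>)"
    using Gamma(2) K0_sets A subgroup.m_inv_closed[OF Gamma(1)]
    by (intro nn_integral_count_space_nn_integral[symmetric] borel_measurable_times_ennreal translate_indicator_measurable) auto
  also have "\<dots> = (\<integral>\<^sup>+x. indicator A x * of_nat q \<partial>\<mu>)"
    by (rule nn_integral_cong) (simp add: nn_integral_cmult count_translates space_mu)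
  also have "\<dots> = of_nat q * emeasure \<mu> A"
    using A by (simp add: nn_integral_multc mult.commute)
  finally have "(\<integral>\<^sup>+C. f C \<partial>\<nu>) = 1 / of_nat q * (of_nat q * emeasure \<mu> A)" .
  also have "\<dots> = emeasure \<mu> A"
    using q_pos ennreal_divide_self[of "of_nat q"]
    by (simp add: ennreal_divide_times mult.commute[of "of_nat q"] of_nat_less_top flip: mult.assoc)
  finally show "emeasure \<mu> A = (\<integral>\<^sup>+C. emeasure (count_space C) (A \<inter> C) \<partial>\<nu>)"
    by (simp add: f_def)
qed

text \<open>The total mass of \<open>\<nu>\<close> is the mass 1 of \<open>K 0\<close> divided by
  \<open>q\<close>.\<close>

lemma covolume: "has_covolume G X \<mu> \<Gamma> (1 / of_nat q)"
proof -
  have pm: "proj \<in> measurable (density \<mu> (indicator (K 0))) NQ"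
    using proj_measurable by simp
  have "emeasure \<nu> (space NQ) = 1 / of_nat q * emeasure (density \<mu> (indicator (K 0))) (space \<mu>)"
  proof -
    have "proj -` space NQ \<inter> space \<mu> = space \<mu>"
      using measurable_space[OF proj_measurable] by auto
    then show ?thesis unfolding \<nu>_def using pm by (simp add: emeasure_distr)
  qed
  also have "emeasure (density \<mu> (indicator (K 0))) (space \<mu>) = emeasure \<mu> (K 0)"
    using K0_sets sets.sets_into_space[OF K0_sets]
    by (simp add: emeasure_density Int_absorb2 flip: indicator_inter_arith)
  finally show ?thesis
    unfolding has_covolume_def using quotient_nu mass by (auto simp: space_NQ)
qed

lemma lattice: "lattice_subgroup G X \<mu> \<Gamma>"
  unfolding lattice_subgroup_def
  using discrete covolume q_pos by (auto intro!: exI[of _ "1 / of_nat q"] simp: ennreal_divide_eq_top_iff less_top[symmetric])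

end

section \<open>Arithmetic of 2-adic numbers\<close>

lemma adic2_int_rep_less: "0 \<le> Rep_adic2_int x n" "Rep_adic2_int x n < 2 ^ n"
  by (subst adic2_int_rep_mod[symmetric]; simp)+

lemma adic2_int_rep_two_power: "Rep_adic2_int (2 ^ m) n = 2 ^ m mod 2 ^ n"
  using of_nat_adic2_int_rep[of "2 ^ m" n] by simp

text \<open>Division by \<open>2 ^ m\<close> costs \<open>m\<close> digits: level \<open>n\<close>
  of the quotient is read off level \<open>n + m\<close> of \<open>x\<close>.\<close>

lemma two_power_dvd_adic2_int_iff: "2 ^ m dvd x \<longleftrightarrow> Rep_adic2_int x m = 0"
proof
  assume "2 ^ m dvd x"
  then obtain y where "x = 2 ^ m * y" by (auto simp: dvd_def)
  then show "Rep_adic2_int x m = 0"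
    by (simp add: times_adic2_int.rep_eq adic2_int_rep_two_power)
next
  assume x: "Rep_adic2_int x m = 0"
  define y where "y n = Rep_adic2_int x (n + m) div 2 ^ m" for n
  have "y n = y (Suc n) mod 2 ^ n" for n
  proof -
    have "Rep_adic2_int x (n + m) = Rep_adic2_int x (Suc n + m) mod 2 ^ (n + m)"
      by (rule adic2_int_rep_mod_le[symmetric]) simp
    also have "\<dots> = Rep_adic2_int x (Suc n + m) mod (2 ^ m * 2 ^ n)"
      by (simp add: power_add mult.commute)
    also have "\<dots> = 2 ^ m * (Rep_adic2_int x (Suc n + m) div 2 ^ m mod 2 ^ n)
        + Rep_adic2_int x (Suc n + m) mod 2 ^ m"
      by (rule zmod_zmult2_eq) simp
    finally have "Rep_adic2_int x (n + m) = \<dots>" .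
    moreover have "Rep_adic2_int x (Suc n + m) mod 2 ^ m = 0"
      using adic2_int_rep_mod_le[of m "Suc n + m" x] x by simp
    ultimately show ?thesis by (simp add: y_def)
  qed
  then have Y: "Rep_adic2_int (Abs_adic2_int y) = y"
    by (intro Abs_adic2_int_inverse CollectI allI)
  have "x = 2 ^ m * Abs_adic2_int y"
  proof (rule adic2_int_eqI)
    fix n
    have "2 ^ m dvd Rep_adic2_int x (n + m)"
      using adic2_int_rep_mod_le[of m "n + m" x] x by (simp add: dvd_eq_mod_eq_0)
    then have "2 ^ m * y n = Rep_adic2_int x (n + m)" by (simp add: y_def)
    then show "Rep_adic2_int x n = Rep_adic2_int (2 ^ m * Abs_adic2_int y) n"
      using adic2_int_rep_mod_le[of n "n + m" x]
      by (simp add: times_adic2_int.rep_eq adic2_int_rep_two_power Y mod_mult_left_eq)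
  qed
  then show "2 ^ m dvd x" by simp
qed

lemma two_dvd_adic2_int_iff: "2 dvd x \<longleftrightarrow> Rep_adic2_int x 1 = 0"
  using two_power_dvd_adic2_int_iff[of 1 x] by simp

lemma adic2_int_rep_1_cases: "Rep_adic2_int x 1 = 0 \<or> Rep_adic2_int x 1 = 1"
  using adic2_int_rep_less[of x 1] by auto

lemma two_dvd_add_adic2_int_iff:
  "2 dvd (x + y :: adic2_int) \<longleftrightarrow> (2 dvd x \<longleftrightarrow> 2 dvd y)"
  using adic2_int_rep_1_cases[of x] adic2_int_rep_1_cases[of y]
  by (auto simp: two_dvd_adic2_int_iff plus_adic2_int.rep_eq)

lemma two_dvd_mult_adic2_int_iff:
  "2 dvd (x * y :: adic2_int) \<longleftrightarrow> 2 dvd x \<or> 2 dvd y"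
  using adic2_int_rep_1_cases[of x] adic2_int_rep_1_cases[of y]
  by (auto simp: two_dvd_adic2_int_iff times_adic2_int.rep_eq)

lemma two_dvd_diff_adic2_int_iff:
  "2 dvd (x - y :: adic2_int) \<longleftrightarrow> (2 dvd x \<longleftrightarrow> 2 dvd y)"
  using two_dvd_add_adic2_int_iff[of x "- y"] by simp

lemma not_two_dvd_one_adic2_int: "\<not> 2 dvd (1 :: adic2_int)"
  by (simp add: two_dvd_adic2_int_iff one_adic2_int.rep_eq)

text \<open>An odd integer has an inverse modulo every \<open>2 ^ n\<close>. The inverses chosen
  level by level are compatible because inverses modulo \<open>2 ^ n\<close> are unique, so together
  they form a 2-adic integer.\<close>

lemma adic2_int_unit_iff: "x dvd 1 \<longleftrightarrow> \<not> 2 dvd (x :: adic2_int)"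
proof
  assume "x dvd 1"
  then show "\<not> 2 dvd x" using not_two_dvd_one_adic2_int dvd_trans by blast
next
  assume x: "\<not> 2 dvd x"
  have odd: "odd (Rep_adic2_int x n)" if "n > 0" for n
  proof -
    have "Rep_adic2_int x n mod 2 ^ 1 = Rep_adic2_int x 1"
      using that by (intro adic2_int_rep_mod_le) simp
    then show ?thesis using x adic2_int_rep_1_cases[of x]
      by (auto simp: two_dvd_adic2_int_iff odd_iff_mod_2_eq_one)
  qed
  then have cop: "coprime (Rep_adic2_int x n) (2 ^ n)" for n
    by (cases "n = 0") (auto simp: coprime_commute)
  have "\<exists>b. (Rep_adic2_int x n * b) mod 2 ^ n = 1 mod 2 ^ n" for n
  proof -
    obtain u v where "u * Rep_adic2_int x n + v * 2 ^ n = 1"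
      using cop[of n] bezout_int[of "Rep_adic2_int x n" "2 ^ n"] by auto
    then have "Rep_adic2_int x n * u = 1 + (- v) * 2 ^ n" by (simp add: algebra_simps)
    then show ?thesis by (metis mod_mult_self1)
  qed
  then obtain b where b: "\<And>n. (Rep_adic2_int x n * b n) mod 2 ^ n = 1 mod 2 ^ n" by metis
  define y where "y n = b n mod 2 ^ n" for n
  have "y n = y (Suc n) mod 2 ^ n" for n
  proof -
    have "(Rep_adic2_int x n * b (Suc n)) mod 2 ^ n = 1 mod 2 ^ n"
    proof -
      have "(Rep_adic2_int x n * b (Suc n)) mod 2 ^ n = (Rep_adic2_int x (Suc n) * b (Suc n)) mod 2 ^ n"
        using adic2_int_rep_mod_le[of n "Suc n" x] by (metis mod_mult_left_eq le_SucI order_refl)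
      also have "\<dots> = ((Rep_adic2_int x (Suc n) * b (Suc n)) mod 2 ^ Suc n) mod 2 ^ n"
        by (rule mod_2_power_Suc[symmetric])
      also have "\<dots> = 1 mod 2 ^ n" unfolding b by (rule mod_2_power_Suc)
      finally show ?thesis .
    qed
    then have "(Rep_adic2_int x n * b (Suc n)) mod 2 ^ n = (Rep_adic2_int x n * b n) mod 2 ^ n"
      by (simp only: b)
    then have "2 ^ n dvd Rep_adic2_int x n * b (Suc n) - Rep_adic2_int x n * b n"
      by (simp only: mod_eq_dvd_iff)
    then have "2 ^ n dvd Rep_adic2_int x n * (b (Suc n) - b n)" by (simp add: right_diff_distrib)
    then have "2 ^ n dvd b (Suc n) - b n"
      using cop[of n] by (simp add: coprime_dvd_mult_right_iff coprime_commute)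
    then have "b (Suc n) mod 2 ^ n = b n mod 2 ^ n" by (simp add: mod_eq_dvd_iff)
    then show ?thesis by (simp only: y_def mod_2_power_Suc)
  qed
  then have Y: "Rep_adic2_int (Abs_adic2_int y) = y"
    by (intro Abs_adic2_int_inverse CollectI allI)
  have "x * Abs_adic2_int y = 1"
    by (rule adic2_int_eqI) (simp add: times_adic2_int.rep_eq one_adic2_int.rep_eq Y y_def mod_mult_right_eq b)
  then show "x dvd 1" by (metis dvd_triv_left)
qed

section \<open>Factorization and the 2-adic valuation\<close>

text \<open>Some digit of \<open>x\<close> is nonzero, so a least power of 2 not dividing
  \<open>x\<close> exists; removing the power just below it leaves an odd cofactor.\<close>

lemma adic2_int_factor:
  fixes x :: adic2_int
  assumes "x \<noteq> 0"
  shows "\<exists>n u. u dvd 1 \<and> x = 2 ^ n * u"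
proof -
  obtain m where m: "Rep_adic2_int x m \<noteq> 0"
    using assms by (metis adic2_int_eqI zero_adic2_int.rep_eq)
  let ?P = "\<lambda>n. \<not> 2 ^ n dvd x"
  define k where "k = (LEAST n. ?P n)"
  have P: "?P m" using m two_power_dvd_adic2_int_iff by blast
  then have k: "?P k" unfolding k_def by (rule LeastI)
  then obtain n where n: "k = Suc n" by (cases k) auto
  then have "2 ^ n dvd x" using not_less_Least[of n ?P] by (simp add: k_def)
  then obtain u where u: "x = 2 ^ n * u" by (auto simp: dvd_def)
  have "\<not> 2 dvd u"
  proof
    assume "2 dvd u"
    then have "2 ^ n * 2 dvd x" unfolding u by (rule mult_dvd_mono[OF dvd_refl])
    then show False using k n by (simp add: mult.commute)
  qed
  then show ?thesis using u adic2_int_unit_iff by blast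
qed

lemma of_adic2_int_0: "of_adic2_int 0 = 0"
  using of_adic2_int_of_nat[of 0] by simp

lemma of_adic2_int_minus: "of_adic2_int (- x) = - of_adic2_int x"
  using of_adic2_int_add[of x "- x"] by (simp add: of_adic2_int_0 eq_neg_iff_add_eq_0 add.commute)

lemma of_adic2_int_diff: "of_adic2_int (x - y) = of_adic2_int x - of_adic2_int y"
  using of_adic2_int_add[of x "- y"] by (simp add: of_adic2_int_minus)

lemma of_adic2_int_numeral: "of_adic2_int (numeral k) = numeral k"
  using of_adic2_int_of_nat[of "numeral k"] by simp

lemma of_adic2_int_power: "of_adic2_int (x ^ n) = of_adic2_int x ^ n"
  by (induction n) (simp_all add: of_adic2_int_1 of_adic2_int_mult)

lemma of_adic2_int_eq_0_iff: "of_adic2_int x = 0 \<longleftrightarrow> x = 0"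
  using of_adic2_int_inject[of x 0] by (simp add: of_adic2_int_0)

lemma adic2_frac: "\<exists>x y. y \<noteq> 0 \<and> z = of_adic2_int x / of_adic2_int y"
proof -
  obtain f where f: "z = Abs_adic2 f" by (cases z) auto
  obtain x y where xy: "f = Fract x y" "y \<noteq> 0" by (cases f)
  then have "z = of_adic2_int x / of_adic2_int y"
    using f by (simp add: of_adic2_int_def divide_adic2.abs_eq)
  then show ?thesis using xy by blast
qed

lemma adic2_factor:
  fixes z :: adic2
  assumes "z \<noteq> 0"
  shows "\<exists>k u. u dvd 1 \<and> z = 2 powi k * of_adic2_int u"
proof -
  obtain x y where xy: "y \<noteq> 0" "z = of_adic2_int x / of_adic2_int y" using adic2_frac by blast
  then have "x \<noteq> 0" using assms by (auto simp: of_adic2_int_0)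
  then obtain m u where u: "u dvd 1" "x = 2 ^ m * u" using adic2_int_factor by blast
  obtain n v where v: "v dvd 1" "y = 2 ^ n * v" using adic2_int_factor xy by blast
  obtain w where w: "v * w = 1" using v by (auto simp: dvd_def)
  then have ww: "of_adic2_int v * of_adic2_int w = 1"
    by (simp add: of_adic2_int_1 flip: of_adic2_int_mult)
  then have nz: "of_adic2_int v \<noteq> 0" by auto
  have iw: "of_adic2_int w = 1 / of_adic2_int v" using ww nz by (simp add: field_simps)
  have "z = 2 ^ m / 2 ^ n * (of_adic2_int u * of_adic2_int w)"
    unfolding iw xy(2) u(2) v(2) by (simp add: of_adic2_int_mult of_adic2_int_power of_adic2_int_numeral)
  also have "\<dots> = 2 powi (int m - int n) * of_adic2_int (u * w)"
    by (simp add: power_int_diff of_adic2_int_mult)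
  finally have "z = 2 powi (int m - int n) * of_adic2_int (u * w)" .
  moreover have "u * w dvd 1" using u w by (metis dvd_triv_right mult_dvd_mono mult_1)
  ultimately show ?thesis by blast
qed

lemma adic2_factor_unique:
  assumes u: "u dvd 1" "v dvd 1" and eq: "2 powi k * of_adic2_int u = 2 powi l * of_adic2_int v"
  shows "k = l"
proof -
  have le: "l \<le> k" if u: "u dvd 1" "v dvd 1" "2 powi k * of_adic2_int u = 2 powi l * of_adic2_int v" for k l u v
  proof (rule ccontr)
    assume "\<not> l \<le> k"
    then obtain n where n: "l = k + int (Suc n)" using zless_iff_Suc_zadd[of k l] by auto
    have "2 powi k * of_adic2_int u = 2 powi k * (2 ^ Suc n * of_adic2_int v)"
      using u(3) unfolding n by (simp add: power_int_add)
    then have "of_adic2_int u = of_adic2_int (2 ^ Suc n * v)"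
      by (simp add: of_adic2_int_mult of_adic2_int_power of_adic2_int_numeral)
    then have "2 dvd u" by (simp only: of_adic2_int_inject) simp
    then show False using u adic2_int_unit_iff by blast
  qed
  show ?thesis using le[OF u eq] le[OF u(2,1) eq[symmetric]] by simp
qed

text \<open>The 2-adic valuation. At 0 no such representation exists and the value is unspecified,
  hence the recurring side conditions that arguments be nonzero.\<close>

definition val :: "adic2 \<Rightarrow> int"
  where "val z = (THE k. \<exists>u. u dvd 1 \<and> z = 2 powi k * of_adic2_int u)"

lemma val_eqI:
  assumes "u dvd 1" "z = 2 powi k * of_adic2_int u"
  shows "val z = k"
  unfolding val_def
proof (rule the_equality)
  show "\<exists>u. u dvd 1 \<and> z = 2 powi k * of_adic2_int u" using assms by blast
  fix l assume "\<exists>u. u dvd 1 \<and> z = 2 powi l * of_adic2_int u"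
  then obtain v where v: "v dvd 1" "z = 2 powi l * of_adic2_int v" by blast
  show "l = k" by (rule adic2_factor_unique[OF v(1) assms(1)]) (simp only: flip: v(2) assms(2))
qed

lemma val_factor: "z \<noteq> 0 \<Longrightarrow> \<exists>u. u dvd 1 \<and> z = 2 powi (val z) * of_adic2_int u"
  using adic2_factor[of z] val_eqI by metis

lemma val_mult:
  assumes "x \<noteq> 0" "y \<noteq> 0"
  shows "val (x * y) = val x + val y"
proof -
  obtain u v where "u dvd 1" "x = 2 powi (val x) * of_adic2_int u"
    "v dvd 1" "y = 2 powi (val y) * of_adic2_int v" using val_factor assms by metis
  note uv = this
  have "u * v dvd 1" using mult_dvd_mono[OF uv(1,3)] by simp
  moreover have "x * y = 2 powi (val x + val y) * of_adic2_int (u * v)"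
    by (subst uv(2), subst uv(4)) (simp add: power_int_add of_adic2_int_mult)
  ultimately show ?thesis by (rule val_eqI)
qed

lemma val_unit: "u dvd 1 \<Longrightarrow> val (of_adic2_int u) = 0"
  by (rule val_eqI[of u]) simp_all

lemma val_1: "val 1 = 0"
  using val_unit[of 1] by (simp add: of_adic2_int_1)

lemma val_2: "val 2 = 1"
  by (rule val_eqI[of 1]) (simp_all add: of_adic2_int_1)

lemma val_inverse: "x \<noteq> 0 \<Longrightarrow> val (inverse x) = - val x"
  using val_mult[of x "inverse x"] by (simp add: val_1)

lemma val_power: "x \<noteq> 0 \<Longrightarrow> val (x ^ n) = int n * val x"
  by (induction n) (simp_all add: val_1 val_mult algebra_simps)

definition adic2_ints :: "adic2 set"
  where "adic2_ints = range of_adic2_int"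

lemma adic2_ints_of [simp, intro]: "of_adic2_int x \<in> adic2_ints"
  by (simp add: adic2_ints_def)

lemma adic2_ints_add [intro]: "x \<in> adic2_ints \<Longrightarrow> y \<in> adic2_ints \<Longrightarrow> x + y \<in> adic2_ints"
  unfolding adic2_ints_def by (auto simp flip: of_adic2_int_add)

lemma adic2_ints_mult [intro]: "x \<in> adic2_ints \<Longrightarrow> y \<in> adic2_ints \<Longrightarrow> x * y \<in> adic2_ints"
  unfolding adic2_ints_def by (auto simp flip: of_adic2_int_mult)

lemma adic2_ints_diff [intro]: "x \<in> adic2_ints \<Longrightarrow> y \<in> adic2_ints \<Longrightarrow> x - y \<in> adic2_ints"
  unfolding adic2_ints_def by (auto simp flip: of_adic2_int_diff)

lemma adic2_ints_0 [simp]: "0 \<in> adic2_ints"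
  using adic2_ints_of[of 0] by (simp only: of_adic2_int_0)

lemma adic2_ints_1 [simp]: "1 \<in> adic2_ints"
  using adic2_ints_of[of 1] by (simp only: of_adic2_int_1)

lemma adic2_ints_numeral [simp]: "numeral k \<in> adic2_ints"
  using adic2_ints_of[of "numeral k"] by (simp only: of_adic2_int_numeral)

lemma adic2_ints_power [intro]: "x \<in> adic2_ints \<Longrightarrow> x ^ n \<in> adic2_ints"
  by (induction n) auto

lemma adic2_ints_val_iff: "x \<in> adic2_ints \<longleftrightarrow> x = 0 \<or> 0 \<le> val x"
proof
  assume "x \<in> adic2_ints"
  then obtain y where y: "x = of_adic2_int y" by (auto simp: adic2_ints_def)
  show "x = 0 \<or> 0 \<le> val x"
  proof (cases "y = 0")
    case False
    then obtain n u where "u dvd 1" "y = 2 ^ n * u" using adic2_int_factor by blast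
    then have "val x = int n"
      by (intro val_eqI[of u]) (simp_all add: y of_adic2_int_mult of_adic2_int_power of_adic2_int_numeral)
    then show ?thesis by simp
  qed (simp add: y of_adic2_int_0)
next
  assume x: "x = 0 \<or> 0 \<le> val x"
  show "x \<in> adic2_ints"
  proof (cases "x = 0")
    case False
    then obtain u where u: "x = 2 powi (val x) * of_adic2_int u" using val_factor by blast
    have "x = 2 ^ nat (val x) * of_adic2_int u"
      using x False by (subst u) (simp add: power_int_def)
    then show ?thesis by (metis adic2_ints_mult adic2_ints_power adic2_ints_numeral adic2_ints_of)
  qed simp
qed

lemma inverse_adic2_ints: "x \<noteq> 0 \<Longrightarrow> val x = 0 \<Longrightarrow> inverse x \<in> adic2_ints"
  by (simp add: adic2_ints_val_iff val_inverse)

lemma adic2_scale_integral: "\<exists>n. 2 ^ n * z \<in> adic2_ints"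
proof (cases "z = 0")
  case False
  have "0 \<le> val (2 ^ nat (- val z) * z)"
    using False by (simp add: val_mult val_power val_2)
  then show ?thesis using adic2_ints_val_iff by blast
qed simp

lemma adic2_scale_integral_finite:
  assumes "finite A"
  shows "\<exists>n. \<forall>z\<in>A. 2 ^ n * z \<in> adic2_ints"
  using assms
proof induction
  case (insert z A)
  then obtain m where m: "\<forall>z\<in>A. 2 ^ m * z \<in> adic2_ints" by blast
  obtain n where n: "2 ^ n * z \<in> adic2_ints" using adic2_scale_integral by blast
  have "2 ^ (m + n) * x \<in> adic2_ints" if "x \<in> insert z A" for x
  proof (cases "x = z")
    case True
    have "2 ^ (m + n) * x = 2 ^ m * (2 ^ n * z)" by (simp add: True power_add)
    then show ?thesis using n by (metis adic2_ints_mult adic2_ints_power adic2_ints_numeral)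
  next
    case False
    have "2 ^ (m + n) * x = 2 ^ n * (2 ^ m * x)" by (simp add: power_add)
    then show ?thesis using m that False by (metis insertE adic2_ints_mult adic2_ints_power adic2_ints_numeral)
  qed
  then show ?case by blast
qed simp

section \<open>The group \<open>PGL\<^sub>3\<close> and its topology\<close>

text \<open>The adjugate. It gives inverses over rings that are not fields, here
  \<open>adic2_int\<close> and subrings of Q(lam), with explicit control over the entries.\<close>

definition adj3 :: "'a :: comm_ring_1^3^3 \<Rightarrow> 'a^3^3"
  where "adj3 A = vector
    [vector [A$2$2 * A$3$3 - A$2$3 * A$3$2, A$1$3 * A$3$2 - A$1$2 * A$3$3, A$1$2 * A$2$3 - A$1$3 * A$2$2],
     vector [A$2$3 * A$3$1 - A$2$1 * A$3$3, A$1$1 * A$3$3 - A$1$3 * A$3$1, A$1$3 * A$2$1 - A$1$1 * A$2$3],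
     vector [A$2$1 * A$3$2 - A$2$2 * A$3$1, A$1$2 * A$3$1 - A$1$1 * A$3$2, A$1$1 * A$2$2 - A$1$2 * A$2$1]]"

lemma mat3_eq_iff: "A = B \<longleftrightarrow> (\<forall>i j. A$i$j = B$i$j)"
  by (simp add: vec_eq_iff)

lemma matrix_mult_3: "(A ** B) $ i $ j = A$i$1 * B$1$j + A$i$2 * B$2$j + A$i$3 * (B :: 'a :: semiring_1^3^3)$3$j"
  by (simp add: matrix_matrix_mult_def sum_3)

lemma matrix_vector_3: "(A *v x) $ i = A$i$1 * x$1 + A$i$2 * x$2 + A$i$3 * (x :: 'a :: semiring_1^3)$3"
  by (simp add: matrix_vector_mult_def sum_3)

lemma mat_3: "(mat c :: 'a :: semiring_1^3^3) $ i $ j = (if i = j then c else 0)"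
  by (simp add: mat_def)

lemma mult_adj3: "A ** adj3 A = mat (det A)"
  unfolding mat3_eq_iff forall_3 matrix_mult_3 mat_3 det_3 adj3_def
  by (simp add: algebra_simps)

lemma adj3_mult: "adj3 A ** A = mat (det A)"
  unfolding mat3_eq_iff forall_3 matrix_mult_3 mat_3 det_3 adj3_def
  by (simp add: algebra_simps)

lemma mat_mult_nth: "(mat c ** A) $ i $ j = c * (A :: 'a :: comm_ring_1^3^3) $ i $ j"
  using exhaust_3[of i] by (auto simp: matrix_mult_3 mat_3)

lemma mult_mat_nth: "(A ** mat c) $ i $ j = c * (A :: 'a :: comm_ring_1^3^3) $ i $ j"
  using exhaust_3[of j] by (auto simp: matrix_mult_3 mat_3)

lemma mat_commute: "mat c ** A = A ** mat c" for A :: "'a :: comm_ring_1^3^3"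
  by (simp add: mat3_eq_iff mat_mult_nth mult_mat_nth)

lemma mat_out: "A ** (mat c ** B) = mat c ** (A ** B)" for A B :: "'a :: comm_ring_1^3^3"
  by (metis mat_commute matrix_mul_assoc)

lemma mat_mult_mat: "mat a ** mat b = (mat (a * b) :: 'a :: comm_ring_1^3^3)"
  by (simp add: mat3_eq_iff mat_mult_nth mat_3)

lemma invertible_iff_det_unit: "invertible (A :: 'a :: comm_ring_1^3^3) \<longleftrightarrow> det A dvd 1"
proof
  assume "invertible A"
  then obtain B where "A ** B = mat 1" unfolding invertible_def by blast
  then have "det A * det B = 1" by (metis det_I det_mul)
  then show "det A dvd 1" by (metis dvd_triv_left)
next
  assume "det A dvd 1"
  then obtain u where u: "det A * u = 1" by (auto simp: dvd_def)
  have "A ** (mat u ** adj3 A) = mat 1"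
    by (metis mat_commute matrix_mul_assoc mult_adj3 mat_mult_mat u)
  moreover have "(mat u ** adj3 A) ** A = mat 1"
    by (metis matrix_mul_assoc adj3_mult mat_mult_mat u mult.commute)
  ultimately show "invertible A" unfolding invertible_def by blast
qed

lemma invertible_mat: "invertible (mat c :: adic2^3^3) \<longleftrightarrow> c \<noteq> 0"
  by (simp add: invertible_det_nz det_3 mat_3)

lemma matrix_inv_left: "invertible A \<Longrightarrow> matrix_inv A ** A = mat 1"
  and matrix_inv_right: "invertible A \<Longrightarrow> A ** matrix_inv A = mat 1"
  unfolding matrix_inv_def invertible_def by (metis (mono_tags, lifting) someI_ex)+

lemma invertible_matrix_inv: "invertible A \<Longrightarrow> invertible (matrix_inv A)"
  using matrix_inv_left matrix_inv_right unfolding invertible_def by blast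

lemma matrix_inv_cancel:
  fixes A B :: "adic2^3^3"
  assumes "invertible A"
  shows "matrix_inv A ** (A ** B) = B" "A ** (matrix_inv A ** B) = B"
    "(B ** A) ** matrix_inv A = B" "(B ** matrix_inv A) ** A = B"
  by (simp_all add: matrix_mul_assoc matrix_inv_left matrix_inv_right assms)
     (simp_all add: matrix_inv_left matrix_inv_right assms flip: matrix_mul_assoc)

lemma map_matrix_of_adic2_int_mult:
  "map_matrix of_adic2_int (A ** B) = map_matrix of_adic2_int A ** map_matrix of_adic2_int (B :: adic2_int^3^3)"
  by (simp add: mat3_eq_iff matrix_mult_3 of_adic2_int_add of_adic2_int_mult)

lemma map_matrix_of_adic2_int_mat: "map_matrix of_adic2_int (mat c) = (mat (of_adic2_int c) :: adic2^3^3)"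
  by (simp add: mat3_eq_iff mat_3 of_adic2_int_0)

lemma map_matrix_of_adic2_int_inject: "map_matrix of_adic2_int A = map_matrix of_adic2_int B \<longleftrightarrow> (A :: adic2_int^3^3) = B"
  by (simp add: mat3_eq_iff of_adic2_int_inject)

lemma invertible_map_matrix_of_adic2_int:
  assumes "invertible (A :: adic2_int^3^3)"
  shows "invertible (map_matrix of_adic2_int A)"
proof -
  obtain B where "A ** B = mat 1" "B ** A = mat 1" using assms unfolding invertible_def by blast
  then have "map_matrix of_adic2_int A ** map_matrix of_adic2_int B = mat 1"
    "map_matrix of_adic2_int B ** map_matrix of_adic2_int A = mat 1"
    by (simp_all add: map_matrix_of_adic2_int_mat of_adic2_int_1 flip: map_matrix_of_adic2_int_mult)
  then show ?thesis unfolding invertible_def by blast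
qed

lemma integral_matrix_obtain:
  fixes A :: "adic2^3^3"
  assumes "\<And>i j. A$i$j \<in> adic2_ints"
  obtains B where "A = map_matrix of_adic2_int B"
proof -
  have "\<forall>i j. \<exists>b. A$i$j = of_adic2_int b" using assms by (auto simp: adic2_ints_def)
  then obtain b where "\<forall>i j. A$i$j = of_adic2_int (b i j)" by metis
  then have "A = map_matrix of_adic2_int (\<chi> i j. b i j)" by (simp add: mat3_eq_iff)
  then show ?thesis by (rule that)
qed

lemma group_GL3: "group GL3"
proof (rule groupI)
  fix A B C assume A: "A \<in> carrier GL3" and B: "B \<in> carrier GL3"
  then show "A \<otimes>\<^bsub>GL3\<^esub> B \<in> carrier GL3" by (simp add: GL3_def invertible_mult)
  show "A \<otimes>\<^bsub>GL3\<^esub> B \<otimes>\<^bsub>GL3\<^esub> C = A \<otimes>\<^bsub>GL3\<^esub> (B \<otimes>\<^bsub>GL3\<^esub> C)" by (simp add: GL3_def matrix_mul_assoc)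
  show "\<one>\<^bsub>GL3\<^esub> \<otimes>\<^bsub>GL3\<^esub> A = A" by (simp add: GL3_def)
  show "\<exists>B\<in>carrier GL3. B \<otimes>\<^bsub>GL3\<^esub> A = \<one>\<^bsub>GL3\<^esub>"
    using A matrix_inv_left invertible_matrix_inv by (auto simp: GL3_def)
qed (simp add: GL3_def invertible_mat)

lemma GL3_simps: "carrier GL3 = {A. invertible A}" "A \<otimes>\<^bsub>GL3\<^esub> B = A ** B" "\<one>\<^bsub>GL3\<^esub> = mat 1"
  by (simp_all add: GL3_def)

lemma GL3_inv: "invertible A \<Longrightarrow> inv\<^bsub>GL3\<^esub> A = matrix_inv A"
  by (rule group.inv_equality[OF group_GL3]) (simp_all add: GL3_simps matrix_inv_left invertible_matrix_inv)

lemma to_PGL3_eq: "to_PGL3 A = {mat c ** A | c. c \<noteq> 0}"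
  by (auto simp: to_PGL3_def r_coset_def scalars3_def GL3_simps)

lemma normal_scalars3: "scalars3 \<lhd> GL3"
proof -
  interpret group GL3 by (rule group_GL3)
  have inv_mat: "inv\<^bsub>GL3\<^esub> (mat c) = mat (inverse c)" if "c \<noteq> 0" for c
    using that by (intro inv_equality) (simp_all add: GL3_simps mat_mult_mat invertible_mat)
  have "subgroup scalars3 GL3"
  proof (rule subgroupI)
    show "scalars3 \<subseteq> carrier GL3" by (auto simp: scalars3_def GL3_simps invertible_mat)
    show "scalars3 \<noteq> {}" by (auto simp: scalars3_def intro: exI[of _ 1])
    fix a b assume a: "a \<in> scalars3"
    then show "inv\<^bsub>GL3\<^esub> a \<in> scalars3" using inv_mat by (auto simp: scalars3_def)
    assume "b \<in> scalars3"
    with a show "a \<otimes>\<^bsub>GL3\<^esub> b \<in> scalars3" by (auto simp: scalars3_def GL3_simps mat_mult_mat)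
  qed
  moreover have "A \<otimes>\<^bsub>GL3\<^esub> h \<otimes>\<^bsub>GL3\<^esub> inv\<^bsub>GL3\<^esub> A = h"
    if Ah: "A \<in> carrier GL3" "h \<in> scalars3" for A h
  proof -
    obtain c where c: "h = mat c" using Ah by (auto simp: scalars3_def)
    have "A ** h ** matrix_inv A = h"
      using Ah unfolding c mat_commute[of c A, symmetric] by (simp add: GL3_simps matrix_inv_cancel)
    then show ?thesis using Ah by (simp add: GL3_simps GL3_inv)
  qed
  ultimately show ?thesis unfolding normal_inv_iff by simp
qed

lemma group_PGL3: "group PGL3"
  unfolding PGL3_def using normal_scalars3 by (rule normal.factorgroup_is_group)

interpretation PGL3: group PGL3 by (rule group_PGL3)

lemma carrier_PGL3: "carrier PGL3 = to_PGL3 ` {A. invertible A}"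
  by (simp add: PGL3_def carrier_FactGroup to_PGL3_def[abs_def] GL3_simps)

lemma to_PGL3_carrier [simp]: "invertible A \<Longrightarrow> to_PGL3 A \<in> carrier PGL3"
  by (simp add: carrier_PGL3)

lemma to_PGL3_mult: "invertible A \<Longrightarrow> invertible B \<Longrightarrow> to_PGL3 A \<otimes>\<^bsub>PGL3\<^esub> to_PGL3 B = to_PGL3 (A ** B)"
  using normal.rcos_sum[OF normal_scalars3, of A B]
  by (simp add: PGL3_def to_PGL3_def GL3_simps)

lemma one_PGL3: "\<one>\<^bsub>PGL3\<^esub> = to_PGL3 (mat 1)"
  by (auto simp: PGL3_def scalars3_def to_PGL3_eq)

lemma to_PGL3_inv: "invertible A \<Longrightarrow> inv\<^bsub>PGL3\<^esub> to_PGL3 A = to_PGL3 (matrix_inv A)"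
  by (rule PGL3.inv_equality)
     (simp_all add: to_PGL3_mult invertible_matrix_inv matrix_inv_left one_PGL3)

lemma to_PGL3_self: "A \<in> to_PGL3 A"
  by (auto simp: to_PGL3_eq intro: exI[of _ 1])

lemma to_PGL3_scale:
  assumes c: "c \<noteq> 0"
  shows "to_PGL3 (mat c ** A) = to_PGL3 A"
proof (intro equalityI subsetI)
  fix B assume "B \<in> to_PGL3 (mat c ** A)"
  then obtain d where "d \<noteq> 0" "B = mat d ** (mat c ** A)" by (auto simp: to_PGL3_eq)
  then have "B = mat (d * c) ** A" "d * c \<noteq> 0" using c by (simp_all add: matrix_mul_assoc mat_mult_mat)
  then show "B \<in> to_PGL3 A" unfolding to_PGL3_eq by blast
next
  fix B assume "B \<in> to_PGL3 A"
  then obtain d where "d \<noteq> 0" "B = mat d ** A" by (auto simp: to_PGL3_eq)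
  then have "B = mat (d / c) ** (mat c ** A)" "d / c \<noteq> 0" using c by (simp_all add: matrix_mul_assoc mat_mult_mat)
  then show "B \<in> to_PGL3 (mat c ** A)" unfolding to_PGL3_eq[of "mat c ** A"] by blast
qed

lemma to_PGL3_eq_iff: "to_PGL3 A = to_PGL3 B \<longleftrightarrow> (\<exists>c. c \<noteq> 0 \<and> A = mat c ** B)"
  using to_PGL3_self[of A] to_PGL3_scale[of _ B] by (auto simp: to_PGL3_eq[of B])

lemma mem_to_PGL3_invertible: "invertible A \<Longrightarrow> B \<in> to_PGL3 A \<Longrightarrow> invertible B \<and> to_PGL3 B = to_PGL3 A"
  using to_PGL3_scale by (auto simp: to_PGL3_eq[of A] invertible_mult invertible_mat)

lemma PGL3_cases: "g \<in> carrier PGL3 \<Longrightarrow> \<exists>A. invertible A \<and> g = to_PGL3 A"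
  by (auto simp: carrier_PGL3)

text \<open>Elements of \<open>PGL3\<close> are sets of matrices, so \<open>\<Union>U\<close> is the
  preimage of \<open>U\<close> in \<open>GL3\<close>, the set that the quotient topology tests for
  openness.\<close>

lemma Union_PGL3:
  assumes "U \<subseteq> carrier PGL3"
  shows "\<Union>U = {A. invertible A \<and> to_PGL3 A \<in> U}"
proof (intro equalityI subsetI)
  fix A assume "A \<in> \<Union>U"
  then obtain g where g: "g \<in> U" "A \<in> g" by blast
  then obtain B where "invertible B" "g = to_PGL3 B" using assms PGL3_cases by blast
  then have "invertible A" "to_PGL3 A = g" using g mem_to_PGL3_invertible by blast+
  then show "A \<in> {A. invertible A \<and> to_PGL3 A \<in> U}" using g by simp
next
  fix A assume "A \<in> {A. invertible A \<and> to_PGL3 A \<in> U}"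
  then show "A \<in> \<Union>U" using to_PGL3_self by blast
qed

section \<open>Congruence subgroups as neighbourhoods of the identity\<close>

lemma open_matrix_iff:
  fixes S :: "(adic2^3^3) set"
  shows "open S \<longleftrightarrow> (\<forall>A\<in>S. \<exists>N. \<forall>B. (\<forall>i j. \<exists>z. B$i$j = A$i$j + of_adic2_int (2 ^ N * z)) \<longrightarrow> B \<in> S)"
proof
  assume S: "open S"
  show "\<forall>A\<in>S. \<exists>N. \<forall>B. (\<forall>i j. \<exists>z. B$i$j = A$i$j + of_adic2_int (2 ^ N * z)) \<longrightarrow> B \<in> S"
  proof
    fix A assume "A \<in> S"
    then obtain R where R: "\<And>i. open (R i)" "\<And>i. A$i \<in> R i" "\<And>y. (\<And>i. y$i \<in> R i) \<Longrightarrow> y \<in> S"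
      using S unfolding open_vec_def by metis
    have "\<forall>i. \<exists>T. (\<forall>j. open (T j) \<and> A$i$j \<in> T j) \<and> (\<forall>y. (\<forall>j. y$j \<in> T j) \<longrightarrow> y \<in> R i)"
      using R(1,2) unfolding open_vec_def[of "R _"] by blast
    then obtain T where T: "\<And>i j. open (T i j)" "\<And>i j. A$i$j \<in> T i j"
      "\<And>i y. (\<And>j. y$j \<in> T i j) \<Longrightarrow> y \<in> R i" by metis
    have "\<forall>i j. \<exists>n. \<forall>z. A$i$j + of_adic2_int (2 ^ n * z) \<in> T i j"
      using T(1,2) unfolding open_adic2_def by blast
    then obtain n where n: "\<And>i j z. A$i$j + of_adic2_int (2 ^ n i j * z) \<in> T i j" by metis
    \<comment> \<open>The sum dominates each exponent, so one power of 2 serves all nine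
      entries.\<close>
    define N where "N = (\<Sum>i\<in>UNIV. \<Sum>j\<in>UNIV. n i j)"
    have le: "n i j \<le> N" for i j
      unfolding N_def using member_le_sum[of i UNIV "\<lambda>i. \<Sum>j\<in>UNIV. n i j"] member_le_sum[of j UNIV "n i"]
      by (meson UNIV_I finite order_trans zero_le)
    have "B \<in> S" if B: "\<forall>i j. \<exists>z. B$i$j = A$i$j + of_adic2_int (2 ^ N * z)" for B
    proof (rule R(3), rule T(3))
      fix i j
      obtain z where z: "B$i$j = A$i$j + of_adic2_int (2 ^ N * z)" using B by blast
      have "2 ^ N * z = 2 ^ n i j * (2 ^ (N - n i j) * z)"
        using le[of i j] by (simp add: mult.assoc[symmetric] power_add[symmetric])
      then show "B$i$j \<in> T i j" using n z by metis
    qed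
    then show "\<exists>N. \<forall>B. (\<forall>i j. \<exists>z. B$i$j = A$i$j + of_adic2_int (2 ^ N * z)) \<longrightarrow> B \<in> S" by blast
  qed
next
  assume S: "\<forall>A\<in>S. \<exists>N. \<forall>B. (\<forall>i j. \<exists>z. B$i$j = A$i$j + of_adic2_int (2 ^ N * z)) \<longrightarrow> B \<in> S"
  have ball: "open {x. \<exists>z. x = a + of_adic2_int (2 ^ N * z)}" for a N
    unfolding open_adic2_def
  proof safe
    fix z
    show "\<exists>n. \<forall>w. a + of_adic2_int (2 ^ N * z) + of_adic2_int (2 ^ n * w)
        \<in> {x. \<exists>z. x = a + of_adic2_int (2 ^ N * z)}"
      by (rule exI[of _ N]) (auto simp: add.assoc simp flip: of_adic2_int_add distrib_left)
  qed
  show "open S"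
    unfolding open_vec_def[of S]
  proof
    fix A assume "A \<in> S"
    then obtain N where N: "\<And>B. (\<forall>i j. \<exists>z. B$i$j = A$i$j + of_adic2_int (2 ^ N * z)) \<Longrightarrow> B \<in> S"
      using S by blast
    let ?R = "\<lambda>i. {y. \<forall>j. \<exists>z. y$j = A$i$j + of_adic2_int (2 ^ N * z)}"
    have self: "\<exists>z. a = a + of_adic2_int (2 ^ N * z)" for a
      by (rule exI[of _ 0]) (simp add: of_adic2_int_0)
    have "open (?R i)" for i
      unfolding open_vec_def
    proof
      fix y assume y: "y \<in> ?R i"
      show "\<exists>T. (\<forall>j. open (T j) \<and> y$j \<in> T j) \<and> (\<forall>x. (\<forall>j. x$j \<in> T j) \<longrightarrow> x \<in> ?R i)"
        by (rule exI[of _ "\<lambda>j. {x. \<exists>z. x = A$i$j + of_adic2_int (2 ^ N * z)}"]) (use y ball in auto)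
    qed
    then show "\<exists>R. (\<forall>i. open (R i) \<and> A$i \<in> R i) \<and> (\<forall>y. (\<forall>i. y$i \<in> R i) \<longrightarrow> y \<in> S)"
      using self by (intro exI[of _ ?R]) (auto intro!: N)
  qed
qed

text \<open>At \<open>n = 0\<close> the congruence is void; demanding invertibility makes this level
  all of GL3 over the 2-adic integers, as \<open>K 0\<close> should be. For \<open>n > 0\<close> the
  congruence itself implies invertibility.\<close>

definition congruence_matrices :: "nat \<Rightarrow> (adic2_int^3^3) set"
  where "congruence_matrices n = {A. invertible A \<and> (\<forall>i j. 2 ^ n dvd A$i$j - mat 1$i$j)}"

definition congruence_subgroup :: "nat \<Rightarrow> (adic2^3^3) set set"
  where "congruence_subgroup n = (\<lambda>A. to_PGL3 (map_matrix of_adic2_int A)) ` congruence_matrices n"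

lemma congruence_subgroup_0: "congruence_subgroup 0 = PGL3_int"
  by (auto simp: congruence_subgroup_def congruence_matrices_def PGL3_int_def)

lemma invertible_adic2_int_iff: "invertible (A :: adic2_int^3^3) \<longleftrightarrow> \<not> 2 dvd det A"
  by (simp add: invertible_iff_det_unit adic2_int_unit_iff)

lemma invertible_if_cong_one:
  assumes "\<And>i j. 2 dvd (A :: adic2_int^3^3)$i$j - mat 1$i$j"
  shows "invertible A"
proof -
  have *: "2 dvd A$i$j \<longleftrightarrow> i \<noteq> j" for i j
    using assms[of i j] not_two_dvd_one_adic2_int by (auto simp: mat_3 two_dvd_diff_adic2_int_iff split: if_splits)
  show ?thesis
    unfolding invertible_adic2_int_iff det_3
    by (simp add: two_dvd_diff_adic2_int_iff two_dvd_add_adic2_int_iff two_dvd_mult_adic2_int_iff *)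
qed

lemma matrix_diff_ldistrib: "A ** (B - C) = A ** B - A ** C" for A B C :: "'a :: comm_ring_1^3^3"
  by (simp add: mat3_eq_iff matrix_mult_3 algebra_simps)

lemma matrix_add_rdistrib: "(A + B) ** C = A ** C + B ** C" for A B C :: "'a :: comm_ring_1^3^3"
  by (simp add: mat3_eq_iff matrix_mult_3 algebra_simps)

lemma dvd_matrix_mult_left:
  assumes "\<And>i j. d dvd (B :: 'a :: comm_ring_1^3^3)$i$j"
  shows "d dvd (A ** B)$i$j" "d dvd (B ** A)$i$j"
  unfolding matrix_mult_3 using assms by (auto intro!: dvd_add dvd_mult dvd_mult2)

lemma congruence_subgroup_subset: "congruence_subgroup n \<subseteq> carrier PGL3"
  by (auto simp: congruence_subgroup_def congruence_matrices_def intro!: to_PGL3_carrier invertible_map_matrix_of_adic2_int)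

lemma congruence_matrices_mult:
  assumes A: "A \<in> congruence_matrices n" and B: "B \<in> congruence_matrices n"
  shows "A ** B \<in> congruence_matrices n"
proof -
  have "2 ^ n dvd (A ** B)$i$j - mat 1$i$j" for i j
  proof -
    have "2 ^ n dvd (A ** (B - mat 1))$i$j"
      using B by (intro dvd_matrix_mult_left) (simp add: congruence_matrices_def)
    moreover have "2 ^ n dvd A$i$j - mat 1$i$j" using A by (simp add: congruence_matrices_def)
    ultimately have "2 ^ n dvd (A ** (B - mat 1))$i$j + (A$i$j - mat 1$i$j)" by (rule dvd_add)
    then show ?thesis by (simp add: matrix_diff_ldistrib)
  qed
  then show ?thesis
    using A B by (simp add: congruence_matrices_def invertible_mult)
qed

text \<open>If \<open>B\<close> is inverse to \<open>A\<close> then B - 1 = - B (A - 1), so the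
  congruence passes to \<open>B\<close>.\<close>

lemma congruence_matrices_inv:
  assumes A: "A \<in> congruence_matrices n"
  shows "\<exists>B\<in>congruence_matrices n. A ** B = mat 1 \<and> B ** A = mat 1"
proof -
  obtain B where B: "A ** B = mat 1" "B ** A = mat 1"
    using A unfolding congruence_matrices_def invertible_def by blast
  have "B - mat 1 = - (B ** (A - mat 1))" by (simp add: matrix_diff_ldistrib B)
  moreover have "2 ^ n dvd (B ** (A - mat 1))$i$j" for i j
    using A by (intro dvd_matrix_mult_left) (simp add: congruence_matrices_def)
  ultimately have "2 ^ n dvd (B - mat 1)$i$j" for i j by simp
  then have "B \<in> congruence_matrices n"
    using B by (auto simp: congruence_matrices_def invertible_def)
  then show ?thesis using B by blast
qed

lemma subgroup_congruence: "subgroup (congruence_subgroup n) PGL3"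
proof (rule PGL3.subgroupI)
  show "congruence_subgroup n \<subseteq> carrier PGL3" by (rule congruence_subgroup_subset)
  have "mat 1 \<in> congruence_matrices n"
    by (auto simp: congruence_matrices_def invertible_def intro: exI[of _ "mat 1"])
  then show "congruence_subgroup n \<noteq> {}" by (auto simp: congruence_subgroup_def)
  fix g h assume "g \<in> congruence_subgroup n"
  then obtain A where A: "A \<in> congruence_matrices n" "g = to_PGL3 (map_matrix of_adic2_int A)"
    by (auto simp: congruence_subgroup_def)
  have iA: "invertible (map_matrix of_adic2_int A)"
    using A by (auto simp: congruence_matrices_def intro: invertible_map_matrix_of_adic2_int)
  obtain B where B: "B \<in> congruence_matrices n" "A ** B = mat 1" "B ** A = mat 1"
    using congruence_matrices_inv A by blast
  have iB: "invertible (map_matrix of_adic2_int B)"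
    using B by (auto simp: congruence_matrices_def intro: invertible_map_matrix_of_adic2_int)
  have "inv\<^bsub>PGL3\<^esub> g = to_PGL3 (map_matrix of_adic2_int B)"
    using iA iB B by (intro PGL3.inv_equality)
      (simp_all add: A to_PGL3_mult one_PGL3 map_matrix_of_adic2_int_mat of_adic2_int_1 flip: map_matrix_of_adic2_int_mult)
  then show "inv\<^bsub>PGL3\<^esub> g \<in> congruence_subgroup n" using B by (auto simp: congruence_subgroup_def)
  assume "h \<in> congruence_subgroup n"
  then obtain C where C: "C \<in> congruence_matrices n" "h = to_PGL3 (map_matrix of_adic2_int C)"
    by (auto simp: congruence_subgroup_def)
  have iC: "invertible (map_matrix of_adic2_int C)"
    using C by (auto simp: congruence_matrices_def intro: invertible_map_matrix_of_adic2_int)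
  have "g \<otimes>\<^bsub>PGL3\<^esub> h = to_PGL3 (map_matrix of_adic2_int (A ** C))"
    using iA iC by (simp add: A C to_PGL3_mult map_matrix_of_adic2_int_mult)
  then show "g \<otimes>\<^bsub>PGL3\<^esub> h \<in> congruence_subgroup n"
    using congruence_matrices_mult A C by (auto simp: congruence_subgroup_def)
qed

lemma congruence_matrices_mono: "m \<le> n \<Longrightarrow> congruence_matrices n \<subseteq> congruence_matrices m"
  by (auto simp: congruence_matrices_def intro: dvd_trans[OF le_imp_power_dvd])

lemma congruence_subgroup_mono: "m \<le> n \<Longrightarrow> congruence_subgroup n \<subseteq> congruence_subgroup m"
  using congruence_matrices_mono[of m n] by (auto simp: congruence_subgroup_def)

lemma scale_matrix_integral: "\<exists>m. \<forall>i j. 2 ^ m * (A :: adic2^3^3)$i$j \<in> adic2_ints"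
  using adic2_scale_integral_finite[of "range (\<lambda>(i, j). A$i$j)"] by auto

text \<open>A positive exponent makes 1 + 2^n P invertible for every integral P. Together with
  \<open>congruence_matrixD\<close> this translates between additive and multiplicative
  neighbourhoods.\<close>

lemma congruence_matrixI:
  fixes C P :: "adic2^3^3"
  assumes n: "n \<ge> 1" and P: "\<And>i j. P$i$j \<in> adic2_ints" and C: "C = mat 1 + mat (2 ^ n) ** P"
  shows "\<exists>C'\<in>congruence_matrices n. C = map_matrix of_adic2_int C'"
proof -
  obtain Q where Q: "P = map_matrix of_adic2_int Q" using integral_matrix_obtain P by blast
  let ?C = "mat 1 + mat (2 ^ n) ** Q"
  have dvd: "2 ^ n dvd ?C$i$j - mat 1$i$j" for i j by (simp add: mat_mult_nth)
  moreover have "2 dvd ?C$i$j - mat 1$i$j" for i j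
    using dvd_trans[OF dvd_power[of n 2] dvd] n by simp
  ultimately have "?C \<in> congruence_matrices n"
    using invertible_if_cong_one[of ?C] by (simp add: congruence_matrices_def)
  moreover have "C = map_matrix of_adic2_int ?C"
    by (simp add: C Q mat3_eq_iff mat_mult_nth mat_3 of_adic2_int_add of_adic2_int_mult of_adic2_int_power
        of_adic2_int_numeral of_adic2_int_1 of_adic2_int_0)
  ultimately show ?thesis by blast
qed

lemma congruence_matrixD:
  assumes "C \<in> congruence_matrices n"
  shows "\<exists>P :: adic2^3^3. (\<forall>i j. P$i$j \<in> adic2_ints) \<and> map_matrix of_adic2_int C = mat 1 + mat (2 ^ n) ** P"
proof -
  have "\<forall>i j. \<exists>q. C$i$j - mat 1$i$j = 2 ^ n * q" using assms by (auto simp: congruence_matrices_def dvd_def)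
  then obtain q where q: "\<And>i j. C$i$j - mat 1$i$j = 2 ^ n * q i j" by metis
  have e: "C$i$j = mat 1$i$j + 2 ^ n * q i j" for i j using q[of i j] by (simp add: algebra_simps)
  have "map_matrix of_adic2_int C = mat 1 + mat (2 ^ n) ** (\<chi> i j. of_adic2_int (q i j))"
    by (simp add: mat3_eq_iff e mat_mult_nth mat_3 of_adic2_int_add of_adic2_int_mult of_adic2_int_power
        of_adic2_int_numeral of_adic2_int_1 of_adic2_int_0)
  then show ?thesis by (intro exI[of _ "\<chi> i j. of_adic2_int (q i j)"]) simp
qed

lemma integral_matrix_mult:
  assumes "\<And>i j. (A :: adic2^3^3)$i$j \<in> adic2_ints" "\<And>i j. (B :: adic2^3^3)$i$j \<in> adic2_ints"
  shows "(A ** B)$i$j \<in> adic2_ints"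
  unfolding matrix_mult_3 using assms by (intro adic2_ints_add adic2_ints_mult)

lemma PGL3_l_coset:
  assumes "invertible A"
  shows "to_PGL3 A <#\<^bsub>PGL3\<^esub> congruence_subgroup n = (\<lambda>C. to_PGL3 (A ** map_matrix of_adic2_int C)) ` congruence_matrices n"
  unfolding l_coset_def congruence_subgroup_def
  using assms by (auto simp: to_PGL3_mult invertible_map_matrix_of_adic2_int congruence_matrices_def image_iff
      intro!: bexI[rotated])

text \<open>A neighbourhood of \<open>A\<close> among matrices allows an additive error 2^N Z, a
  coset of a congruence subgroup a right factor 1 + 2^n P. The two are compared by clearing the
  denominators of \<open>A\<close> in one direction and those of its inverse in the other.\<close>

lemma openin_PGL3_topology_iff:
  "openin PGL3_topology U \<longleftrightarrow> U \<subseteq> carrier PGL3 \<and> (\<forall>g\<in>U. \<exists>n. g <#\<^bsub>PGL3\<^esub> congruence_subgroup n \<subseteq> U)"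
proof -
  have disj: "disjoint (carrier PGL3)"
    using group.rcos_disjoint[OF group_GL3 normal_imp_subgroup[OF normal_scalars3]]
    by (simp add: PGL3_def FactGroup_def disjoint_def pairwise_def disjnt_def)
  have main: "openin (top_of_set (carrier GL3)) (\<Union>U) \<longleftrightarrow> (\<forall>g\<in>U. \<exists>n. g <#\<^bsub>PGL3\<^esub> congruence_subgroup n \<subseteq> U)"
    if U: "U \<subseteq> carrier PGL3"
  proof
    assume "openin (top_of_set (carrier GL3)) (\<Union>U)"
    then obtain T where T: "open T" "\<Union>U = carrier GL3 \<inter> T" by (auto simp: openin_open)
    show "\<forall>g\<in>U. \<exists>n. g <#\<^bsub>PGL3\<^esub> congruence_subgroup n \<subseteq> U"
    proof
      fix g assume g: "g \<in> U"
      then obtain A where A: "invertible A" "g = to_PGL3 A" using U PGL3_cases by blast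
      then have "A \<in> T" using g T to_PGL3_self by blast
      then obtain N where N: "\<And>B. (\<forall>i j. \<exists>z. B$i$j = A$i$j + of_adic2_int (2 ^ N * z)) \<Longrightarrow> B \<in> T"
        using T(1) unfolding open_matrix_iff by blast
      obtain m where m: "\<And>i j. 2 ^ m * A$i$j \<in> adic2_ints" using scale_matrix_integral by blast
      have "to_PGL3 (A ** map_matrix of_adic2_int C) \<in> U" if C: "C \<in> congruence_matrices (m + N)" for C
      proof -
        obtain P :: "adic2^3^3" where P: "\<And>i j. P$i$j \<in> adic2_ints"
          "map_matrix of_adic2_int C = mat 1 + mat (2 ^ (m + N)) ** P" using congruence_matrixD C by blast
        let ?B = "A ** map_matrix of_adic2_int C"
        have iB: "invertible ?B"
          using A C by (auto simp: congruence_matrices_def intro!: invertible_mult invertible_map_matrix_of_adic2_int)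
        have "\<exists>z. ?B$i$j = A$i$j + of_adic2_int (2 ^ N * z)" for i j
        proof -
          have "((mat (2 ^ m) ** A) ** P)$i$j \<in> adic2_ints"
            by (rule integral_matrix_mult) (simp_all add: mat_mult_nth m P(1))
          then obtain z where z: "((mat (2 ^ m) ** A) ** P)$i$j = of_adic2_int z" by (auto simp: adic2_ints_def)
          have "?B = A + mat (2 ^ N) ** ((mat (2 ^ m) ** A) ** P)"
            unfolding P(2) mat3_eq_iff matrix_mult_3 mat_mult_nth
            by (simp add: mat_3 mat_mult_nth matrix_mult_3 forall_3 algebra_simps power_add)
          then have "?B$i$j = A$i$j + 2 ^ N * of_adic2_int z"
            by (simp add: mat_mult_nth z)
          then show ?thesis
            by (intro exI[of _ z]) (simp add: of_adic2_int_mult of_adic2_int_power of_adic2_int_numeral)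
        qed
        then have "?B \<in> T" by (intro N) blast
        then have "?B \<in> \<Union>U" using T iB by (simp add: GL3_simps)
        then show ?thesis unfolding Union_PGL3[OF U] by simp
      qed
      then show "\<exists>n. g <#\<^bsub>PGL3\<^esub> congruence_subgroup n \<subseteq> U"
        using A PGL3_l_coset by (intro exI[of _ "m + N"]) auto
    qed
  next
    assume *: "\<forall>g\<in>U. \<exists>n. g <#\<^bsub>PGL3\<^esub> congruence_subgroup n \<subseteq> U"
    have "open (\<Union>U)"
      unfolding open_matrix_iff
    proof
      fix A assume "A \<in> \<Union>U"
      then have A: "invertible A" "to_PGL3 A \<in> U" using Union_PGL3[OF U] by auto
      then obtain n where n: "to_PGL3 A <#\<^bsub>PGL3\<^esub> congruence_subgroup n \<subseteq> U" using * by blast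
      obtain m where m: "\<And>i j. 2 ^ m * matrix_inv A$i$j \<in> adic2_ints" using scale_matrix_integral by blast
      \<comment> \<open>The part \<open>m\<close> of the exponent absorbs the denominators of the
        inverse; \<open>Suc n\<close> in place of \<open>n\<close> keeps the remaining exponent
        positive, as \<open>congruence_matrixI\<close> requires.\<close>
      have "B \<in> \<Union>U" if B: "\<forall>i j. \<exists>z. B$i$j = A$i$j + of_adic2_int (2 ^ (m + Suc n) * z)" for B
      proof -
        obtain z where z: "\<And>i j. B$i$j = A$i$j + of_adic2_int (2 ^ (m + Suc n) * z i j)" using B by metis
        define Z :: "adic2^3^3" where "Z = (\<chi> i j. of_adic2_int (z i j))"
        have BA: "B = A + mat (2 ^ (m + Suc n)) ** Z"
          by (simp add: mat3_eq_iff z mat_mult_nth Z_def of_adic2_int_mult of_adic2_int_power of_adic2_int_numeral)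
        define P where "P = (mat (2 ^ m) ** matrix_inv A) ** Z"
        have P: "P$i$j \<in> adic2_ints" for i j
          unfolding P_def by (rule integral_matrix_mult) (simp_all add: mat_mult_nth m Z_def)
        obtain C where C: "C \<in> congruence_matrices (Suc n)" "mat 1 + mat (2 ^ Suc n) ** P = map_matrix of_adic2_int C"
          using congruence_matrixI[OF _ P refl, of "Suc n"] by auto
        have "mat (2 ^ (m + Suc n)) ** Z = A ** (mat (2 ^ Suc n) ** P)"
        proof -
          have "A ** (mat (2 ^ Suc n) ** P) = mat (2 ^ Suc n) ** (mat (2 ^ m) ** (A ** (matrix_inv A ** Z)))"
            unfolding P_def by (simp only: mat_out[of A] matrix_mul_assoc[of "mat (2 ^ m)", symmetric])
          also have "\<dots> = mat (2 ^ Suc n * 2 ^ m) ** Z"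
            using A by (simp add: matrix_inv_cancel matrix_mul_assoc mat_mult_mat)
          finally show ?thesis by (simp add: power_add mult_ac)
        qed
        then have BC: "B = A ** map_matrix of_adic2_int C"
          unfolding BA C(2)[symmetric] by (simp add: matrix_add_ldistrib)
        have "C \<in> congruence_matrices n" using C congruence_matrices_mono[of n "Suc n"] by auto
        then have "to_PGL3 B \<in> U" unfolding BC using n PGL3_l_coset[OF A(1)] by blast
        moreover have "invertible B"
          unfolding BC using A C by (intro invertible_mult invertible_map_matrix_of_adic2_int) (simp_all add: congruence_matrices_def)
        ultimately show ?thesis by (simp add: Union_PGL3[OF U])
      qed
      then show "\<exists>N. \<forall>B. (\<forall>i j. \<exists>z. B$i$j = A$i$j + of_adic2_int (2 ^ N * z)) \<longrightarrow> B \<in> \<Union>U" by blast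
    qed
    moreover have "\<Union>U \<subseteq> carrier GL3" using Union_PGL3[OF U] by (auto simp: GL3_simps)
    ultimately show "openin (top_of_set (carrier GL3)) (\<Union>U)"
      by (auto simp: openin_open)
  qed
  show ?thesis
    unfolding PGL3_topology_def openin_quotient_topology[OF disj] using main by blast
qed

text \<open>On 1 + 2^(a + b + n + 1) P, conjugation by \<open>A\<close> loses at most the
  denominators 2^a of \<open>A\<close> and 2^b of its inverse.\<close>

lemma congruence_conj:
  assumes "g \<in> carrier PGL3"
  shows "\<exists>m. \<forall>k\<in>congruence_subgroup m. g \<otimes>\<^bsub>PGL3\<^esub> k \<otimes>\<^bsub>PGL3\<^esub> inv\<^bsub>PGL3\<^esub> g \<in> congruence_subgroup n"
proof -
  obtain A where A: "invertible A" "g = to_PGL3 A" using assms PGL3_cases by blast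
  obtain a where a: "\<And>i j. 2 ^ a * A$i$j \<in> adic2_ints" using scale_matrix_integral by blast
  obtain b where b: "\<And>i j. 2 ^ b * matrix_inv A$i$j \<in> adic2_ints" using scale_matrix_integral by blast
  have "g \<otimes>\<^bsub>PGL3\<^esub> k \<otimes>\<^bsub>PGL3\<^esub> inv\<^bsub>PGL3\<^esub> g \<in> congruence_subgroup n"
    if k: "k \<in> congruence_subgroup (a + b + Suc n)" for k
  proof -
    obtain C where C: "C \<in> congruence_matrices (a + b + Suc n)" "k = to_PGL3 (map_matrix of_adic2_int C)"
      using k by (auto simp: congruence_subgroup_def)
    have iC: "invertible (map_matrix of_adic2_int C)"
      using C by (auto simp: congruence_matrices_def intro: invertible_map_matrix_of_adic2_int)
    obtain P :: "adic2^3^3" where P: "\<And>i j. P$i$j \<in> adic2_ints"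
      "map_matrix of_adic2_int C = mat 1 + mat (2 ^ (a + b + Suc n)) ** P" using congruence_matrixD C by blast
    define P' where "P' = ((mat (2 ^ a) ** A) ** P) ** (mat (2 ^ b) ** matrix_inv A)"
    have P': "P'$i$j \<in> adic2_ints" for i j
      unfolding P'_def by (rule integral_matrix_mult, rule integral_matrix_mult) (simp_all add: mat_mult_nth a b P(1))
    have "A ** (mat (2 ^ (a + b + Suc n)) ** P) ** matrix_inv A = mat (2 ^ Suc n) ** P'"
    proof -
      have "mat (2 ^ Suc n) ** P' = mat (2 ^ Suc n) ** (mat (2 ^ a) ** (mat (2 ^ b) ** ((A ** P) ** matrix_inv A)))"
        unfolding P'_def by (simp only: mat_out[of "A ** P"] matrix_mul_assoc[of "mat (2 ^ a)", symmetric])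
      also have "\<dots> = mat (2 ^ (a + b + Suc n)) ** ((A ** P) ** matrix_inv A)"
        by (simp add: matrix_mul_assoc mat_mult_mat power_add mult_ac)
      also have "\<dots> = A ** (mat (2 ^ (a + b + Suc n)) ** P) ** matrix_inv A"
        by (simp only: mat_out[of A] matrix_mul_assoc[of "mat (2 ^ (a + b + Suc n))", symmetric])
      finally show ?thesis ..
    qed
    then have "A ** map_matrix of_adic2_int C ** matrix_inv A = mat 1 + mat (2 ^ Suc n) ** P'"
      unfolding P(2) using A by (simp add: matrix_add_ldistrib matrix_add_rdistrib matrix_inv_right)
    then obtain C' where C': "C' \<in> congruence_matrices (Suc n)"
      "A ** map_matrix of_adic2_int C ** matrix_inv A = map_matrix of_adic2_int C'"
      using congruence_matrixI[OF _ P', of "Suc n"] by auto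
    have "g \<otimes>\<^bsub>PGL3\<^esub> k \<otimes>\<^bsub>PGL3\<^esub> inv\<^bsub>PGL3\<^esub> g = to_PGL3 (map_matrix of_adic2_int C')"
      using A iC by (simp add: C to_PGL3_inv to_PGL3_mult invertible_mult invertible_matrix_inv flip: C'(2))
    then show ?thesis
      using C' congruence_matrices_mono[of n "Suc n"] by (auto simp: congruence_subgroup_def)
  qed
  then show ?thesis by blast
qed

text \<open>Integral invertible matrices with equal residues modulo \<open>2 ^ n\<close> differ by a
  right factor congruent to 1, so the coset depends only on the residue matrix, of which there are
  finitely many.\<close>

lemma congruence_index: "finite ((\<lambda>k. k <#\<^bsub>PGL3\<^esub> congruence_subgroup n) ` congruence_subgroup 0)"
proof -
  define res where "res A = (\<lambda>i j. Rep_adic2_int ((A :: adic2_int^3^3)$i$j) n)" for A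
  define F where "F A = to_PGL3 (map_matrix of_adic2_int A) <#\<^bsub>PGL3\<^esub> congruence_subgroup n" for A
  let ?I = "{A :: adic2_int^3^3. invertible A}"
  have "finite {f :: 3 \<Rightarrow> 3 \<Rightarrow> int. \<forall>i j. f i j \<in> {0..<2 ^ n}}"
  proof -
    have "finite {f :: 3 \<Rightarrow> int. \<forall>i. f i \<in> {0..<2 ^ n}}"
      using finite_PiE[of "UNIV :: 3 set" "\<lambda>_. {0..<2 ^ n :: int}"] by (simp add: PiE_UNIV_domain Pi_def)
    then show ?thesis
      using finite_PiE[of "UNIV :: 3 set" "\<lambda>_. {f :: 3 \<Rightarrow> int. \<forall>i. f i \<in> {0..<2 ^ n}}"] by (simp add: PiE_UNIV_domain Pi_def)
  qed
  moreover have "res ` ?I \<subseteq> {f. \<forall>i j. f i j \<in> {0..<2 ^ n}}"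
    using adic2_int_rep_less by (auto simp: res_def)
  ultimately have fin: "finite (res ` ?I)" by (rule finite_subset[rotated])
  have F: "F A = F B" if A: "invertible A" and B: "invertible B" and eq: "res A = res B" for A B
  proof -
    obtain A' where A': "A ** A' = mat 1" "A' ** A = mat 1" using A unfolding invertible_def by blast
    have "2 ^ n dvd (B - A)$i$j" for i j
      using fun_cong[OF fun_cong[OF eq, of i], of j]
      by (simp add: two_power_dvd_adic2_int_iff res_def minus_adic2_int.rep_eq)
    then have "2 ^ n dvd (A' ** (B - A))$i$j" for i j by (rule dvd_matrix_mult_left)
    then have "A' ** B \<in> congruence_matrices n"
      using invertible_mult[of A' B] A' B by (simp add: congruence_matrices_def matrix_diff_ldistrib) (auto simp: invertible_def)
    moreover have "map_matrix of_adic2_int B = map_matrix of_adic2_int A ** map_matrix of_adic2_int (A' ** B)"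
      unfolding map_matrix_of_adic2_int_mult[symmetric] matrix_mul_assoc A'(1) matrix_mul_lid ..
    ultimately have "to_PGL3 (map_matrix of_adic2_int B) \<in> F A"
      unfolding F_def PGL3_l_coset[OF invertible_map_matrix_of_adic2_int[OF A]] by (auto intro: image_eqI)
    then show ?thesis
      unfolding F_def
      by (rule PGL3.l_repr_independence[OF _ to_PGL3_carrier[OF invertible_map_matrix_of_adic2_int[OF A]] subgroup_congruence])
  qed
  have "F ` ?I \<subseteq> (\<lambda>r. F (inv_into ?I res r)) ` (res ` ?I)"
  proof
    fix x assume "x \<in> F ` ?I"
    then obtain A where A: "A \<in> ?I" "x = F A" by (rule imageE)
    then have r: "res A \<in> res ` ?I" by (rule_tac imageI)
    have "inv_into ?I res (res A) \<in> ?I" "res (inv_into ?I res (res A)) = res A"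
      by (rule inv_into_into[OF r], rule f_inv_into_f[OF r])
    then have "F A = F (inv_into ?I res (res A))" using A(1) by (intro F) simp_all
    then show "x \<in> (\<lambda>r. F (inv_into ?I res r)) ` (res ` ?I)"
      unfolding A(2) using r by (rule image_eqI)
  qed
  then have "finite (F ` ?I)" using finite_subset finite_imageI[OF fin] by metis
  moreover have "(\<lambda>k. k <#\<^bsub>PGL3\<^esub> congruence_subgroup n) ` congruence_subgroup 0 = F ` ?I"
    by (auto simp: congruence_subgroup_def congruence_matrices_def F_def)
  ultimately show ?thesis by simp
qed

lemma filtered_PGL3: "filtered_group PGL3 PGL3_topology congruence_subgroup"
proof (rule filtered_group.intro[OF group_PGL3], rule filtered_group_axioms.intro)
  show "congruence_subgroup (Suc n) \<subseteq> congruence_subgroup n" for n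
    by (rule congruence_subgroup_mono) simp
qed (rule subgroup_congruence openin_PGL3_topology_iff congruence_conj congruence_index; assumption?)+

section \<open>Lattices in the 3-dimensional space\<close>

definition even2 :: "adic2 \<Rightarrow> bool"
  where "even2 x \<longleftrightarrow> (\<exists>y. x = of_adic2_int y \<and> 2 dvd y)"

lemma even2_of_adic2_int [simp]: "even2 (of_adic2_int y) \<longleftrightarrow> 2 dvd y"
  by (auto simp: even2_def of_adic2_int_inject)

lemma even2_0 [simp]: "even2 0" and not_even2_1 [simp]: "\<not> even2 1"
  using even2_of_adic2_int[of 0] even2_of_adic2_int[of 1]
  by (simp_all only: of_adic2_int_0 of_adic2_int_1) (simp_all add: not_two_dvd_one_adic2_int)

lemma even2_add:
  assumes "x \<in> adic2_ints" "y \<in> adic2_ints"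
  shows "even2 (x + y) \<longleftrightarrow> (even2 x \<longleftrightarrow> even2 y)"
  using assms by (auto simp: adic2_ints_def two_dvd_add_adic2_int_iff simp flip: of_adic2_int_add)

lemma even2_diff:
  assumes "x \<in> adic2_ints" "y \<in> adic2_ints"
  shows "even2 (x - y) \<longleftrightarrow> (even2 x \<longleftrightarrow> even2 y)"
  using assms by (auto simp: adic2_ints_def two_dvd_diff_adic2_int_iff simp flip: of_adic2_int_diff)

lemma even2_mult:
  assumes "x \<in> adic2_ints" "y \<in> adic2_ints"
  shows "even2 (x * y) \<longleftrightarrow> even2 x \<or> even2 y"
  using assms by (auto simp: adic2_ints_def two_dvd_mult_adic2_int_iff simp flip: of_adic2_int_mult)

lemma even2_iff_half: "even2 x \<longleftrightarrow> (\<exists>y\<in>adic2_ints. x = 2 * y)"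
proof
  assume "even2 x"
  then obtain y where "x = of_adic2_int (2 * y)" by (auto simp: even2_def dvd_def)
  then have "x = 2 * of_adic2_int y" by (simp only: of_adic2_int_mult of_adic2_int_numeral)
  then show "\<exists>y\<in>adic2_ints. x = 2 * y" by blast
next
  assume "\<exists>y\<in>adic2_ints. x = 2 * y"
  then obtain y where "x = 2 * of_adic2_int y" by (auto simp: adic2_ints_def)
  then have "x = of_adic2_int (2 * y)" by (simp only: of_adic2_int_mult of_adic2_int_numeral)
  then show "even2 x" by simp
qed

lemma val_odd:
  assumes "x \<in> adic2_ints" "\<not> even2 x"
  shows "x \<noteq> 0 \<and> val x = 0"
proof -
  obtain y where y: "x = of_adic2_int y" using assms by (auto simp: adic2_ints_def)
  then have "y dvd 1" using assms adic2_int_unit_iff[of y] by simp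
  moreover have "x \<noteq> 0" using assms(2) by auto
  ultimately show ?thesis using y val_unit by simp
qed

definition Z3 :: "(adic2^3) set"
  where "Z3 = {z. \<forall>i. z$i \<in> adic2_ints}"

text \<open>The nested equivalence says that the exclusive or of the three conjunctions is false:
  the kernel of a z1 + b z2 + c z3 modulo 2. Boolean coefficients make the seven nonzero forms
  accessible to case distinction.\<close>

definition hyperplane :: "bool \<Rightarrow> bool \<Rightarrow> bool \<Rightarrow> (adic2^3) set"
  where "hyperplane a b c = {z \<in> Z3.
    ((a \<and> \<not> even2 (z$1)) = (b \<and> \<not> even2 (z$2))) = (\<not> (c \<and> \<not> even2 (z$3)))}"

definition submodule2 :: "(adic2^3) set \<Rightarrow> bool"
  where "submodule2 L \<longleftrightarrow> 0 \<in> L \<and> (\<forall>x\<in>L. \<forall>y\<in>L. x + y \<in> L) \<and> (\<forall>a\<in>adic2_ints. \<forall>x\<in>L. a *s x \<in> L)"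

lemma submodule2_span: "submodule2 L \<longleftrightarrow> adic2_int_module.subspace L"
  unfolding submodule2_def adic2_int_module.subspace_def adic2_ints_def by blast

lemma submodule2_add: "submodule2 L \<Longrightarrow> x \<in> L \<Longrightarrow> y \<in> L \<Longrightarrow> x + y \<in> L"
  and submodule2_scale: "submodule2 L \<Longrightarrow> a \<in> adic2_ints \<Longrightarrow> x \<in> L \<Longrightarrow> a *s x \<in> L"
  and submodule2_0: "submodule2 L \<Longrightarrow> 0 \<in> L"
  by (auto simp: submodule2_def)

lemma submodule2_diff: "submodule2 L \<Longrightarrow> x \<in> L \<Longrightarrow> y \<in> L \<Longrightarrow> x - y \<in> L"
  using submodule2_span adic2_int_module.subspace_diff by blast

lemma submodule2_image: "submodule2 L \<Longrightarrow> submodule2 ((*v) A ` L)"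
  unfolding submodule2_def
  by (safe; (metis (no_types, opaque_lifting) image_eqI matrix_vector_right_distrib vector_scalar_commute
      matrix_vector_mult_0_right))

lemma submodule2_Z3: "submodule2 Z3"
  unfolding submodule2_def Z3_def by auto

lemma matrix_image_image: "(*v) A ` ((*v) B ` L) = (*v) (A ** B) ` L" for A B :: "adic2^3^3"
  by (simp add: image_image matrix_vector_mul_assoc)

lemma matrix_image_1: "(*v) (mat 1) ` L = L" for L :: "(adic2^3) set"
  by simp

lemma matrix_image_inv: "invertible A \<Longrightarrow> (*v) (matrix_inv A) ` ((*v) A ` L) = L"
  "invertible A \<Longrightarrow> (*v) A ` ((*v) (matrix_inv A) ` L) = L" for A :: "adic2^3^3"
  by (simp_all only: matrix_image_image matrix_inv_left matrix_inv_right matrix_image_1)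

lemma mat_vector_mult: "mat c *v x = c *s x" for x :: "adic2^3"
  using exhaust_3 by (simp add: vec_eq_iff forall_3 matrix_vector_3 mat_3)

lemma columns3_mult:
  "transpose (vector [x, y, z] :: adic2^3^3) *v v = v$1 *s x + v$2 *s y + v$3 *s (z :: adic2^3)"
  by (simp add: vec_eq_iff matrix_vector_3 transpose_def mult.commute del: vector_3) (simp add: mult.commute)

lemma integral_matrix_image: "(\<And>i j. A$i$j \<in> adic2_ints) \<Longrightarrow> (*v) A ` Z3 \<subseteq> Z3"
  unfolding Z3_def image_subset_iff mem_Collect_eq matrix_vector_3
  by (auto intro!: adic2_ints_add adic2_ints_mult)

lemma matrix_vector_axis: "(A *v axis j 1) $ i = A$i$j" for A :: "adic2^3^3"
  using exhaust_3[of j] by (auto simp: matrix_vector_3 axis_def)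

lemma integral_matrix_image_iff: "(*v) A ` Z3 \<subseteq> Z3 \<longleftrightarrow> (\<forall>i j. A$i$j \<in> adic2_ints)"
proof
  assume A: "(*v) A ` Z3 \<subseteq> Z3"
  have "A$i$j \<in> adic2_ints" for i j
  proof -
    have "axis j 1 \<in> Z3" by (simp add: Z3_def axis_def)
    then have "A *v axis j 1 \<in> Z3" using A by blast
    then show ?thesis by (simp add: Z3_def matrix_vector_axis)
  qed
  then show "\<forall>i j. A$i$j \<in> adic2_ints" by blast
qed (simp add: integral_matrix_image)

lemma det_integral: "(\<And>i j. A$i$j \<in> adic2_ints) \<Longrightarrow> det (A :: adic2^3^3) \<in> adic2_ints"
  unfolding det_3 by (intro adic2_ints_add adic2_ints_diff adic2_ints_mult)

lemma det_matrix_inv: "invertible A \<Longrightarrow> det (matrix_inv A) = inverse (det (A :: adic2^3^3))"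
  using det_mul[of A "matrix_inv A"] by (simp add: matrix_inv_right inverse_unique)

lemma matrix_inv_unique: "A ** B = mat 1 \<Longrightarrow> matrix_inv A = B" for A B :: "adic2^3^3"
  by (metis invertible_left_inverse matrix_left_right_inverse matrix_inv_left matrix_mul_assoc matrix_mul_lid matrix_mul_rid)

lemma matrix_inv_integral:
  assumes A: "\<And>i j. A$i$j \<in> adic2_ints" and d: "det (A :: adic2^3^3) \<noteq> 0" "val (det A) = 0"
  shows "matrix_inv A$i$j \<in> adic2_ints"
proof -
  have "A ** (mat (inverse (det A)) ** adj3 A) = mat 1"
    using d by (simp add: mat_out mult_adj3 mat_mult_mat)
  then have "matrix_inv A = mat (inverse (det A)) ** adj3 A" by (rule matrix_inv_unique)
  moreover have "adj3 A$i$j \<in> adic2_ints"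
    using exhaust_3[of i] exhaust_3[of j] A unfolding adj3_def by (auto intro!: adic2_ints_diff adic2_ints_mult)
  ultimately show ?thesis
    using inverse_adic2_ints[OF d] by (auto simp: mat_mult_nth)
qed

lemma det_mat: "det (mat c :: 'a :: comm_ring_1^3^3) = c ^ 3"
  by (simp add: det_3 mat_3 power3_eq_cube)

lemma image_Z3_eq:
  assumes A: "\<And>i j. A$i$j \<in> adic2_ints" and d: "det (A :: adic2^3^3) \<noteq> 0" "val (det A) = 0"
  shows "(*v) A ` Z3 = Z3"
proof
  show "(*v) A ` Z3 \<subseteq> Z3" using A by (rule integral_matrix_image)
  have inv: "invertible A" using d by (simp add: invertible_det_nz)
  have "(*v) (matrix_inv A) ` Z3 \<subseteq> Z3" using matrix_inv_integral[OF A d] by (rule integral_matrix_image)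
  then have "(*v) A ` ((*v) (matrix_inv A) ` Z3) \<subseteq> (*v) A ` Z3" by blast
  then show "Z3 \<subseteq> (*v) A ` Z3" using inv by (simp only: matrix_image_inv)
qed

lemma image_Z3_eqD:
  assumes inv: "invertible A" and eq: "(*v) A ` Z3 = Z3"
  shows "\<forall>i j. A$i$j \<in> adic2_ints" "\<forall>i j. matrix_inv A$i$j \<in> adic2_ints" "val (det A) = 0"
proof -
  show 1: "\<forall>i j. A$i$j \<in> adic2_ints" using eq integral_matrix_image_iff by blast
  have "(*v) (matrix_inv A) ` Z3 = Z3" using matrix_image_inv(1)[OF inv, of Z3] eq by simp
  then show 2: "\<forall>i j. matrix_inv A$i$j \<in> adic2_ints" using integral_matrix_image_iff by blast
  have "det A \<noteq> 0" using inv by (simp add: invertible_det_nz)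
  then show "val (det A) = 0"
    using det_integral[of A] det_integral[of "matrix_inv A"] 1 2 inv
    by (auto simp: adic2_ints_val_iff det_matrix_inv val_inverse)
qed

text \<open>Linear algebra over the field with two elements: \<open>P\<close> is closed under
  addition, and no nonzero form vanishes on it. With the Boolean quantifiers expanded this is a
  propositional statement in the eight values of \<open>P\<close>.\<close>

lemma xor_closed_full:
  fixes P :: "bool \<Rightarrow> bool \<Rightarrow> bool \<Rightarrow> bool"
  assumes "\<And>a b c a' b' c'. P a b c \<Longrightarrow> P a' b' c' \<Longrightarrow> P (a \<noteq> a') (b \<noteq> b') (c \<noteq> c')"
    and "\<And>a b c. (a, b, c) \<noteq> (False, False, False) \<Longrightarrow>
      \<exists>p q r. P p q r \<and> ((a \<and> p) = (b \<and> q)) \<noteq> (\<not> (c \<and> r))"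
  shows "P True False False \<and> P False True False \<and> P False False True"
proof -
  have 1: "\<forall>a b c a' b' c'. P a b c \<longrightarrow> P a' b' c' \<longrightarrow> P (a \<noteq> a') (b \<noteq> b') (c \<noteq> c')"
    using assms(1) by blast
  have 2: "\<forall>a b c. (a, b, c) \<noteq> (False, False, False) \<longrightarrow>
      (\<exists>p q r. P p q r \<and> ((a \<and> p) = (b \<and> q)) \<noteq> (\<not> (c \<and> r)))"
    using assms(2) by blast
  show ?thesis
    using 1[unfolded all_bool_eq ex_bool_eq, simplified] 2[unfolded all_bool_eq ex_bool_eq, simplified]
    by satx
qed

text \<open>A proper submodule of \<open>Z3\<close> is proper modulo 2: otherwise it would contain vectors congruent to
  the standard basis, and these generate \<open>Z3\<close>.\<close>

lemma submodule_dichotomy: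
  assumes L: "submodule2 L" "L \<subseteq> Z3" "L \<noteq> Z3"
  shows "\<exists>a b c. (a, b, c) \<noteq> (False, False, False) \<and> L \<subseteq> hyperplane a b c"
proof (rule ccontr)
  assume neg: "\<not> ?thesis"
  define P where "P a b c \<longleftrightarrow> (\<exists>z\<in>L. (\<not> even2 (z$1)) = a \<and> (\<not> even2 (z$2)) = b \<and> (\<not> even2 (z$3)) = c)" for a b c
  have int: "z \<in> L \<Longrightarrow> z$i \<in> adic2_ints" for z i using L(2) by (auto simp: Z3_def)
  have "P True False False \<and> P False True False \<and> P False False True"
  proof (rule xor_closed_full)
    fix a b c a' b' c' assume "P a b c" "P a' b' c'"
    then obtain x y where xy: "x \<in> L" "y \<in> L" "(\<not> even2 (x$1)) = a" "(\<not> even2 (x$2)) = b" "(\<not> even2 (x$3)) = c"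
      "(\<not> even2 (y$1)) = a'" "(\<not> even2 (y$2)) = b'" "(\<not> even2 (y$3)) = c'" unfolding P_def by blast
    then have "x + y \<in> L" using L submodule2_add by blast
    then show "P (a \<noteq> a') (b \<noteq> b') (c \<noteq> c')"
      unfolding P_def using xy int by (intro bexI[of _ "x + y"]) (auto simp: even2_add)
  next
    fix a b c assume "(a, b, c) \<noteq> (False, False, False)"
    then have "\<not> L \<subseteq> hyperplane a b c" using neg by blast
    then obtain z where z: "z \<in> L" "z \<in> Z3" "z \<notin> hyperplane a b c" using L(2) by blast
    have "P (\<not> even2 (z$1)) (\<not> even2 (z$2)) (\<not> even2 (z$3))" unfolding P_def using z(1) by (intro bexI[of _ z]) simp_all
    moreover have "((a \<and> \<not> even2 (z$1)) = (b \<and> \<not> even2 (z$2))) \<noteq> (\<not> (c \<and> \<not> even2 (z$3)))"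
      using z(2,3) by (simp only: hyperplane_def mem_Collect_eq simp_thms)
    ultimately show "\<exists>p q r. P p q r \<and> ((a \<and> p) = (b \<and> q)) \<noteq> (\<not> (c \<and> r))" by (intro exI conjI)
  qed
  then obtain x y z where x: "x \<in> L" "\<not> even2 (x$1)" "even2 (x$2)" "even2 (x$3)"
    and y: "y \<in> L" "even2 (y$1)" "\<not> even2 (y$2)" "even2 (y$3)"
    and z: "z \<in> L" "even2 (z$1)" "even2 (z$2)" "\<not> even2 (z$3)"
    unfolding P_def by auto
  \<comment> \<open>Modulo 2 this is the identity matrix, so its determinant is odd, a unit.\<close>
  let ?Y = "transpose (vector [x, y, z]) :: adic2^3^3"
  have Yint: "?Y$i$j \<in> adic2_ints" for i j
    using exhaust_3[of j] int x y z by (auto simp: transpose_def)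
  have "\<not> even2 (det ?Y)"
    unfolding det_3 transpose_def using x y z int
    by (simp add: even2_add even2_diff even2_mult adic2_ints_add adic2_ints_mult adic2_ints_diff)
  then have "det ?Y \<noteq> 0 \<and> val (det ?Y) = 0" using val_odd det_integral Yint by blast
  then have Y: "Z3 = (*v) ?Y ` Z3" using image_Z3_eq[OF Yint] by blast
  have "?Y *v v \<in> L" if "v \<in> Z3" for v
    unfolding columns3_mult using that x y z L(1)
    by (intro submodule2_add submodule2_scale) (auto simp: Z3_def)
  then have "(*v) ?Y ` Z3 \<subseteq> L" by (rule image_subsetI)
  then have "Z3 \<subseteq> L" by (subst Y)
  then show False using L by blast
qed

lemma hyperplane_subset: "hyperplane a b c \<subseteq> Z3"
  by (auto simp: hyperplane_def)

section \<open>Descent through index-2 sublattices\<close>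

text \<open>Abstracts the words in sigma and beta: each index-2 sublattice of \<open>Z3\<close> is
  the image of \<open>Z3\<close> under some \<open>t\<close> that may be put in front of any element
  of \<open>D\<close>.\<close>

locale hyperplane_generators =
  fixes D :: "(adic2^3^3) set"
  assumes D_one: "mat 1 \<in> D"
    and D_invertible: "X \<in> D \<Longrightarrow> invertible X"
    and D_hyperplane: "(a, b, c) \<noteq> (False, False, False) \<Longrightarrow>
      \<exists>t. (\<forall>X\<in>D. t ** X \<in> D) \<and> invertible t \<and> (*v) t ` Z3 = hyperplane a b c \<and> val (det t) = 1"
begin

text \<open>Induction on the valuation \<open>d\<close> of the determinant of a lattice contained in
  \<open>L\<close>. A proper \<open>L\<close> lies in some hyperplane, the image of
  \<open>Z3\<close> under \<open>t\<close>; pulling back by \<open>t\<close> keeps it inside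
  \<open>Z3\<close> and lowers \<open>d\<close> by 1. At \<open>d = 0\<close> the contained lattice
  is already \<open>Z3\<close>.\<close>

lemma sublattice_obtain:
  assumes "submodule2 L" "L \<subseteq> Z3" "invertible M" "(*v) M ` Z3 \<subseteq> L" "val (det M) = int d"
  shows "\<exists>X\<in>D. L = (*v) X ` Z3"
  using assms
proof (induction d arbitrary: L M)
  case (0 L M)
  have "(*v) M ` Z3 \<subseteq> Z3" using 0 by blast
  then have "(*v) M ` Z3 = Z3" using 0 integral_matrix_image_iff image_Z3_eq by (simp add: invertible_det_nz)
  then show ?case using 0 D_one by (intro bexI[of _ "mat 1"]) auto
next
  case (Suc d L M)
  show ?case
  proof (cases "L = Z3")
    case True
    then show ?thesis using D_one by (intro bexI[of _ "mat 1"]) auto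
  next
    case False
    then obtain a b c where abc: "(a, b, c) \<noteq> (False, False, False)" "L \<subseteq> hyperplane a b c"
      using submodule_dichotomy[OF Suc.prems(1,2)] by blast
    obtain t where t: "\<forall>X\<in>D. t ** X \<in> D" "invertible t" "(*v) t ` Z3 = hyperplane a b c" "val (det t) = 1"
      using D_hyperplane[OF abc(1)] by blast
    let ?u = "matrix_inv t"
    have "\<exists>X\<in>D. (*v) ?u ` L = (*v) X ` Z3"
    proof (rule Suc.IH)
      show "submodule2 ((*v) ?u ` L)" using Suc.prems(1) by (rule submodule2_image)
      have "(*v) ?u ` L \<subseteq> (*v) ?u ` ((*v) t ` Z3)" unfolding t(3) using abc(2) by (rule image_mono)
      then show "(*v) ?u ` L \<subseteq> Z3" unfolding matrix_image_inv(1)[OF t(2)] .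
      show "invertible (?u ** M)" using t(2) Suc.prems(3) by (intro invertible_mult invertible_matrix_inv)
      show "(*v) (?u ** M) ` Z3 \<subseteq> (*v) ?u ` L" unfolding matrix_image_image[symmetric] using Suc.prems(4) by (rule image_mono)
      have "det t \<noteq> 0" "det M \<noteq> 0" using t(2) Suc.prems(3) by (simp_all add: invertible_det_nz)
      then show "val (det (?u ** M)) = int d"
        using t(2,4) Suc.prems(5) by (simp add: det_mul det_matrix_inv val_mult val_inverse)
    qed
    then obtain X where X: "X \<in> D" "(*v) ?u ` L = (*v) X ` Z3" by blast
    then have "(*v) t ` ((*v) ?u ` L) = (*v) (t ** X) ` Z3" by (simp only: matrix_image_image)
    then have "L = (*v) (t ** X) ` Z3" unfolding matrix_image_inv(2)[OF t(2)] .
    then show ?thesis using t(1) X(1) by blast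
  qed
qed

end

lemma lattice_submodule2: "L \<in> adic2_lattices \<Longrightarrow> submodule2 L"
  by (auto simp: adic2_lattices_def submodule2_span)

lemma vec_scale_Z3: "\<exists>n. 2 ^ n *s (x :: adic2^3) \<in> Z3"
  using adic2_scale_integral_finite[of "range (($) x)"] by (auto simp: Z3_def)

lemma scale_mono_Z3: "2 ^ m *s x \<in> Z3 \<Longrightarrow> m \<le> n \<Longrightarrow> 2 ^ n *s x \<in> Z3"
proof -
  assume x: "2 ^ m *s x \<in> Z3" "m \<le> n"
  have "2 ^ n *s x = 2 ^ (n - m) *s (2 ^ m *s x)"
    using x(2) by (simp add: vector_smult_assoc flip: power_add)
  then show "2 ^ n *s x \<in> Z3" using x submodule2_scale[OF submodule2_Z3] adic2_ints_power[OF adic2_ints_numeral] by metis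
qed

lemma lattice_bounded:
  assumes "L \<in> adic2_lattices"
  shows "\<exists>n. \<forall>x\<in>L. 2 ^ n *s x \<in> Z3"
proof -
  obtain S where S: "finite S" "L = adic2_int_module.span S" using assms by (auto simp: adic2_lattices_def)
  have "\<exists>n. \<forall>x\<in>S. 2 ^ n *s x \<in> Z3"
    using S(1)
  proof induction
    case (insert x S)
    then obtain m where m: "\<forall>x\<in>S. 2 ^ m *s x \<in> Z3" by blast
    obtain n where "2 ^ n *s x \<in> Z3" using vec_scale_Z3 by blast
    then have "\<forall>y\<in>insert x S. 2 ^ (m + n) *s y \<in> Z3"
      using m scale_mono_Z3[of n x "m + n"] scale_mono_Z3[of m _ "m + n"] by auto
    then show ?case by blast
  qed simp
  then obtain n where n: "\<forall>x\<in>S. 2 ^ n *s x \<in> Z3" by blast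
  have "submodule2 {x. 2 ^ n *s x \<in> Z3}"
    unfolding submodule2_def
  proof (safe)
    fix x y :: "adic2^3" and a
    show "2 ^ n *s (0 :: adic2^3) \<in> Z3" by (simp add: Z3_def)
    assume x: "2 ^ n *s x \<in> Z3"
    then show "2 ^ n *s y \<in> Z3 \<Longrightarrow> 2 ^ n *s (x + y) \<in> Z3"
      using submodule2_add[OF submodule2_Z3] by (simp add: vector_add_ldistrib)
    show "a \<in> adic2_ints \<Longrightarrow> 2 ^ n *s (a *s x) \<in> Z3"
      using submodule2_scale[OF submodule2_Z3 _ x, of a] by (simp add: vector_smult_assoc mult.commute)
  qed
  then have "L \<subseteq> {x. 2 ^ n *s x \<in> Z3}"
    unfolding S(2) using n by (intro adic2_int_module.span_minimal) (auto simp: submodule2_span)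
  then show ?thesis by blast
qed

text \<open>The vectors that a power of 2 carries into \<open>L\<close> form a 2-adic vector space
  containing \<open>L\<close>, hence everything. A common exponent for the three standard basis
  vectors gives the claim.\<close>

lemma lattice_absorbing:
  assumes "L \<in> adic2_lattices"
  shows "\<exists>m. (*v) (mat (2 ^ m)) ` Z3 \<subseteq> L"
proof -
  have L: "submodule2 L" using assms by (rule lattice_submodule2)
  let ?T = "{v. \<exists>m. 2 ^ m *s v \<in> L}"
  have mono: "2 ^ n *s v \<in> L" if v: "2 ^ m *s v \<in> L" "m \<le> n" for v m n
  proof -
    have "2 ^ n *s v = 2 ^ (n - m) *s (2 ^ m *s v)"
      using v(2) by (simp add: vector_smult_assoc flip: power_add)
    then show ?thesis using v submodule2_scale[OF L] adic2_ints_power[OF adic2_ints_numeral] by metis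
  qed
  have "vec.subspace ?T"
    unfolding vec.subspace_def
  proof (safe)
    fix x y :: "adic2^3" and c and m n
    show "\<exists>m. 2 ^ m *s (0 :: adic2^3) \<in> L" using submodule2_0[OF L] by simp
    assume x: "2 ^ m *s x \<in> L"
    show "\<exists>m. 2 ^ m *s (x + y) \<in> L" if "2 ^ n *s y \<in> L"
      using submodule2_add[OF L mono[OF x, of "m + n"] mono[OF that, of "m + n"]]
      by (auto simp: vector_add_ldistrib)
    obtain k where k: "2 ^ k * c \<in> adic2_ints" using adic2_scale_integral by blast
    have "2 ^ (k + m) *s (c *s x) = (2 ^ k * c) *s (2 ^ m *s x)"
      by (simp add: vector_smult_assoc power_add mult_ac)
    then show "\<exists>m. 2 ^ m *s (c *s x) \<in> L" using submodule2_scale[OF L k x] by metis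
  qed
  moreover have "L \<subseteq> ?T" using mono by (auto intro!: exI[of _ 0])
  ultimately have "vec.span L \<subseteq> ?T" by (rule vec.span_minimal[rotated])
  then have T: "\<exists>m. 2 ^ m *s v \<in> L" for v using assms by (auto simp: adic2_lattices_def)
  obtain m1 m2 m3 where m: "2 ^ m1 *s axis 1 1 \<in> L" "2 ^ m2 *s axis 2 1 \<in> L" "2 ^ m3 *s axis 3 1 \<in> L" using T by metis
  define m where "m = m1 + m2 + m3"
  have e: "2 ^ m *s axis 1 1 \<in> L" "2 ^ m *s axis 2 1 \<in> L" "2 ^ m *s axis 3 1 \<in> L"
    using mono[OF m(1), of m] mono[OF m(2), of m] mono[OF m(3), of m] by (auto simp: m_def)
  have "mat (2 ^ m) *v z \<in> L" if z: "z \<in> Z3" for z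
  proof -
    have "mat (2 ^ m) *v z = z$1 *s (2 ^ m *s axis 1 1) + z$2 *s (2 ^ m *s axis 2 1) + z$3 *s (2 ^ m *s axis 3 1)"
      by (simp add: vec_eq_iff forall_3 mat_vector_mult axis_def)
    moreover have "z$i \<in> adic2_ints" for i using z by (simp add: Z3_def)
    ultimately show ?thesis using e submodule2_add[OF L] submodule2_scale[OF L] by metis
  qed
  then show ?thesis by blast
qed

lemma lattice_image:
  assumes "L \<in> adic2_lattices" "invertible (A :: adic2^3^3)"
  shows "(*v) A ` L \<in> adic2_lattices"
proof -
  obtain S where S: "finite S" "L = adic2_int_module.span S" "vec.span L = UNIV"
    using assms by (auto simp: adic2_lattices_def)
  have "module_hom (\<lambda>z (x :: adic2^3). of_adic2_int z *s x) (\<lambda>z x. of_adic2_int z *s x) ((*v) A)"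
    by unfold_locales (simp_all add: matrix_vector_right_distrib vector_scalar_commute)
  then have "(*v) A ` L = adic2_int_module.span ((*v) A ` S)"
    using module_hom.span_image S by metis
  moreover have "vec.span ((*v) A ` L) = UNIV"
  proof -
    have "vec.span ((*v) A ` L) = (*v) A ` vec.span L" by (rule vec.span_image)
    also have "\<dots> = UNIV" using matrix_image_inv(2)[OF assms(2), of UNIV] S(3) by auto
    finally show ?thesis .
  qed
  ultimately show ?thesis using S(1) by (auto simp: adic2_lattices_def)
qed

lemma lattice_Z3: "Z3 \<in> adic2_lattices"
proof -
  let ?S = "range (\<lambda>i :: 3. axis i (1 :: adic2))"
  have sum: "z = z$1 *s axis 1 1 + z$2 *s axis 2 1 + z$3 *s axis 3 1" for z :: "adic2^3"
    by (simp add: vec_eq_iff forall_3 axis_def)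
  have "Z3 = adic2_int_module.span ?S"
  proof
    have "?S \<subseteq> Z3" by (auto simp: Z3_def axis_def)
    then show "adic2_int_module.span ?S \<subseteq> Z3"
      using submodule2_Z3 by (intro adic2_int_module.span_minimal) (simp_all add: submodule2_span)
    have sp: "submodule2 (adic2_int_module.span ?S)" by (simp add: submodule2_span)
    show "Z3 \<subseteq> adic2_int_module.span ?S"
    proof
      fix z assume z: "z \<in> Z3"
      show "z \<in> adic2_int_module.span ?S"
        by (subst sum, intro submodule2_add[OF sp] submodule2_scale[OF sp])
           (use z in \<open>auto simp: Z3_def intro: adic2_int_module.span_base\<close>)
    qed
  qed
  moreover have "vec.span Z3 = UNIV"
  proof -
    have "z \<in> vec.span Z3" for z
      by (subst sum, intro vec.span_add vec.span_scale vec.span_base) (auto simp: Z3_def axis_def)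
    then show ?thesis by blast
  qed
  moreover have "finite ?S" by simp
  ultimately show ?thesis unfolding adic2_lattices_def by blast
qed

context hyperplane_generators
begin

text \<open>A power of 2 carries \<open>L\<close> into \<open>Z3\<close>, and the result contains
  2^m times \<open>Z3\<close>; the descent starts from this lattice, whose determinant has valuation
  3 m.\<close>

lemma lattice_obtain:
  assumes L: "L \<in> adic2_lattices"
  shows "\<exists>c X. c \<noteq> 0 \<and> X \<in> D \<and> L = (*v) (mat c ** X) ` Z3"
proof -
  obtain n where n: "\<forall>x\<in>L. 2 ^ n *s x \<in> Z3" using lattice_bounded L by blast
  let ?L = "(*v) (mat (2 ^ n)) ` L"
  have "?L \<in> adic2_lattices" using L by (intro lattice_image) (simp_all add: invertible_mat)
  then obtain m where m: "(*v) (mat (2 ^ m)) ` Z3 \<subseteq> ?L" using lattice_absorbing by blast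
  have "\<exists>X\<in>D. ?L = (*v) X ` Z3"
  proof (rule sublattice_obtain[OF _ _ _ m])
    show "submodule2 ?L" using L by (intro submodule2_image lattice_submodule2)
    show "?L \<subseteq> Z3" using n by (auto simp: mat_vector_mult)
    show "invertible (mat (2 ^ m) :: adic2^3^3)" by (simp add: invertible_mat)
    have "det (mat (2 ^ m) :: adic2^3^3) = 2 ^ (3 * m)"
      by (simp add: det_mat mult.commute[of 3] power_mult)
    then show "val (det (mat (2 ^ m) :: adic2^3^3)) = int (3 * m)" by (simp add: val_power val_2)
  qed
  then obtain X where X: "X \<in> D" "?L = (*v) X ` Z3" by blast
  have "(*v) (mat (1 / 2 ^ n)) ` ?L = L" by (simp add: matrix_image_image mat_mult_mat)
  then have "L = (*v) (mat (1 / 2 ^ n) ** X) ` Z3" unfolding X(2) matrix_image_image ..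
  then show ?thesis using X by (intro exI[of _ "1 / 2 ^ n"]) auto
qed

end

text \<open>There are exactly two cosets of \<open>L'\<close>, so all elements outside
  \<open>L'\<close> share the second one.\<close>

lemma index_2_sublattice:
  assumes L: "contains_with_index_2 L L'" "submodule2 L" "submodule2 L'"
  shows "L' \<subseteq> L" "L' \<noteq> L" "\<And>x y. x \<in> L \<Longrightarrow> y \<in> L \<Longrightarrow> x \<notin> L' \<Longrightarrow> y \<notin> L' \<Longrightarrow> x - y \<in> L'"
proof -
  show sub: "L' \<subseteq> L" using L by (simp add: contains_with_index_2_def)
  let ?c = "\<lambda>x. (\<lambda>y. x + y) ` L'"
  have card: "card (?c ` L) = 2" using L by (simp add: contains_with_index_2_def)
  have eqD: "x - y \<in> L'" if "?c x = ?c y" for x y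
  proof -
    have "x + 0 \<in> ?c x" using submodule2_0[OF L(3)] by blast
    then have "x \<in> ?c y" using that by simp
    then show ?thesis by auto
  qed
  have c0: "?c x = L'" if "x \<in> L'" for x
  proof
    show "?c x \<subseteq> L'" using that submodule2_add[OF L(3)] by blast
    show "L' \<subseteq> ?c x"
    proof
      fix y assume "y \<in> L'"
      then have "y - x \<in> L'" using that submodule2_diff[OF L(3)] by blast
      then have "x + (y - x) \<in> ?c x" by (rule imageI)
      then show "y \<in> ?c x" by simp
    qed
  qed
  show "L' \<noteq> L"
  proof
    assume "L' = L"
    then have "?c ` L \<subseteq> {L'}" using c0 by blast
    then have "card (?c ` L) \<le> card {L'}" by (intro card_mono) auto
    then show False using card by simp
  qed
  fix x y assume xy: "x \<in> L" "y \<in> L" "x \<notin> L'" "y \<notin> L'"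
  have "?c 0 \<in> ?c ` L" "?c x \<in> ?c ` L" "?c y \<in> ?c ` L" using xy submodule2_0[OF L(2)] by blast+
  moreover have "?c x \<noteq> ?c 0" "?c y \<noteq> ?c 0" using xy eqD[of _ 0] by auto
  ultimately have "?c x = ?c y" using card by (metis (no_types, lifting) card_2_iff insertE singletonD)
  then show "x - y \<in> L'" by (rule eqD)
qed

text \<open>By \<open>submodule_dichotomy\<close> \<open>L\<close> lies in a hyperplane. If it
  missed some \<open>x\<close> of it, then for \<open>y\<close> outside the hyperplane index 2 would
  put \<open>x - y\<close> into \<open>L\<close>, forcing \<open>y\<close> into the
  hyperplane.\<close>

lemma index_2_hyperplane:
  assumes L: "contains_with_index_2 Z3 L" "submodule2 L"
  shows "\<exists>a b c. (a, b, c) \<noteq> (False, False, False) \<and> L = hyperplane a b c"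
proof -
  note p = index_2_sublattice[OF L(1) submodule2_Z3 L(2)]
  obtain a b c where abc: "(a, b, c) \<noteq> (False, False, False)" "L \<subseteq> hyperplane a b c"
    using submodule_dichotomy[OF L(2) p(1,2)] by blast
  have int: "z \<in> Z3 \<Longrightarrow> z$i \<in> adic2_ints" for z i by (auto simp: Z3_def)
  have ax: "axis i 1 \<in> Z3" for i :: 3 by (simp add: Z3_def axis_def)
  have "hyperplane a b c \<subseteq> L"
  proof (rule ccontr)
    assume "\<not> hyperplane a b c \<subseteq> L"
    then obtain x where x: "x \<in> hyperplane a b c" "x \<notin> L" by blast
    obtain y where y: "y \<in> Z3" "y \<notin> hyperplane a b c"
    proof -
      have "axis 1 1 \<notin> hyperplane a b c \<or> axis 2 1 \<notin> hyperplane a b c \<or> axis 3 1 \<notin> hyperplane a b c"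
        using abc(1) by (auto simp: hyperplane_def axis_def)
      then show ?thesis using that ax by blast
    qed
    have xz: "x \<in> Z3" using x hyperplane_subset by blast
    have "x - y \<in> L" using p(3)[OF xz y(1) x(2)] y abc by blast
    then have "x - y \<in> hyperplane a b c" using abc by blast
    then have "y \<in> hyperplane a b c"
      using x y(1) int[OF xz] int[OF y(1)] unfolding hyperplane_def by (auto simp: even2_diff)
    then show False using y by blast
  qed
  then show ?thesis using abc by blast
qed

lemma matrix_inj: "invertible (A :: adic2^3^3) \<Longrightarrow> A *v x = A *v y \<longleftrightarrow> x = y"
  by (metis matrix_inv_left matrix_vector_mul_assoc matrix_vector_mul_lid)

lemma contains_with_index_2_image:
  assumes L: "contains_with_index_2 L L'" and A: "invertible (A :: adic2^3^3)"
  shows "contains_with_index_2 ((*v) A ` L) ((*v) A ` L')"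
proof -
  let ?c = "\<lambda>x. (\<lambda>y. x + y) ` L'"
  have inj: "inj ((*v) A)" using matrix_inj[OF A] by (auto simp: inj_on_def)
  have "(\<lambda>x. (\<lambda>y. x + y) ` ((*v) A ` L')) ` ((*v) A ` L) = (\<lambda>C. (*v) A ` C) ` (?c ` L)"
    by (simp add: image_image matrix_vector_right_distrib)
  moreover have "card ((\<lambda>C. (*v) A ` C) ` (?c ` L)) = card (?c ` L)"
    using inj by (intro card_image) (auto simp: inj_on_def inj_image_eq_iff)
  ultimately show ?thesis using L by (auto simp: contains_with_index_2_def)
qed

section \<open>Vertices of the building and their types\<close>

text \<open>Every vertex has this form (\<open>vertex_cases\<close>), so vertices are handled as
  matrices modulo scalars on the one side and integral automorphisms on the other.\<close>

definition vertex_of :: "adic2^3^3 \<Rightarrow> (adic2^3) set set"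
  where "vertex_of A = homothety_class ((*v) A ` Z3)"

lemma homothety_class_mat: "homothety_class L = {(*v) (mat c) ` L | c. c \<noteq> 0}"
  by (simp add: homothety_class_def mat_vector_mult[abs_def])

lemma homothety_class_self: "L \<in> homothety_class L"
  unfolding homothety_class_mat using matrix_image_1[of L] zero_neq_one by (metis (mono_tags, lifting) mem_Collect_eq)

lemma homothety_class_scale:
  assumes c: "c \<noteq> 0"
  shows "homothety_class ((*v) (mat c) ` L) = homothety_class L"
proof (intro equalityI subsetI)
  fix M assume "M \<in> homothety_class ((*v) (mat c) ` L)"
  then obtain d where "d \<noteq> 0" "M = (*v) (mat d) ` ((*v) (mat c) ` L)" by (auto simp: homothety_class_mat)
  then have "d * c \<noteq> 0 \<and> M = (*v) (mat (d * c)) ` L" using c by (simp only: matrix_image_image mat_mult_mat) simp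
  then show "M \<in> homothety_class L" unfolding homothety_class_mat by blast
next
  fix M assume "M \<in> homothety_class L"
  then obtain d where "d \<noteq> 0" "M = (*v) (mat d) ` L" by (auto simp: homothety_class_mat)
  then have "d / c \<noteq> 0 \<and> M = (*v) (mat (d / c)) ` ((*v) (mat c) ` L)" using c by (simp only: matrix_image_image mat_mult_mat) simp
  then show "M \<in> homothety_class ((*v) (mat c) ` L)" unfolding homothety_class_mat[of "(*v) (mat c) ` L"] by blast
qed

lemma homothety_class_eq_iff: "homothety_class L = homothety_class M \<longleftrightarrow> (\<exists>c. c \<noteq> 0 \<and> L = (*v) (mat c) ` M)"
proof
  assume "homothety_class L = homothety_class M"
  then have "L \<in> homothety_class M" using homothety_class_self by blast
  then show "\<exists>c. c \<noteq> 0 \<and> L = (*v) (mat c) ` M" by (auto simp: homothety_class_mat)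
qed (use homothety_class_scale in blast)

lemma mem_homothety_class: "M \<in> homothety_class L \<Longrightarrow> homothety_class M = homothety_class L"
  unfolding homothety_class_eq_iff by (auto simp: homothety_class_mat)

lemma vertex_map_homothety_class:
  "vertex_map (to_PGL3 A) (homothety_class L) = homothety_class ((*v) A ` L)"
proof -
  have "(*v) (mat c ** A) ` ((*v) (mat d) ` L) = (*v) (mat (c * d)) ` ((*v) A ` L)" for c d
  proof -
    have "mat c ** A ** mat d = mat (c * d) ** A"
      by (metis mat_commute mat_mult_mat matrix_mul_assoc)
    then show ?thesis by (simp only: matrix_image_image)
  qed
  note eq = this
  show ?thesis
  proof (intro equalityI subsetI)
    fix M assume "M \<in> vertex_map (to_PGL3 A) (homothety_class L)"
    then obtain c d where "c \<noteq> 0" "d \<noteq> 0" "M = (*v) (mat c ** A) ` ((*v) (mat d) ` L)"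
      unfolding vertex_map_def to_PGL3_eq homothety_class_mat by blast
    then have "c * d \<noteq> 0 \<and> M = (*v) (mat (c * d)) ` ((*v) A ` L)" unfolding eq by simp
    then show "M \<in> homothety_class ((*v) A ` L)" unfolding homothety_class_mat by blast
  next
    fix M assume "M \<in> homothety_class ((*v) A ` L)"
    then obtain c where c: "c \<noteq> 0" "M = (*v) (mat c) ` ((*v) A ` L)" by (auto simp: homothety_class_mat)
    then have "M = (*v) (mat c ** A) ` L" by (simp only: matrix_image_image)
    moreover have "mat c ** A \<in> to_PGL3 A" unfolding to_PGL3_eq using c by blast
    ultimately show "M \<in> vertex_map (to_PGL3 A) (homothety_class L)"
      unfolding vertex_map_def using homothety_class_self by blast
  qed
qed

lemma vertex_map_vertex_of: "vertex_map (to_PGL3 A) (vertex_of B) = vertex_of (A ** B)"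
  by (simp only: vertex_of_def vertex_map_homothety_class matrix_image_image)

lemma vertex_of_vertex: "invertible A \<Longrightarrow> vertex_of A \<in> building_vertices"
  unfolding vertex_of_def building_vertices_def using lattice_image[OF lattice_Z3] by blast

lemma vertex_of_scale: "c \<noteq> 0 \<Longrightarrow> vertex_of (mat c ** A) = vertex_of A"
  unfolding vertex_of_def matrix_image_image[symmetric] by (rule homothety_class_scale)

lemma vertex_of_mult_image: "(*v) A ` Z3 = (*v) B ` Z3 \<Longrightarrow> vertex_of (C ** A) = vertex_of (C ** B)"
  for A B C :: "adic2^3^3"
  by (simp only: vertex_of_def matrix_image_image[symmetric])

lemma vertex_map_closed:
  assumes "g \<in> carrier PGL3" "v \<in> building_vertices"
  shows "vertex_map g v \<in> building_vertices"
proof -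
  obtain A where A: "invertible A" "g = to_PGL3 A" using assms PGL3_cases by blast
  obtain L where L: "L \<in> adic2_lattices" "v = homothety_class L" using assms by (auto simp: building_vertices_def)
  show ?thesis unfolding A L vertex_map_homothety_class building_vertices_def
    using lattice_image[OF L(1) A(1)] by blast
qed

lemma vertex_map_mult:
  assumes "g \<in> carrier PGL3" "h \<in> carrier PGL3" "v \<in> building_vertices"
  shows "vertex_map (g \<otimes>\<^bsub>PGL3\<^esub> h) v = vertex_map g (vertex_map h v)"
proof -
  obtain A B where A: "invertible A" "g = to_PGL3 A" and B: "invertible B" "h = to_PGL3 B"
    using assms PGL3_cases by metis
  obtain L where L: "v = homothety_class L" using assms by (auto simp: building_vertices_def)
  show ?thesis
    unfolding A(2) B(2) to_PGL3_mult[OF A(1) B(1)] L vertex_map_homothety_class matrix_image_image ..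
qed

lemma vertex_map_one: "v \<in> building_vertices \<Longrightarrow> vertex_map \<one>\<^bsub>PGL3\<^esub> v = v"
  by (auto simp: building_vertices_def one_PGL3 vertex_map_homothety_class)

section \<open>Directed edges and the type of a vertex\<close>

text \<open>Adjacency is symmetric; the direction of the inclusion is retained because it determines
  how the type changes.\<close>

definition arrow :: "(adic2^3) set set \<Rightarrow> (adic2^3) set set \<Rightarrow> bool"
  where "arrow v w \<longleftrightarrow> (\<exists>L\<in>v. \<exists>L'\<in>w. contains_with_index_2 L L')"

lemma joined_arrow: "joined v w \<longleftrightarrow> arrow v w \<or> arrow w v"
  by (auto simp: joined_def arrow_def)

lemma arrow_vertex_map:
  assumes "g \<in> carrier PGL3" "arrow v w"
  shows "arrow (vertex_map g v) (vertex_map g w)"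
proof -
  obtain A where A: "invertible A" "g = to_PGL3 A" using assms PGL3_cases by blast
  obtain L L' where L: "L \<in> v" "L' \<in> w" "contains_with_index_2 L L'" using assms by (auto simp: arrow_def)
  have "(*v) A ` L \<in> vertex_map g v" "(*v) A ` L' \<in> vertex_map g w"
    unfolding vertex_map_def A(2) using L to_PGL3_self by blast+
  then show ?thesis unfolding arrow_def using contains_with_index_2_image[OF L(3) A(1)] by blast
qed

lemma joined_vertex_map:
  "g \<in> carrier PGL3 \<Longrightarrow> joined v w \<Longrightarrow> joined (vertex_map g v) (vertex_map g w)"
  unfolding joined_arrow using arrow_vertex_map by blast

text \<open>Pulling back by the scaled matrix turns the larger lattice into \<open>Z3\<close>, whose
  index-2 sublattices are the hyperplanes.\<close>

lemma arrow_obtain: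
  assumes A: "invertible A" and w: "w \<in> building_vertices" and ar: "arrow (vertex_of A) w"
  shows "\<exists>a b c. (a, b, c) \<noteq> (False, False, False) \<and> w = homothety_class ((*v) A ` hyperplane a b c)"
proof -
  obtain L L' where L: "L \<in> vertex_of A" "L' \<in> w" "contains_with_index_2 L L'" using ar unfolding arrow_def by blast
  obtain N where N: "N \<in> adic2_lattices" "w = homothety_class N" using w by (auto simp: building_vertices_def)
  obtain d where d: "d \<noteq> 0" "L' = (*v) (mat d) ` N" using L(2) unfolding N(2) homothety_class_mat by blast
  obtain c where c: "c \<noteq> 0" "L = (*v) (mat c) ` ((*v) A ` Z3)" using L(1) unfolding vertex_of_def homothety_class_mat by blast
  let ?B = "matrix_inv (mat c ** A)"
  have inv: "invertible (mat c ** A)" using A c by (simp add: invertible_mult invertible_mat)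
  have LA: "L = (*v) (mat c ** A) ` Z3" unfolding c(2) matrix_image_image ..
  have "contains_with_index_2 ((*v) ?B ` L) ((*v) ?B ` L')"
    using L(3) invertible_matrix_inv[OF inv] by (rule contains_with_index_2_image)
  then have "contains_with_index_2 Z3 ((*v) ?B ` L')" unfolding LA matrix_image_inv(1)[OF inv] .
  moreover have "submodule2 ((*v) ?B ` L')"
    unfolding d(2) using N(1) by (intro submodule2_image lattice_submodule2)
  ultimately obtain a b c' where abc: "(a, b, c') \<noteq> (False, False, False)" "(*v) ?B ` L' = hyperplane a b c'"
    using index_2_hyperplane[of "(*v) ?B ` L'"] by blast
  have "L' = (*v) (mat c ** A) ` hyperplane a b c'"
    unfolding abc(2)[symmetric] matrix_image_inv(2)[OF inv] ..
  then have "L' = (*v) (mat c) ` ((*v) A ` hyperplane a b c')" by (simp only: matrix_image_image)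
  then have "homothety_class L' = homothety_class ((*v) A ` hyperplane a b c')"
    using homothety_class_scale[OF c(1)] by simp
  moreover have "homothety_class L' = w" unfolding N(2) using L(2) unfolding N(2) by (rule mem_homothety_class)
  ultimately show ?thesis using abc(1) by blast
qed

lemma vertex_of_eq_iff:
  assumes A: "invertible A" and B: "invertible B"
  shows "vertex_of A = vertex_of B \<longleftrightarrow>
    (\<exists>c. c \<noteq> 0 \<and> (*v) (mat c ** (matrix_inv B ** A)) ` Z3 = Z3)"
proof -
  have "((*v) A ` Z3 = (*v) (mat c) ` ((*v) B ` Z3)) \<longleftrightarrow> (*v) (mat (inverse c) ** (matrix_inv B ** A)) ` Z3 = Z3"
    if c: "c \<noteq> 0" for c
  proof
    assume "(*v) A ` Z3 = (*v) (mat c) ` ((*v) B ` Z3)"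
    then have "(*v) (matrix_inv B) ` ((*v) (mat (inverse c)) ` ((*v) A ` Z3)) = Z3"
      using c by (simp add: matrix_image_image mat_mult_mat matrix_mul_assoc)
        (simp add: matrix_inv_left B flip: matrix_mul_assoc)
    then show "(*v) (mat (inverse c) ** (matrix_inv B ** A)) ` Z3 = Z3"
      by (simp only: matrix_image_image mat_out[of "matrix_inv B"])
  next
    assume *: "(*v) (mat (inverse c) ** (matrix_inv B ** A)) ` Z3 = Z3"
    have "(*v) (mat c) ` ((*v) B ` Z3) = (*v) (mat c ** (B ** (mat (inverse c) ** (matrix_inv B ** A)))) ` Z3"
      using * by (simp only: matrix_image_image[symmetric])
    also have "mat c ** (B ** (mat (inverse c) ** (matrix_inv B ** A))) = A"
      unfolding mat_out[of B] matrix_inv_cancel(2)[OF B]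
      using c by (simp add: matrix_mul_assoc mat_mult_mat)
    finally show "(*v) A ` Z3 = (*v) (mat c) ` ((*v) B ` Z3)" ..
  qed
  note eq = this
  show ?thesis
    unfolding vertex_of_def homothety_class_eq_iff
  proof
    assume "\<exists>c. c \<noteq> 0 \<and> (*v) A ` Z3 = (*v) (mat c) ` ((*v) B ` Z3)"
    then obtain c where c: "c \<noteq> 0" "(*v) A ` Z3 = (*v) (mat c) ` ((*v) B ` Z3)" by (elim exE conjE)
    show "\<exists>c. c \<noteq> 0 \<and> (*v) (mat c ** (matrix_inv B ** A)) ` Z3 = Z3"
      using c(1) eq[OF c(1)] c(2) by (intro exI[of _ "inverse c"]) simp
  next
    assume "\<exists>c. c \<noteq> 0 \<and> (*v) (mat c ** (matrix_inv B ** A)) ` Z3 = Z3"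
    then obtain c where c: "c \<noteq> 0" "(*v) (mat c ** (matrix_inv B ** A)) ` Z3 = Z3" by (elim exE conjE)
    show "\<exists>c. c \<noteq> 0 \<and> (*v) A ` Z3 = (*v) (mat c) ` ((*v) B ` Z3)"
      using c eq[of "inverse c"] by (intro exI[of _ "inverse c"]) simp
  qed
qed

text \<open>A matrix preserving \<open>Z3\<close> has determinant of valuation 0, while a scalar
  \<open>c\<close> contributes three times its valuation; the last clause is what makes types modulo
  3 well defined.\<close>

lemma vertex_of_eqD:
  assumes A: "invertible A" and B: "invertible B" and eq: "vertex_of A = vertex_of B"
  shows "\<exists>c. c \<noteq> 0 \<and> (\<forall>i j. (mat c ** (matrix_inv B ** A))$i$j \<in> adic2_ints)
    \<and> (\<forall>i j. matrix_inv (mat c ** (matrix_inv B ** A))$i$j \<in> adic2_ints)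
    \<and> val (det A) = val (det B) - 3 * val c"
proof -
  obtain c where c: "c \<noteq> 0" "(*v) (mat c ** (matrix_inv B ** A)) ` Z3 = Z3"
    using eq vertex_of_eq_iff[OF A B] by blast
  have inv: "invertible (mat c ** (matrix_inv B ** A))"
    using A B c by (simp add: invertible_mult invertible_mat invertible_matrix_inv)
  note d = image_Z3_eqD[OF inv c(2)]
  have "det A \<noteq> 0" "det B \<noteq> 0" using A B by (simp_all add: invertible_det_nz)
  then have "val (det A) = val (det B) - 3 * val c"
    using d(3) c B by (simp add: det_mul det_mat det_matrix_inv val_mult val_power val_inverse)
  then show ?thesis using c d by blast
qed

definition vertex_type :: "(adic2^3) set set \<Rightarrow> int"
  where "vertex_type v = (THE k. \<exists>A. invertible A \<and> v = vertex_of A \<and> k = val (det A) mod 3)"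

lemma vertex_type_of:
  assumes A: "invertible A"
  shows "vertex_type (vertex_of A) = val (det A) mod 3"
  unfolding vertex_type_def
proof (rule the_equality)
  show "\<exists>B. invertible B \<and> vertex_of A = vertex_of B \<and> val (det A) mod 3 = val (det B) mod 3" using A by blast
  fix k assume "\<exists>B. invertible B \<and> vertex_of A = vertex_of B \<and> k = val (det B) mod 3"
  then obtain B where B: "invertible B" "vertex_of A = vertex_of B" "k = val (det B) mod 3" by blast
  obtain c where "val (det A) = val (det B) - 3 * val c" using vertex_of_eqD[OF A B(1,2)] by blast
  then show "k = val (det A) mod 3" unfolding B(3) by presburger
qed

context hyperplane_generators
begin

lemma vertex_obtain:
  assumes v: "v \<in> building_vertices" and h: "invertible h"
  shows "\<exists>X\<in>D. v = vertex_of (h ** X)"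
proof -
  obtain L where L: "L \<in> adic2_lattices" "v = homothety_class L" using v by (auto simp: building_vertices_def)
  then have "(*v) (matrix_inv h) ` L \<in> adic2_lattices" using h by (intro lattice_image invertible_matrix_inv)
  then obtain c X where X: "c \<noteq> 0" "X \<in> D" "(*v) (matrix_inv h) ` L = (*v) (mat c ** X) ` Z3"
    using lattice_obtain by blast
  have "L = (*v) h ` ((*v) (mat c ** X) ` Z3)" unfolding X(3)[symmetric] matrix_image_inv(2)[OF h] ..
  also have "\<dots> = (*v) (mat c) ` ((*v) (h ** X) ` Z3)" by (simp only: matrix_image_image mat_out[of h])
  finally have "v = vertex_of (h ** X)"
    unfolding L(2) vertex_of_def using homothety_class_scale[OF X(1)] by simp
  then show ?thesis using X by blast
qed

lemma vertex_cases: "v \<in> building_vertices \<Longrightarrow> \<exists>A. invertible A \<and> v = vertex_of A"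
  using vertex_obtain[of v "mat 1"] D_invertible by (auto simp: invertible_mat)

lemma vertex_type_vertex_map:
  assumes A: "invertible A" and v: "v \<in> building_vertices"
  shows "vertex_type (vertex_map (to_PGL3 A) v) = (vertex_type v + val (det A)) mod 3"
proof -
  obtain B where B: "invertible B" "v = vertex_of B" using vertex_cases v by blast
  have "det A \<noteq> 0" "det B \<noteq> 0" using A B by (simp_all add: invertible_det_nz)
  then show ?thesis
    using A B by (simp add: vertex_map_vertex_of vertex_type_of invertible_mult det_mul val_mult mod_simps add.commute)
qed

text \<open>The smaller lattice is obtained by a right factor \<open>t\<close> whose determinant has
  valuation 1.\<close>

lemma arrow_type:
  assumes v: "v \<in> building_vertices" and w: "w \<in> building_vertices" and ar: "arrow v w"
  shows "vertex_type w = (vertex_type v + 1) mod 3"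
proof -
  obtain A where A: "invertible A" "v = vertex_of A" using vertex_cases v by blast
  obtain a b c where abc: "(a, b, c) \<noteq> (False, False, False)" "w = homothety_class ((*v) A ` hyperplane a b c)"
    using arrow_obtain[OF A(1) w] ar unfolding A(2) by blast
  obtain t where t: "invertible t" "(*v) t ` Z3 = hyperplane a b c" "val (det t) = 1"
    using D_hyperplane[OF abc(1)] by blast
  have w: "w = vertex_of (A ** t)"
    unfolding abc(2) t(2)[symmetric] vertex_of_def matrix_image_image ..
  have "det A \<noteq> 0" "det t \<noteq> 0" using A t by (simp_all add: invertible_det_nz)
  then show ?thesis
    unfolding w A(2) using A(1) t by (simp add: vertex_type_of invertible_mult det_mul val_mult mod_simps)
qed

lemma vertex_type_range: "v \<in> building_vertices \<Longrightarrow> vertex_type v \<in> {0..<3}"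
  using vertex_cases vertex_type_of by fastforce

text \<open>An arrow in the opposite direction would make the types differ by -1, which is not 1
  modulo 3.\<close>

lemma joined_type_arrow:
  assumes v: "v \<in> building_vertices" and w: "w \<in> building_vertices" and j: "joined v w"
    and ty: "vertex_type w = (vertex_type v + 1) mod 3"
  shows "arrow v w"
proof (rule ccontr)
  assume "\<not> arrow v w"
  then have "arrow w v" using j joined_arrow by blast
  then have "vertex_type v = (vertex_type w + 1) mod 3" using arrow_type w v by blast
  then show False using ty vertex_type_range[OF v] by (simp add: mod_simps) presburger
qed

lemma mod3_cycle:
  fixes a b c :: int
  assumes "a \<in> {0..<3}" "b \<in> {0..<3}" "c \<in> {0..<3}"
    and "b = (a + 1) mod 3 \<or> a = (b + 1) mod 3" "c = (b + 1) mod 3 \<or> b = (c + 1) mod 3"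
      "c = (a + 1) mod 3 \<or> a = (c + 1) mod 3"
  shows "(b = (a + 1) mod 3 \<and> c = (b + 1) mod 3 \<and> a = (c + 1) mod 3)
    \<or> (c = (a + 1) mod 3 \<and> b = (c + 1) mod 3 \<and> a = (b + 1) mod 3)"
proof -
  have s: "(x + 1) mod 3 = (if x = 2 then 0 else x + 1)" if "x \<in> {0..<3}" for x :: int
    using that by auto
  show ?thesis
    using assms unfolding s[OF assms(1)] s[OF assms(2)] s[OF assms(3)]
    by (cases "a = 2"; cases "b = 2"; cases "c = 2") auto
qed

lemma edge_obtain:
  assumes "\<sigma> \<in> building_edges"
  shows "\<exists>v w. v \<in> building_vertices \<and> w \<in> building_vertices \<and> \<sigma> = {v, w} \<and> arrow v w"
proof -
  have \<sigma>: "\<sigma> \<subseteq> building_vertices" "card \<sigma> = 2" "pairwise joined \<sigma>"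
    using assms by (auto simp: building_simplices_def)
  then obtain v w where vw: "\<sigma> = {v, w}" "v \<noteq> w" by (auto simp: card_2_iff)
  then have "joined v w" using \<sigma>(3) by (auto simp: pairwise_def)
  then show ?thesis using vw \<sigma>(1) unfolding joined_arrow by blast
qed

text \<open>Adjacency gives arrows of unknown direction. The three types differ pairwise by 1 or -1
  modulo 3, hence put the vertices in a cyclic order, and \<open>joined_type_arrow\<close> directs
  the arrows along it.\<close>

lemma triangle_obtain:
  assumes "\<sigma> \<in> building_triangles"
  shows "\<exists>u v w. u \<in> building_vertices \<and> v \<in> building_vertices \<and> w \<in> building_vertices
    \<and> \<sigma> = {u, v, w} \<and> arrow u v \<and> arrow v w \<and> arrow w u"
proof -
  have \<sigma>: "\<sigma> \<subseteq> building_vertices" "card \<sigma> = 3" "pairwise joined \<sigma>"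
    using assms by (auto simp: building_simplices_def)
  then obtain x y z where xyz: "\<sigma> = {x, y, z}" "x \<noteq> y" "y \<noteq> z" "x \<noteq> z" by (auto simp: card_3_iff)
  have vert: "x \<in> building_vertices" "y \<in> building_vertices" "z \<in> building_vertices" using \<sigma>(1) xyz(1) by auto
  have join: "joined x y" "joined y x" "joined y z" "joined z y" "joined x z" "joined z x"
    using \<sigma>(3) xyz by (auto simp: pairwise_def)
  have step: "vertex_type b = (vertex_type a + 1) mod 3 \<or> vertex_type a = (vertex_type b + 1) mod 3"
    if "a \<in> building_vertices" "b \<in> building_vertices" "joined a b" for a b
    using that arrow_type unfolding joined_arrow by blast
  have r: "vertex_type x \<in> {0..<3}" "vertex_type y \<in> {0..<3}" "vertex_type z \<in> {0..<3}"
    using vert vertex_type_range by blast+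
  have "(vertex_type y = (vertex_type x + 1) mod 3 \<and> vertex_type z = (vertex_type y + 1) mod 3 \<and> vertex_type x = (vertex_type z + 1) mod 3)
    \<or> (vertex_type z = (vertex_type x + 1) mod 3 \<and> vertex_type y = (vertex_type z + 1) mod 3 \<and> vertex_type x = (vertex_type y + 1) mod 3)"
    using mod3_cycle[OF r step[OF vert(1,2) join(1)] step[OF vert(2,3) join(3)] step[OF vert(1,3) join(5)]] .
  then show ?thesis
  proof
    assume t: "vertex_type y = (vertex_type x + 1) mod 3 \<and> vertex_type z = (vertex_type y + 1) mod 3 \<and> vertex_type x = (vertex_type z + 1) mod 3"
    have "arrow x y" "arrow y z" "arrow z x"
      using t vert join by (auto intro!: joined_type_arrow)
    then show ?thesis using vert xyz(1) by blast
  next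
    assume t: "vertex_type z = (vertex_type x + 1) mod 3 \<and> vertex_type y = (vertex_type z + 1) mod 3 \<and> vertex_type x = (vertex_type y + 1) mod 3"
    have "arrow x z" "arrow z y" "arrow y x"
      using t vert join by (auto intro!: joined_type_arrow)
    moreover have "\<sigma> = {x, z, y}" using xyz(1) by auto
    ultimately show ?thesis using vert by blast
  qed
qed

end

section \<open>Actions of subgroups of \<open>PGL\<^sub>3\<close>\<close>

lemma PGL3_subgroup_group: "subgroup H PGL3 \<Longrightarrow> group (PGL3\<lparr>carrier := H\<rparr>)"
  by (rule group.subgroup_imp_group[OF group_PGL3])

text \<open>Elements of \<open>BijGroup\<close> are extensional functions, hence the restricted
  abstraction; bijectivity comes from the map of the inverse element.\<close>

lemma group_action_restrictI:
  assumes H: "subgroup H PGL3"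
    and closed: "\<And>g e. g \<in> carrier PGL3 \<Longrightarrow> e \<in> E \<Longrightarrow> f g e \<in> E"
    and mult: "\<And>g h e. g \<in> carrier PGL3 \<Longrightarrow> h \<in> carrier PGL3 \<Longrightarrow> e \<in> E \<Longrightarrow> f (g \<otimes>\<^bsub>PGL3\<^esub> h) e = f g (f h e)"
    and one: "\<And>e. e \<in> E \<Longrightarrow> f \<one>\<^bsub>PGL3\<^esub> e = e"
  shows "group_action (PGL3\<lparr>carrier := H\<rparr>) E (\<lambda>g. \<lambda>e\<in>E. f g e)"
proof -
  have Hc: "g \<in> carrier PGL3" if "g \<in> H" for g using H that by (rule subgroup.mem_carrier)
  have bij: "(\<lambda>e\<in>E. f g e) \<in> Bij E" if g: "g \<in> carrier PGL3" for g
  proof -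
    have i: "inv\<^bsub>PGL3\<^esub> g \<in> carrier PGL3" using g by simp
    have "bij_betw (\<lambda>e\<in>E. f g e) E E"
    proof (rule bij_betw_byWitness[where f' = "\<lambda>e\<in>E. f (inv\<^bsub>PGL3\<^esub> g) e"])
      show "\<forall>e\<in>E. (\<lambda>e\<in>E. f (inv\<^bsub>PGL3\<^esub> g) e) ((\<lambda>e\<in>E. f g e) e) = e"
        using g i closed one mult[OF i g] by simp
      show "\<forall>e\<in>E. (\<lambda>e\<in>E. f g e) ((\<lambda>e\<in>E. f (inv\<^bsub>PGL3\<^esub> g) e) e) = e"
        using g i closed one mult[OF g i] by simp
    qed (use closed[OF g] closed[OF i] in auto)
    then show ?thesis by (simp add: Bij_def)
  qed
  have "(\<lambda>e\<in>E. f (g \<otimes>\<^bsub>PGL3\<^esub> h) e) = compose E (\<lambda>e\<in>E. f g e) (\<lambda>e\<in>E. f h e)"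
    if "g \<in> carrier PGL3" "h \<in> carrier PGL3" for g h
    using that mult closed by (auto simp: compose_def)
  then have "(\<lambda>g. \<lambda>e\<in>E. f g e) \<in> hom (PGL3\<lparr>carrier := H\<rparr>) (BijGroup E)"
    using Hc bij by (auto simp: hom_def BijGroup_def)
  then show ?thesis
    unfolding group_action_def group_hom_def group_hom_axioms_def
    using PGL3_subgroup_group[OF H] group_BijGroup by blast
qed

text \<open>Conjugation by \<open>g\<close> is the isomorphism; through it one base simplex
  represents all others.\<close>

lemma stabilizer_conj_iso:
  assumes H: "subgroup H PGL3" and act: "group_action (PGL3\<lparr>carrier := H\<rparr>) E \<phi>"
    and x: "x \<in> E" and g: "g \<in> H" and y: "y = \<phi> g x"
  shows "PGL3\<lparr>carrier := stabilizer (PGL3\<lparr>carrier := H\<rparr>) \<phi> x\<rparr>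
    \<cong> PGL3\<lparr>carrier := stabilizer (PGL3\<lparr>carrier := H\<rparr>) \<phi> y\<rparr>"
proof -
  interpret A: group_action "PGL3\<lparr>carrier := H\<rparr>" E \<phi> by (rule act)
  have Hc: "k \<in> carrier PGL3" if "k \<in> H" for k using H that by (rule subgroup.mem_carrier)
  have Hm: "k \<otimes>\<^bsub>PGL3\<^esub> l \<in> H" if "k \<in> H" "l \<in> H" for k l using H that by (rule subgroup.m_closed)
  have Hi: "inv\<^bsub>PGL3\<^esub> k \<in> H" if "k \<in> H" for k using H that by (rule subgroup.m_inv_closed)
  have comp: "\<phi> (k \<otimes>\<^bsub>PGL3\<^esub> l) e = \<phi> k (\<phi> l e)" if "e \<in> E" "k \<in> H" "l \<in> H" for k l e
    using A.composition_rule[of e k l] that by simp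
  have cl: "\<phi> k e \<in> E" if "e \<in> E" "k \<in> H" for k e using A.element_image[of k e] that by simp
  have "\<phi> \<one>\<^bsub>PGL3\<^esub> = (\<lambda>e\<in>E. e)" using A.id_eq_one by simp
  then have one: "\<phi> \<one>\<^bsub>PGL3\<^esub> e = e" if "e \<in> E" for e using that by simp
  have inv_act: "\<phi> (inv\<^bsub>PGL3\<^esub> g) y = x"
    using comp[OF x Hi[OF g] g] one[OF x] g Hc y by simp
  let ?S = "\<lambda>z. stabilizer (PGL3\<lparr>carrier := H\<rparr>) \<phi> z"
  let ?c = "\<lambda>k. g \<otimes>\<^bsub>PGL3\<^esub> k \<otimes>\<^bsub>PGL3\<^esub> inv\<^bsub>PGL3\<^esub> g"
  let ?d = "\<lambda>k. inv\<^bsub>PGL3\<^esub> g \<otimes>\<^bsub>PGL3\<^esub> k \<otimes>\<^bsub>PGL3\<^esub> g"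
  have yE: "y \<in> E" using cl x g y by simp
  have S: "k \<in> ?S z \<longleftrightarrow> k \<in> H \<and> \<phi> k z = z" for k z by (simp add: stabilizer_def)
  have c: "?c k \<in> ?S y" if "k \<in> ?S x" for k
    using that g x yE inv_act y unfolding S by (simp add: Hm Hi comp cl)
  have d: "?d k \<in> ?S x" if "k \<in> ?S y" for k
    using that g x yE inv_act y unfolding S by (simp add: Hm Hi comp cl)
  have "?c \<in> iso (PGL3\<lparr>carrier := ?S x\<rparr>) (PGL3\<lparr>carrier := ?S y\<rparr>)"
    unfolding iso_def hom_def
  proof (intro CollectI conjI)
    show "?c \<in> carrier (PGL3\<lparr>carrier := ?S x\<rparr>) \<rightarrow> carrier (PGL3\<lparr>carrier := ?S y\<rparr>)" using c by simp
    show "\<forall>k\<in>carrier (PGL3\<lparr>carrier := ?S x\<rparr>). \<forall>l\<in>carrier (PGL3\<lparr>carrier := ?S x\<rparr>).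
      ?c (k \<otimes>\<^bsub>PGL3\<lparr>carrier := ?S x\<rparr>\<^esub> l) = ?c k \<otimes>\<^bsub>PGL3\<lparr>carrier := ?S y\<rparr>\<^esub> ?c l"
    proof (intro ballI)
      fix k l assume "k \<in> carrier (PGL3\<lparr>carrier := ?S x\<rparr>)" "l \<in> carrier (PGL3\<lparr>carrier := ?S x\<rparr>)"
      then have "k \<in> carrier PGL3" "l \<in> carrier PGL3" "g \<in> carrier PGL3" using Hc S g by auto
      then show "?c (k \<otimes>\<^bsub>PGL3\<lparr>carrier := ?S x\<rparr>\<^esub> l) = ?c k \<otimes>\<^bsub>PGL3\<lparr>carrier := ?S y\<rparr>\<^esub> ?c l"
        by (simp add: PGL3.m_assoc) (simp add: PGL3.m_assoc[symmetric])
    qed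
    show "bij_betw ?c (carrier (PGL3\<lparr>carrier := ?S x\<rparr>)) (carrier (PGL3\<lparr>carrier := ?S y\<rparr>))"
    proof (rule bij_betw_byWitness[where f' = ?d])
      have cancel: "?d (?c k) = k" "?c (?d k) = k" if "k \<in> H" for k
        using Hc[OF that] Hc[OF g] by (simp_all add: PGL3.m_assoc) (simp_all add: PGL3.m_assoc[symmetric])
      show "\<forall>k\<in>carrier (PGL3\<lparr>carrier := ?S x\<rparr>). ?d (?c k) = k" using cancel S by simp
      show "\<forall>k\<in>carrier (PGL3\<lparr>carrier := ?S y\<rparr>). ?c (?d k) = k" using cancel S by simp
    qed (use c d in auto)
  qed
  then show ?thesis by (auto simp: is_iso_def)
qed

lemma vertex_group_action:
  "subgroup H PGL3 \<Longrightarrow> group_action (PGL3\<lparr>carrier := H\<rparr>) building_vertices vertex_action"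
  unfolding vertex_action_def[abs_def]
  by (rule group_action_restrictI) (simp_all add: vertex_map_closed vertex_map_mult vertex_map_one)

lemma inj_on_vertex_map:
  assumes g: "g \<in> carrier PGL3"
  shows "inj_on (vertex_map g) building_vertices"
proof (rule inj_on_inverseI[where g = "vertex_map (inv\<^bsub>PGL3\<^esub> g)"])
  fix v assume "v \<in> building_vertices"
  then show "vertex_map (inv\<^bsub>PGL3\<^esub> g) (vertex_map g v) = v"
    using g vertex_map_mult[of "inv\<^bsub>PGL3\<^esub> g" g v] by (simp add: vertex_map_one)
qed

lemma simplex_map_closed:
  assumes g: "g \<in> carrier PGL3" and \<sigma>: "\<sigma> \<in> building_simplices k"
  shows "vertex_map g ` \<sigma> \<in> building_simplices k"
proof -
  have s: "\<sigma> \<subseteq> building_vertices" "card \<sigma> = k + 1" "pairwise joined \<sigma>"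
    using \<sigma> by (auto simp: building_simplices_def)
  have "vertex_map g ` \<sigma> \<subseteq> building_vertices" using s(1) vertex_map_closed[OF g] by blast
  moreover have "card (vertex_map g ` \<sigma>) = k + 1"
    using s inj_on_subset[OF inj_on_vertex_map[OF g]] by (simp add: card_image)
  moreover have "pairwise joined (vertex_map g ` \<sigma>)"
    unfolding pairwise_def
  proof (intro ballI impI)
    fix x y assume "x \<in> vertex_map g ` \<sigma>" "y \<in> vertex_map g ` \<sigma>" "x \<noteq> y"
    then obtain a b where ab: "a \<in> \<sigma>" "b \<in> \<sigma>" "a \<noteq> b" "x = vertex_map g a" "y = vertex_map g b" by auto
    then have "joined a b" using s(3) by (simp add: pairwise_def)
    then show "joined x y" unfolding ab(4,5) by (rule joined_vertex_map[OF g])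
  qed
  ultimately show ?thesis by (simp add: building_simplices_def)
qed

lemma simplex_group_action:
  assumes "subgroup H PGL3"
  shows "group_action (PGL3\<lparr>carrier := H\<rparr>) (building_simplices k) (simplex_action k)"
  unfolding simplex_action_def[abs_def]
proof (rule group_action_restrictI[OF assms])
  have sub: "v \<in> building_vertices" if "\<sigma> \<in> building_simplices k" "v \<in> \<sigma>" for \<sigma> v
    using that by (auto simp: building_simplices_def)
  fix g \<sigma> assume g: "g \<in> carrier PGL3" and \<sigma>: "\<sigma> \<in> building_simplices k"
  show "vertex_map g ` \<sigma> \<in> building_simplices k" using g \<sigma> by (rule simplex_map_closed)
  fix h assume h: "h \<in> carrier PGL3"
  show "vertex_map (g \<otimes>\<^bsub>PGL3\<^esub> h) ` \<sigma> = vertex_map g ` (vertex_map h ` \<sigma>)"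
    unfolding image_image using sub[OF \<sigma>] vertex_map_mult[OF g h] by (intro image_cong) auto
next
  fix \<sigma> assume "\<sigma> \<in> building_simplices k"
  then have "\<sigma> \<subseteq> building_vertices" by (auto simp: building_simplices_def)
  then have "vertex_map \<one>\<^bsub>PGL3\<^esub> ` \<sigma> = (\<lambda>v. v) ` \<sigma>" by (intro image_cong) (auto simp: vertex_map_one)
  then show "vertex_map \<one>\<^bsub>PGL3\<^esub> ` \<sigma> = \<sigma>" by simp
qed

lemma cyclic_group_3_iso:
  assumes x: "x \<in> carrier PGL3" "x \<noteq> \<one>\<^bsub>PGL3\<^esub>" "x \<otimes>\<^bsub>PGL3\<^esub> (x \<otimes>\<^bsub>PGL3\<^esub> x) = \<one>\<^bsub>PGL3\<^esub>"
    and S: "S = {\<one>\<^bsub>PGL3\<^esub>, x, x \<otimes>\<^bsub>PGL3\<^esub> x}"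
  shows "PGL3\<lparr>carrier := S\<rparr> \<cong> integer_mod_group 3"
proof -
  define y where "y = x \<otimes>\<^bsub>PGL3\<^esub> x"
  have y: "y \<in> carrier PGL3" using x by (simp add: y_def)
  have mult: "x \<otimes>\<^bsub>PGL3\<^esub> x = y" "x \<otimes>\<^bsub>PGL3\<^esub> y = \<one>\<^bsub>PGL3\<^esub>" "y \<otimes>\<^bsub>PGL3\<^esub> x = \<one>\<^bsub>PGL3\<^esub>" "y \<otimes>\<^bsub>PGL3\<^esub> y = x"
    using x by (simp_all add: y_def PGL3.m_assoc)
  have yx: "y \<noteq> x" "y \<noteq> \<one>\<^bsub>PGL3\<^esub>" using x mult y by (metis PGL3.l_cancel_one' PGL3.r_one)+
  define f where "f s = (if s = \<one>\<^bsub>PGL3\<^esub> then 0 else if s = x then 1 else 2 :: int)" for s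
  have f: "f \<one>\<^bsub>PGL3\<^esub> = 0" "f x = 1" "f y = 2" using x yx by (simp_all add: f_def)
  have S: "S = {\<one>\<^bsub>PGL3\<^esub>, x, y}" by (simp add: S y_def)
  have "f \<in> iso (PGL3\<lparr>carrier := S\<rparr>) (integer_mod_group 3)"
    unfolding iso_def hom_def
  proof (intro CollectI conjI)
    show "f \<in> carrier (PGL3\<lparr>carrier := S\<rparr>) \<rightarrow> carrier (integer_mod_group 3)"
      using f by (auto simp: S carrier_integer_mod_group)
    show "\<forall>a\<in>carrier (PGL3\<lparr>carrier := S\<rparr>). \<forall>b\<in>carrier (PGL3\<lparr>carrier := S\<rparr>).
        f (a \<otimes>\<^bsub>PGL3\<lparr>carrier := S\<rparr>\<^esub> b) = f a \<otimes>\<^bsub>integer_mod_group 3\<^esub> f b"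
      using f x y by (simp add: S mult)
    show "bij_betw f (carrier (PGL3\<lparr>carrier := S\<rparr>)) (carrier (integer_mod_group 3))"
      unfolding bij_betw_def
    proof
      show "inj_on f (carrier (PGL3\<lparr>carrier := S\<rparr>))" using f by (auto simp: S inj_on_def)
      have "{0..<3 :: int} = {0, 1, 2}" by auto
      then show "f ` carrier (PGL3\<lparr>carrier := S\<rparr>) = carrier (integer_mod_group 3)"
        using f by (simp add: S carrier_integer_mod_group)
    qed
  qed
  then show ?thesis by (auto simp: is_iso_def)
qed

section \<open>The arithmetic of \<open>\<rat>(\<lambda>)\<close>\<close>

lemma lam_square_left: "lam * (lam * x) = - (lam * x) - 2 * x"
  by (simp add: mult.assoc[symmetric] lam_square) (simp add: algebra_simps)

lemmas lam_simps = cnj_lam lam_square lam_square_left power2_eq_square power3_eq_cube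

lemma lam_nonzero: "lam \<noteq> 0" "cnj lam \<noteq> 0"
  by (simp_all add: lam_def complex_eq_iff)

lemma lam_cnj_lam: "lam * cnj lam = 2" "cnj lam * lam = 2"
  by (simp_all add: lam_simps algebra_simps)

text \<open>Pairs of integers make O executable: with \<open>padd\<close>, \<open>pmul\<close> and
  \<open>pcnj\<close> the finite searches can be run by evaluation.\<close>

definition ol :: "int \<times> int \<Rightarrow> complex"
  where "ol p = of_int (fst p) + of_int (snd p) * lam"

definition padd :: "int \<times> int \<Rightarrow> int \<times> int \<Rightarrow> int \<times> int"
  where "padd p q = (fst p + fst q, snd p + snd q)"

definition pmul :: "int \<times> int \<Rightarrow> int \<times> int \<Rightarrow> int \<times> int"
  where "pmul p q = (fst p * fst q - 2 * (snd p * snd q), fst p * snd q + snd p * fst q - snd p * snd q)"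

definition pcnj :: "int \<times> int \<Rightarrow> int \<times> int"
  where "pcnj p = (fst p - snd p, - snd p)"

lemma ol_padd: "ol (padd p q) = ol p + ol q"
  by (simp add: ol_def padd_def algebra_simps)

lemma ol_pmul: "ol (pmul p q) = ol p * ol q"
  by (simp add: ol_def pmul_def algebra_simps lam_square lam_square_left)

lemma ol_pcnj: "ol (pcnj p) = cnj (ol p)"
  by (simp add: ol_def pcnj_def cnj_lam algebra_simps)

lemma ol_inject: "ol p = ol q \<longleftrightarrow> p = q"
proof
  assume "ol p = ol q"
  then show "p = q" by (cases p; cases q) (auto simp: ol_def lam_def complex_eq_iff)
qed simp

lemma ol_consts: "ol (0, 0) = 0" "ol (1, 0) = 1" "ol (0, 1) = lam" "ol (- 1, - 1) = cnj lam" "ol (3, 0) = 3"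
  by (simp_all add: ol_def cnj_lam)

lemma O_lam_ol: "O_lam = range ol"
proof (intro equalityI subsetI)
  fix x assume "x \<in> O_lam"
  then obtain a b where "x = ol (a, b)" by (auto simp: O_lam_def ol_def)
  then show "x \<in> range ol" by blast
qed (auto simp: O_lam_def ol_def)

text \<open>Covers O, O[1/2] and Q(lam), so that the isometries of M and of M[1/2] are described by
  one proof.\<close>

definition lam_ring :: "complex set \<Rightarrow> bool"
  where "lam_ring R \<longleftrightarrow> O_lam \<subseteq> R \<and> R \<subseteq> Q_lam \<and>
    (\<forall>x\<in>R. \<forall>y\<in>R. x + y \<in> R \<and> x * y \<in> R) \<and> (\<forall>x\<in>R. cnj x \<in> R)"

lemma O_lam_add: "x \<in> O_lam \<Longrightarrow> y \<in> O_lam \<Longrightarrow> x + y \<in> O_lam"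
  unfolding O_lam_ol by (auto simp flip: ol_padd)

lemma O_lam_mult: "x \<in> O_lam \<Longrightarrow> y \<in> O_lam \<Longrightarrow> x * y \<in> O_lam"
  unfolding O_lam_ol by (auto simp flip: ol_pmul)

lemma O_lam_cnj: "x \<in> O_lam \<Longrightarrow> cnj x \<in> O_lam"
  unfolding O_lam_ol by (auto simp flip: ol_pcnj)

lemma O_lam_int: "of_int n \<in> O_lam"
  unfolding O_lam_def by (intro CollectI exI[of _ n] exI[of _ "0::int"]) simp

lemma O_lam_consts: "0 \<in> O_lam" "1 \<in> O_lam" "numeral k \<in> O_lam" "lam \<in> O_lam"
  using O_lam_int[of 0] O_lam_int[of 1] O_lam_int[of "numeral k"] by (simp_all add: O_lam_ol)
    (metis ol_consts(3) rangeI)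

lemma O_lam_minus: "x \<in> O_lam \<Longrightarrow> - x \<in> O_lam"
  using O_lam_mult[OF O_lam_int[of "- 1"]] by simp

lemma O_lam_diff: "x \<in> O_lam \<Longrightarrow> y \<in> O_lam \<Longrightarrow> x - y \<in> O_lam"
  using O_lam_add[of x "- y"] O_lam_minus by simp

lemmas O_lam_intros = O_lam_add O_lam_diff O_lam_mult O_lam_minus O_lam_cnj O_lam_consts

lemma Q_lam_ratio: "z \<in> Q_lam \<longleftrightarrow> (\<exists>x\<in>O_lam. \<exists>n::int. n > 0 \<and> z = x / of_int n)"
proof
  assume "z \<in> Q_lam"
  then obtain a b where z: "z = of_rat a + of_rat b * lam" by (auto simp: Q_lam_def)
  obtain p q r s where ab: "a = of_int p / of_int q" "q > 0" "b = of_int r / of_int s" "s > 0"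
    by (metis Rat_cases Fract_of_int_quotient)
  have "z = (of_int (p * s) + of_int (r * q) * lam) / of_int (q * s)"
    unfolding z ab(1,3) using ab(2,4) by (simp add: of_rat_divide field_simps)
  moreover have "of_int (p * s) + of_int (r * q) * lam \<in> O_lam" unfolding O_lam_def by blast
  moreover have "q * s > 0" using ab by simp
  ultimately show "\<exists>x\<in>O_lam. \<exists>n::int. n > 0 \<and> z = x / of_int n" by blast
next
  assume "\<exists>x\<in>O_lam. \<exists>n::int. n > 0 \<and> z = x / of_int n"
  then obtain a b n where n: "n > 0" "z = (of_int a + of_int b * lam) / of_int n" by (auto simp: O_lam_def)
  then have "z = of_rat (of_int a / of_int n) + of_rat (of_int b / of_int n) * lam"
    by (simp add: of_rat_divide add_divide_distrib)
  then show "z \<in> Q_lam" unfolding Q_lam_def by blast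
qed

lemma lam_ring_Q_lam: "lam_ring Q_lam"
  unfolding lam_ring_def
proof (intro conjI ballI)
  show "O_lam \<subseteq> Q_lam" using Q_lam_ratio by (auto intro!: bexI exI[of _ "1::int"])
  fix x assume "x \<in> Q_lam"
  then obtain u m where u: "u \<in> O_lam" "m > 0" "x = u / of_int (m :: int)" using Q_lam_ratio by blast
  then show "cnj x \<in> Q_lam" using Q_lam_ratio O_lam_cnj by (auto intro!: bexI exI[of _ m])
  fix y assume "y \<in> Q_lam"
  then obtain v n where v: "v \<in> O_lam" "n > 0" "y = v / of_int (n :: int)" using Q_lam_ratio by blast
  have "x + y = (u * of_int n + v * of_int m) / of_int (m * n)" using u v by (simp add: field_simps)
  moreover have "u * of_int n + v * of_int m \<in> O_lam" using u v by (intro O_lam_add O_lam_mult O_lam_int)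
  moreover have "m * n > 0" using u v by simp
  ultimately show "x + y \<in> Q_lam" using Q_lam_ratio by blast
  have "x * y = (u * v) / of_int (m * n)" using u v by simp
  moreover have "u * v \<in> O_lam" using u v by (intro O_lam_mult)
  ultimately show "x * y \<in> Q_lam" using \<open>m * n > 0\<close> Q_lam_ratio by blast
qed simp

definition O_half :: "complex set"
  where "O_half = {x / 2 ^ n | x n. x \<in> O_lam}"

lemma lam_ring_O_half: "lam_ring O_half"
  unfolding lam_ring_def
proof (intro conjI ballI)
  show "O_lam \<subseteq> O_half" by (auto simp: O_half_def intro!: exI[of _ "0::nat"])
  show "O_half \<subseteq> Q_lam"
  proof
    fix x assume "x \<in> O_half"
    then obtain u m where u: "u \<in> O_lam" "x = u / 2 ^ m" by (auto simp: O_half_def)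
    then have "x = u / of_int (2 ^ m)" by simp
    then show "x \<in> Q_lam" using u Q_lam_ratio by (metis zero_less_numeral zero_less_power)
  qed
  fix x assume "x \<in> O_half"
  then obtain u m where u: "u \<in> O_lam" "x = u / 2 ^ m" by (auto simp: O_half_def)
  then have "cnj x = cnj u / 2 ^ m" by simp
  then show "cnj x \<in> O_half" using O_lam_cnj[OF u(1)] unfolding O_half_def by blast
  fix y assume "y \<in> O_half"
  then obtain v n where v: "v \<in> O_lam" "y = v / 2 ^ n" by (auto simp: O_half_def)
  have p: "(2 :: complex) ^ k \<in> O_lam" for k using O_lam_int[of "2 ^ k"] by simp
  have "x + y = (u * 2 ^ n + v * 2 ^ m) / 2 ^ (m + n)" unfolding u(2) v(2) by (simp add: field_simps power_add)
  moreover have "u * 2 ^ n + v * 2 ^ m \<in> O_lam" using u v p by (intro O_lam_add O_lam_mult)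
  ultimately show "x + y \<in> O_half" unfolding O_half_def by blast
  have "x * y = (u * v) / 2 ^ (m + n)" unfolding u(2) v(2) by (simp add: power_add)
  moreover have "u * v \<in> O_lam" using u v by (intro O_lam_mult)
  ultimately show "x * y \<in> O_half" unfolding O_half_def by blast
qed

lemma lam_ring_O_lam: "lam_ring O_lam"
  using lam_ring_Q_lam by (simp add: lam_ring_def O_lam_intros)

lemma lam_ringD:
  assumes "lam_ring R"
  shows "x \<in> O_lam \<Longrightarrow> x \<in> R" "x \<in> R \<Longrightarrow> x \<in> Q_lam" "x \<in> R \<Longrightarrow> y \<in> R \<Longrightarrow> x + y \<in> R"
    "x \<in> R \<Longrightarrow> y \<in> R \<Longrightarrow> x * y \<in> R" "x \<in> R \<Longrightarrow> cnj x \<in> R"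
    "x \<in> R \<Longrightarrow> - x \<in> R" "x \<in> R \<Longrightarrow> y \<in> R \<Longrightarrow> x - y \<in> R"
proof -
  show 1: "x \<in> O_lam \<Longrightarrow> x \<in> R" and "x \<in> R \<Longrightarrow> x \<in> Q_lam"
    and 2: "x \<in> R \<Longrightarrow> y \<in> R \<Longrightarrow> x + y \<in> R" and 3: "x \<in> R \<Longrightarrow> y \<in> R \<Longrightarrow> x * y \<in> R" and "x \<in> R \<Longrightarrow> cnj x \<in> R"
    for x y using assms by (auto simp: lam_ring_def)
  have m: "- 1 \<in> R" using 1 O_lam_minus O_lam_consts(2) by blast
  show 4: "x \<in> R \<Longrightarrow> - x \<in> R" for x using 3[OF m, of x] by simp
  show "x \<in> R \<Longrightarrow> y \<in> R \<Longrightarrow> x - y \<in> R" using 2[of x "- y"] 4[of y] by simp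
qed

lemma lam_ring_matrix_mult:
  assumes R: "lam_ring R" and "\<And>i j. A$i$j \<in> R" "\<And>i j. (B :: complex^3^3)$i$j \<in> R"
  shows "(A ** B)$i$j \<in> R"
  unfolding matrix_mult_3 using assms(2,3) by (intro lam_ringD(3,4)[OF R])

section \<open>The Hermitian form in the basis \<open>e\<^sub>1, e\<^sub>2, e\<^sub>3\<close>\<close>

definition basis_M :: "complex^3^3"
  where "basis_M = transpose (vector [e1, e2, e3])"

text \<open>The determinant of \<open>basis_M\<close> is 2 lam - 6, of norm 56, and (-4 - lam) / 28
  is its inverse.\<close>

definition basis_inv :: "complex^3^3"
  where "basis_inv = mat ((- 4 - lam) / 28) ** adj3 basis_M"

lemma basis_M_nth:
  "basis_M$1$1 = 2 + cnj lam" "basis_M$2$1 = - cnj lam" "basis_M$3$1 = 0"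
  "basis_M$1$2 = lam" "basis_M$2$2 = lam" "basis_M$3$2 = lam"
  "basis_M$1$3 = 1" "basis_M$2$3 = - lam - 2" "basis_M$3$3 = - 1"
  by (simp_all add: basis_M_def transpose_def e1_def e2_def e3_def lam_simps algebra_simps)

lemma det_basis_M: "det basis_M = 2 * lam - 6"
  unfolding det_3 basis_M_nth by (simp add: lam_simps algebra_simps)

lemma basis_inv: "basis_M ** basis_inv = mat 1" "basis_inv ** basis_M = mat 1"
proof -
  have "(- 4 - lam) / 28 * (2 * lam - 6) = 1" by (simp add: lam_simps algebra_simps)
  then show "basis_M ** basis_inv = mat 1" "basis_inv ** basis_M = mat 1"
    unfolding basis_inv_def by (simp_all add: mat_out mult_adj3 adj3_mult det_basis_M mat_mult_mat flip: matrix_mul_assoc)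
qed

lemma basis_M_O_lam: "basis_M$i$j \<in> O_lam"
  using exhaust_3[of i] exhaust_3[of j] by (auto simp: basis_M_nth intro!: O_lam_intros)

lemma basis_inv_Q_lam: "basis_inv$i$j \<in> Q_lam"
proof -
  have "adj3 basis_M$i$j \<in> O_lam"
    using exhaust_3[of i] exhaust_3[of j] basis_M_O_lam by (auto simp: adj3_def intro!: O_lam_diff O_lam_mult)
  then have "(- 4 - lam) * adj3 basis_M$i$j \<in> O_lam" by (intro O_lam_intros)
  then show ?thesis
    unfolding basis_inv_def mat_mult_nth Q_lam_ratio by (intro bexI[rotated] exI[of _ 28]) auto
qed

definition gram :: "complex^3 \<Rightarrow> complex^3 \<Rightarrow> complex"
  where "gram x y = 3 * (x$1 * cnj (y$1) + x$2 * cnj (y$2) + x$3 * cnj (y$3))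
    + cnj lam * (x$1 * cnj (y$2) + x$1 * cnj (y$3) + x$2 * cnj (y$3))
    + lam * (x$2 * cnj (y$1) + x$3 * cnj (y$1) + x$3 * cnj (y$2))"

lemma herm_basis: "herm (basis_M *v x) (basis_M *v y) = gram x y"
  unfolding herm_def sum_3 matrix_vector_3 basis_M_nth gram_def
  by (simp add: lam_simps algebra_simps)

definition gram_matrix :: "complex^3^3"
  where "gram_matrix = vector [vector [3, cnj lam, cnj lam], vector [lam, 3, cnj lam], vector [lam, lam, 3]]"

lemma gram_matrix_nth:
  "(transpose B ** gram_matrix ** map_matrix cnj B)$i$j = gram (column i B) (column j B)"
  for B :: "complex^3^3"
  by (simp add: matrix_mult_3 gram_matrix_def transpose_def column_def gram_def algebra_simps)

lemma gram_axis: "gram (axis i 1) (axis j 1) = gram_matrix$i$j"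
  using exhaust_3[of i] exhaust_3[of j] by (auto simp: gram_def gram_matrix_def axis_def)

lemma det_gram_matrix: "det gram_matrix = 7"
  unfolding det_3 gram_matrix_def by (simp add: lam_simps algebra_simps)

lemma matrix_vector_axis3: "(B *v axis j 1) $ i = B$i$j" for B :: "complex^3^3"
  using exhaust_3[of j] by (auto simp: matrix_vector_3 axis_def)

lemma column_axis: "column j B = B *v axis j 1" for B :: "complex^3^3"
  using exhaust_3[of j] by (auto simp: vec_eq_iff column_def matrix_vector_3 axis_def)

lemma gram_expand:
  "gram (B *v x) (B *v y) = (\<Sum>i\<in>UNIV. \<Sum>j\<in>UNIV. x$i * cnj (y$j) * gram (column i B) (column j B))"
  for B :: "complex^3^3"
  unfolding sum_3 gram_def matrix_vector_3 column_def by (simp add: algebra_simps)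

text \<open>Isometries in coordinates with respect to e1, e2, e3; therefore the Gram matrix takes
  the place of the identity matrix.\<close>

definition unitary_over :: "complex set \<Rightarrow> (complex^3^3) set"
  where "unitary_over R = {B. (\<forall>i j. B$i$j \<in> R) \<and> transpose B ** gram_matrix ** map_matrix cnj B = gram_matrix}"

lemma unitary_iff_columns:
  "transpose B ** gram_matrix ** map_matrix cnj B = gram_matrix \<longleftrightarrow>
    (\<forall>i j. gram (column i B) (column j B) = gram_matrix$i$j)"
  by (simp add: mat3_eq_iff gram_matrix_nth)

lemma unitary_gram:
  assumes "B \<in> unitary_over R"
  shows "gram (B *v x) (B *v y) = gram x y"
proof -
  have "gram (column i B) (column j B) = gram_matrix$i$j" for i j
    using assms unfolding unitary_over_def unitary_iff_columns by blast
  then show ?thesis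
    unfolding gram_expand by (simp add: sum_3 gram_matrix_def gram_def algebra_simps)
qed

lemma unitaryI_gram:
  assumes "\<And>i j. B$i$j \<in> R" and "\<And>i j. gram (B *v axis i 1) (B *v axis j 1) = gram (axis i 1) (axis j 1)"
  shows "B \<in> unitary_over R"
  using assms unfolding unitary_over_def unitary_iff_columns column_axis gram_axis by blast

lemma unitary_mult:
  assumes R: "lam_ring R" and A: "A \<in> unitary_over R" and B: "B \<in> unitary_over R"
  shows "A ** B \<in> unitary_over R"
proof (rule unitaryI_gram)
  show "(A ** B)$i$j \<in> R" for i j
    using A B by (intro lam_ring_matrix_mult[OF R]) (simp_all add: unitary_over_def)
  show "gram ((A ** B) *v axis i 1) ((A ** B) *v axis j 1) = gram (axis i 1) (axis j 1)" for i j
    by (simp add: unitary_gram[OF A] unitary_gram[OF B] flip: matrix_vector_mul_assoc)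
qed

lemma unitary_det:
  assumes "B \<in> unitary_over R"
  shows "det B * cnj (det B) = 1"
proof -
  have "det (map_matrix cnj B) = cnj (det B)" by (simp add: det_3)
  then have "det B * 7 * cnj (det B) = 7"
    using assms unfolding unitary_over_def by (metis (mono_tags, lifting) det_gram_matrix det_mul det_transpose mem_Collect_eq)
  then show ?thesis by simp
qed

lemma unitary_one: "lam_ring R \<Longrightarrow> mat 1 \<in> unitary_over R"
  by (rule unitaryI_gram) (auto simp: mat_3 lam_ringD(1) O_lam_consts)

text \<open>The determinant has norm 1, so its conjugate is its inverse. The conjugate times the
  adjugate is then the inverse matrix, with entries in \<open>R\<close> again.\<close>

lemma unitary_inv:
  assumes R: "lam_ring R" and B: "B \<in> unitary_over R"
  shows "\<exists>C\<in>unitary_over R. B ** C = mat 1 \<and> C ** B = mat 1"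
proof -
  define C where "C = mat (cnj (det B)) ** adj3 B"
  have BR: "B$i$j \<in> R" for i j using B by (simp add: unitary_over_def)
  have BC: "B ** C = mat 1" and CB: "C ** B = mat 1"
    unfolding C_def using unitary_det[OF B]
    by (simp_all add: mat_out mult_adj3 adj3_mult mat_mult_mat mult.commute flip: matrix_mul_assoc)
  have "det B \<in> R" unfolding det_3 using BR by (intro lam_ringD(3,4,7)[OF R])
  moreover have "adj3 B$i$j \<in> R" for i j
    using exhaust_3[of i] exhaust_3[of j] BR by (auto simp: adj3_def intro!: lam_ringD(4,7)[OF R])
  ultimately have "C$i$j \<in> R" for i j
    unfolding C_def mat_mult_nth by (intro lam_ringD(4,5)[OF R])
  moreover have "gram (C *v x) (C *v y) = gram x y" for x y
    using unitary_gram[OF B, of "C *v x" "C *v y"] by (simp add: matrix_vector_mul_assoc BC)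
  ultimately have "C \<in> unitary_over R" by (intro unitaryI_gram)
  then show ?thesis using BC CB by blast
qed

lemma unitary_scalar:
  assumes R: "lam_ring R" and c: "c \<in> R" "c * cnj c = 1" and B: "B \<in> unitary_over R"
  shows "mat c ** B \<in> unitary_over R"
proof (rule unitary_mult[OF R _ B], rule unitaryI_gram)
  show "mat c$i$j \<in> R" for i j :: 3 using c lam_ringD(1)[OF R] O_lam_consts by (simp add: mat_3)
  have "mat c *v x = c *s x" for x :: "complex^3"
    by (simp add: vec_eq_iff forall_3 matrix_vector_3 mat_3)
  moreover have "gram (c *s x) (c *s y) = (c * cnj c) * gram x y" for x y
    by (simp add: gram_def algebra_simps)
  ultimately show "gram (mat c *v axis i 1) (mat c *v axis j 1) = gram (axis i 1) (axis j 1)" for i j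
    using c(2) by simp
qed

text \<open>The images of the basis vectors show that the entries of \<open>B\<close> lie in
  \<open>R\<close> and satisfy the Gram relations. Conversely the inverse from
  \<open>unitary_inv\<close> provides surjectivity on \<open>X\<close>.\<close>

lemma isometries_basis:
  assumes R: "lam_ring R" and X: "X = (*v) basis_M ` {c. \<forall>i. c$i \<in> R}"
  shows "isometries X = (\<lambda>B. basis_M ** B ** basis_inv) ` unitary_over R"
proof (intro equalityI subsetI)
  fix A assume "A \<in> isometries X"
  then have A: "(\<lambda>x. A *v x) ` X = X" "\<And>x y. x \<in> X \<Longrightarrow> y \<in> X \<Longrightarrow> herm (A *v x) (A *v y) = herm x y"
    by (auto simp: isometries_def)
  define B where "B = basis_inv ** A ** basis_M"
  have AB: "basis_M ** B = A ** basis_M" unfolding B_def by (simp add: matrix_mul_assoc basis_inv)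
  have ax: "basis_M *v axis j 1 \<in> X" for j
    unfolding X using lam_ringD(1)[OF R] O_lam_consts by (auto simp: axis_def)
  have act: "A *v (basis_M *v c) = basis_M *v (B *v c)" for c
    by (simp add: matrix_vector_mul_assoc AB)
  have "B$i$j \<in> R" for i j
  proof -
    have "A *v (basis_M *v axis j 1) \<in> X" using A(1) ax by blast
    then obtain c where c: "\<forall>i. c$i \<in> R" "basis_M *v (B *v axis j 1) = basis_M *v c" unfolding act X by blast
    then have "B *v axis j 1 = c"
      by (metis basis_inv(2) matrix_vector_mul_assoc matrix_vector_mul_lid)
    moreover have "B$i$j = (B *v axis j 1)$i" by (simp add: column_def flip: column_axis)
    ultimately show ?thesis using c by simp
  qed
  moreover have "gram (B *v axis i 1) (B *v axis j 1) = gram (axis i 1) (axis j 1)" for i j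
    using A(2)[OF ax ax, of i j] unfolding act herm_basis .
  ultimately have "B \<in> unitary_over R" by (intro unitaryI_gram)
  moreover have "A = basis_M ** B ** basis_inv"
    unfolding AB by (simp add: basis_inv flip: matrix_mul_assoc)
  ultimately show "A \<in> (\<lambda>B. basis_M ** B ** basis_inv) ` unitary_over R" by blast
next
  fix A assume "A \<in> (\<lambda>B. basis_M ** B ** basis_inv) ` unitary_over R"
  then obtain B where B: "B \<in> unitary_over R" "A = basis_M ** B ** basis_inv" by blast
  have stable: "C *v c \<in> {c. \<forall>i. c$i \<in> R}" if "C \<in> unitary_over R" "c \<in> {c. \<forall>i. c$i \<in> R}" for C c
    using that by (auto simp: matrix_vector_3 unitary_over_def intro!: lam_ringD(3,4)[OF R])
  have act: "A *v (basis_M *v c) = basis_M *v (B *v c)" for c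
    unfolding B(2) by (simp add: matrix_vector_mul_assoc basis_inv flip: matrix_mul_assoc)
  have "A$i$j \<in> Q_lam" for i j
    unfolding B(2) using basis_inv_Q_lam lam_ringD(1)[OF lam_ring_Q_lam basis_M_O_lam] B(1) lam_ringD(2)[OF R]
    by (intro lam_ring_matrix_mult[OF lam_ring_Q_lam]) (auto simp: unitary_over_def)
  moreover have "(\<lambda>x. A *v x) ` X = X"
  proof
    show "(\<lambda>x. A *v x) ` X \<subseteq> X"
    proof (rule image_subsetI)
      fix x assume "x \<in> X"
      then obtain c where c: "c \<in> {c. \<forall>i. c$i \<in> R}" "x = basis_M *v c" unfolding X by blast
      show "A *v x \<in> X" unfolding c(2) act X using stable[OF B(1) c(1)] by (rule imageI)
    qed
    obtain C where C: "C \<in> unitary_over R" "B ** C = mat 1" using unitary_inv[OF R B(1)] by blast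
    show "X \<subseteq> (\<lambda>x. A *v x) ` X"
    proof
      fix x assume "x \<in> X"
      then obtain c where c: "c \<in> {c. \<forall>i. c$i \<in> R}" "x = basis_M *v c" unfolding X by blast
      have "x = A *v (basis_M *v (C *v c))" unfolding act c(2) by (simp add: matrix_vector_mul_assoc C)
      moreover have "basis_M *v (C *v c) \<in> X" unfolding X using stable[OF C(1) c(1)] by (rule imageI)
      ultimately show "x \<in> (\<lambda>x. A *v x) ` X" by (rule image_eqI)
    qed
  qed
  moreover have "herm (A *v x) (A *v y) = herm x y" if xy: "x \<in> X" "y \<in> X" for x y
  proof -
    obtain c d where "x = basis_M *v c" "y = basis_M *v d" using xy unfolding X by blast
    then show ?thesis by (simp add: act herm_basis unitary_gram[OF B(1)])
  qed
  ultimately show "A \<in> isometries X" by (simp add: isometries_def)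
qed

text \<open>The coordinates of \<open>x \<in> M\<close> in the basis are found from the witnesses \<open>p, q, r, t\<close> of the
  congruences that define \<open>M\<close>.\<close>

lemma M_lattice_basis: "M_lattice = (*v) basis_M ` {c. \<forall>i. c$i \<in> O_lam}"
proof (intro equalityI subsetI)
  fix x assume "x \<in> M_lattice"
  then have xO: "\<And>i. x$i \<in> O_lam" and "cong_O (x$1) (x$2) (cnj lam)" "cong_O (x$1) (x$3) (cnj lam)"
    "cong_O (x$1 + x$2 + x$3) 0 lam" "cong_O (herm x s_vec) 0 theta"
    by (auto simp: M_lattice_def L_lattice_def)
  then obtain p q r t where p: "p \<in> O_lam" "x$1 - x$2 = cnj lam * p" and q: "q \<in> O_lam" "x$1 - x$3 = cnj lam * q"
    and r: "r \<in> O_lam" "x$1 + x$2 + x$3 - 0 = lam * r" and t: "t \<in> O_lam" "herm x s_vec - 0 = theta * t"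
    unfolding cong_O_def by blast
  have p': "p = (x$1 - x$2) * lam / 2" using p(2) lam_cnj_lam by (simp add: field_simps)
  have q': "q = (x$1 - x$3) * lam / 2" using q(2) lam_cnj_lam by (simp add: field_simps)
  have r': "r = (x$1 + x$2 + x$3) * cnj lam / 2" using r(2) lam_cnj_lam by (simp add: field_simps)
  have "theta * theta = - 7" by (simp add: theta_def lam_simps algebra_simps)
  then have "- (theta * (theta * t)) / 7 = t" by (simp add: mult.assoc[symmetric])
  then have t': "t = - (theta * herm x s_vec) / 7" using t(2) by simp
  \<comment> \<open>\<open>c\<close> is an O-linear combination of \<open>p\<close>,
    \<open>w\<close> and \<open>z\<close>, which shows that it is integral; inserting
    \<open>p'\<close>, \<open>q'\<close>, \<open>r'\<close>, \<open>t'\<close> turns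
    \<open>basis_M *v c = x\<close> into an identity over Q(lam) in the coordinates of
    \<open>x\<close>.\<close>
  define w where "w = r - cnj lam * x$1 + lam * (p + q)"
  define z where "z = 3 * (t - w) - (1 - lam) * q + 2 * theta * p"
  define c :: "complex^3" where "c = vector [(- 3 - 2 * lam) * p + (1 - lam) * z,
    (- 3 - 6 * lam) * p + 4 * z + w, (1 - 2 * lam) * p + (2 + lam) * z]"
  have w: "w \<in> O_lam" unfolding w_def using p q r xO by (intro O_lam_intros)
  have z: "z \<in> O_lam" unfolding z_def theta_def using p q t w by (intro O_lam_intros)
  have "c$i \<in> O_lam" for i
    unfolding c_def using exhaust_3[of i] p w z by (auto intro!: O_lam_intros)
  moreover have "basis_M *v c = x"
    unfolding vec_eq_iff forall_3 matrix_vector_3 basis_M_nth c_def vector_3 z_def w_def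
    unfolding t' p' q' r' herm_def sum_3 s_vec_def vector_3 theta_def
    by (simp add: lam_simps algebra_simps add_divide_distrib diff_divide_distrib)
  ultimately show "x \<in> (*v) basis_M ` {c. \<forall>i. c$i \<in> O_lam}" by (intro image_eqI[of _ _ c]) auto
next
  fix x assume "x \<in> (*v) basis_M ` {c. \<forall>i. c$i \<in> O_lam}"
  then obtain c where c: "\<And>i. c$i \<in> O_lam" and x: "x = basis_M *v c" by blast
  have xO: "x$i \<in> O_lam" for i
    unfolding x matrix_vector_3 using c basis_M_O_lam by (intro O_lam_intros)
  let ?d = "(1 - cnj lam) * c$1 + (lam - 1) * c$3" and ?e = "- cnj lam * c$1 + lam * c$3"
  have d: "?d \<in> O_lam" "?e \<in> O_lam" "?e - ?d \<in> O_lam" by (auto intro!: O_lam_intros c)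
  have eqs: "x$1 - x$2 = cnj lam * ?d" "x$1 - x$3 = cnj lam * ?e"
    "x$1 + x$2 + x$3 - 0 = lam * (cnj lam * c$1 + 3 * c$2 + lam * c$3)"
    "herm x s_vec - 0 = theta * (c$2 + lam * c$3)"
    unfolding x herm_def sum_3 s_vec_def vector_3 matrix_vector_3 basis_M_nth theta_def
    by (simp_all add: lam_simps algebra_simps)
  have "\<exists>d\<in>O_lam. x$i - x$j = cnj lam * d" for i j
  proof -
    have "\<exists>d\<in>O_lam. x$1 - x$k = cnj lam * d" for k
      using exhaust_3[of k] eqs(1,2) d by (auto intro: bexI[of _ 0] simp: O_lam_consts)
    then obtain f where f: "\<And>k. f k \<in> O_lam" "\<And>k. x$1 - x$k = cnj lam * f k" by metis
    have "x$i - x$j = cnj lam * (f j - f i)" using f(2)[of i] f(2)[of j] by (simp add: right_diff_distrib flip: f(2))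
    then show ?thesis using f(1) O_lam_diff by blast
  qed
  moreover have "\<exists>d\<in>O_lam. x$1 + x$2 + x$3 - 0 = lam * d"
    by (rule bexI[where x = "cnj lam * c$1 + 3 * c$2 + lam * c$3"], rule eqs(3), intro O_lam_intros c)
  moreover have "\<exists>d\<in>O_lam. herm x s_vec - 0 = theta * d"
    by (rule bexI[where x = "c$2 + lam * c$3"], rule eqs(4), intro O_lam_intros c)
  ultimately show "x \<in> M_lattice"
    using xO unfolding M_lattice_def L_lattice_def cong_O_def by blast
qed

lemma M_half_basis: "M_half = (*v) basis_M ` {c. \<forall>i. c$i \<in> O_half}"
proof (intro equalityI subsetI)
  fix x assume "x \<in> M_half"
  then obtain n y where y: "y \<in> M_lattice" "x = (1 / 2 ^ n) *s y" by (auto simp: M_half_def)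
  then obtain c where c: "\<forall>i. c$i \<in> O_lam" "y = basis_M *v c" unfolding M_lattice_basis by blast
  have "x = basis_M *v ((1 / 2 ^ n) *s c)" unfolding y(2) c(2) by (simp add: vector_scalar_commute)
  moreover have "\<forall>i. ((1 / 2 ^ n) *s c)$i \<in> O_half" using c(1) by (auto simp: O_half_def)
  ultimately show "x \<in> (*v) basis_M ` {c. \<forall>i. c$i \<in> O_half}" by blast
next
  fix x assume "x \<in> (*v) basis_M ` {c. \<forall>i. c$i \<in> O_half}"
  then obtain c where c: "\<forall>i. c$i \<in> O_half" "x = basis_M *v c" by blast
  then have "\<forall>i. \<exists>u n. u \<in> O_lam \<and> c$i = u / 2 ^ n" unfolding O_half_def by blast
  then obtain u n where u: "\<And>i. u i \<in> O_lam" "\<And>i. c$i = u i / 2 ^ n i" by metis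
  define N where "N = n 1 + n 2 + n 3"
  have le: "n i \<le> N" for i using exhaust_3[of i] by (auto simp: N_def)
  define d :: "complex^3" where "d = 2 ^ N *s c"
  have "d$i \<in> O_lam" for i
  proof -
    have "d$i = 2 ^ (N - n i) * u i"
      using le[of i] by (simp add: d_def u(2) power_diff field_simps)
    moreover have "(2 :: complex) ^ (N - n i) \<in> O_lam" using O_lam_int[of "2 ^ (N - n i)"] by simp
    ultimately show ?thesis using u(1) O_lam_mult by simp
  qed
  then have "basis_M *v d \<in> M_lattice" unfolding M_lattice_basis by blast
  moreover have "x = (1 / 2 ^ N) *s (basis_M *v d)"
    unfolding c(2) d_def by (simp add: vector_scalar_commute vector_smult_assoc)
  ultimately show "x \<in> M_half" unfolding M_half_def by blast
qed

section \<open>The isometries of \<open>M\<close>\<close>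

type_synonym pvec = "(int \<times> int) \<times> (int \<times> int) \<times> (int \<times> int)"

definition pvec_of :: "pvec \<Rightarrow> complex^3"
  where "pvec_of v = vector [ol (fst v), ol (fst (snd v)), ol (snd (snd v))]"

text \<open>A matrix with entries in \<open>\<O>\<close> is encoded by its three columns.\<close>

definition pmat_of :: "pvec \<times> pvec \<times> pvec \<Rightarrow> complex^3^3"
  where "pmat_of M = transpose (vector [pvec_of (fst M), pvec_of (fst (snd M)), pvec_of (snd (snd M))])"

definition pmv :: "pvec \<times> pvec \<times> pvec \<Rightarrow> pvec \<Rightarrow> pvec"
  where "pmv = (\<lambda>((a1, a2, a3), (b1, b2, b3), (c1, c2, c3)) (x, y, z).
    (padd (pmul a1 x) (padd (pmul b1 y) (pmul c1 z)),
     padd (pmul a2 x) (padd (pmul b2 y) (pmul c2 z)),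
     padd (pmul a3 x) (padd (pmul b3 y) (pmul c3 z))))"

definition pmm :: "pvec \<times> pvec \<times> pvec \<Rightarrow> pvec \<times> pvec \<times> pvec \<Rightarrow> pvec \<times> pvec \<times> pvec"
  where "pmm A = (\<lambda>(x, y, z). (pmv A x, pmv A y, pmv A z))"

definition pgram :: "pvec \<Rightarrow> pvec \<Rightarrow> int \<times> int"
  where "pgram = (\<lambda>(x1, x2, x3) (y1, y2, y3). padd
    (pmul (3, 0) (padd (pmul x1 (pcnj y1)) (padd (pmul x2 (pcnj y2)) (pmul x3 (pcnj y3)))))
    (padd (pmul (- 1, - 1) (padd (pmul x1 (pcnj y2)) (padd (pmul x1 (pcnj y3)) (pmul x2 (pcnj y3)))))
      (pmul (0, 1) (padd (pmul x2 (pcnj y1)) (padd (pmul x3 (pcnj y1)) (pmul x3 (pcnj y2)))))))"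

lemma pmv: "pvec_of (pmv M v) = pmat_of M *v pvec_of v"
  by (cases M; cases v) (auto simp: pmv_def pvec_of_def pmat_of_def transpose_def vec_eq_iff forall_3
      matrix_vector_3 ol_padd ol_pmul)

lemma pmm: "pmat_of (pmm A B) = pmat_of A ** pmat_of B"
  using pmv[of A] by (cases B)
    (auto simp: pmm_def pmat_of_def[of "(_, _, _)"] mat3_eq_iff forall_3 transpose_def matrix_vector_3 matrix_mult_3
      vec_eq_iff)

lemma pgram: "gram (pvec_of v) (pvec_of w) = ol (pgram v w)"
  by (cases v; cases w) (auto simp: pgram_def pvec_of_def gram_def ol_padd ol_pmul ol_pcnj ol_consts algebra_simps)

lemma pmat_of_column:
  "column 1 (pmat_of (x, y, z)) = pvec_of x" "column 2 (pmat_of (x, y, z)) = pvec_of y"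
  "column 3 (pmat_of (x, y, z)) = pvec_of z"
  by (simp_all add: pmat_of_def transpose_def column_def vec_eq_iff)

lemma pvec_of_inject: "pvec_of v = pvec_of w \<longleftrightarrow> v = w"
  by (cases v; cases w) (auto simp: pvec_of_def vec_eq_iff forall_3 ol_inject)

lemma pvec_obtain:
  assumes "\<And>i. x$i \<in> O_lam"
  shows "\<exists>v. x = pvec_of v"
proof -
  have "\<forall>i. \<exists>p. x$i = ol p" using assms unfolding O_lam_ol by blast
  then obtain f where "\<And>i. x$i = ol (f i)" by metis
  then have "x = pvec_of (f 1, f 2, f 3)" by (simp add: pvec_of_def vec_eq_iff forall_3)
  then show ?thesis by blast
qed

lemma pmat_obtain:
  assumes "\<And>i j. B$i$j \<in> O_lam"
  shows "\<exists>x y z. B = pmat_of (x, y, z)"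
proof -
  have "\<exists>v. column j B = pvec_of v" for j using assms by (intro pvec_obtain) (simp add: column_def)
  then obtain x y z where "column 1 B = pvec_of x" "column 2 B = pvec_of y" "column 3 B = pvec_of z" by metis
  then have "B = pmat_of (x, y, z)"
    by (simp add: pmat_of_def mat3_eq_iff forall_3 transpose_def column_def vec_eq_iff)
  then show ?thesis by blast
qed

lemma pmat_of_O_lam: "pmat_of M$i$j \<in> O_lam"
  using exhaust_3[of i] exhaust_3[of j] by (auto simp: pmat_of_def transpose_def pvec_of_def O_lam_ol)

lemma gram_matrix_ol:
  "gram_matrix$1$1 = ol (3, 0)" "gram_matrix$1$2 = ol (- 1, - 1)" "gram_matrix$1$3 = ol (- 1, - 1)"
  "gram_matrix$2$1 = ol (0, 1)" "gram_matrix$2$2 = ol (3, 0)" "gram_matrix$2$3 = ol (- 1, - 1)"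
  "gram_matrix$3$1 = ol (0, 1)" "gram_matrix$3$2 = ol (0, 1)" "gram_matrix$3$3 = ol (3, 0)"
  by (simp_all add: gram_matrix_def ol_consts)

lemma pmat_unitary_iff:
  "pmat_of (x, y, z) \<in> unitary_over O_lam \<longleftrightarrow>
    pgram x x = (3, 0) \<and> pgram y y = (3, 0) \<and> pgram z z = (3, 0) \<and>
    pgram x y = (- 1, - 1) \<and> pgram x z = (- 1, - 1) \<and> pgram y z = (- 1, - 1) \<and>
    pgram y x = (0, 1) \<and> pgram z x = (0, 1) \<and> pgram z y = (0, 1)"
  unfolding unitary_over_def mem_Collect_eq unitary_iff_columns forall_3 pmat_of_column pgram gram_matrix_ol ol_inject
  using pmat_of_O_lam by auto

section \<open>The vectors of norm 3 in M\<close>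

definition pnorm :: "int \<times> int \<Rightarrow> int"
  where "pnorm p = fst p * fst p - fst p * snd p + 2 * (snd p * snd p)"

text \<open>The elements \<open>a + b\<lambda>\<close> of norm at most 6, with their norms and their residues modulo \<open>\<lambda>\<close>-bar
  and modulo \<open>\<theta>\<close>.\<close>

definition small_elements :: "((int \<times> int) \<times> int \<times> bool \<times> int) list"
  where "small_elements = [((0, 0), 0, True, 0), ((1, 0), 1, False, 1), ((- 1, 0), 1, False, 6), ((2, 0), 4, True, 2), ((- 2, 0), 4, True, 5), ((0, 1), 2, False, 3), ((1, 1), 2, True, 4), ((- 1, 1), 4, True, 2), ((2, 1), 4, False, 5), ((0, - 1), 2, False, 4), ((- 1, - 1), 2, True, 3), ((1, - 1), 4, True, 5), ((- 2, - 1), 4, False, 2)]"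

text \<open>Four times the norm of a + b lam is (2 a - b)^2 + 7 b^2. This bounds b by 1 and a by 2
  in absolute value, leaving fifteen pairs to check.\<close>

lemma pnorm_bound:
  assumes "pnorm p \<le> 6"
  shows "(p, pnorm p, even (fst p + snd p), (fst p + 3 * snd p) mod 7) \<in> set small_elements"
proof -
  obtain a b where p: "p = (a, b)" by fastforce
  have n: "a * a - a * b + 2 * (b * b) \<le> 6" using assms by (simp add: pnorm_def p)
  have "4 * (a * a - a * b + 2 * (b * b)) = (2 * a - b) ^ 2 + 7 * b ^ 2" by (simp add: power2_eq_square algebra_simps)
  moreover have "4 * (a * a - a * b + 2 * (b * b)) \<le> 24" using n by simp
  ultimately have s: "(2 * a - b) ^ 2 + 7 * b ^ 2 \<le> 24" by (simp only:)
  then have "7 * b ^ 2 \<le> 24" using zero_le_power2[of "2 * a - b"] by linarith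
  then have "b ^ 2 < 2 ^ 2" by simp
  then have b: "- 1 \<le> b \<and> b \<le> 1" using power2_less_imp_less[of b 2] power2_less_imp_less[of "- b" 2] by simp
  have "(2 * a - b) ^ 2 \<le> 24" using s zero_le_power2[of b] by linarith
  then have "(2 * a - b) ^ 2 < 5 ^ 2" by simp
  then have "- 4 \<le> 2 * a - b \<and> 2 * a - b \<le> 4"
    using power2_less_imp_less[of "2 * a - b" 5] power2_less_imp_less[of "b - 2 * a" 5]
    by (simp add: power2_commute[of b])
  then have a: "- 2 \<le> a \<and> a \<le> 2" using b by linarith
  have "b = - 1 \<or> b = 0 \<or> b = 1" "a = - 2 \<or> a = - 1 \<or> a = 0 \<or> a = 1 \<or> a = 2" using a b by auto
  then show ?thesis using n unfolding p pnorm_def small_elements_def by (elim disjE; simp)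
qed

definition pbasis :: "pvec \<times> pvec \<times> pvec"
  where "pbasis = (((1, - 1), (1, 1), (0, 0)), ((0, 1), (0, 1), (0, 1)), ((1, 0), (- 2, - 1), (- 1, 0)))"

text \<open>The conjugate of the determinant 2 lam - 6 times the adjugate of \<open>pbasis\<close>.
  Composed with \<open>pbasis\<close> it multiplies by the norm 56, so coordinates are recovered by
  exact integer division.\<close>

definition pbasis_adj :: "pvec \<times> pvec \<times> pvec"
  where "pbasis_adj = (((16, 4), (- 4, - 8), (16, 4)), ((8, - 12), (12, - 4), (8, 16)), ((- 24, 8), (- 36, - 16), (- 24, - 20)))"

lemma pbasis_adj: "pmv pbasis_adj (pmv pbasis ((a, b), (c, d), (e, f))) = ((56 * a, 56 * b), (56 * c, 56 * d), (56 * e, 56 * f))"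
  by (simp add: pmv_def pbasis_def pbasis_adj_def padd_def pmul_def)

text \<open>Because of the factor 1/2 in the form, a vector of norm 3 has three ambient coordinates
  in O whose norms sum to 6.\<close>

lemma pnorm_pbasis:
  "2 * fst (pgram v v) = (case pmv pbasis v of (x, y, z) \<Rightarrow> pnorm x + pnorm y + pnorm z)"
  by (cases v) (simp add: pmv_def pbasis_def padd_def pmul_def pgram_def pcnj_def pnorm_def algebra_simps)

text \<open>The companion matrix of x^3 - lam x^2 + cnj lam x - 1, the factor of the seventh
  cyclotomic polynomial with roots zeta, zeta^2, zeta^4.\<close>

definition psigma :: "pvec \<times> pvec \<times> pvec"
  where "psigma = (((0, 0), (1, 0), (0, 0)), ((0, 0), (0, 0), (1, 0)), ((1, 0), (1, 1), (0, 1)))"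

text \<open>The Galois automorphism taking zeta to zeta^2 in the basis 1, zeta, zeta^2; the last
  column expresses zeta^4 = lam - zeta - zeta^2.\<close>

definition prho :: "pvec \<times> pvec \<times> pvec"
  where "prho = (((1, 0), (0, 0), (0, 0)), ((0, 0), (0, 0), (1, 0)), ((0, 1), (- 1, 0), (- 1, 0)))"

definition pone :: "pvec \<times> pvec \<times> pvec"
  where "pone = (((1, 0), (0, 0), (0, 0)), ((0, 0), (1, 0), (0, 0)), ((0, 0), (0, 0), (1, 0)))"

definition pneg :: "pvec \<Rightarrow> pvec"
  where "pneg = (\<lambda>((a, b), (c, d), (e, f)). ((- a, - b), (- c, - d), (- e, - f)))"

primrec ppow :: "pvec \<times> pvec \<times> pvec \<Rightarrow> nat \<Rightarrow> pvec \<times> pvec \<times> pvec"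
  where "ppow M 0 = pone" | "ppow M (Suc n) = pmm M (ppow M n)"

definition frobenius_list :: "(pvec \<times> pvec \<times> pvec) list"
  where "frobenius_list = map (\<lambda>(a, i). pmm (ppow psigma a) (ppow prho i)) (List.product [0..<7] [0..<3])"

text \<open>The powers of sigma applied to e1, and their negatives; \<open>short_vectors\<close>
  shows that these 14 exhaust the vectors of norm 3.\<close>

definition short_list :: "pvec list"
  where "short_list = (let l = map (\<lambda>a. fst (ppow psigma a)) [0..<7] in l @ map pneg l)"

text \<open>A search through the triples in O^3 with norm sum 6 that obey the congruences of M: a
  common residue modulo \<open>cnj lam\<close>, a sum divisible by lam (parity of the first
  components), and a condition modulo theta. There lam is 3, so \<open>s_vec\<close> is (3, -9, 27),
  proportional to the weights (1, 4, 2). Testing the partial sum early keeps the search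
  small.\<close>

lemma small_products:
  "list_all (\<lambda>(x, n, p, r). list_all (\<lambda>(y, n', p', r'). if n + n' \<le> 6 \<and> p = p' then
      list_all (\<lambda>(z, n'', p'', r''). if p = p'' \<and> n + n' + n'' = 6 \<and> (r + 4 * r' + 2 * r'') mod 7 = 0 \<and> even (fst x + fst y + fst z) then
        (case pmv pbasis_adj (x, y, z) of ((a, b), (c, d), (e, f)) \<Rightarrow>
            ((a div 56, b div 56), (c div 56, d div 56), (e div 56, f div 56))) \<in> set short_list
      else True) small_elements else True) small_elements) small_elements"
  by code_simp

text \<open>Once the first column is e1, the inner products with it and with each other leave just
  the three powers of rho.\<close>

lemma short_pairs:
  "list_all (\<lambda>y. if pgram (fst pone) y = (- 1, - 1) then list_all (\<lambda>z.
      if pgram (fst pone) z = (- 1, - 1) \<and> pgram y z = (- 1, - 1)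
      then (fst pone, y, z) \<in> set (map (ppow prho) [0..<3]) else True)
      short_list else True) short_list"
  by code_simp

lemma small_products_D:
  assumes "(x, n, p, r) \<in> set small_elements" "(y, n', p, r') \<in> set small_elements" "(z, n'', p, r'') \<in> set small_elements"
    and "n + n' + n'' = 6" "0 \<le> n''" "(r + 4 * r' + 2 * r'') mod 7 = 0" "even (fst x + fst y + fst z)"
  shows "(case pmv pbasis_adj (x, y, z) of ((a, b), (c, d), (e, f)) \<Rightarrow>
            ((a div 56, b div 56), (c div 56, d div 56), (e div 56, f div 56))) \<in> set short_list"
proof -
  have c: "n + n' \<le> 6 \<and> p = p" using assms(4,5) by simp
  have d: "p = p \<and> n + n' + n'' = 6 \<and> (r + 4 * r' + 2 * r'') mod 7 = 0 \<and> even (fst x + fst y + fst z)"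
    using assms(4,6,7) by simp
  note 1 = bspec[OF small_products[unfolded list_all_iff] assms(1), unfolded prod.case]
  note 2 = bspec[OF 1 assms(2), unfolded prod.case if_P[OF c]]
  show ?thesis using bspec[OF 2 assms(3), unfolded prod.case if_P[OF d]] .
qed

lemma pnorm_nonneg: "0 \<le> pnorm p"
proof -
  have "4 * pnorm p = (2 * fst p - snd p) ^ 2 + 7 * (snd p) ^ 2"
    by (simp add: pnorm_def power2_eq_square algebra_simps)
  then show ?thesis using zero_le_power2[of "2 * fst p - snd p"] zero_le_power2[of "snd p"] by linarith
qed

text \<open>Each ambient coordinate has norm at most 6 and so occurs in
  \<open>small_elements\<close>. The congruences follow from the expression of the coordinates
  through the basis, and \<open>pbasis_adj\<close> leads back from the coordinates to
  \<open>v\<close>.\<close>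

lemma short_vectors:
  assumes "pgram v v = (3, 0)"
  shows "v \<in> set short_list"
proof -
  obtain v1 v2 v3 where v123: "v = (v1, v2, v3)" by (rule prod_cases3)
  obtain a b where v1: "v1 = (a, b)" by (rule prod.exhaust)
  obtain c d where v2: "v2 = (c, d)" by (rule prod.exhaust)
  obtain e f where v3: "v3 = (e, f)" by (rule prod.exhaust)
  note v = v123[unfolded v1 v2 v3]
  obtain x y z where w: "pmv pbasis v = (x, y, z)" by (rule prod_cases3)
  have n: "pnorm x + pnorm y + pnorm z = 6" using pnorm_pbasis[of v] assms w by simp
  have le: "pnorm x \<le> 6" "pnorm y \<le> 6" "pnorm z \<le> 6"
    using n pnorm_nonneg[of x] pnorm_nonneg[of y] pnorm_nonneg[of z] by linarith+
  have ev: "even (fst x + fst y + fst z)" and par: "even (fst y + snd y) \<longleftrightarrow> even (fst x + snd x)"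
      "even (fst z + snd z) \<longleftrightarrow> even (fst x + snd x)"
    and m7: "7 dvd (fst x + 3 * snd x) + 4 * (fst y + 3 * snd y) + 2 * (fst z + 3 * snd z)"
    using w unfolding v by (auto simp: pmv_def pbasis_def padd_def pmul_def)
  have "((fst x + 3 * snd x) mod 7 + 4 * ((fst y + 3 * snd y) mod 7) + 2 * ((fst z + 3 * snd z) mod 7)) mod 7
      = ((fst x + 3 * snd x) + 4 * (fst y + 3 * snd y) + 2 * (fst z + 3 * snd z)) mod 7"
    by (intro mod_add_cong mod_mult_cong refl mod_mod_trivial)
  then have "((fst x + 3 * snd x) mod 7 + 4 * ((fst y + 3 * snd y) mod 7) + 2 * ((fst z + 3 * snd z) mod 7)) mod 7 = 0"
    using m7 by (simp only: dvd_eq_mod_eq_0)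
  then have "(case pmv pbasis_adj (x, y, z) of ((a, b), (c, d), (e, f)) \<Rightarrow>
            ((a div 56, b div 56), (c div 56, d div 56), (e div 56, f div 56))) \<in> set short_list"
    using small_products_D[OF pnorm_bound[OF le(1)] pnorm_bound[OF le(2), unfolded par(1)]
      pnorm_bound[OF le(3), unfolded par(2)] n pnorm_nonneg _ ev] by (simp only:)
  moreover have "pmv pbasis_adj (x, y, z) = ((56 * a, 56 * b), (56 * c, 56 * d), (56 * e, 56 * f))"
    using pbasis_adj w unfolding v by metis
  ultimately show ?thesis unfolding v by simp
qed

section \<open>The group of order 21 generated by sigma and rho\<close>

lemma pmat_of_pone: "pmat_of pone = mat 1"
  by (simp add: pmat_of_def pone_def pvec_of_def mat3_eq_iff forall_3 transpose_def mat_3 ol_consts)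

lemma ppow_add: "pmat_of (ppow M (m + n)) = pmat_of (ppow M m) ** pmat_of (ppow M n)"
  by (induction m) (simp_all add: pmat_of_pone pmm matrix_mul_assoc)

lemma ppow_mod:
  assumes "ppow M k = pone"
  shows "pmat_of (ppow M n) = pmat_of (ppow M (n mod k))"
proof -
  have "pmat_of (ppow M (q * k)) = mat 1" for q
    by (induction q) (simp_all add: ppow_add assms pmat_of_pone)
  then have "pmat_of (ppow M (n div k * k + n mod k)) = pmat_of (ppow M (n mod k))"
    by (simp only: ppow_add matrix_mul_lid)
  then show ?thesis by simp
qed

lemma psigma_7: "ppow psigma 7 = pone" and prho_3: "ppow prho 3 = pone"
  and prho_psigma: "pmm prho psigma = pmm (ppow psigma 2) prho"
  by code_simp+

definition frob :: "nat \<Rightarrow> nat \<Rightarrow> complex^3^3"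
  where "frob a i = pmat_of (ppow psigma a) ** pmat_of (ppow prho i)"

lemma frob_pmat: "frob a i = pmat_of (pmm (ppow psigma a) (ppow prho i))"
  by (simp add: frob_def pmm)

lemma frob_mod: "frob a i = frob (a mod 7) (i mod 3)"
  unfolding frob_def using ppow_mod[OF psigma_7, of a] ppow_mod[OF prho_3, of i] by simp

text \<open>Moving one rho past a power of sigma doubles the exponent; both inductions rest on the
  single relation \<open>prho_psigma\<close>.\<close>

lemma prho_ppow_psigma:
  "pmat_of (ppow prho i) ** pmat_of (ppow psigma b) = pmat_of (ppow psigma (2 ^ i * b)) ** pmat_of (ppow prho i)"
proof -
  have one: "ppow M 1 = pmm M pone" for M by simp
  have 1: "pmat_of prho ** pmat_of (ppow psigma b) = pmat_of (ppow psigma (2 * b)) ** pmat_of prho" for b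
  proof (induction b)
    case 0
    then show ?case by (simp add: pmat_of_pone)
  next
    case (Suc b)
    have "pmat_of prho ** pmat_of psigma = pmat_of (ppow psigma 2) ** pmat_of prho"
      using prho_psigma by (simp only: pmm[symmetric])
    then have "pmat_of prho ** pmat_of (ppow psigma (Suc b))
        = pmat_of (ppow psigma 2) ** (pmat_of prho ** pmat_of (ppow psigma b))"
      by (simp add: pmm matrix_mul_assoc)
    also have "\<dots> = pmat_of (ppow psigma (2 + 2 * b)) ** pmat_of prho"
      unfolding Suc ppow_add by (simp only: matrix_mul_assoc)
    finally show ?case by simp
  qed
  show ?thesis
  proof (induction i)
    case 0
    then show ?case by (simp add: pmat_of_pone)
  next
    case (Suc i)
    have "pmat_of (ppow prho (Suc i)) ** pmat_of (ppow psigma b)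
        = pmat_of prho ** (pmat_of (ppow prho i) ** pmat_of (ppow psigma b))"
      by (simp add: pmm matrix_mul_assoc)
    also have "\<dots> = (pmat_of prho ** pmat_of (ppow psigma (2 ^ i * b))) ** pmat_of (ppow prho i)"
      unfolding Suc by (simp only: matrix_mul_assoc)
    also have "\<dots> = pmat_of (ppow psigma (2 * (2 ^ i * b))) ** pmat_of (ppow prho (Suc i))"
      unfolding 1 by (simp add: pmm matrix_mul_assoc)
    finally show ?case by (simp add: mult.assoc)
  qed
qed

lemma frob_mult: "frob a i ** frob b j = frob ((a + 2 ^ i * b) mod 7) ((i + j) mod 3)"
proof -
  have "frob a i ** frob b j = pmat_of (ppow psigma a) ** (pmat_of (ppow prho i) ** pmat_of (ppow psigma b)) ** pmat_of (ppow prho j)"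
    by (simp add: frob_def matrix_mul_assoc)
  also have "\<dots> = frob (a + 2 ^ i * b) (i + j)"
    unfolding prho_ppow_psigma by (simp add: frob_def ppow_add matrix_mul_assoc)
  finally show ?thesis using frob_mod by metis
qed

lemma frob_0_0: "frob 0 0 = mat 1"
  by (simp add: frob_def pmat_of_pone)

lemma psigma_unitary: "pmat_of psigma \<in> unitary_over O_lam"
  and prho_unitary: "pmat_of prho \<in> unitary_over O_lam"
  by (simp_all add: psigma_def prho_def pmat_unitary_iff pgram_def padd_def pmul_def pcnj_def)

lemma ppow_unitary: "pmat_of M \<in> unitary_over O_lam \<Longrightarrow> pmat_of (ppow M n) \<in> unitary_over O_lam"
  by (induction n) (simp_all add: pmat_of_pone unitary_one[OF lam_ring_O_lam] pmm unitary_mult[OF lam_ring_O_lam])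

lemma frob_unitary: "frob a i \<in> unitary_over O_lam"
  unfolding frob_def using unitary_mult[OF lam_ring_O_lam] ppow_unitary psigma_unitary prho_unitary by blast

lemma short_listD: "v \<in> set short_list \<Longrightarrow> \<exists>a s. a < 7 \<and> s * s = 1 \<and> s \<in> O_lam \<and> cnj s = s \<and>
    pvec_of v = s *s (pmat_of (ppow psigma a) *v axis 1 1)"
proof -
  have col: "pmat_of M *v axis 1 1 = pvec_of (fst M)" for M
    by (cases M) (metis column_axis pmat_of_column(1) fst_conv)
  have neg: "pvec_of (pneg v) = (- 1) *s pvec_of v" for v
    by (cases v) (auto simp: pneg_def pvec_of_def vec_eq_iff forall_3 ol_def)
  assume "v \<in> set short_list"
  then obtain a where a: "a < 7" "v = fst (ppow psigma a) \<or> v = pneg (fst (ppow psigma a))"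
    by (auto simp: short_list_def Let_def)
  from a(2) show ?thesis
  proof
    assume "v = fst (ppow psigma a)"
    then show ?thesis using a(1) by (intro exI[of _ a] exI[of _ 1]) (simp add: col O_lam_consts)
  next
    assume "v = pneg (fst (ppow psigma a))"
    then show ?thesis using a(1) by (intro exI[of _ a] exI[of _ "- 1"]) (simp add: col neg O_lam_intros)
  qed
qed

text \<open>The first column has norm 3, so it is a sign \<open>s\<close> times sigma^a e1.
  Multiplying by \<open>s\<close> and by sigma^(7 - a) moves it to e1, after which
  \<open>short_pairs\<close> identifies the matrix as a power of rho.\<close>

lemma unitary_O_lam_frob:
  assumes B: "B \<in> unitary_over O_lam"
  shows "\<exists>s a i. a < 7 \<and> i < 3 \<and> s * s = 1 \<and> B = mat s ** frob a i"
proof -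
  have BO: "B$i$j \<in> O_lam" for i j using B by (simp add: unitary_over_def)
  obtain x y z where xyz: "B = pmat_of (x, y, z)" using pmat_obtain[of B] BO by blast
  then have "pgram x x = (3, 0)" using B pmat_unitary_iff by blast
  then obtain a s where a: "a < 7" "s * s = 1" "s \<in> O_lam" "cnj s = s"
    "pvec_of x = s *s (pmat_of (ppow psigma a) *v axis 1 1)" using short_listD short_vectors by blast
  define S where "S n = pmat_of (ppow psigma n)" for n
  have S7: "S (7 - a) ** S a = mat 1" "S a ** S (7 - a) = mat 1"
    using a(1) by (simp_all add: S_def psigma_7 pmat_of_pone flip: ppow_add)
  define C where "C = mat s ** (S (7 - a) ** B)"
  have C: "C \<in> unitary_over O_lam"
    unfolding C_def S_def using a B
    by (intro unitary_scalar[OF lam_ring_O_lam] unitary_mult[OF lam_ring_O_lam] ppow_unitary psigma_unitary) auto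
  have "C$i$j \<in> O_lam" for i j using C by (simp add: unitary_over_def)
  then obtain x' y' z' where xyz': "C = pmat_of (x', y', z')" using pmat_obtain[of C] by blast
  have ms: "mat s *v v = s *s v" for v :: "complex^3"
    by (simp add: vec_eq_iff forall_3 matrix_vector_3 mat_3)
  have "pvec_of x' = C *v axis 1 1" unfolding xyz' by (metis column_axis pmat_of_column(1))
  also have "\<dots> = s *s (S (7 - a) *v (B *v axis 1 1))"
    unfolding C_def by (simp add: ms flip: matrix_vector_mul_assoc)
  also have "B *v axis 1 1 = s *s (S a *v axis 1 1)"
    unfolding S_def using a(5) xyz by (metis column_axis pmat_of_column(1))
  also have "s *s (S (7 - a) *v (s *s (S a *v axis 1 1))) = axis 1 1"
    using a(2) by (simp add: vector_scalar_commute[symmetric] vector_smult_assoc matrix_vector_mul_assoc S7)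
  also have "axis 1 1 = pvec_of (fst pone)"
    by (simp add: pone_def pvec_of_def vec_eq_iff forall_3 axis_def ol_consts)
  finally have x': "x' = fst pone" by (simp add: pvec_of_inject)
  have g: "pgram y' y' = (3, 0)" "pgram z' z' = (3, 0)" "pgram x' y' = (- 1, - 1)" "pgram x' z' = (- 1, - 1)"
    "pgram y' z' = (- 1, - 1)" using C pmat_unitary_iff unfolding xyz' by blast+
  then have "y' \<in> set short_list" "z' \<in> set short_list" using short_vectors by blast+
  then have "(fst pone, y', z') \<in> set (map (ppow prho) [0..<3])"
    using short_pairs g unfolding x' list_all_iff by (auto dest!: bspec)
  then obtain i where i: "i < 3" "(x', y', z') = ppow prho i" unfolding x' by auto
  have CR: "C = pmat_of (ppow prho i)" unfolding xyz' i(2) ..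
  have "mat s ** (S a ** C) = mat (s * s) ** ((S a ** S (7 - a)) ** B)"
    unfolding C_def by (simp only: mat_out[of "S a"] matrix_mul_assoc[of "mat s" "mat s"] matrix_mul_assoc[of "S a" "S (7 - a)"] mat_mult_mat)
  then have "B = mat s ** (S a ** C)" using a(2) by (simp add: S7)
  then have "B = mat s ** frob a i" unfolding CR frob_def S_def .
  then show ?thesis using a i by blast
qed

text \<open>Reduction modulo lam, which divides a + b lam exactly when a is even. These nine bits
  already separate the 21 matrices.\<close>

definition pparity :: "pvec \<times> pvec \<times> pvec \<Rightarrow> bool list"
  where "pparity = (\<lambda>((a1, a2, a3), (b1, b2, b3), (c1, c2, c3)).
    map (\<lambda>p. even (fst p)) [a1, a2, a3, b1, b2, b3, c1, c2, c3])"

lemma frobenius_parity_distinct: "distinct (map pparity frobenius_list)"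
  by code_simp

lemma frobenius_parity_inj:
  assumes "a < 7" "i < 3" "b < 7" "j < 3"
    and "pparity (pmm (ppow psigma a) (ppow prho i)) = pparity (pmm (ppow psigma b) (ppow prho j))"
  shows "a = b \<and> i = j"
proof -
  have "inj_on (pparity \<circ> (\<lambda>(a, i). pmm (ppow psigma a) (ppow prho i))) (set (List.product [0..<7] [0..<3]))"
    using frobenius_parity_distinct unfolding frobenius_list_def map_map distinct_map by simp
  then show ?thesis
    using inj_onD[of _ _ "(a, i)" "(b, j)"] assms by fastforce
qed

section \<open>The generator \<open>\<beta>\<^sub>M\<close>\<close>

text \<open>\<open>beta_M\<close> in the basis e1, e2, e3; its cube is the scalar lam / cnj
  lam.\<close>

definition beta :: "complex^3^3"
  where "beta = vector [vector [0, 0, lam / cnj lam], vector [1, 0, 0], vector [0, 1, 0]]"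

lemma lam_ratio: "lam / cnj lam = (- lam - 2) / 2" "cnj lam / lam = (lam - 1) / 2"
proof -
  have "(- lam - 2) * cnj lam = 2 * lam" "(lam - 1) * lam = 2 * cnj lam"
    by (simp_all add: lam_simps algebra_simps)
  then have "(- lam - 2) / 2 * cnj lam = lam" "(lam - 1) / 2 * lam = cnj lam"
    by (simp_all only: times_divide_eq_left) simp_all
  then show "lam / cnj lam = (- lam - 2) / 2" "cnj lam / lam = (lam - 1) / 2"
    using lam_nonzero by (metis nonzero_mult_div_cancel_right)+
qed

lemma lam_ratio_O_half: "lam / cnj lam \<in> O_half" "cnj lam / lam \<in> O_half"
proof -
  have half: "x / 2 \<in> O_half" if "x \<in> O_lam" for x
    unfolding O_half_def using that by (intro CollectI exI[of _ x] exI[of _ "1::nat"]) simp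
  show "lam / cnj lam \<in> O_half" "cnj lam / lam \<in> O_half"
    unfolding lam_ratio by (rule half, intro O_lam_intros)+
qed

lemma beta_vector: "beta *v x = vector [lam / cnj lam * x$3, x$1, x$2]"
  by (simp add: beta_def vec_eq_iff forall_3 matrix_vector_3)

text \<open>The cyclic shift carries a basis vector across the diagonal of the Gram matrix and so
  exchanges \<open>lam\<close> and \<open>cnj lam\<close> in its products with the others; the
  factor \<open>m\<close> on that vector undoes the exchange.\<close>

lemma gram_beta: "gram (beta *v x) (beta *v y) = gram x y"
proof -
  define m where "m = lam / cnj lam"
  have m: "cnj lam * m = lam" "lam * cnj m = cnj lam" "m * cnj m = 1"
    using lam_nonzero by (simp_all add: m_def)
  have "gram (beta *v x) (beta *v y) = 3 * ((m * cnj m) * (x$3 * cnj (y$3)) + x$1 * cnj (y$1) + x$2 * cnj (y$2))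
    + ((cnj lam * m) * (x$3 * cnj (y$1)) + (cnj lam * m) * (x$3 * cnj (y$2)) + cnj lam * (x$1 * cnj (y$2)))
    + ((lam * cnj m) * (x$1 * cnj (y$3)) + (lam * cnj m) * (x$2 * cnj (y$3)) + lam * (x$2 * cnj (y$1)))"
    unfolding beta_vector gram_def vector_3 m_def[symmetric] complex_cnj_mult
    by (simp only: distrib_left mult.assoc mult.left_commute mult.commute add_ac)
  also have "\<dots> = gram x y"
    unfolding m gram_def by (simp add: algebra_simps)
  finally show ?thesis .
qed

lemma beta_unitary: "beta \<in> unitary_over O_half"
proof (rule unitaryI_gram)
  fix i j
  have "0 \<in> O_half" "1 \<in> O_half" using lam_ringD(1)[OF lam_ring_O_half] O_lam_consts by blast+
  then show "beta$i$j \<in> O_half"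
    using exhaust_3[of i] exhaust_3[of j] lam_ratio_O_half by (auto simp: beta_def)
  show "gram (beta *v axis i 1) (beta *v axis j 1) = gram (axis i 1) (axis j 1)"
    by (rule gram_beta)
qed

lemma beta_M_basis: "beta_M = basis_M ** beta ** basis_inv"
proof -
  let ?B = "basis_M ** beta ** basis_inv"
  have e: "basis_M *v axis 1 1 = e1" "basis_M *v axis 2 1 = e2" "basis_M *v axis 3 1 = e3"
    by (simp_all add: basis_M_def vec_eq_iff forall_3 matrix_vector_axis3 transpose_def)
  have act: "?B *v (basis_M *v c) = basis_M *v (beta *v c)" for c
    by (simp add: matrix_vector_mul_assoc basis_inv flip: matrix_mul_assoc)
  have b: "beta *v axis 1 1 = axis 2 1" "beta *v axis 2 1 = axis 3 1" "beta *v axis 3 1 = (lam / cnj lam) *s axis 1 1"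
    by (simp_all add: beta_def vec_eq_iff forall_3 matrix_vector_3 axis_def)
  have "?B *v e1 = e2 \<and> ?B *v e2 = e3 \<and> ?B *v e3 = (lam / cnj lam) *s e1"
    unfolding e[symmetric] act b by (simp add: vector_scalar_commute)
  then show ?thesis
    unfolding beta_M_def by (rule the1_equality[OF beta_M_exists_unique])
qed

section \<open>Embedding into the 2-adic numbers\<close>

text \<open>Words grow at the front, which is how the descent through index-2 sublattices builds
  them.\<close>

inductive_set generated_monoid :: "adic2^3^3 \<Rightarrow> adic2^3^3 \<Rightarrow> (adic2^3^3) set" for A B where
  one: "mat 1 \<in> generated_monoid A B"
| left: "X \<in> generated_monoid A B \<Longrightarrow> A ** X \<in> generated_monoid A B"
| right: "X \<in> generated_monoid A B \<Longrightarrow> B ** X \<in> generated_monoid A B"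

text \<open>With determinants of equal valuation the scalar relating the two lattices has valuation
  0, and such a scalar preserves \<open>Z3\<close>.\<close>

lemma vertex_of_eq_val:
  assumes A: "invertible A" and B: "invertible B" and eq: "vertex_of A = vertex_of B" and v: "val (det A) = val (det B)"
  shows "(*v) A ` Z3 = (*v) B ` Z3"
proof -
  let ?N = "matrix_inv B ** A"
  obtain c where c: "c \<noteq> 0" "(*v) (mat c ** ?N) ` Z3 = Z3" using eq vertex_of_eq_iff[OF A B] by blast
  have inv: "invertible (mat c ** ?N)" using A B c by (simp add: invertible_mult invertible_mat invertible_matrix_inv)
  have nz: "det A \<noteq> 0" "det B \<noteq> 0" using A B by (simp_all add: invertible_det_nz)
  then have "val c = 0"
    using image_Z3_eqD(3)[OF inv c(2)] v c B by (simp add: det_mul det_mat det_matrix_inv val_mult val_power val_inverse)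
  then have m: "(*v) (mat (1 / c)) ` Z3 = Z3"
    using c inverse_adic2_ints[OF c(1)]
    by (intro image_Z3_eq) (auto simp: det_mat mat_3 val_power val_inverse divide_inverse)
  have "(*v) ?N ` Z3 = (*v) (mat (1 / c)) ` ((*v) (mat c ** ?N) ` Z3)"
    unfolding matrix_image_image matrix_mul_assoc[of "mat (1 / c)"] mat_mult_mat using c(1) by simp
  also have "\<dots> = Z3" unfolding c(2) m ..
  finally have "(*v) B ` ((*v) ?N ` Z3) = (*v) B ` Z3" by simp
  then show ?thesis by (simp only: matrix_image_image matrix_inv_cancel(2)[OF B])
qed

lemma image_hyperplane:
  assumes F: "(*v) F ` Z3 = Z3" and par: "\<And>z. z \<in> Z3 \<Longrightarrow> F *v z \<in> hyperplane a' b' c' \<longleftrightarrow> z \<in> hyperplane a b c"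
  shows "(*v) F ` hyperplane a b c = hyperplane a' b' c'"
proof
  show "(*v) F ` hyperplane a b c \<subseteq> hyperplane a' b' c'"
    using par hyperplane_subset by blast
  show "hyperplane a' b' c' \<subseteq> (*v) F ` hyperplane a b c"
  proof
    fix w assume w: "w \<in> hyperplane a' b' c'"
    then have "w \<in> (*v) F ` Z3" unfolding F using hyperplane_subset by blast
    then obtain z where z: "z \<in> Z3" "w = F *v z" by (rule imageE)
    then have "z \<in> hyperplane a b c" using par w by blast
    then show "w \<in> (*v) F ` hyperplane a b c" unfolding z(2) by (rule imageI)
  qed
qed

lemma hyperplane_inject: "hyperplane a b c = hyperplane a' b' c' \<longleftrightarrow> a = a' \<and> b = b' \<and> c = c'"
proof
  assume eq: "hyperplane a b c = hyperplane a' b' c'"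
  have ax: "axis i 1 \<in> Z3" for i :: 3 by (simp add: Z3_def axis_def)
  have "axis 1 1 \<in> hyperplane p q r \<longleftrightarrow> \<not> p" "axis 2 1 \<in> hyperplane p q r \<longleftrightarrow> \<not> q"
    "axis 3 1 \<in> hyperplane p q r \<longleftrightarrow> \<not> r" for p q r
    by (simp_all add: hyperplane_def ax) (simp_all add: axis_def)
  then show "a = a' \<and> b = b' \<and> c = c'" using eq by metis
qed simp

locale embedding =
  fixes \<iota> :: "complex \<Rightarrow> adic2"
  assumes emb: "adic2_embedding \<iota>"
begin

lemma iota_add: "x \<in> Q_lam \<Longrightarrow> y \<in> Q_lam \<Longrightarrow> \<iota> (x + y) = \<iota> x + \<iota> y"
  and iota_mult: "x \<in> Q_lam \<Longrightarrow> y \<in> Q_lam \<Longrightarrow> \<iota> (x * y) = \<iota> x * \<iota> y"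
  and iota_1: "\<iota> 1 = 1"
  using emb by (simp_all add: adic2_embedding_def)

lemma Q_lam_O: "x \<in> O_lam \<Longrightarrow> x \<in> Q_lam"
  using lam_ringD(1)[OF lam_ring_Q_lam] by blast

lemma iota_0: "\<iota> 0 = 0"
  using iota_add[of 0 0] Q_lam_O[OF O_lam_consts(1)] by simp

lemma iota_minus: "x \<in> Q_lam \<Longrightarrow> \<iota> (- x) = - \<iota> x"
  using iota_add[of x "- x"] lam_ringD(6)[OF lam_ring_Q_lam] by (simp add: iota_0 eq_neg_iff_add_eq_0 add.commute)

lemma iota_nat: "\<iota> (of_nat n) = of_nat n"
proof (induction n)
  case (Suc n)
  have "of_nat n \<in> Q_lam" using Q_lam_O O_lam_int[of "int n"] by simp
  then show ?case using Suc iota_add[of 1 "of_nat n"] Q_lam_O[OF O_lam_consts(2)] by (simp add: iota_1)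
qed (simp add: iota_0)

lemma iota_int: "\<iota> (of_int n) = of_int n"
proof (cases n)
  case (neg m)
  have "of_nat (Suc m) \<in> Q_lam" using Q_lam_O[OF O_lam_int[of "int (Suc m)"]] by (simp only: of_int_of_nat_eq)
  then show ?thesis using iota_minus[of "of_nat (Suc m)"] unfolding neg iota_nat by (simp only: of_int_minus of_int_of_nat_eq)
qed (simp add: iota_nat)

lemma iota_lam: "\<exists>u. u dvd 1 \<and> \<iota> lam = 2 * of_adic2_int u"
  and iota_cnj_lam: "\<exists>u. u dvd 1 \<and> \<iota> (cnj lam) = of_adic2_int u"
  using emb by (auto simp: adic2_embedding_def)

lemma adic2_ints_of_int: "of_int n \<in> adic2_ints" and even2_of_int: "even2 (of_int n) \<longleftrightarrow> even n"
proof -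
  have o: "of_int n = of_adic2_int (of_int n)" for n
  proof (cases n)
    case (neg m)
    then show ?thesis using of_adic2_int_of_nat[of "Suc m"] by (simp only: of_int_minus of_int_of_nat_eq of_adic2_int_minus)
  qed (simp add: of_adic2_int_of_nat)
  then show "of_int n \<in> adic2_ints" by simp
  have e: "even2 (of_int n)" if "even n" for n
  proof -
    obtain m where "n = 2 * m" using \<open>even n\<close> by blast
    moreover have "(of_int m :: adic2) \<in> adic2_ints" by (subst o) simp
    ultimately show ?thesis unfolding even2_iff_half by (intro bexI[of _ "of_int m"]) simp_all
  qed
  show "even2 (of_int n) \<longleftrightarrow> even n"
  proof
    assume n: "even2 (of_int n)"
    show "even n"
    proof (rule ccontr)
      assume "odd n"
      then have "even2 (of_int (n - 1))" by (intro e) simp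
      then have "even2 (1 :: adic2)"
        using n even2_diff[of "of_int n" "of_int (n - 1)"] o by (metis adic2_ints_of diff_diff_eq2 add_diff_cancel_left' of_int_1 of_int_diff)
      then show False by simp
    qed
  qed (rule e)
qed

lemma iota_lam_ints: "\<iota> lam \<in> adic2_ints" "even2 (\<iota> lam)"
proof -
  obtain u where u: "\<iota> lam = 2 * of_adic2_int u" using iota_lam by blast
  show "\<iota> lam \<in> adic2_ints" unfolding u by (intro adic2_ints_mult) simp_all
  show "even2 (\<iota> lam)" unfolding u even2_iff_half by blast
qed

lemma iota_ol: "\<iota> (ol p) = of_int (fst p) + of_int (snd p) * \<iota> lam"
  unfolding ol_def using Q_lam_O[OF O_lam_int] Q_lam_O[OF O_lam_consts(4)] lam_ringD(4)[OF lam_ring_Q_lam]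
  by (simp add: iota_add iota_mult iota_int)

lemma iota_ol_ints: "\<iota> (ol p) \<in> adic2_ints" and even2_iota_ol: "even2 (\<iota> (ol p)) \<longleftrightarrow> even (fst p)"
proof -
  have i: "of_int (snd p) * \<iota> lam \<in> adic2_ints" "even2 (of_int (snd p) * \<iota> lam)"
    using iota_lam_ints adic2_ints_of_int by (auto simp: even2_mult)
  show "\<iota> (ol p) \<in> adic2_ints" unfolding iota_ol using i adic2_ints_of_int by blast
  show "even2 (\<iota> (ol p)) \<longleftrightarrow> even (fst p)"
    unfolding iota_ol using i adic2_ints_of_int by (simp add: even2_add even2_of_int)
qed

lemma iota_O_lam_ints: "x \<in> O_lam \<Longrightarrow> \<iota> x \<in> adic2_ints"
  unfolding O_lam_ol using iota_ol_ints by blast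

text \<open>lam and \<open>cnj lam\<close> are the two primes over 2, and integrality at both
  removes the denominator. Concretely, for u = a + b lam over 2^(n + 1), integrality at the two
  places makes a and a - b even, so a factor 2 cancels.\<close>

lemma O_half_integral:
  assumes "x \<in> O_half" "\<iota> x \<in> adic2_ints" "\<iota> (cnj x) \<in> adic2_ints"
  shows "x \<in> O_lam"
proof -
  have "u / 2 ^ n \<in> O_lam" if "u \<in> O_lam" "\<iota> (u / 2 ^ n) \<in> adic2_ints" "\<iota> (cnj (u / 2 ^ n)) \<in> adic2_ints" for u n
    using that
  proof (induction n arbitrary: u)
    case (Suc n)
    let ?x = "u / 2 ^ Suc n"
    have xQ: "?x \<in> Q_lam" "cnj ?x \<in> Q_lam"
      using lam_ringD(2,5)[OF lam_ring_O_half] Suc.prems(1) unfolding O_half_def by blast+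
    have ev: "even2 (\<iota> (2 ^ Suc n * y))" if y: "y \<in> Q_lam" "\<iota> y \<in> adic2_ints" for y
    proof -
      have "\<iota> (of_int (2 ^ Suc n) * y) = of_int (2 ^ Suc n) * \<iota> y"
        using iota_mult[OF Q_lam_O[OF O_lam_int] y(1)] by (simp only: iota_int)
      then have "\<iota> (2 ^ Suc n * y) = of_int (2 ^ Suc n) * \<iota> y" by simp
      then show ?thesis using y(2) adic2_ints_of_int even2_of_int[of "2 ^ Suc n"] by (simp only: even2_mult) simp
    qed
    have "2 ^ Suc n * ?x = u" "2 ^ Suc n * cnj ?x = cnj u" by simp_all
    then have e: "even2 (\<iota> u)" "even2 (\<iota> (cnj u))"
      using ev[OF xQ(1) Suc.prems(2)] ev[OF xQ(2) Suc.prems(3)] by (simp_all only:)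
    obtain a b where u: "u = ol (a, b)" using Suc.prems(1) unfolding O_lam_ol by auto
    have ab: "even a" "even (a - b)"
      using e even2_iota_ol[of "(a, b)"] even2_iota_ol[of "pcnj (a, b)"] unfolding u ol_pcnj[symmetric] by (simp_all add: pcnj_def)
    then have "even b" by simp
    obtain c d where cd: "a = 2 * c" "b = 2 * d" using evenE[OF ab(1)] evenE[OF \<open>even b\<close>] by metis
    have half: "?x = ol (c, d) / 2 ^ n" unfolding u cd by (simp add: ol_def field_simps)
    show ?case unfolding half
    proof (rule Suc.IH)
      show "ol (c, d) \<in> O_lam" unfolding O_lam_ol by blast
      show "\<iota> (ol (c, d) / 2 ^ n) \<in> adic2_ints" "\<iota> (cnj (ol (c, d) / 2 ^ n)) \<in> adic2_ints"
        using Suc.prems(2,3) unfolding half .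
    qed
  qed simp
  then show ?thesis using assms unfolding O_half_def by blast
qed

section \<open>Transfer of isometries to 2-adic matrices\<close>

text \<open>Multiplicativity is available only for entries in Q(lam), since \<open>\<iota>\<close>
  is arbitrary elsewhere.\<close>

definition I :: "complex^3^3 \<Rightarrow> adic2^3^3"
  where "I = map_matrix \<iota>"

lemma I_nth: "I A$i$j = \<iota> (A$i$j)"
  by (simp add: I_def)

lemma I_mult:
  assumes "\<And>i j. A$i$j \<in> Q_lam" "\<And>i j. B$i$j \<in> Q_lam"
  shows "I (A ** B) = I A ** I B"
  using assms lam_ringD(3,4)[OF lam_ring_Q_lam]
  by (simp add: mat3_eq_iff I_nth matrix_mult_3 iota_add iota_mult)

lemma I_mat: "I (mat c) = mat (\<iota> c)"
  by (simp add: mat3_eq_iff I_nth mat_3 iota_0)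

lemma unitary_Q_lam: "lam_ring R \<Longrightarrow> B \<in> unitary_over R \<Longrightarrow> B$i$j \<in> Q_lam"
  using lam_ringD(2) by (auto simp: unitary_over_def)

lemma I_unitary_mult:
  assumes "lam_ring R" "A \<in> unitary_over R" "B \<in> unitary_over R"
  shows "I (A ** B) = I A ** I B"
  using assms unitary_Q_lam by (intro I_mult) blast+

lemma I_unitary_inverse:
  assumes R: "lam_ring R" and B: "B \<in> unitary_over R"
  shows "\<exists>C\<in>unitary_over R. B ** C = mat 1 \<and> C ** B = mat 1 \<and> I B ** I C = mat 1 \<and> matrix_inv (I B) = I C \<and> invertible (I B)"
proof -
  obtain C where C: "C \<in> unitary_over R" "B ** C = mat 1" "C ** B = mat 1" using unitary_inv[OF R B] by blast
  have 1: "I B ** I C = mat 1" "I C ** I B = mat 1"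
    using I_unitary_mult[OF R B C(1)] I_unitary_mult[OF R C(1) B] C(2,3) by (simp_all add: I_mat iota_1)
  then have "invertible (I B)" unfolding invertible_def by blast
  then show ?thesis using C 1 matrix_inv_unique[OF 1(1)] by (intro bexI[of _ C]) simp_all
qed

lemma I_invertible: "lam_ring R \<Longrightarrow> B \<in> unitary_over R \<Longrightarrow> invertible (I B)"
  using I_unitary_inverse by blast

lemma unitary_O_lam_half: "unitary_over O_lam \<subseteq> unitary_over O_half"
  using lam_ringD(1)[OF lam_ring_O_half] by (auto simp: unitary_over_def)

lemma I_O_lam_ints:
  assumes "B \<in> unitary_over O_lam"
  shows "I B$i$j \<in> adic2_ints" "matrix_inv (I B)$i$j \<in> adic2_ints" "(*v) (I B) ` Z3 = Z3" "val (det (I B)) = 0"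
proof -
  have int: "I C$i$j \<in> adic2_ints" if "C \<in> unitary_over O_lam" for C i j
    using that iota_O_lam_ints by (simp add: I_nth unitary_over_def)
  obtain C where C: "C \<in> unitary_over O_lam" "matrix_inv (I B) = I C" "invertible (I B)"
    using I_unitary_inverse[OF lam_ring_O_lam assms] by blast
  show "I B$i$j \<in> adic2_ints" "matrix_inv (I B)$i$j \<in> adic2_ints" using int assms C by simp_all
  have "(*v) (I C) ` Z3 \<subseteq> Z3" using int[OF C(1)] by (rule integral_matrix_image)
  then have "(*v) (I B) ` ((*v) (matrix_inv (I B)) ` Z3) \<subseteq> (*v) (I B) ` Z3" unfolding C(2) by (rule image_mono)
  then have "Z3 \<subseteq> (*v) (I B) ` Z3" unfolding matrix_image_inv(2)[OF C(3)] .
  moreover have "(*v) (I B) ` Z3 \<subseteq> Z3" using int[OF assms] by (rule integral_matrix_image)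
  ultimately show eq: "(*v) (I B) ` Z3 = Z3" by simp
  show "val (det (I B)) = 0" using image_Z3_eqD(3)[OF C(3) eq] .
qed

text \<open>Base change from coordinates in e1, e2, e3 to standard ones; the image of
  \<open>Z3\<close> under \<open>h\<close> is the lattice spanned by M at the place lam.\<close>

definition h :: "adic2^3^3" where "h = I basis_M"

lemma basis_Q_lam: "basis_M$i$j \<in> Q_lam"
  using Q_lam_O[OF basis_M_O_lam] .

lemma h_inv: "h ** I basis_inv = mat 1" "matrix_inv h = I basis_inv"
  and invertible_h: "invertible h"
proof -
  show 1: "h ** I basis_inv = mat 1"
    unfolding h_def using I_mult[of basis_M basis_inv] basis_Q_lam basis_inv_Q_lam by (simp add: basis_inv I_mat iota_1)
  then show "matrix_inv h = I basis_inv" by (rule matrix_inv_unique)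
  show "invertible h" using 1 invertible_right_inverse by blast
qed

text \<open>The class of the linear map that acts as \<open>X\<close> on coordinates in the basis of
  M.\<close>

definition pr :: "adic2^3^3 \<Rightarrow> (adic2^3^3) set"
  where "pr X = to_PGL3 (h ** X ** matrix_inv h)"

lemma pr_closed: "invertible X \<Longrightarrow> pr X \<in> carrier PGL3"
  unfolding pr_def using invertible_h by (intro to_PGL3_carrier invertible_mult invertible_matrix_inv)

lemma pr_mult:
  assumes "invertible X" "invertible Y"
  shows "pr X \<otimes>\<^bsub>PGL3\<^esub> pr Y = pr (X ** Y)"
proof -
  have "h ** X ** matrix_inv h ** (h ** Y ** matrix_inv h) = h ** (X ** Y) ** matrix_inv h"
    by (simp add: matrix_inv_cancel[OF invertible_h] flip: matrix_mul_assoc)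
  then show ?thesis
    unfolding pr_def using assms invertible_h by (simp add: to_PGL3_mult invertible_mult invertible_matrix_inv)
qed

lemma pr_one: "pr (mat 1) = \<one>\<^bsub>PGL3\<^esub>"
  by (simp add: pr_def one_PGL3 matrix_inv_right invertible_h)

lemma pr_scale: "c \<noteq> 0 \<Longrightarrow> pr (mat c ** X) = pr X"
proof -
  assume c: "c \<noteq> 0"
  have "h ** (mat c ** X) ** matrix_inv h = mat c ** (h ** X ** matrix_inv h)"
    by (simp only: mat_out[of h] matrix_mul_assoc[of "mat c", symmetric])
  then show ?thesis unfolding pr_def using to_PGL3_scale[OF c] by simp
qed

lemma pr_vertex: "vertex_map (pr X) (vertex_of (h ** Y)) = vertex_of (h ** (X ** Y))"
proof -
  have "h ** X ** matrix_inv h ** (h ** Y) = h ** (X ** Y)"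
    by (simp add: matrix_inv_cancel[OF invertible_h] flip: matrix_mul_assoc)
  then show ?thesis unfolding pr_def vertex_map_vertex_of by simp
qed

lemma to_PGL3_basis:
  assumes R: "lam_ring R" and B: "B \<in> unitary_over R"
  shows "to_PGL3 (map_matrix \<iota> (basis_M ** B ** basis_inv)) = pr (I B)"
proof -
  have "I (basis_M ** B) = h ** I B"
    unfolding h_def using basis_Q_lam unitary_Q_lam[OF R B] by (rule I_mult)
  moreover have "I ((basis_M ** B) ** basis_inv) = I (basis_M ** B) ** I basis_inv"
    using lam_ring_matrix_mult[OF lam_ring_Q_lam basis_Q_lam unitary_Q_lam[OF R B]] basis_inv_Q_lam by (rule I_mult)
  ultimately have "I (basis_M ** B ** basis_inv) = h ** I B ** I basis_inv" by simp
  then show ?thesis unfolding pr_def h_inv(2) I_def[symmetric] by simp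
qed

lemma PGamma_pr: "PGamma_M \<iota> = (\<lambda>B. pr (I B)) ` unitary_over O_half"
  and PIsom_pr: "PIsom_M \<iota> = (\<lambda>B. pr (I B)) ` unitary_over O_lam"
proof -
  show "PGamma_M \<iota> = (\<lambda>B. pr (I B)) ` unitary_over O_half"
    unfolding PGamma_M_def isometries_basis[OF lam_ring_O_half M_half_basis] image_image
    by (rule image_cong[OF refl]) (rule to_PGL3_basis[OF lam_ring_O_half])
  show "PIsom_M \<iota> = (\<lambda>B. pr (I B)) ` unitary_over O_lam"
    unfolding PIsom_M_def isometries_basis[OF lam_ring_O_lam M_lattice_basis] image_image
    by (rule image_cong[OF refl]) (rule to_PGL3_basis[OF lam_ring_O_lam])
qed

lemma pr_unitary_subgroup:
  assumes R: "lam_ring R"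
  shows "subgroup ((\<lambda>B. pr (I B)) ` unitary_over R) PGL3"
proof (rule PGL3.subgroupI)
  show "(\<lambda>B. pr (I B)) ` unitary_over R \<subseteq> carrier PGL3" using pr_closed I_invertible[OF R] by blast
  show "(\<lambda>B. pr (I B)) ` unitary_over R \<noteq> {}" using unitary_one[OF R] by blast
  fix g k assume "g \<in> (\<lambda>B. pr (I B)) ` unitary_over R"
  then obtain B where B: "B \<in> unitary_over R" "g = pr (I B)" by blast
  obtain C where C: "C \<in> unitary_over R" "C ** B = mat 1" using I_unitary_inverse[OF R B(1)] by blast
  have "pr (I C) \<otimes>\<^bsub>PGL3\<^esub> pr (I B) = \<one>\<^bsub>PGL3\<^esub>"
    unfolding pr_mult[OF I_invertible[OF R C(1)] I_invertible[OF R B(1)]] I_unitary_mult[OF R C(1) B(1), symmetric] C(2)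
    by (simp add: I_mat iota_1 pr_one)
  then have "inv\<^bsub>PGL3\<^esub> g = pr (I C)"
    unfolding B(2) using pr_closed I_invertible[OF R] B(1) C(1) by (intro PGL3.inv_equality) auto
  then show "inv\<^bsub>PGL3\<^esub> g \<in> (\<lambda>B. pr (I B)) ` unitary_over R" using C(1) by blast
  assume "k \<in> (\<lambda>B. pr (I B)) ` unitary_over R"
  then obtain D where D: "D \<in> unitary_over R" "k = pr (I D)" by blast
  have "g \<otimes>\<^bsub>PGL3\<^esub> k = pr (I (B ** D))"
    unfolding B(2) D(2) I_unitary_mult[OF R B(1) D(1)] using I_invertible[OF R] B(1) D(1) by (intro pr_mult) auto
  then show "g \<otimes>\<^bsub>PGL3\<^esub> k \<in> (\<lambda>B. pr (I B)) ` unitary_over R" using unitary_mult[OF R B(1) D(1)] by blast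
qed

lemma subgroup_PGamma: "subgroup (PGamma_M \<iota>) PGL3" and subgroup_PIsom: "subgroup (PIsom_M \<iota>) PGL3"
  unfolding PGamma_pr PIsom_pr by (rule pr_unitary_subgroup[OF lam_ring_O_half], rule pr_unitary_subgroup[OF lam_ring_O_lam])

lemma PIsom_subset: "PIsom_M \<iota> \<subseteq> PGamma_M \<iota>"
  unfolding PGamma_pr PIsom_pr using unitary_O_lam_half by blast

lemma frob_Q_lam: "frob a i$k$l \<in> Q_lam"
  using unitary_Q_lam[OF lam_ring_O_lam frob_unitary] .

lemma frob_invertible: "invertible (I (frob a i))"
  using I_invertible[OF lam_ring_O_lam frob_unitary] .

lemma I_frob_mult: "I (frob a i ** frob b j) = I (frob a i) ** I (frob b j)"
  using I_unitary_mult[OF lam_ring_O_lam frob_unitary frob_unitary] .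

text \<open>The scalar left by \<open>unitary_O_lam_frob\<close> is a sign and becomes trivial in
  \<open>PGL3\<close>.\<close>

lemma PIsom_frob: "PIsom_M \<iota> = (\<lambda>(a, i). pr (I (frob a i))) ` ({0..<7} \<times> {0..<3})"
proof (intro equalityI subsetI)
  fix g assume "g \<in> PIsom_M \<iota>"
  then obtain B where B: "B \<in> unitary_over O_lam" "g = pr (I B)" unfolding PIsom_pr by blast
  obtain s a i where s: "a < 7" "i < 3" "s * s = 1" "B = mat s ** frob a i" using unitary_O_lam_frob[OF B(1)] by blast
  have "s = 1 \<or> s = - 1" using s(3) by (metis power2_eq_1_iff power2_eq_square)
  then have sO: "s \<in> Q_lam" "\<iota> s \<noteq> 0"
    using Q_lam_O[OF O_lam_consts(2)] lam_ringD(6)[OF lam_ring_Q_lam] iota_minus[of 1] by (auto simp: iota_1)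
  have "I B = mat (\<iota> s) ** I (frob a i)"
    unfolding s(4) using sO frob_Q_lam iota_mult by (simp add: mat3_eq_iff I_nth mat_mult_nth)
  then have "g = pr (I (frob a i))" unfolding B(2) using pr_scale[OF sO(2)] by simp
  then show "g \<in> (\<lambda>(a, i). pr (I (frob a i))) ` ({0..<7} \<times> {0..<3})" using s(1,2) by force
next
  fix g assume "g \<in> (\<lambda>(a, i). pr (I (frob a i))) ` ({0..<7} \<times> {0..<3})"
  then show "g \<in> PIsom_M \<iota>" unfolding PIsom_pr using frob_unitary by auto
qed

lemma pmat_cases: "\<exists>a1 a2 a3 b1 b2 b3 c1 c2 c3. M = ((a1, a2, a3), (b1, b2, b3), (c1, c2, c3))"
  for M :: "pvec \<times> pvec \<times> pvec"
proof -
  obtain x y z where M: "M = (x, y, z)" by (rule prod_cases3)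
  obtain a1 a2 a3 where x: "x = (a1, a2, a3)" by (rule prod_cases3)
  obtain b1 b2 b3 where y: "y = (b1, b2, b3)" by (rule prod_cases3)
  obtain c1 c2 c3 where z: "z = (c1, c2, c3)" by (rule prod_cases3)
  show ?thesis unfolding M x y z by blast
qed

text \<open>A scalar between matrices in \<open>GL\<^sub>3(\<int>\<^sub>2)\<close> is a unit, hence \<open>1\<close> modulo 2, and the 21 matrices
  \<open>\<sigma>\<^sup>a\<rho>\<^sup>i\<close> are distinct modulo 2.\<close>

lemma frob_proportional:
  assumes ab: "a < 7" "i < 3" "b < 7" "j < 3" and C: "c \<noteq> 0" "I (frob a i) = mat c ** C"
    and Cint: "\<And>k l. C$k$l \<in> adic2_ints" and Cdet: "det C \<noteq> 0" "val (det C) = 0"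
    and Ceven: "\<And>k l. even2 (C$k$l) \<longleftrightarrow> even2 (I (frob b j)$k$l)"
  shows "a = b \<and> i = j"
proof -
  let ?A = "pmm (ppow psigma a) (ppow prho i)" and ?B = "pmm (ppow psigma b) (ppow prho j)"
  have "val (det (I (frob a i))) = 0" using I_O_lam_ints(4)[OF frob_unitary] .
  then have "val c = 0" using C Cdet by (simp add: det_mul det_mat val_mult val_power)
  then have c: "c \<in> adic2_ints" "\<not> even2 c"
    using C(1) by (auto simp: adic2_ints_val_iff even2_iff_half val_mult val_2)
  have "even2 (I (frob a i)$k$l) \<longleftrightarrow> even2 (I (frob b j)$k$l)" for k l
    unfolding C(2) mat_mult_nth using c Cint Ceven by (simp add: even2_mult)
  then have eq: "\<forall>k l. even2 (\<iota> (pmat_of ?A$k$l)) \<longleftrightarrow> even2 (\<iota> (pmat_of ?B$k$l))"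
    by (simp add: I_nth frob_pmat)
  have "even2 (\<iota> (pmat_of ((a1, a2, a3), (b1, b2, b3), (c1, c2, c3))$k$l)) \<longleftrightarrow>
      even (fst ((if l = 1 then (if k = 1 then a1 else if k = 2 then a2 else a3)
        else if l = 2 then (if k = 1 then b1 else if k = 2 then b2 else b3)
        else (if k = 1 then c1 else if k = 2 then c2 else c3))))" for a1 a2 a3 b1 b2 b3 c1 c2 c3 and k l :: 3
    using exhaust_3[of k] exhaust_3[of l] by (auto simp: pmat_of_def pvec_of_def transpose_def even2_iota_ol)
  note par = this
  obtain a1 a2 a3 b1 b2 b3 c1 c2 c3 where A: "?A = ((a1, a2, a3), (b1, b2, b3), (c1, c2, c3))"
    using pmat_cases[of ?A] by (elim exE)
  obtain a1' a2' a3' b1' b2' b3' c1' c2' c3' where B: "?B = ((a1', a2', a3'), (b1', b2', b3'), (c1', c2', c3'))"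
    using pmat_cases[of ?B] by (elim exE)
  have "pparity ?A = pparity ?B"
    using eq unfolding A B par forall_3 by (simp add: pparity_def)
  then show ?thesis using frobenius_parity_inj[OF ab] by blast
qed

lemma frob_inj: "inj_on (\<lambda>(a, i). pr (I (frob a i))) ({0..<7} \<times> {0..<3})"
proof (rule inj_onI, clarsimp)
  fix a i b j :: nat assume ab: "a < 7" "i < 3" "b < 7" "j < 3" and eq: "pr (I (frob a i)) = pr (I (frob b j))"
  obtain c where c: "c \<noteq> 0" "h ** I (frob a i) ** matrix_inv h = mat c ** (h ** I (frob b j) ** matrix_inv h)"
    using eq unfolding pr_def to_PGL3_eq_iff by blast
  have "mat c ** (h ** I (frob b j) ** matrix_inv h) = h ** (mat c ** I (frob b j)) ** matrix_inv h"
    by (simp only: mat_out[of h] matrix_mul_assoc[of "mat c", symmetric])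
  then have "matrix_inv h ** (h ** I (frob a i) ** matrix_inv h) ** h = matrix_inv h ** (h ** (mat c ** I (frob b j)) ** matrix_inv h) ** h"
    using c(2) by simp
  then have "I (frob a i) = mat c ** I (frob b j)"
    by (simp add: matrix_inv_cancel[OF invertible_h] matrix_inv_left[OF invertible_h] flip: matrix_mul_assoc)
  then show "a = b \<and> i = j"
    using frob_proportional[OF ab c(1)] I_O_lam_ints[OF frob_unitary] frob_invertible by (simp add: invertible_det_nz)
qed

text \<open>By \<open>frob_mult\<close> the exponents \<open>(a, i)\<close> multiply as in
  \<open>F21\<close>, so \<open>f\<close> respects products; the isomorphism is its inverse.\<close>

lemma PIsom_iso: "PGL3\<lparr>carrier := PIsom_M \<iota>\<rparr> \<cong> F21"
proof -
  define f where "f = (\<lambda>(a, i). pr (I (frob a i)))"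
  let ?S = "{0..<7} \<times> {0..<3} :: (nat \<times> nat) set"
  define g where "g = inv_into ?S f"
  have inj: "inj_on f ?S" unfolding f_def by (rule frob_inj)
  have im: "f ` ?S = PIsom_M \<iota>" unfolding f_def PIsom_frob ..
  have mult: "f x \<otimes>\<^bsub>PGL3\<^esub> f y = f (x \<otimes>\<^bsub>F21\<^esub> y)" for x y
    by (cases x; cases y) (simp add: f_def F21_def pr_mult frob_invertible frob_mult flip: I_frob_mult)
  have closed: "x \<otimes>\<^bsub>F21\<^esub> y \<in> ?S" for x y by (cases x; cases y) (simp add: F21_def)
  have gf: "g (f x) = x" if "x \<in> ?S" for x unfolding g_def using inj that by simp
  have fg: "f (g y) = y" "g y \<in> ?S" if "y \<in> PIsom_M \<iota>" for y
    unfolding g_def using that f_inv_into_f[of y f ?S] inv_into_into[of y f ?S] unfolding im by simp_all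
  have "g \<in> iso (PGL3\<lparr>carrier := PIsom_M \<iota>\<rparr>) F21"
    unfolding iso_def hom_def
  proof (intro CollectI conjI)
    show "g \<in> carrier (PGL3\<lparr>carrier := PIsom_M \<iota>\<rparr>) \<rightarrow> carrier F21"
      using fg(2) by (auto simp: F21_def)
    show "\<forall>x\<in>carrier (PGL3\<lparr>carrier := PIsom_M \<iota>\<rparr>). \<forall>y\<in>carrier (PGL3\<lparr>carrier := PIsom_M \<iota>\<rparr>).
      g (x \<otimes>\<^bsub>PGL3\<lparr>carrier := PIsom_M \<iota>\<rparr>\<^esub> y) = g x \<otimes>\<^bsub>F21\<^esub> g y"
    proof (intro ballI)
      fix x y assume "x \<in> carrier (PGL3\<lparr>carrier := PIsom_M \<iota>\<rparr>)" "y \<in> carrier (PGL3\<lparr>carrier := PIsom_M \<iota>\<rparr>)"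
      then have "x \<otimes>\<^bsub>PGL3\<^esub> y = f (g x \<otimes>\<^bsub>F21\<^esub> g y)" using fg(1) by (simp flip: mult)
      then show "g (x \<otimes>\<^bsub>PGL3\<lparr>carrier := PIsom_M \<iota>\<rparr>\<^esub> y) = g x \<otimes>\<^bsub>F21\<^esub> g y" using gf[OF closed] by simp
    qed
    have "bij_betw f ?S (PIsom_M \<iota>)" using inj im by (simp add: bij_betw_def)
    then have "bij_betw g (PIsom_M \<iota>) ?S" unfolding g_def by (rule bij_betw_inv_into)
    then show "bij_betw g (carrier (PGL3\<lparr>carrier := PIsom_M \<iota>\<rparr>)) (carrier F21)" by (simp add: F21_def)
  qed
  then show ?thesis by (auto simp: is_iso_def)
qed

lemma card_PIsom: "card (PIsom_M \<iota>) = 21"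
  unfolding PIsom_frob card_image[OF frob_inj] by simp

end

section \<open>Generators, stabilizers and transitivity\<close>

lemma hyperplane_TFF: "w \<in> hyperplane True False False \<longleftrightarrow> w \<in> Z3 \<and> even2 (w$1)"
  by (simp add: hyperplane_def)

definition pnu :: "pvec \<times> pvec \<times> pvec"
  where "pnu = (((0, 0), (1, 0), (0, 0)), ((- 1, 0), (- 1, 0), (- 1, - 1)), ((0, 0), (0, 0), (1, 0)))"

lemma pnu_unitary: "pmat_of pnu \<in> unitary_over O_lam"
  by (simp add: pnu_def pmat_unitary_iff pgram_def padd_def pmul_def pcnj_def)

lemma pmat_of_nth:
  "pmat_of ((a1, a2, a3), (b1, b2, b3), (c1, c2, c3)) =
    vector [vector [ol a1, ol b1, ol c1], vector [ol a2, ol b2, ol c2], vector [ol a3, ol b3, ol c3]]"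
  by (simp add: pmat_of_def pvec_of_def mat3_eq_iff forall_3 transpose_def)

text \<open>\<open>\<nu> = \<beta>\<^sup>-\<^sup>1\<rho>\<beta>\<close> is again integral.\<close>

lemma rho_beta: "pmat_of prho ** beta = beta ** pmat_of pnu"
  unfolding mat3_eq_iff forall_3 matrix_mult_3 prho_def pnu_def pmat_of_nth beta_def vector_3 ol_def
  using lam_nonzero by (simp add: cnj_lam add_divide_eq_iff divide_simps)

definition hyp :: "bool \<times> bool \<times> bool \<Rightarrow> (adic2^3) set"
  where "hyp = (\<lambda>(a, b, c). hyperplane a b c)"

text \<open>How sigma acts on linear forms modulo 2: a linear feedback shift register of maximal
  period 7.\<close>

definition sigma_step :: "bool \<times> bool \<times> bool \<Rightarrow> bool \<times> bool \<times> bool"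
  where "sigma_step = (\<lambda>(a, b, c). (a \<noteq> c, a, b))"

lemma sigma_step_orbit:
  "list_all (\<lambda>n. (sigma_step ^^ n) (True, False, False) \<noteq> (True, False, False)) [1..<7]"
  by code_simp

context embedding
begin

abbreviation "sg \<equiv> I (pmat_of psigma)"
abbreviation "rh \<equiv> I (pmat_of prho)"
abbreviation "nu \<equiv> I (pmat_of pnu)"
abbreviation "bt \<equiv> I beta"
abbreviation "S n \<equiv> I (pmat_of (ppow psigma n))"
abbreviation "R n \<equiv> I (pmat_of (ppow prho n))"

text \<open>A uniformizer of the 2-adic numbers, and the scalar that \<open>bt\<close> cubed
  equals.\<close>

definition mu :: adic2 where "mu = \<iota> (lam / cnj lam)"

lemma iota_ratio: "\<iota> (lam / cnj lam) \<noteq> 0" "val (\<iota> (lam / cnj lam)) = 1"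
  "\<iota> (cnj lam / lam) \<noteq> 0" "val (\<iota> (cnj lam / lam)) = - 1"
proof -
  have q: "lam \<in> Q_lam" "cnj lam \<in> Q_lam" "lam / cnj lam \<in> Q_lam" "cnj lam / lam \<in> Q_lam"
    using lam_ringD(2)[OF lam_ring_O_half] lam_ratio_O_half Q_lam_O[OF O_lam_consts(4)] Q_lam_O[OF O_lam_cnj[OF O_lam_consts(4)]] by auto
  have e: "\<iota> lam = \<iota> (lam / cnj lam) * \<iota> (cnj lam)" "\<iota> (cnj lam) = \<iota> (cnj lam / lam) * \<iota> lam"
    using iota_mult[OF q(3) q(2)] iota_mult[OF q(4) q(1)] lam_nonzero by simp_all
  obtain u where u: "u dvd 1" "\<iota> lam = 2 * of_adic2_int u" using iota_lam by blast
  obtain v where v: "v dvd 1" "\<iota> (cnj lam) = of_adic2_int v" using iota_cnj_lam by blast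
  have nz: "of_adic2_int u \<noteq> 0" "of_adic2_int v \<noteq> 0" using u v by (auto simp: of_adic2_int_eq_0_iff)
  have l: "\<iota> lam \<noteq> 0" "val (\<iota> lam) = 1" using u nz by (simp_all add: val_mult val_2 val_unit)
  have cl: "\<iota> (cnj lam) \<noteq> 0" "val (\<iota> (cnj lam)) = 0" using v nz by (simp_all add: val_unit)
  show 1: "\<iota> (lam / cnj lam) \<noteq> 0" "\<iota> (cnj lam / lam) \<noteq> 0" using e l cl by auto
  show "val (\<iota> (lam / cnj lam)) = 1" "val (\<iota> (cnj lam / lam)) = - 1"
    using val_mult[OF 1(1) cl(1)] val_mult[OF 1(2) l(1)] unfolding e(1)[symmetric] e(2)[symmetric] l(2) cl(2) by simp_all
qed

lemma mu: "mu \<noteq> 0" "val mu = 1" "mu \<in> adic2_ints" "even2 mu"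
proof -
  show 1: "mu \<noteq> 0" "val mu = 1" using iota_ratio by (simp_all add: mu_def)
  have "mu / 2 \<in> adic2_ints" using 1 val_mult[of "mu / 2" 2] by (simp add: adic2_ints_val_iff val_2)
  then show "even2 mu" unfolding even2_iff_half by (intro bexI[of _ "mu / 2"]) simp_all
  show "mu \<in> adic2_ints" using 1 by (simp add: adic2_ints_val_iff)
qed

lemma bt_vector: "(bt *v z)$1 = mu * z$3" "(bt *v z)$2 = z$1" "(bt *v z)$3 = z$2"
  by (simp_all add: matrix_vector_3 I_nth beta_def mu_def iota_0 iota_1)

lemma bt_invertible: "invertible bt"
  using I_invertible[OF lam_ring_O_half beta_unitary] .

lemma det_bt: "det bt \<noteq> 0" "val (det bt) = 1"
proof -
  have "det bt = mu" by (simp add: det_3 I_nth beta_def mu_def iota_0 iota_1)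
  then show "det bt \<noteq> 0" "val (det bt) = 1" using mu by simp_all
qed

section \<open>The action of the generators on linear forms modulo 2\<close>

text \<open>\<open>bt\<close> shifts the coordinates and multiplies the one that arrives in front by
  \<open>mu\<close>, which is 2 times a unit.\<close>

lemma bt_image: "(*v) bt ` Z3 = hyperplane True False False"
proof (intro equalityI subsetI)
  fix w assume "w \<in> (*v) bt ` Z3"
  then obtain z where z: "z \<in> Z3" "w = bt *v z" by (rule imageE)
  have zi: "z$i \<in> adic2_ints" for i using z(1) by (simp add: Z3_def)
  then show "w \<in> hyperplane True False False"
    unfolding hyperplane_TFF z(2) Z3_def mem_Collect_eq forall_3 bt_vector using mu by (auto simp: even2_mult)
next
  fix w assume "w \<in> hyperplane True False False"
  then have w: "\<And>i. w$i \<in> adic2_ints" "even2 (w$1)" by (simp_all add: hyperplane_TFF Z3_def)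
  obtain y where y: "y \<in> adic2_ints" "w$1 = 2 * y" using w(2) even2_iff_half by blast
  have "val (2 / mu) = 0" using val_mult[of "2 / mu" mu] mu by (simp add: val_2)
  then have "2 / mu \<in> adic2_ints" using mu by (simp add: adic2_ints_val_iff)
  then have q: "w$1 / mu \<in> adic2_ints" using y adic2_ints_mult[of "2 / mu" y] by simp
  define z :: "adic2^3" where "z = vector [w$2, w$3, w$1 / mu]"
  have "z \<in> Z3" unfolding Z3_def mem_Collect_eq forall_3 z_def vector_3 using w q by simp
  moreover have "w = bt *v z" unfolding vec_eq_iff forall_3 bt_vector z_def vector_3 using mu by simp
  ultimately show "w \<in> (*v) bt ` Z3" by (rule rev_image_eqI)
qed

text \<open>Modulo 2 sigma is the companion matrix of x^3 + x + 1, and forms transform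
  contragrediently. Since sigma preserves \<open>Z3\<close>, comparing parities suffices.\<close>

lemma sg_hyperplane: "(*v) sg ` hyperplane a b c = hyperplane (a \<noteq> c) a b"
proof (rule image_hyperplane[OF I_O_lam_ints(3)[OF psigma_unitary]])
  fix z assume z: "z \<in> Z3"
  have zi: "z$i \<in> adic2_ints" for i using z by (simp add: Z3_def)
  have e: "(sg *v z)$1 = z$3" "(sg *v z)$2 = z$1 + \<iota> (ol (1, 1)) * z$3" "(sg *v z)$3 = z$2 + \<iota> (ol (0, 1)) * z$3"
    by (simp_all add: matrix_vector_3 I_nth psigma_def pmat_of_nth ol_consts(1,2) iota_0 iota_1)
  have i: "\<iota> (ol p) * z$3 \<in> adic2_ints" for p using zi iota_ol_ints by blast
  have par: "even2 (z$1 + \<iota> (ol (1, 1)) * z$3) \<longleftrightarrow> (even2 (z$1) \<longleftrightarrow> even2 (z$3))"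
    "even2 (z$2 + \<iota> (ol (0, 1)) * z$3) \<longleftrightarrow> even2 (z$2)"
    using zi i iota_ol_ints by (simp_all add: even2_add even2_mult even2_iota_ol)
  have "sg *v z \<in> Z3" using I_O_lam_ints(3)[OF psigma_unitary] z by blast
  then show "sg *v z \<in> hyperplane (a \<noteq> c) a b \<longleftrightarrow> z \<in> hyperplane a b c"
    using z unfolding hyperplane_def mem_Collect_eq e par by (cases a; cases b; cases c) auto
qed

lemma rh_hyperplane: "(*v) rh ` hyperplane True False False = hyperplane True False False"
proof (rule image_hyperplane[OF I_O_lam_ints(3)[OF prho_unitary]])
  fix z assume z: "z \<in> Z3"
  have zi: "z$i \<in> adic2_ints" for i using z by (simp add: Z3_def)
  have e: "(rh *v z)$1 = z$1 + \<iota> (ol (0, 1)) * z$3"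
    by (simp add: matrix_vector_3 I_nth prho_def pmat_of_nth ol_consts(1,2) iota_0 iota_1)
  have i: "\<iota> (ol p) * z$3 \<in> adic2_ints" for p using zi iota_ol_ints by blast
  have par: "even2 (z$1 + \<iota> (ol (0, 1)) * z$3) \<longleftrightarrow> even2 (z$1)"
    using zi i iota_ol_ints by (simp add: even2_add even2_mult even2_iota_ol)
  have "rh *v z \<in> Z3" using I_O_lam_ints(3)[OF prho_unitary] z by blast
  then show "rh *v z \<in> hyperplane True False False \<longleftrightarrow> z \<in> hyperplane True False False"
    using z unfolding hyperplane_TFF e par by simp
qed

lemma nu_hyperplane: "(*v) nu ` hyperplane a b False = hyperplane (a \<noteq> b) a False"
proof (rule image_hyperplane[OF I_O_lam_ints(3)[OF pnu_unitary]])
  fix z assume z: "z \<in> Z3"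
  have zi: "z$i \<in> adic2_ints" for i using z by (simp add: Z3_def)
  have e: "(nu *v z)$1 = \<iota> (ol (- 1, 0)) * z$2" "(nu *v z)$2 = z$1 + \<iota> (ol (- 1, 0)) * z$2"
    by (simp_all add: matrix_vector_3 I_nth pnu_def pmat_of_nth ol_consts(1,2) iota_0 iota_1)
  have i: "\<iota> (ol p) * z$2 \<in> adic2_ints" for p using zi iota_ol_ints by blast
  have par: "even2 (\<iota> (ol (- 1, 0)) * z$2) \<longleftrightarrow> even2 (z$2)"
    "even2 (z$1 + \<iota> (ol (- 1, 0)) * z$2) \<longleftrightarrow> (even2 (z$1) \<longleftrightarrow> even2 (z$2))"
    using zi i iota_ol_ints by (simp_all add: even2_add even2_mult even2_iota_ol)
  have "nu *v z \<in> Z3" using I_O_lam_ints(3)[OF pnu_unitary] z by blast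
  then show "nu *v z \<in> hyperplane (a \<noteq> b) a False \<longleftrightarrow> z \<in> hyperplane a b False"
    using z unfolding hyperplane_def mem_Collect_eq e par by (cases a; cases b) auto
qed

abbreviation "D \<equiv> generated_monoid sg bt"

lemma sg_invertible: "invertible sg" and rh_invertible: "invertible rh"
  using I_invertible[OF lam_ring_O_lam] psigma_unitary prho_unitary by blast+

lemma D_invertible: "X \<in> D \<Longrightarrow> invertible X"
  by (induction rule: generated_monoid.induct) (simp_all add: invertible_mat invertible_mult sg_invertible bt_invertible)

text \<open>\<open>bt\<close> realizes the form (1, 0, 0), and each further factor sigma advances by
  one step on the cycle of all seven nonzero forms.\<close>

lemma D_hyperplane:
  assumes "(a, b, c) \<noteq> (False, False, False)"
  shows "\<exists>t. (\<forall>X\<in>D. t ** X \<in> D) \<and> invertible t \<and> (*v) t ` Z3 = hyperplane a b c \<and> val (det t) = 1"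
proof -
  define good where "good a b c \<longleftrightarrow> (\<exists>t. (\<forall>X\<in>D. t ** X \<in> D) \<and> invertible t \<and>
    (*v) t ` Z3 = hyperplane a b c \<and> val (det t) = 1)" for a b c
  have base: "good True False False"
    unfolding good_def using generated_monoid.right[of _ sg bt] bt_invertible bt_image det_bt by blast
  have step: "good (a \<noteq> c) a b" if g: "good a b c" for a b c
  proof -
    obtain t where t: "\<forall>X\<in>D. t ** X \<in> D" "invertible t" "(*v) t ` Z3 = hyperplane a b c" "val (det t) = 1"
      using g unfolding good_def by (elim exE conjE)
    have "\<forall>X\<in>D. (sg ** t) ** X \<in> D"
      using t(1) generated_monoid.left by (simp add: matrix_mul_assoc[symmetric])
    moreover have "invertible (sg ** t)" using t(2) sg_invertible by (intro invertible_mult)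
    moreover have "(*v) (sg ** t) ` Z3 = hyperplane (a \<noteq> c) a b"
      unfolding matrix_image_image[symmetric] t(3) by (rule sg_hyperplane)
    moreover have "val (det (sg ** t)) = 1"
      using t(2,4) sg_invertible I_O_lam_ints(4)[OF psigma_unitary] by (simp add: det_mul val_mult invertible_det_nz)
    ultimately show ?thesis unfolding good_def by (intro exI conjI)
  qed
  have 1: "good True True False" using step[OF base] by simp
  have 2: "good True True True" using step[OF 1] by simp
  have 3: "good False True True" using step[OF 2] by simp
  have 4: "good True False True" using step[OF 3] by simp
  have 5: "good False True False" using step[OF 4] by simp
  have 6: "good False False True" using step[OF 5] by simp
  have "good a b c" using base 1 2 3 4 5 6 assms by (cases a; cases b; cases c) simp_all
  then show ?thesis unfolding good_def .
qed

sublocale hg: hyperplane_generators D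
  by unfold_locales (rule generated_monoid.one, erule D_invertible, rule D_hyperplane)

definition "v0 = vertex_of h"
definition "v1 = vertex_of (h ** bt)"
definition "v2 = vertex_of (h ** (bt ** bt))"

lemma v_vertices: "v0 \<in> building_vertices" "v1 \<in> building_vertices" "v2 \<in> building_vertices"
  unfolding v0_def v1_def v2_def using invertible_h bt_invertible by (auto intro!: vertex_of_vertex invertible_mult)

lemma pr_v0: "vertex_map (pr X) v0 = vertex_of (h ** X)"
  unfolding v0_def using pr_vertex[of X "mat 1"] by simp

lemma pr_bt_act: "vertex_map (pr bt) v0 = v1" "vertex_map (pr bt) v1 = v2" "vertex_map (pr bt) v2 = v0"
proof -
  show "vertex_map (pr bt) v0 = v1" "vertex_map (pr bt) v1 = v2"
    by (simp_all add: pr_v0 v1_def v2_def pr_vertex)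
  have "bt ** (bt ** bt) = mat mu"
    by (simp add: mat3_eq_iff forall_3 matrix_mult_3 I_nth beta_def mu_def iota_0 iota_1 mat_3)
  then have "vertex_map (pr bt) v2 = vertex_of (mat mu ** h)"
    unfolding v2_def pr_vertex using mat_commute[of mu h] by simp
  then show "vertex_map (pr bt) v2 = v0" unfolding v0_def using vertex_of_scale[OF mu(1)] by simp
qed

lemma pr_bt_cube: "pr bt \<otimes>\<^bsub>PGL3\<^esub> (pr bt \<otimes>\<^bsub>PGL3\<^esub> pr bt) = \<one>\<^bsub>PGL3\<^esub>"
proof -
  have "bt ** (bt ** bt) = mat mu ** mat 1"
    by (simp add: mat3_eq_iff forall_3 matrix_mult_3 I_nth beta_def mu_def iota_0 iota_1 mat_3)
  then show ?thesis
    using pr_scale[OF mu(1), of "mat 1"] by (simp add: pr_mult bt_invertible invertible_mult pr_one)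
qed

text \<open>lam / cnj lam has norm 1 and valuation 1; its powers, and those of the inverse quotient
  for negative \<open>k\<close>, realize every valuation.\<close>

lemma norm_one_scalar: "\<exists>\<eta>\<in>O_half. \<eta> * cnj \<eta> = 1 \<and> \<iota> \<eta> \<noteq> 0 \<and> val (\<iota> \<eta>) = k"
proof -
  have pow: "\<exists>\<eta>\<in>O_half. \<eta> * cnj \<eta> = 1 \<and> \<iota> \<eta> \<noteq> 0 \<and> val (\<iota> \<eta>) = int n * val (\<iota> c)"
    if c: "c \<in> O_half" "c * cnj c = 1" "\<iota> c \<noteq> 0" for c n
  proof (induction n)
    case 0
    show ?case using lam_ringD(1)[OF lam_ring_O_half O_lam_consts(2)]
      by (intro bexI[of _ 1]) (simp_all add: iota_1 val_1)
  next
    case (Suc n)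
    then obtain \<eta> where e: "\<eta> \<in> O_half" "\<eta> * cnj \<eta> = 1" "\<iota> \<eta> \<noteq> 0" "val (\<iota> \<eta>) = int n * val (\<iota> c)" by blast
    have m: "\<iota> (c * \<eta>) = \<iota> c * \<iota> \<eta>" using c(1) e(1) lam_ringD(2)[OF lam_ring_O_half] iota_mult by blast
    have "(c * \<eta>) * cnj (c * \<eta>) = (c * cnj c) * (\<eta> * cnj \<eta>)" by simp
    then have "(c * \<eta>) * cnj (c * \<eta>) = 1" using c(2) e(2) by simp
    moreover have "c * \<eta> \<in> O_half" using c(1) e(1) lam_ringD(4)[OF lam_ring_O_half] by blast
    ultimately show ?case using m c(3) e(3,4)
      by (intro bexI[of _ "c * \<eta>"]) (simp_all add: val_mult algebra_simps)
  qed
  have u: "lam / cnj lam * cnj (lam / cnj lam) = 1" "cnj lam / lam * cnj (cnj lam / lam) = 1"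
    using lam_nonzero by simp_all
  show ?thesis
  proof (cases "k \<ge> 0")
    case True
    then show ?thesis using pow[OF lam_ratio_O_half(1) u(1) iota_ratio(1), of "nat k"] by (simp add: iota_ratio)
  next
    case False
    then show ?thesis using pow[OF lam_ratio_O_half(2) u(2) iota_ratio(3), of "nat (- k)"] by (simp add: iota_ratio)
  qed
qed

lemma iota_ints_closed:
  assumes "x \<in> Q_lam \<and> \<iota> x \<in> adic2_ints" "y \<in> Q_lam \<and> \<iota> y \<in> adic2_ints"
  shows "x + y \<in> Q_lam \<and> \<iota> (x + y) \<in> adic2_ints" "x * y \<in> Q_lam \<and> \<iota> (x * y) \<in> adic2_ints"
  using assms lam_ringD(3,4)[OF lam_ring_Q_lam] adic2_ints_add adic2_ints_mult by (simp_all add: iota_add iota_mult)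

lemma iota_matrix_mult_ints:
  fixes A B :: "complex^3^3"
  assumes "\<And>i j. A$i$j \<in> Q_lam \<and> \<iota> (A$i$j) \<in> adic2_ints" "\<And>i j. B$i$j \<in> Q_lam \<and> \<iota> (B$i$j) \<in> adic2_ints"
  shows "(A ** B)$i$j \<in> Q_lam \<and> \<iota> ((A ** B)$i$j) \<in> adic2_ints"
  unfolding matrix_mult_3 by (intro iota_ints_closed assms)

text \<open>The relation \<open>B\<^sup>* H B = H\<close> with \<open>det H = 7\<close> shows that an isometry that is integral together with
  its inverse at the place \<open>\<lambda>\<close> is also integral at the conjugate place.\<close>

lemma unitary_integral:
  assumes B: "B \<in> unitary_over O_half" and C: "C \<in> unitary_over O_half" "B ** C = mat 1"
    and int: "\<And>i j. \<iota> (B$i$j) \<in> adic2_ints" "\<And>i j. \<iota> (C$i$j) \<in> adic2_ints"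
  shows "B \<in> unitary_over O_lam"
proof -
  have BQ: "B$i$j \<in> Q_lam" and CQ: "C$i$j \<in> Q_lam" for i j using B C unitary_Q_lam[OF lam_ring_O_half] by blast+
  have gO: "gram_matrix$i$j \<in> O_lam" for i j
    using exhaust_3[of i] exhaust_3[of j] by (auto simp: gram_matrix_def intro!: O_lam_intros)
  have aO: "adj3 gram_matrix$i$j \<in> O_lam" for i j
    using exhaust_3[of i] exhaust_3[of j] gO by (auto simp: adj3_def intro!: O_lam_diff O_lam_mult)
  have rel: "transpose B ** gram_matrix ** map_matrix cnj B = gram_matrix" using B by (simp add: unitary_over_def)
  have "transpose C ** transpose B = mat 1" using C(2) by (metis matrix_transpose_mul transpose_mat)
  then have "gram_matrix ** map_matrix cnj B = transpose C ** (transpose B ** gram_matrix ** map_matrix cnj B)"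
    by (simp add: matrix_mul_assoc)
  also have "\<dots> = transpose C ** gram_matrix" unfolding rel ..
  finally have "adj3 gram_matrix ** (gram_matrix ** map_matrix cnj B) = adj3 gram_matrix ** (transpose C ** gram_matrix)"
    by simp
  then have seven: "mat 7 ** map_matrix cnj B = adj3 gram_matrix ** (transpose C ** gram_matrix)"
    by (simp add: matrix_mul_assoc adj3_mult det_gram_matrix)
  have ok: "(adj3 gram_matrix ** (transpose C ** gram_matrix))$i$j \<in> Q_lam \<and>
    \<iota> ((adj3 gram_matrix ** (transpose C ** gram_matrix))$i$j) \<in> adic2_ints" for i j
    using gO aO Q_lam_O iota_O_lam_ints CQ int(2) by (intro iota_matrix_mult_ints) (simp_all add: transpose_def)
  have "\<iota> (cnj (B$i$j)) \<in> adic2_ints" for i j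
  proof -
    have "7 * cnj (B$i$j) = (adj3 gram_matrix ** (transpose C ** gram_matrix))$i$j"
      by (simp add: mat_mult_nth flip: seven)
    then have "\<iota> (7 * cnj (B$i$j)) \<in> adic2_ints" using ok[of i j] by simp
    moreover have "\<iota> (of_int 7 * cnj (B$i$j)) = of_int 7 * \<iota> (cnj (B$i$j))"
      using iota_mult[OF Q_lam_O[OF O_lam_int] lam_ringD(5)[OF lam_ring_Q_lam BQ]] by (simp only: iota_int)
    ultimately have p: "of_int 7 * \<iota> (cnj (B$i$j)) \<in> adic2_ints" by simp
    \<comment> \<open>7 is odd, hence a unit at the place lam, and can be divided out.\<close>
    have s: "of_int 7 \<noteq> (0 :: adic2) \<and> val (of_int 7) = 0"
      using val_odd[of "of_int 7"] adic2_ints_of_int even2_of_int[of 7] by simp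
    have "inverse (of_int 7) \<in> adic2_ints" using s by (intro inverse_adic2_ints) simp_all
    from adic2_ints_mult[OF this p] have "inverse (of_int 7) * (of_int 7 * \<iota> (cnj (B$i$j))) \<in> adic2_ints" .
    then show ?thesis unfolding mult.assoc[symmetric] left_inverse[OF conjunct1[OF s]] by simp
  qed
  then have "B$i$j \<in> O_lam" for i j
    using B int(1) by (intro O_half_integral) (simp_all add: unitary_over_def)
  then show ?thesis using B by (simp add: unitary_over_def)
qed

lemma stabilizer_v0:
  assumes g: "g \<in> PGamma_M \<iota>" and fix0: "vertex_map g v0 = v0"
  shows "g \<in> PIsom_M \<iota>"
proof -
  obtain B where B: "B \<in> unitary_over O_half" "g = pr (I B)" using g unfolding PGamma_pr by blast
  have iB: "invertible (I B)" using I_invertible[OF lam_ring_O_half B(1)] .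
  have "vertex_of (h ** I B) = vertex_of h" using fix0 unfolding B(2) pr_v0 unfolding v0_def .
  from vertex_of_eqD[OF invertible_mult[OF invertible_h iB] invertible_h this]
  obtain c where c: "c \<noteq> 0" and ci: "\<And>i j. (mat c ** I B)$i$j \<in> adic2_ints"
    and ci': "\<And>i j. matrix_inv (mat c ** I B)$i$j \<in> adic2_ints"
    unfolding matrix_inv_cancel(1)[OF invertible_h] by blast
  \<comment> \<open>\<open>c\<close> is merely a 2-adic scalar. The norm-one element of O[1/2] with
    the same valuation replaces it up to the unit \<open>u\<close>, so that the rescaled matrix is
    again an isometry over O[1/2].\<close>
  obtain \<eta> where e: "\<eta> \<in> O_half" "\<eta> * cnj \<eta> = 1" "\<iota> \<eta> \<noteq> 0" "val (\<iota> \<eta>) = val c" using norm_one_scalar by blast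
  define B' where "B' = mat \<eta> ** B"
  have B': "B' \<in> unitary_over O_half" unfolding B'_def using unitary_scalar[OF lam_ring_O_half e(1,2) B(1)] .
  obtain C where C: "C \<in> unitary_over O_half" "B' ** C = mat 1" "matrix_inv (I B') = I C" "invertible (I B')"
    using I_unitary_inverse[OF lam_ring_O_half B'] by blast
  have IB': "I B' = mat (\<iota> \<eta>) ** I B"
    unfolding B'_def using e(1) lam_ringD(2)[OF lam_ring_O_half] unitary_Q_lam[OF lam_ring_O_half B(1)] iota_mult
    by (simp add: mat3_eq_iff I_nth mat_mult_nth)
  define u where "u = \<iota> \<eta> / c"
  have "val u = 0" using val_mult[of u c] c e by (simp add: u_def)
  then have u: "u \<noteq> 0" "u \<in> adic2_ints" "inverse u \<in> adic2_ints"
    using c e inverse_adic2_ints[of u] by (simp_all add: u_def adic2_ints_val_iff)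
  have IB'': "I B' = mat u ** (mat c ** I B)"
    unfolding IB' using c by (simp add: u_def matrix_mul_assoc mat_mult_mat)
  have "mat u ** (mat c ** I B) ** (mat (inverse u) ** matrix_inv (mat c ** I B)) =
      mat (inverse u) ** (mat u ** (mat c ** I B ** matrix_inv (mat c ** I B)))"
    unfolding mat_out[of "mat u ** (mat c ** I B)"] by (simp only: matrix_mul_assoc)
  also have "mat c ** I B ** matrix_inv (mat c ** I B) = mat 1"
    using c iB by (intro matrix_inv_right) (simp add: invertible_mult invertible_mat)
  also have "mat (inverse u) ** (mat u ** mat 1) = (mat 1 :: adic2^3^3)" using u by (simp add: mat_mult_mat)
  finally have "mat u ** (mat c ** I B) ** (mat (inverse u) ** matrix_inv (mat c ** I B)) = mat 1" .
  then have IC: "I C = mat (inverse u) ** matrix_inv (mat c ** I B)"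
    unfolding C(3)[symmetric] IB'' by (rule matrix_inv_unique)
  have "\<iota> (B'$i$j) \<in> adic2_ints" for i j
    using ci u unfolding I_nth[symmetric] IB'' mat_mult_nth[of u] by (intro adic2_ints_mult)
  moreover have "\<iota> (C$i$j) \<in> adic2_ints" for i j
    using ci' u unfolding I_nth[symmetric] IC mat_mult_nth[of "inverse u"] by (intro adic2_ints_mult)
  ultimately have "B' \<in> unitary_over O_lam" using unitary_integral[OF B' C(1,2)] by blast
  moreover have "g = pr (I B')" unfolding B(2) IB' using pr_scale[OF e(3)] by simp
  ultimately show ?thesis unfolding PIsom_pr by blast
qed

lemma PIsom_v0:
  assumes "g \<in> PIsom_M \<iota>"
  shows "vertex_map g v0 = v0"
proof -
  obtain B where B: "B \<in> unitary_over O_lam" "g = pr (I B)" using assms unfolding PIsom_pr by blast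
  have "vertex_of (h ** I B) = vertex_of (h ** mat 1)"
    using I_O_lam_ints(3)[OF B(1)] by (intro vertex_of_mult_image) simp
  then show ?thesis unfolding B(2) pr_v0 by (simp add: v0_def)
qed

section \<open>Transitivity on vertices and generation\<close>

text \<open>All three elements have finite order, which the argument about the modulus exploits; the
  first two generate the image of Isom M.\<close>

definition "gens = {pr sg, pr rh, pr bt}"

lemma gens_carrier: "gens \<subseteq> carrier PGL3"
  using pr_closed sg_invertible rh_invertible bt_invertible by (simp add: gens_def)

lemma D_generate: "X \<in> D \<Longrightarrow> pr X \<in> generate PGL3 gens"
proof (induction rule: generated_monoid.induct)
  case one
  show ?case unfolding pr_one by (rule generate.one)
next
  case (left X)
  have "pr sg \<in> generate PGL3 gens" by (rule generate.incl) (simp add: gens_def)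
  then show ?case using left generate.eng[of "pr sg" PGL3 gens "pr X"] pr_mult[OF sg_invertible D_invertible] by simp
next
  case (right X)
  have "pr bt \<in> generate PGL3 gens" by (rule generate.incl) (simp add: gens_def)
  then show ?case using right generate.eng[of "pr bt" PGL3 gens "pr X"] pr_mult[OF bt_invertible D_invertible] by simp
qed

lemma ppow_I:
  assumes "pmat_of M \<in> unitary_over O_lam"
  shows "I (pmat_of (ppow M (Suc n))) = I (pmat_of M) ** I (pmat_of (ppow M n))"
    "invertible (I (pmat_of (ppow M n)))" "I (pmat_of (ppow M 0)) = mat 1"
  using assms I_unitary_mult[OF lam_ring_O_lam assms ppow_unitary[OF assms]] I_invertible[OF lam_ring_O_lam ppow_unitary[OF assms]]
  by (simp_all add: pmm pmat_of_pone I_mat iota_1)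

lemma ppow_generate:
  assumes M: "pmat_of M \<in> unitary_over O_lam" "pr (I (pmat_of M)) \<in> gens"
  shows "pr (I (pmat_of (ppow M n))) \<in> generate PGL3 gens"
proof (induction n)
  case 0
  show ?case unfolding ppow_I(3)[OF M(1)] pr_one by (rule generate.one)
next
  case (Suc n)
  have "pr (I (pmat_of M)) \<otimes>\<^bsub>PGL3\<^esub> pr (I (pmat_of (ppow M n))) \<in> generate PGL3 gens"
    using generate.eng[OF generate.incl[OF M(2)] Suc] .
  moreover have "invertible (I (pmat_of M))" using I_invertible[OF lam_ring_O_lam M(1)] .
  ultimately show ?case unfolding ppow_I(1)[OF M(1)] using pr_mult ppow_I(2)[OF M(1)] by simp
qed

lemma I_frob: "I (frob a i) = S a ** R i"
  unfolding frob_def by (rule I_unitary_mult[OF lam_ring_O_lam]) (rule ppow_unitary psigma_unitary prho_unitary)+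

lemma PIsom_generate: "PIsom_M \<iota> \<subseteq> generate PGL3 gens"
proof
  fix g assume "g \<in> PIsom_M \<iota>"
  then obtain a i where g: "g = pr (I (frob a i))" unfolding PIsom_frob by auto
  have "pr (S a) \<otimes>\<^bsub>PGL3\<^esub> pr (R i) \<in> generate PGL3 gens"
    by (intro generate.eng ppow_generate psigma_unitary prho_unitary) (simp_all add: gens_def)
  then show "g \<in> generate PGL3 gens"
    unfolding g I_frob using pr_mult ppow_I(2)[OF psigma_unitary] ppow_I(2)[OF prho_unitary] by simp
qed

lemma PGamma_pr_bt: "pr bt \<in> PGamma_M \<iota>"
  unfolding PGamma_pr using beta_unitary by blast

lemma gens_PIsom: "pr sg \<in> PIsom_M \<iota>" "pr rh \<in> PIsom_M \<iota>"
  unfolding PIsom_pr using psigma_unitary prho_unitary by blast+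

lemma generate_gens_subset: "generate PGL3 gens \<subseteq> generate PGL3 (PIsom_M \<iota> \<union> {pr bt})"
  using gens_PIsom by (intro PGL3.mono_generate) (auto simp: gens_def)

lemma generate_subset_PGamma: "generate PGL3 (PIsom_M \<iota> \<union> {pr bt}) \<subseteq> PGamma_M \<iota>"
  using PIsom_subset PGamma_pr_bt by (intro PGL3.generate_subgroup_incl subgroup_PGamma) auto

lemma PGamma_carrier: "PGamma_M \<iota> \<subseteq> carrier PGL3"
  using subgroup.subset[OF subgroup_PGamma] .

lemma vertex_transitive:
  assumes "v \<in> building_vertices"
  shows "\<exists>g\<in>generate PGL3 gens. vertex_map g v0 = v"
  using hg.vertex_obtain[OF assms invertible_h] D_generate pr_v0 by metis

lemma generate_gens_PGamma: "generate PGL3 gens \<subseteq> PGamma_M \<iota>"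
  using generate_gens_subset generate_subset_PGamma by (rule subset_trans)

text \<open>A subgroup that acts transitively and contains a full point stabilizer is the whole
  group.\<close>

lemma PGamma_subset_generate: "PGamma_M \<iota> \<subseteq> generate PGL3 gens"
proof
  fix g assume g: "g \<in> PGamma_M \<iota>"
  then have gc: "g \<in> carrier PGL3" using PGamma_carrier by blast
  obtain k where k: "k \<in> generate PGL3 gens" "vertex_map k v0 = vertex_map g v0"
    using vertex_transitive[OF vertex_map_closed[OF gc v_vertices(1)]] by blast
  have kP: "k \<in> PGamma_M \<iota>" "k \<in> carrier PGL3" using k(1) generate_gens_PGamma PGamma_carrier by blast+
  let ?d = "inv\<^bsub>PGL3\<^esub> k \<otimes>\<^bsub>PGL3\<^esub> g"
  have "vertex_map ?d v0 = vertex_map (inv\<^bsub>PGL3\<^esub> k) (vertex_map k v0)"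
    using kP gc v_vertices(1) k(2) by (simp add: vertex_map_mult)
  also have "\<dots> = v0"
    using kP v_vertices(1) vertex_map_mult[of "inv\<^bsub>PGL3\<^esub> k" k v0] by (simp add: vertex_map_one)
  finally have "?d \<in> PIsom_M \<iota>"
    using kP g by (intro stabilizer_v0 subgroup.m_closed[OF subgroup_PGamma] subgroup.m_inv_closed[OF subgroup_PGamma])
  then have "k \<otimes>\<^bsub>PGL3\<^esub> ?d \<in> generate PGL3 gens" using generate.eng[OF k(1)] PIsom_generate by blast
  moreover have "k \<otimes>\<^bsub>PGL3\<^esub> ?d = g" using kP gc by (simp add: PGL3.m_assoc[symmetric])
  ultimately show "g \<in> generate PGL3 gens" by simp
qed

lemma PGamma_eq_generate: "PGamma_M \<iota> = generate PGL3 (PIsom_M \<iota> \<union> {pr bt})"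
  using PGamma_subset_generate generate_gens_subset generate_subset_PGamma by blast

lemma to_PGL3_beta_M: "to_PGL3 (map_matrix \<iota> beta_M) = pr bt"
  unfolding beta_M_basis using to_PGL3_basis[OF lam_ring_O_half beta_unitary] .

end

section \<open>Simplex stabilizers\<close>

lemma transitive_actionI:
  assumes H: "subgroup H PGL3" and act: "group_action (PGL3\<lparr>carrier := H\<rparr>) E \<phi>"
    and orb: "\<And>x. x \<in> E \<Longrightarrow> \<exists>g\<in>H. \<phi> g x = x0"
  shows "transitive_action (PGL3\<lparr>carrier := H\<rparr>) E \<phi>"
proof -
  interpret A: group_action "PGL3\<lparr>carrier := H\<rparr>" E \<phi> by (rule act)
  have "\<exists>g\<in>H. \<phi> g x = y" if x: "x \<in> E" and y: "y \<in> E" for x y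
  proof -
    obtain g where g: "g \<in> H" "\<phi> g x = x0" using orb[OF x] by blast
    obtain k where k: "k \<in> H" "\<phi> k y = x0" using orb[OF y] by blast
    have i: "inv\<^bsub>PGL3\<lparr>carrier := H\<rparr>\<^esub> k \<in> H"
      using group.inv_closed[OF PGL3_subgroup_group[OF H], of k] k(1) by simp
    have "\<phi> (inv\<^bsub>PGL3\<lparr>carrier := H\<rparr>\<^esub> k) x0 = y"
      using A.orbit_sym_aux[of k y x0] k y by simp
    then have "\<phi> (inv\<^bsub>PGL3\<lparr>carrier := H\<rparr>\<^esub> k \<otimes>\<^bsub>PGL3\<^esub> g) x = y"
      using A.composition_rule[of x "inv\<^bsub>PGL3\<lparr>carrier := H\<rparr>\<^esub> k" g] x i g by simp
    then show ?thesis using subgroup.m_closed[OF H i g(1)] by blast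
  qed
  then show ?thesis by unfold_locales simp
qed

lemma simplex_orbit:
  assumes H: "subgroup H PGL3" and \<sigma>0: "\<sigma>0 \<subseteq> building_vertices" and \<sigma>: "\<sigma> \<in> building_simplices k"
    and g: "g \<in> H" "\<sigma> = vertex_map g ` \<sigma>0"
  shows "\<exists>k'\<in>H. simplex_action k k' \<sigma> = \<sigma>0" "\<sigma>0 \<in> building_simplices k"
proof -
  have gc: "g \<in> carrier PGL3" using subgroup.mem_carrier[OF H g(1)] .
  let ?i = "inv\<^bsub>PGL3\<^esub> g"
  have i: "?i \<in> H" "?i \<in> carrier PGL3" using subgroup.m_inv_closed[OF H g(1)] gc by simp_all
  have "vertex_map ?i ` \<sigma> = (\<lambda>v. v) ` \<sigma>0"
    unfolding g(2) image_image
  proof (rule image_cong[OF refl])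
    fix v assume "v \<in> \<sigma>0"
    then have v: "v \<in> building_vertices" using \<sigma>0 by blast
    show "vertex_map ?i (vertex_map g v) = v"
      using vertex_map_mult[OF i(2) gc v] gc vertex_map_one[OF v] by simp
  qed
  then have e: "vertex_map ?i ` \<sigma> = \<sigma>0" by simp
  show "\<sigma>0 \<in> building_simplices k" using simplex_map_closed[OF i(2) \<sigma>] unfolding e .
  show "\<exists>k'\<in>H. simplex_action k k' \<sigma> = \<sigma>0"
    using i(1) e \<sigma> by (intro bexI[of _ ?i]) (simp_all add: simplex_action_def)
qed

text \<open>Transfers a computation at one base simplex to all simplices. \<open>\<sigma>0\<close>
  is only required to consist of vertices: that it is a simplex follows from the orbit hypothesis
  for any given simplex.\<close>

lemma simplex_action_orbit:
  assumes H: "subgroup H PGL3" and \<sigma>0: "\<sigma>0 \<subseteq> building_vertices"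
    and orb: "\<And>\<sigma>. \<sigma> \<in> building_simplices k \<Longrightarrow> \<exists>g\<in>H. \<sigma> = vertex_map g ` \<sigma>0"
    and S: "{g \<in> H. vertex_map g ` \<sigma>0 = \<sigma>0} = S" "PGL3\<lparr>carrier := S\<rparr> \<cong> B"
  shows "transitive_action (PGL3\<lparr>carrier := H\<rparr>) (building_simplices k) (simplex_action k)"
    "\<forall>\<sigma>\<in>building_simplices k.
      PGL3\<lparr>carrier := stabilizer (PGL3\<lparr>carrier := H\<rparr>) (simplex_action k) \<sigma>\<rparr> \<cong> B"
proof -
  have o: "(\<exists>g\<in>H. simplex_action k g \<sigma> = \<sigma>0) \<and> \<sigma>0 \<in> building_simplices k" if \<sigma>: "\<sigma> \<in> building_simplices k" for \<sigma>
  proof -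
    obtain g where "g \<in> H" "\<sigma> = vertex_map g ` \<sigma>0" using orb[OF \<sigma>] by blast
    then show ?thesis using simplex_orbit[OF H \<sigma>0 \<sigma>] by blast
  qed
  show "transitive_action (PGL3\<lparr>carrier := H\<rparr>) (building_simplices k) (simplex_action k)"
    using o by (intro transitive_actionI[OF H simplex_group_action[OF H]]) blast
  show "\<forall>\<sigma>\<in>building_simplices k.
      PGL3\<lparr>carrier := stabilizer (PGL3\<lparr>carrier := H\<rparr>) (simplex_action k) \<sigma>\<rparr> \<cong> B"
  proof
    fix \<sigma> assume \<sigma>: "\<sigma> \<in> building_simplices k"
    obtain g where g: "g \<in> H" "simplex_action k g \<sigma> = \<sigma>0" using o[OF \<sigma>] by blast
    have st: "stabilizer (PGL3\<lparr>carrier := H\<rparr>) (simplex_action k) \<sigma>0 = S"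
      using o[OF \<sigma>] S(1) by (simp add: stabilizer_def simplex_action_def)
    have "PGL3\<lparr>carrier := stabilizer (PGL3\<lparr>carrier := H\<rparr>) (simplex_action k) \<sigma>\<rparr> \<cong>
        PGL3\<lparr>carrier := stabilizer (PGL3\<lparr>carrier := H\<rparr>) (simplex_action k) \<sigma>0\<rparr>"
      by (rule stabilizer_conj_iso[OF H simplex_group_action[OF H] \<sigma> g(1) g(2)[symmetric]])
    from iso_trans[OF this[unfolded st] S(2)]
    show "PGL3\<lparr>carrier := stabilizer (PGL3\<lparr>carrier := H\<rparr>) (simplex_action k) \<sigma>\<rparr> \<cong> B" .
  qed
qed

context embedding
begin

lemma vertex_type_shift:
  assumes "g \<in> carrier PGL3"
  shows "\<exists>k. \<forall>v\<in>building_vertices. vertex_type (vertex_map g v) = (vertex_type v + k) mod 3"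
proof -
  obtain A where "invertible A" "g = to_PGL3 A" using PGL3_cases[OF assms] by blast
  then show ?thesis using hg.vertex_type_vertex_map by blast
qed

lemma v_types: "vertex_type v1 = (vertex_type v0 + 1) mod 3" "vertex_type v2 = (vertex_type v0 + 2) mod 3"
  "vertex_type v0 \<in> {0..<3}"
proof -
  have "det h \<noteq> 0" using invertible_h by (simp add: invertible_det_nz)
  then show "vertex_type v1 = (vertex_type v0 + 1) mod 3" "vertex_type v2 = (vertex_type v0 + 2) mod 3"
    unfolding v0_def v1_def v2_def using invertible_h bt_invertible det_bt
    by (simp_all add: vertex_type_of invertible_mult det_mul val_mult mod_simps)
  show "vertex_type v0 \<in> {0..<3}" using hg.vertex_type_range v_vertices(1) .
qed

lemma v_distinct: "v0 \<noteq> v1" "v1 \<noteq> v2" "v0 \<noteq> v2"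
proof -
  have "(vertex_type v0 + 1) mod 3 \<noteq> vertex_type v0" "(vertex_type v0 + 1) mod 3 \<noteq> (vertex_type v0 + 2) mod 3"
    "(vertex_type v0 + 2) mod 3 \<noteq> vertex_type v0"
    using v_types(3) by (simp_all, presburger+)
  then show "v0 \<noteq> v1" "v1 \<noteq> v2" "v0 \<noteq> v2" using v_types(1,2) by metis+
qed

text \<open>An element shifts all types by the same amount, but a flip would shift \<open>v0\<close>
  by 1 and \<open>v1\<close> by -1 modulo 3.\<close>

lemma edge_fix:
  assumes g: "g \<in> carrier PGL3" and e: "vertex_map g ` {v0, v1} = {v0, v1}"
  shows "vertex_map g v0 = v0 \<and> vertex_map g v1 = v1"
proof (rule ccontr)
  assume "\<not> (vertex_map g v0 = v0 \<and> vertex_map g v1 = v1)"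
  then have sw: "vertex_map g v0 = v1" "vertex_map g v1 = v0" using e by (auto simp: doubleton_eq_iff)
  obtain k where k: "\<forall>v\<in>building_vertices. vertex_type (vertex_map g v) = (vertex_type v + k) mod 3"
    using vertex_type_shift[OF g] by blast
  have "vertex_type v1 = (vertex_type v0 + k) mod 3" "vertex_type v0 = (vertex_type v1 + k) mod 3"
    using k v_vertices(1,2) sw by metis+
  then show False using v_types(1) by presburger
qed

text \<open>Fixing \<open>v0\<close> makes the common shift of types zero, and the three vertices
  have distinct types.\<close>

lemma triangle_fix:
  assumes g: "g \<in> carrier PGL3" and e: "vertex_map g ` {v0, v1, v2} = {v0, v1, v2}" and f: "vertex_map g v0 = v0"
  shows "vertex_map g v1 = v1 \<and> vertex_map g v2 = v2"
proof -
  obtain k where k: "\<forall>v\<in>building_vertices. vertex_type (vertex_map g v) = (vertex_type v + k) mod 3"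
    using vertex_type_shift[OF g] by blast
  have k0: "vertex_type v0 = (vertex_type v0 + k) mod 3" using k v_vertices(1) f by metis
  have 1: "vertex_type (vertex_map g v1) = vertex_type v1" "vertex_type (vertex_map g v2) = vertex_type v2"
  proof -
    have "(vertex_type v1 + k) mod 3 = vertex_type v1" "(vertex_type v2 + k) mod 3 = vertex_type v2"
      unfolding v_types(1,2) using k0 by presburger+
    then show "vertex_type (vertex_map g v1) = vertex_type v1" "vertex_type (vertex_map g v2) = vertex_type v2"
      using k v_vertices(2,3) by simp_all
  qed
  have t: "vertex_type v1 \<noteq> vertex_type v0" "vertex_type v1 \<noteq> vertex_type v2" "vertex_type v2 \<noteq> vertex_type v0"
    unfolding v_types(1,2) using v_types(3) by (simp_all, presburger+)
  have "vertex_map g v1 \<in> {v0, v1, v2}" "vertex_map g v2 \<in> {v0, v1, v2}" using e by blast+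
  moreover have "vertex_map g v1 \<notin> {v0, v2}" "vertex_map g v2 \<notin> {v0, v1}" using 1 t by fastforce+
  ultimately show ?thesis by blast
qed

lemma pr_homothety_class:
  fixes X Y :: "adic2^3^3"
  shows
  "vertex_map (pr X) (homothety_class ((*v) (h ** Y) ` L)) = homothety_class ((*v) (h ** (X ** Y)) ` L)"
proof -
  have "h ** X ** matrix_inv h ** (h ** Y) = h ** (X ** Y)"
    by (simp add: matrix_inv_cancel[OF invertible_h] flip: matrix_mul_assoc)
  then show ?thesis unfolding pr_def vertex_map_homothety_class matrix_image_image by simp
qed

lemma v1_hyperplane: "v1 = homothety_class ((*v) (h ** mat 1) ` hyperplane True False False)"
  unfolding v1_def vertex_of_def bt_image[symmetric] matrix_image_image by simp

lemma PIsom_m_closed: "f \<in> PIsom_M \<iota> \<Longrightarrow> g \<in> PIsom_M \<iota> \<Longrightarrow> f \<otimes>\<^bsub>PGL3\<^esub> g \<in> PIsom_M \<iota>"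
  using subgroup.m_closed[OF subgroup_PIsom] .

lemma PIsom_carrier: "g \<in> PIsom_M \<iota> \<Longrightarrow> g \<in> carrier PGL3"
  using subgroup.mem_carrier[OF subgroup_PIsom] .

section \<open>Transitivity on directed edges\<close>

text \<open>The index-2 neighbours of \<open>v0\<close> correspond to the seven nonzero forms,
  through which sigma cycles starting from \<open>v1\<close>.\<close>

lemma neighbour_transitive:
  assumes "(a, b, c) \<noteq> (False, False, False)"
  shows "\<exists>g\<in>PIsom_M \<iota>. vertex_map g v1 = homothety_class ((*v) h ` hyperplane a b c)"
proof -
  define good where "good a b c \<longleftrightarrow>
    (\<exists>g\<in>PIsom_M \<iota>. vertex_map g v1 = homothety_class ((*v) h ` hyperplane a b c))" for a b c
  have "vertex_map \<one>\<^bsub>PGL3\<^esub> v1 = homothety_class ((*v) h ` hyperplane True False False)"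
    using vertex_map_one[OF v_vertices(2)] v1_hyperplane by simp
  then have base: "good True False False"
    unfolding good_def using subgroup.one_closed[OF subgroup_PIsom] by blast
  have step: "good (a \<noteq> c) a b" if g: "good a b c" for a b c
  proof -
    obtain g where g: "g \<in> PIsom_M \<iota>" "vertex_map g v1 = homothety_class ((*v) h ` hyperplane a b c)"
      using g unfolding good_def by blast
    have "vertex_map (pr sg \<otimes>\<^bsub>PGL3\<^esub> g) v1 = vertex_map (pr sg) (homothety_class ((*v) (h ** mat 1) ` hyperplane a b c))"
      using vertex_map_mult[OF PIsom_carrier[OF gens_PIsom(1)] PIsom_carrier[OF g(1)] v_vertices(2)] g(2) by simp
    also have "\<dots> = homothety_class ((*v) h ` hyperplane (a \<noteq> c) a b)"
      unfolding pr_homothety_class sg_hyperplane[symmetric] matrix_image_image by simp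
    finally show ?thesis unfolding good_def using PIsom_m_closed[OF gens_PIsom(1) g(1)] by blast
  qed
  have 1: "good True True False" using step[OF base] by simp
  have 2: "good True True True" using step[OF 1] by simp
  have 3: "good False True True" using step[OF 2] by simp
  have 4: "good True False True" using step[OF 3] by simp
  have 5: "good False True False" using step[OF 4] by simp
  have 6: "good False False True" using step[OF 5] by simp
  have "good a b c" using base 1 2 3 4 5 6 assms by (cases a; cases b; cases c) simp_all
  then show ?thesis unfolding good_def .
qed

text \<open>Vertex transitivity brings \<open>x\<close> to \<open>v0\<close>; the other end is
  adjusted by an element fixing \<open>v0\<close>.\<close>

lemma arrow_transitive:
  assumes x: "x \<in> building_vertices" and y: "y \<in> building_vertices" and ar: "arrow x y"
  shows "\<exists>g\<in>PGamma_M \<iota>. x = vertex_map g v0 \<and> y = vertex_map g v1"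
proof -
  obtain k where k: "k \<in> PGamma_M \<iota>" "vertex_map k v0 = x"
    using vertex_transitive[OF x] generate_gens_PGamma by blast
  let ?i = "inv\<^bsub>PGL3\<^esub> k"
  have kc: "k \<in> carrier PGL3" "?i \<in> carrier PGL3" using k(1) PGamma_carrier by auto
  have "vertex_map ?i x = v0"
    unfolding k(2)[symmetric] vertex_map_mult[OF kc(2,1) v_vertices(1), symmetric]
    using kc(1) vertex_map_one[OF v_vertices(1)] by simp
  then have "arrow (vertex_of h) (vertex_map ?i y)"
    using arrow_vertex_map[OF kc(2) ar] unfolding v0_def by simp
  then obtain a b c where abc: "(a, b, c) \<noteq> (False, False, False)"
      "vertex_map ?i y = homothety_class ((*v) h ` hyperplane a b c)"
    using arrow_obtain[OF invertible_h vertex_map_closed[OF kc(2) y]] by blast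
  obtain f where f: "f \<in> PIsom_M \<iota>" "vertex_map f v1 = vertex_map ?i y"
    using neighbour_transitive[OF abc(1)] unfolding abc(2) by blast
  have fc: "f \<in> carrier PGL3" using PIsom_carrier[OF f(1)] .
  have "vertex_map k (vertex_map ?i y) = y"
    using vertex_map_mult[OF kc y] kc(1) vertex_map_one[OF y] by simp
  then have "y = vertex_map (k \<otimes>\<^bsub>PGL3\<^esub> f) v1" using vertex_map_mult[OF kc(1) fc v_vertices(2)] f(2) by simp
  moreover have "x = vertex_map (k \<otimes>\<^bsub>PGL3\<^esub> f) v0"
    using vertex_map_mult[OF kc(1) fc v_vertices(1)] PIsom_v0[OF f(1)] k(2) by simp
  moreover have "k \<otimes>\<^bsub>PGL3\<^esub> f \<in> PGamma_M \<iota>"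
    using subgroup.m_closed[OF subgroup_PGamma k(1)] f(1) PIsom_subset by blast
  ultimately show ?thesis by blast
qed

section \<open>Stabilizers of the base edge and the base triangle\<close>

abbreviation "\<rho> \<equiv> pr rh"
abbreviation "\<beta> \<equiv> pr bt"

lemma rh_powers: "R 0 = mat 1" "R 1 = rh" "R 2 = rh ** rh"
  using ppow_I(1)[OF prho_unitary, of 0] ppow_I(1)[OF prho_unitary, of 1] ppow_I(3)[OF prho_unitary]
  by (simp_all add: numeral_2_eq_2)

lemma rho_carrier: "\<rho> \<in> carrier PGL3" and beta_carrier: "\<beta> \<in> carrier PGL3"
  using pr_closed rh_invertible bt_invertible by simp_all

lemma rho_cube: "\<rho> \<otimes>\<^bsub>PGL3\<^esub> (\<rho> \<otimes>\<^bsub>PGL3\<^esub> \<rho>) = \<one>\<^bsub>PGL3\<^esub>"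
proof -
  have "R 3 = rh ** (rh ** rh)" using ppow_I(1)[OF prho_unitary, of 2] rh_powers(3) by (simp add: numeral_3_eq_3 numeral_2_eq_2)
  then have "rh ** (rh ** rh) = mat 1" using prho_3 pmat_of_pone I_mat[of 1] iota_1 by simp
  then show ?thesis by (simp add: pr_mult rh_invertible invertible_mult pr_one)
qed

lemma rho_v1: "vertex_map \<rho> v1 = v1"
proof -
  have "(*v) (rh ** bt) ` Z3 = (*v) bt ` Z3"
    unfolding matrix_image_image[symmetric] bt_image by (rule rh_hyperplane)
  then show ?thesis unfolding v1_def pr_vertex by (rule vertex_of_mult_image)
qed

lemma rh_bt: "rh ** bt = bt ** nu"
proof -
  have "I (pmat_of prho ** beta) = rh ** bt"
    using prho_unitary unitary_O_lam_half beta_unitary by (intro I_unitary_mult[OF lam_ring_O_half]) blast+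
  moreover have "I (beta ** pmat_of pnu) = bt ** nu"
    using pnu_unitary unitary_O_lam_half beta_unitary by (intro I_unitary_mult[OF lam_ring_O_half]) blast+
  ultimately show ?thesis unfolding rho_beta by simp
qed

text \<open>The vertices completing the base edge to a triangle come from forms with last
  coefficient 0 (\<open>third_vertex\<close>); on these rho acts through \<open>nu\<close> as a
  3-cycle.\<close>

lemma rho_third:
  "vertex_map \<rho> (homothety_class ((*v) (h ** bt) ` hyperplane a b False)) =
    homothety_class ((*v) (h ** bt) ` hyperplane (a \<noteq> b) a False)"
  unfolding pr_homothety_class rh_bt nu_hyperplane[symmetric] matrix_image_image by (simp add: matrix_mul_assoc)

lemma v2_hyperplane: "v2 = homothety_class ((*v) (h ** bt) ` hyperplane True False False)"
  unfolding v2_def vertex_of_def bt_image[symmetric] matrix_image_image by (simp add: matrix_mul_assoc)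

text \<open>The determinants have equal valuation, so equality of vertices would be equality of
  lattices. Cancelling \<open>h ** bt\<close> would make \<open>nu\<close> fix the form (1, 0, 0),
  which it sends to (1, 1, 0).\<close>

lemma rho_v2: "vertex_map \<rho> v2 \<noteq> v2"
proof
  assume "vertex_map \<rho> v2 = v2"
  then have eq: "vertex_of (h ** (rh ** (bt ** bt))) = vertex_of (h ** (bt ** bt))" unfolding v2_def pr_vertex .
  have nz: "det h \<noteq> 0" "det rh \<noteq> 0" "det bt \<noteq> 0"
    using invertible_h rh_invertible bt_invertible by (simp_all add: invertible_det_nz)
  have img: "(*v) (h ** (rh ** (bt ** bt))) ` Z3 = (*v) (h ** (bt ** bt)) ` Z3"
    using nz I_O_lam_ints(4)[OF prho_unitary] invertible_h rh_invertible bt_invertible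
    by (intro vertex_of_eq_val[OF _ _ eq]) (simp_all add: invertible_mult det_mul val_mult)
  have "rh ** (bt ** bt) = bt ** (nu ** bt)" by (simp only: matrix_mul_assoc rh_bt)
  then have e: "h ** (rh ** (bt ** bt)) = h ** bt ** (nu ** bt)" by (simp only: matrix_mul_assoc)
  have "(*v) (h ** bt) ` ((*v) nu ` ((*v) bt ` Z3)) = (*v) (h ** bt) ` ((*v) bt ` Z3)"
    using img unfolding e by (simp only: matrix_image_image matrix_mul_assoc)
  then have "(*v) nu ` ((*v) bt ` Z3) = (*v) bt ` Z3"
    using matrix_image_inv(1)[OF invertible_mult[OF invertible_h bt_invertible]] by metis
  then show False unfolding bt_image nu_hyperplane hyperplane_inject by simp
qed

lemma rho_not_one: "\<rho> \<noteq> \<one>\<^bsub>PGL3\<^esub>"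
  using rho_v2 vertex_map_one[OF v_vertices(3)] by auto

lemma rho_square_v2: "vertex_map (\<rho> \<otimes>\<^bsub>PGL3\<^esub> \<rho>) v2 \<noteq> v2"
proof
  assume f: "vertex_map (\<rho> \<otimes>\<^bsub>PGL3\<^esub> \<rho>) v2 = v2"
  have "vertex_map \<rho> (vertex_map (\<rho> \<otimes>\<^bsub>PGL3\<^esub> \<rho>) v2) = v2"
    using vertex_map_mult[OF rho_carrier _ v_vertices(3), of "\<rho> \<otimes>\<^bsub>PGL3\<^esub> \<rho>"] rho_carrier rho_cube
      vertex_map_one[OF v_vertices(3)] by simp
  then show False using rho_v2 unfolding f by simp
qed

lemma beta_not_one: "\<beta> \<noteq> \<one>\<^bsub>PGL3\<^esub>"
  using pr_bt_act(1) vertex_map_one[OF v_vertices(1)] v_distinct(1) by auto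

lemma funpow_sg_hyperplane: "(*v) (S n) ` hyp x = hyp ((sigma_step ^^ n) x)"
proof (induction n)
  case 0
  show ?case unfolding ppow_I(3)[OF psigma_unitary] by simp
next
  case (Suc n)
  obtain a b c where y: "(sigma_step ^^ n) x = (a, b, c)" by (rule prod_cases3)
  show ?case unfolding ppow_I(1)[OF psigma_unitary] matrix_image_image[symmetric] Suc funpow.simps o_apply y
    using sg_hyperplane[of a b c] by (simp add: hyp_def sigma_step_def)
qed

text \<open>Fixing \<open>v1\<close> amounts to fixing the form (1, 0, 0). Powers of rho do so,
  hence so must sigma^a; as the orbit under sigma has length 7, \<open>a\<close> is 0.\<close>

lemma PIsom_fix_v1:
  assumes g: "g \<in> PIsom_M \<iota>" and fix1: "vertex_map g v1 = v1"
  shows "g \<in> {\<one>\<^bsub>PGL3\<^esub>, \<rho>, \<rho> \<otimes>\<^bsub>PGL3\<^esub> \<rho>}"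
proof -
  obtain a i where ai: "a < 7" "i < 3" "g = pr (I (frob a i))" using g unfolding PIsom_frob by auto
  let ?F = "I (frob a i)"
  have eq: "vertex_of (h ** (?F ** bt)) = vertex_of (h ** bt)" using fix1 unfolding v1_def ai(3) pr_vertex .
  have nz: "det h \<noteq> 0" "det ?F \<noteq> 0" "det bt \<noteq> 0"
    using invertible_h frob_invertible bt_invertible by (simp_all add: invertible_det_nz)
  have "(*v) (h ** (?F ** bt)) ` Z3 = (*v) (h ** bt) ` Z3"
    using nz I_O_lam_ints(4)[OF frob_unitary] invertible_h frob_invertible bt_invertible
    by (intro vertex_of_eq_val[OF _ _ eq]) (simp_all add: invertible_mult det_mul val_mult)
  then have "(*v) h ` ((*v) ?F ` ((*v) bt ` Z3)) = (*v) h ` ((*v) bt ` Z3)" by (simp add: matrix_image_image)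
  then have F: "(*v) ?F ` hyperplane True False False = hyperplane True False False"
    unfolding bt_image using matrix_image_inv(1)[OF invertible_h] by metis
  have R: "(*v) (R i) ` hyperplane True False False = hyperplane True False False"
  proof (induction i)
    case 0
    show ?case unfolding ppow_I(3)[OF prho_unitary] by simp
  next
    case (Suc i)
    show ?case unfolding ppow_I(1)[OF prho_unitary] matrix_image_image[symmetric] Suc by (rule rh_hyperplane)
  qed
  have "hyp ((sigma_step ^^ a) (True, False, False)) = hyp (True, False, False)"
    using F R funpow_sg_hyperplane[of a "(True, False, False)"]
    unfolding I_frob matrix_image_image[symmetric] by (simp add: hyp_def)
  then have "(sigma_step ^^ a) (True, False, False) = (True, False, False)"
    by (cases "(sigma_step ^^ a) (True, False, False)") (simp add: hyp_def hyperplane_inject)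
  then have "a \<notin> set [1..<7]" using sigma_step_orbit unfolding list_all_iff by blast
  then have "a = 0" using ai(1) by simp
  then have "g = pr (R i)" unfolding ai(3) I_frob using ppow_I(3)[OF psigma_unitary] by simp
  moreover have "i = 0 \<or> i = 1 \<or> i = 2" using ai(2) by auto
  ultimately show ?thesis using rh_powers by (auto simp: pr_one pr_mult rh_invertible)
qed

lemma edge_stabilizer:
  "{g \<in> PGamma_M \<iota>. vertex_map g ` {v0, v1} = {v0, v1}} = {\<one>\<^bsub>PGL3\<^esub>, \<rho>, \<rho> \<otimes>\<^bsub>PGL3\<^esub> \<rho>}"
proof (intro equalityI subsetI)
  fix g assume "g \<in> {g \<in> PGamma_M \<iota>. vertex_map g ` {v0, v1} = {v0, v1}}"
  then have g: "g \<in> PGamma_M \<iota>" "vertex_map g ` {v0, v1} = {v0, v1}" by simp_all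
  have f: "vertex_map g v0 = v0 \<and> vertex_map g v1 = v1" using g PGamma_carrier by (intro edge_fix) auto
  then show "g \<in> {\<one>\<^bsub>PGL3\<^esub>, \<rho>, \<rho> \<otimes>\<^bsub>PGL3\<^esub> \<rho>}" using PIsom_fix_v1 stabilizer_v0[OF g(1)] by blast
next
  fix g assume g: "g \<in> {\<one>\<^bsub>PGL3\<^esub>, \<rho>, \<rho> \<otimes>\<^bsub>PGL3\<^esub> \<rho>}"
  have P: "g \<in> PIsom_M \<iota>"
    using g gens_PIsom(2) PIsom_m_closed[OF gens_PIsom(2) gens_PIsom(2)] subgroup.one_closed[OF subgroup_PIsom] by auto
  have "vertex_map g v1 = v1"
    using g rho_v1 vertex_map_one[OF v_vertices(2)] vertex_map_mult[OF rho_carrier rho_carrier v_vertices(2)] by auto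
  then show "g \<in> {g \<in> PGamma_M \<iota>. vertex_map g ` {v0, v1} = {v0, v1}}"
    using P PIsom_v0[OF P] PIsom_subset by auto
qed

text \<open>By types such an element fixes all three vertices, so it is a power of rho; but rho and
  its square move \<open>v2\<close>.\<close>

lemma triangle_rigid:
  assumes g: "g \<in> PGamma_M \<iota>" "vertex_map g ` {v0, v1, v2} = {v0, v1, v2}" "vertex_map g v0 = v0"
  shows "g = \<one>\<^bsub>PGL3\<^esub>"
proof -
  have f: "vertex_map g v1 = v1 \<and> vertex_map g v2 = v2" using g PGamma_carrier by (intro triangle_fix) auto
  then have "g \<in> {\<one>\<^bsub>PGL3\<^esub>, \<rho>, \<rho> \<otimes>\<^bsub>PGL3\<^esub> \<rho>}" using stabilizer_v0[OF g(1,3)] by (intro PIsom_fix_v1) auto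
  then show ?thesis using f rho_v2 rho_square_v2 by auto
qed

text \<open>A stabilizing element composed with a suitable power of beta fixes \<open>v0\<close>,
  where \<open>triangle_rigid\<close> applies.\<close>

lemma triangle_stabilizer:
  "{g \<in> PGamma_M \<iota>. vertex_map g ` {v0, v1, v2} = {v0, v1, v2}} = {\<one>\<^bsub>PGL3\<^esub>, \<beta>, \<beta> \<otimes>\<^bsub>PGL3\<^esub> \<beta>}"
proof -
  let ?T = "{v0, v1, v2}"
  have T: "?T \<subseteq> building_vertices" using v_vertices by simp
  have b: "vertex_map \<beta> ` ?T = ?T" using pr_bt_act by auto
  have comp: "vertex_map (k \<otimes>\<^bsub>PGL3\<^esub> g) ` ?T = vertex_map k ` (vertex_map g ` ?T)"
    if "k \<in> carrier PGL3" "g \<in> carrier PGL3" for k g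
    unfolding image_image using vertex_map_mult[OF that] T by (intro image_cong) auto
  have bb: "vertex_map (\<beta> \<otimes>\<^bsub>PGL3\<^esub> \<beta>) ` ?T = ?T" unfolding comp[OF beta_carrier beta_carrier] b b ..
  have bbG: "\<beta> \<otimes>\<^bsub>PGL3\<^esub> \<beta> \<in> PGamma_M \<iota>" using subgroup.m_closed[OF subgroup_PGamma] PGamma_pr_bt by blast
  show ?thesis
  proof (intro equalityI subsetI)
    fix g assume "g \<in> {g \<in> PGamma_M \<iota>. vertex_map g ` ?T = ?T}"
    then have g: "g \<in> PGamma_M \<iota>" "vertex_map g ` ?T = ?T" by simp_all
    have gc: "g \<in> carrier PGL3" using g(1) PGamma_carrier by blast
    have rigid: "k \<otimes>\<^bsub>PGL3\<^esub> g = \<one>\<^bsub>PGL3\<^esub>"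
      if k: "k \<in> PGamma_M \<iota>" "vertex_map k ` ?T = ?T" "vertex_map k (vertex_map g v0) = v0" for k
    proof (rule triangle_rigid)
      have kc: "k \<in> carrier PGL3" using k(1) PGamma_carrier by blast
      show "k \<otimes>\<^bsub>PGL3\<^esub> g \<in> PGamma_M \<iota>" using subgroup.m_closed[OF subgroup_PGamma k(1) g(1)] .
      show "vertex_map (k \<otimes>\<^bsub>PGL3\<^esub> g) ` ?T = ?T" unfolding comp[OF kc gc] g(2) k(2) ..
      show "vertex_map (k \<otimes>\<^bsub>PGL3\<^esub> g) v0 = v0" using vertex_map_mult[OF kc gc v_vertices(1)] k(3) by simp
    qed
    have bbv: "vertex_map (\<beta> \<otimes>\<^bsub>PGL3\<^esub> \<beta>) v1 = v0"
      using vertex_map_mult[OF beta_carrier beta_carrier v_vertices(2)] pr_bt_act by simp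
    have bi: "\<beta> \<otimes>\<^bsub>PGL3\<^esub> \<beta> \<otimes>\<^bsub>PGL3\<^esub> \<beta> = \<one>\<^bsub>PGL3\<^esub>" using pr_bt_cube beta_carrier by (simp add: PGL3.m_assoc)
    have "vertex_map g v0 \<in> ?T" using g(2) by blast
    then consider "vertex_map g v0 = v0" | "vertex_map g v0 = v1" | "vertex_map g v0 = v2" by blast
    then show "g \<in> {\<one>\<^bsub>PGL3\<^esub>, \<beta>, \<beta> \<otimes>\<^bsub>PGL3\<^esub> \<beta>}"
    proof cases
      case 1
      then show ?thesis using triangle_rigid[OF g] by simp
    next
      case 2
      have "\<beta> \<otimes>\<^bsub>PGL3\<^esub> \<beta> \<otimes>\<^bsub>PGL3\<^esub> g = \<beta> \<otimes>\<^bsub>PGL3\<^esub> \<beta> \<otimes>\<^bsub>PGL3\<^esub> \<beta>"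
        unfolding bi using bbv 2 by (intro rigid[OF bbG bb]) simp
      then have "g = \<beta>" using iffD1[OF PGL3.Units_l_cancel] gc beta_carrier PGL3.Units_eq PGL3.m_closed by metis
      then show ?thesis by simp
    next
      case 3
      have "\<beta> \<otimes>\<^bsub>PGL3\<^esub> g = \<beta> \<otimes>\<^bsub>PGL3\<^esub> (\<beta> \<otimes>\<^bsub>PGL3\<^esub> \<beta>)"
        unfolding pr_bt_cube using pr_bt_act(3) 3 by (intro rigid[OF PGamma_pr_bt b]) simp
      then have "g = \<beta> \<otimes>\<^bsub>PGL3\<^esub> \<beta>" using iffD1[OF PGL3.Units_l_cancel] gc beta_carrier PGL3.Units_eq PGL3.m_closed by metis
      then show ?thesis by simp
    qed
  next
    fix g assume "g \<in> {\<one>\<^bsub>PGL3\<^esub>, \<beta>, \<beta> \<otimes>\<^bsub>PGL3\<^esub> \<beta>}"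
    moreover have "vertex_map \<one>\<^bsub>PGL3\<^esub> ` ?T = ?T" using vertex_map_one v_vertices by simp
    ultimately show "g \<in> {g \<in> PGamma_M \<iota>. vertex_map g ` ?T = ?T}"
      using b bb bbG PGamma_pr_bt subgroup.one_closed[OF subgroup_PGamma] by auto
  qed
qed

section \<open>The triangles on a given edge\<close>

text \<open>Going down from \<open>v0\<close> through \<open>v1\<close> and \<open>w\<close> back to
  \<open>v0\<close> yields \<open>mu\<close> times the starting lattice. Hence \<open>mu\<close>
  times the first standard vector, which is \<open>bt\<close> of the third one, lies in
  \<open>bt\<close> of the hyperplane; the form therefore vanishes on the third standard
  vector.\<close>

lemma third_vertex:
  assumes w: "w \<in> building_vertices" and ar: "arrow v1 w" "arrow w v0"
  shows "\<exists>a b. (a, b) \<noteq> (False, False) \<and> w = homothety_class ((*v) (h ** bt) ` hyperplane a b False)"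
proof -
  have hb: "invertible (h ** bt)" using invertible_h bt_invertible by (rule invertible_mult)
  obtain a b c where abc: "(a, b, c) \<noteq> (False, False, False)" "w = homothety_class ((*v) (h ** bt) ` hyperplane a b c)"
    using arrow_obtain[OF hb w] ar(1) unfolding v1_def by blast
  obtain t where t: "invertible t" "(*v) t ` Z3 = hyperplane a b c" "val (det t) = 1"
    using hg.D_hyperplane[OF abc(1)] by blast
  have wt: "w = vertex_of (h ** bt ** t)" unfolding abc(2) t(2)[symmetric] vertex_of_def matrix_image_image ..
  have hbt: "invertible (h ** bt ** t)" using hb t(1) by (rule invertible_mult)
  obtain p q r where pqr: "(p, q, r) \<noteq> (False, False, False)" "v0 = homothety_class ((*v) (h ** bt ** t) ` hyperplane p q r)"
    using arrow_obtain[OF hbt v_vertices(1)] ar(2) unfolding wt by blast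
  obtain t' where t': "invertible t'" "(*v) t' ` Z3 = hyperplane p q r" "val (det t') = 1"
    using hg.D_hyperplane[OF pqr(1)] by blast
  have "v0 = vertex_of (h ** bt ** t ** t')" unfolding pqr(2) t'(2)[symmetric] vertex_of_def matrix_image_image ..
  \<comment> \<open>Scaling by \<open>mu\<close> equalizes the valuations of the determinants: three
    for the scalar, one each for \<open>bt\<close>, \<open>t\<close> and \<open>t'\<close>.\<close>
  then have eq: "vertex_of (mat mu ** h) = vertex_of (h ** bt ** t ** t')"
    using vertex_of_scale[OF mu(1), of h] by (simp add: v0_def)
  have nz: "det h \<noteq> 0" "det t \<noteq> 0" "det t' \<noteq> 0"
    using invertible_h t(1) t'(1) by (simp_all add: invertible_det_nz)
  have "(*v) (mat mu ** h) ` Z3 = (*v) (h ** bt ** t ** t') ` Z3"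
    using nz det_bt t t' mu(1,2) invertible_h hbt
    by (intro vertex_of_eq_val[OF _ _ eq]) (simp_all add: invertible_mult invertible_mat det_mul det_mat val_mult val_power)
  moreover have "mat mu ** h = h ** mat mu" by (rule mat_commute)
  ultimately have "(*v) h ` ((*v) (mat mu) ` Z3) = (*v) h ` ((*v) bt ` ((*v) t ` ((*v) t' ` Z3)))"
    by (simp add: matrix_image_image matrix_mul_assoc)
  then have "(*v) (mat mu) ` Z3 = (*v) bt ` ((*v) t ` ((*v) t' ` Z3))"
    using matrix_image_inv(1)[OF invertible_h] by metis
  also have "\<dots> \<subseteq> (*v) bt ` hyperplane a b c"
    unfolding t(2)[symmetric] t'(2) using hyperplane_subset by (intro image_mono)
  finally have sub: "(*v) (mat mu) ` Z3 \<subseteq> (*v) bt ` hyperplane a b c" .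
  have "(axis 1 1 :: adic2^3) \<in> Z3" by (simp add: Z3_def axis_def)
  then have "mat mu *v axis 1 1 \<in> (*v) bt ` hyperplane a b c" using sub by blast
  then obtain z where z: "z \<in> hyperplane a b c" "mat mu *v axis 1 1 = bt *v z" by (rule imageE)
  have m: "mat mu *v axis 1 1 = (mu *s axis 1 1 :: adic2^3)" by (rule mat_vector_mult)
  have "mu = mu * z$3 \<and> z$1 = 0 \<and> z$2 = 0"
    using z(2) unfolding m vec_eq_iff forall_3 bt_vector by (simp add: axis_def)
  then have "z$3 = 1" "z$1 = 0" "z$2 = 0" using mu(1) by simp_all
  then have c: "c = False" using z(1) by (simp add: hyperplane_def)
  have "(a, b) \<noteq> (False, False)" using abc(1) unfolding c by simp
  moreover have "w = homothety_class ((*v) (h ** bt) ` hyperplane a b False)" using abc(2) unfolding c .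
  ultimately show ?thesis by (intro exI conjI)
qed

lemma third_vertex_transitive:
  assumes "w \<in> building_vertices" "arrow v1 w" "arrow w v0"
  shows "\<exists>g\<in>{\<one>\<^bsub>PGL3\<^esub>, \<rho>, \<rho> \<otimes>\<^bsub>PGL3\<^esub> \<rho>}. w = vertex_map g v2"
proof -
  define W where "W a b = homothety_class ((*v) (h ** bt) ` hyperplane a b False)" for a b
  obtain a b where ab: "(a, b) \<noteq> (False, False)" "w = W a b" using third_vertex[OF assms] unfolding W_def[symmetric] by (elim exE conjE)
  have s: "vertex_map \<rho> (W a b) = W (a \<noteq> b) a" for a b unfolding W_def by (rule rho_third)
  have 0: "v2 = W True False" unfolding W_def by (rule v2_hyperplane)
  have 1: "vertex_map \<one>\<^bsub>PGL3\<^esub> v2 = W True False" using vertex_map_one[OF v_vertices(3)] unfolding 0 .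
  have 2: "vertex_map \<rho> v2 = W True True" unfolding 0 s by simp
  have 3: "vertex_map (\<rho> \<otimes>\<^bsub>PGL3\<^esub> \<rho>) v2 = W False True"
    unfolding vertex_map_mult[OF rho_carrier rho_carrier v_vertices(3)] 2 s by simp
  show ?thesis using ab 1 2 3 by (cases a; cases b) auto
qed

lemma edge_orbit:
  assumes "\<sigma> \<in> building_edges"
  shows "\<exists>g\<in>PGamma_M \<iota>. \<sigma> = vertex_map g ` {v0, v1}"
proof -
  obtain v w where "v \<in> building_vertices" "w \<in> building_vertices" "\<sigma> = {v, w}" "arrow v w"
    using hg.edge_obtain[OF assms] by (elim exE conjE)
  then show ?thesis using arrow_transitive[of v w] by auto
qed

text \<open>The arrow from \<open>u\<close> to \<open>v\<close> is moved to the base edge; a power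
  of rho, which fixes that edge, matches the third vertex with \<open>v2\<close>.\<close>

lemma triangle_orbit:
  assumes "\<sigma> \<in> building_triangles"
  shows "\<exists>g\<in>PGamma_M \<iota>. \<sigma> = vertex_map g ` {v0, v1, v2}"
proof -
  obtain u v w where uvw: "u \<in> building_vertices" "v \<in> building_vertices" "w \<in> building_vertices"
      "\<sigma> = {u, v, w}" "arrow u v" "arrow v w" "arrow w u"
    using hg.triangle_obtain[OF assms] by (elim exE conjE)
  obtain k where k: "k \<in> PGamma_M \<iota>" "u = vertex_map k v0" "v = vertex_map k v1"
    using arrow_transitive[OF uvw(1,2,5)] by blast
  let ?i = "inv\<^bsub>PGL3\<^esub> k"
  have kc: "k \<in> carrier PGL3" "?i \<in> carrier PGL3" using k(1) PGamma_carrier by auto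
  have undo: "vertex_map ?i (vertex_map k x) = x" if "x \<in> building_vertices" for x
    using vertex_map_mult[OF kc(2,1) that] kc(1) vertex_map_one[OF that] by simp
  have w': "vertex_map ?i w \<in> building_vertices" using vertex_map_closed[OF kc(2) uvw(3)] .
  have "arrow v1 (vertex_map ?i w)" "arrow (vertex_map ?i w) v0"
    using arrow_vertex_map[OF kc(2) uvw(6)] arrow_vertex_map[OF kc(2) uvw(7)] undo v_vertices unfolding k(2,3) by simp_all
  then obtain f where f: "f \<in> {\<one>\<^bsub>PGL3\<^esub>, \<rho>, \<rho> \<otimes>\<^bsub>PGL3\<^esub> \<rho>}" "vertex_map ?i w = vertex_map f v2"
    using third_vertex_transitive[OF w'] by blast
  have fE: "f \<in> PGamma_M \<iota>" "vertex_map f ` {v0, v1} = {v0, v1}" using f(1) unfolding edge_stabilizer[symmetric] by simp_all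
  have fc: "f \<in> carrier PGL3" using fE(1) PGamma_carrier by blast
  have ff: "vertex_map f v0 = v0" "vertex_map f v1 = v1" using edge_fix[OF fc fE(2)] by simp_all
  have "vertex_map k (vertex_map ?i w) = w" using vertex_map_mult[OF kc uvw(3)] kc(1) vertex_map_one[OF uvw(3)] by simp
  then have "w = vertex_map (k \<otimes>\<^bsub>PGL3\<^esub> f) v2" unfolding f(2) vertex_map_mult[OF kc(1) fc v_vertices(3)] by simp
  moreover have "u = vertex_map (k \<otimes>\<^bsub>PGL3\<^esub> f) v0" "v = vertex_map (k \<otimes>\<^bsub>PGL3\<^esub> f) v1"
    using vertex_map_mult[OF kc(1) fc] v_vertices ff k by simp_all
  ultimately have "\<sigma> = vertex_map (k \<otimes>\<^bsub>PGL3\<^esub> f) ` {v0, v1, v2}" unfolding uvw(4) by simp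
  then show ?thesis using subgroup.m_closed[OF subgroup_PGamma k(1) fE(1)] by blast
qed

lemma edge_action:
  "transitive_action (PGL3\<lparr>carrier := PGamma_M \<iota>\<rparr>) building_edges (simplex_action 1)"
  "\<forall>\<sigma>\<in>building_edges. PGL3\<lparr>carrier := stabilizer (PGL3\<lparr>carrier := PGamma_M \<iota>\<rparr>) (simplex_action 1) \<sigma>\<rparr>
    \<cong> integer_mod_group 3"
  using simplex_action_orbit[OF subgroup_PGamma _ edge_orbit edge_stabilizer
      cyclic_group_3_iso[OF rho_carrier rho_not_one rho_cube refl]] v_vertices by simp_all

lemma triangle_action:
  "transitive_action (PGL3\<lparr>carrier := PGamma_M \<iota>\<rparr>) building_triangles (simplex_action 2)"
  "\<forall>\<sigma>\<in>building_triangles. PGL3\<lparr>carrier := stabilizer (PGL3\<lparr>carrier := PGamma_M \<iota>\<rparr>) (simplex_action 2) \<sigma>\<rparr>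
    \<cong> integer_mod_group 3"
  using simplex_action_orbit[OF subgroup_PGamma _ triangle_orbit triangle_stabilizer
      cyclic_group_3_iso[OF beta_carrier beta_not_one pr_bt_cube refl]] v_vertices by simp_all

lemma vertex_orbit:
  assumes "v \<in> building_vertices"
  shows "\<exists>g\<in>PGamma_M \<iota>. vertex_map g v = v0"
proof -
  obtain k where k: "k \<in> PGamma_M \<iota>" "vertex_map k v0 = v"
    using vertex_transitive[OF assms] generate_gens_PGamma by blast
  have kc: "k \<in> carrier PGL3" using k(1) PGamma_carrier by blast
  have "vertex_map (inv\<^bsub>PGL3\<^esub> k) v = v0"
    unfolding k(2)[symmetric] using vertex_map_mult[of "inv\<^bsub>PGL3\<^esub> k" k v0] kc v_vertices(1) vertex_map_one by simp
  then show ?thesis using subgroup.m_inv_closed[OF subgroup_PGamma k(1)] by blast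
qed

lemma vertex_action_orbit: "v \<in> building_vertices \<Longrightarrow> \<exists>g\<in>PGamma_M \<iota>. vertex_action g v = v0"
  using vertex_orbit by (simp add: vertex_action_def)

lemma vertex_action_transitive:
  "transitive_action (PGL3\<lparr>carrier := PGamma_M \<iota>\<rparr>) building_vertices vertex_action"
  using transitive_actionI[OF subgroup_PGamma vertex_group_action[OF subgroup_PGamma] vertex_action_orbit] .

lemma vertex_stabilizer: "{g \<in> PGamma_M \<iota>. vertex_map g v0 = v0} = PIsom_M \<iota>"
  using stabilizer_v0 PIsom_v0 PIsom_subset by auto

lemma vertex_stabilizer_iso:
  assumes v: "v \<in> building_vertices"
  shows "PGL3\<lparr>carrier := stabilizer (PGL3\<lparr>carrier := PGamma_M \<iota>\<rparr>) vertex_action v\<rparr> \<cong> F21"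
proof -
  obtain g where g: "g \<in> PGamma_M \<iota>" "vertex_action g v = v0" using vertex_action_orbit[OF v] by blast
  have st: "stabilizer (PGL3\<lparr>carrier := PGamma_M \<iota>\<rparr>) vertex_action v0 = PIsom_M \<iota>"
    unfolding vertex_stabilizer[symmetric] using v_vertices(1) by (simp add: stabilizer_def vertex_action_def)
  show ?thesis
    using iso_trans[OF stabilizer_conj_iso[OF subgroup_PGamma vertex_group_action[OF subgroup_PGamma] v g(1) g(2)[symmetric],
      unfolded st] PIsom_iso] .
qed

end

section \<open>Covolume\<close>

lemma image_Z3_of_adic2_int:
  assumes "invertible (B :: adic2_int^3^3)"
  shows "(*v) (map_matrix of_adic2_int B) ` Z3 = Z3"
proof -
  let ?f = "map_matrix of_adic2_int :: adic2_int^3^3 \<Rightarrow> adic2^3^3"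
  obtain C where "B ** C = mat 1" using assms unfolding invertible_def by blast
  then have BC: "?f B ** ?f C = mat 1"
    by (simp add: map_matrix_of_adic2_int_mat of_adic2_int_1 flip: map_matrix_of_adic2_int_mult)
  have i: "(*v) (?f A) ` Z3 \<subseteq> Z3" for A by (rule integral_matrix_image) simp
  have "(*v) (?f B) ` ((*v) (?f C) ` Z3) \<subseteq> (*v) (?f B) ` Z3" using i by (rule image_mono)
  then have "Z3 \<subseteq> (*v) (?f B) ` Z3" unfolding matrix_image_image BC matrix_image_1 .
  then show ?thesis using i by blast
qed

text \<open>The bridge between \<open>K 0\<close> and the building: a matrix fixing the class of
  \<open>Z3\<close> preserves \<open>Z3\<close> after scaling, so it and its inverse are
  integral.\<close>

lemma PGL3_int_stabilizer:
  "g \<in> PGL3_int \<longleftrightarrow> g \<in> carrier PGL3 \<and> vertex_map g (vertex_of (mat 1)) = vertex_of (mat 1)"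
proof
  assume "g \<in> PGL3_int"
  then obtain B :: "adic2_int^3^3" where B: "invertible B" "g = to_PGL3 (map_matrix of_adic2_int B)"
    unfolding PGL3_int_def by blast
  have "vertex_of (map_matrix of_adic2_int B) = vertex_of (mat 1)"
    unfolding vertex_of_def image_Z3_of_adic2_int[OF B(1)] matrix_image_1 ..
  then show "g \<in> carrier PGL3 \<and> vertex_map g (vertex_of (mat 1)) = vertex_of (mat 1)"
    unfolding B(2) vertex_map_vertex_of using invertible_map_matrix_of_adic2_int[OF B(1)] by simp
next
  assume g: "g \<in> carrier PGL3 \<and> vertex_map g (vertex_of (mat 1)) = vertex_of (mat 1)"
  obtain A where A: "invertible A" "g = to_PGL3 A" using g PGL3_cases by blast
  have one: "invertible (mat 1 :: adic2^3^3)" "matrix_inv (mat 1) = (mat 1 :: adic2^3^3)"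
    using invertible_mat[of 1] matrix_inv_unique[of "mat 1" "mat 1"] by simp_all
  have "vertex_of A = vertex_of (mat 1)" using g unfolding A(2) vertex_map_vertex_of by simp
  then obtain c where c: "c \<noteq> 0" "(*v) (mat c ** A) ` Z3 = Z3"
    using vertex_of_eq_iff[OF A(1) one(1)] unfolding one(2) matrix_mul_lid by blast
  let ?N = "mat c ** A"
  have inv: "invertible ?N" using A(1) c(1) by (simp add: invertible_mult invertible_mat)
  obtain B where B: "?N = map_matrix of_adic2_int B" using integral_matrix_obtain image_Z3_eqD(1)[OF inv c(2)] by blast
  obtain C where C: "matrix_inv ?N = map_matrix of_adic2_int C" using integral_matrix_obtain image_Z3_eqD(2)[OF inv c(2)] by blast
  have "map_matrix of_adic2_int (B ** C) = map_matrix of_adic2_int (mat 1)"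
    "map_matrix of_adic2_int (C ** B) = map_matrix of_adic2_int (mat 1)"
    unfolding map_matrix_of_adic2_int_mult B[symmetric] C[symmetric] map_matrix_of_adic2_int_mat of_adic2_int_1
    using inv by (simp_all only: matrix_inv_left matrix_inv_right)
  then have "invertible B" unfolding map_matrix_of_adic2_int_inject invertible_def by blast
  moreover have "g = to_PGL3 (map_matrix of_adic2_int B)"
    unfolding A(2) B[symmetric] using to_PGL3_scale[OF c(1)] by simp
  ultimately show "g \<in> PGL3_int" unfolding PGL3_int_def by blast
qed

lemma countable_matrices:
  assumes "countable S"
  shows "countable {A :: ('a :: zero)^3^3. \<forall>i j. A$i$j \<in> S}"
proof -
  let ?T = "S \<times> S \<times> S"
  let ?f = "\<lambda>((a, b, c), (d, e, f), (g, h, i)). vector [vector [a, b, c], vector [d, e, f], vector [g, h, i]]"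
  have "{A :: ('a :: zero)^3^3. \<forall>i j. A$i$j \<in> S} \<subseteq> ?f ` (?T \<times> ?T \<times> ?T)"
  proof
    fix A :: "'a^3^3" assume "A \<in> {A. \<forall>i j. A$i$j \<in> S}"
    then have "((A$1$1, A$1$2, A$1$3), (A$2$1, A$2$2, A$2$3), (A$3$1, A$3$2, A$3$3)) \<in> ?T \<times> ?T \<times> ?T" by simp
    moreover have "A = ?f ((A$1$1, A$1$2, A$1$3), (A$2$1, A$2$2, A$2$3), (A$3$1, A$3$2, A$3$3))"
      by (simp add: mat3_eq_iff forall_3)
    ultimately show "A \<in> ?f ` (?T \<times> ?T \<times> ?T)" by (rule rev_image_eqI)
  qed
  moreover have "countable (?f ` (?T \<times> ?T \<times> ?T))" using assms by (intro countable_image countable_SIGMA)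
  ultimately show ?thesis by (rule countable_subset)
qed

lemma countable_Q_lam: "countable Q_lam"
proof -
  have Q: "Q_lam = (\<lambda>(a, b). of_rat a + of_rat b * lam) ` UNIV" by (auto simp: Q_lam_def)
  show ?thesis unfolding Q by (rule countable_image[OF countableI_type])
qed

context embedding
begin

lemma countable_PGamma: "countable (PGamma_M \<iota>)"
proof -
  have "unitary_over O_half \<subseteq> {A. \<forall>i j. A$i$j \<in> Q_lam}" using unitary_Q_lam[OF lam_ring_O_half] by blast
  then have "countable (unitary_over O_half)" using countable_matrices[OF countable_Q_lam] by (rule countable_subset)
  then show ?thesis unfolding PGamma_pr by (rule countable_image)
qed

lemma pr_power:
  assumes M: "pmat_of M \<in> unitary_over O_lam"
  shows "pr (I (pmat_of M)) [^]\<^bsub>PGL3\<^esub> n = pr (I (pmat_of (ppow M n)))"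
proof (induction n)
  case 0
  show ?case unfolding ppow_I(3)[OF M] pr_one by simp
next
  case (Suc n)
  have inv: "invertible (I (pmat_of M))" using I_invertible[OF lam_ring_O_lam M] .
  have "pr (I (pmat_of M)) [^]\<^bsub>PGL3\<^esub> Suc n =
      pr (I (pmat_of M)) \<otimes>\<^bsub>PGL3\<^esub> pr (I (pmat_of M)) [^]\<^bsub>PGL3\<^esub> n"
    by (rule PGL3.nat_pow_Suc2[OF pr_closed[OF inv]])
  then show ?case unfolding Suc ppow_I(1)[OF M] pr_mult[OF inv ppow_I(2)[OF M]] .
qed

lemma gens_torsion: "s \<in> gens \<Longrightarrow> \<exists>n>0. s [^]\<^bsub>PGL3\<^esub> (n :: nat) = \<one>\<^bsub>PGL3\<^esub>"
proof -
  assume s: "s \<in> gens"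
  have "pr sg [^]\<^bsub>PGL3\<^esub> (7 :: nat) = \<one>\<^bsub>PGL3\<^esub>" "pr rh [^]\<^bsub>PGL3\<^esub> (3 :: nat) = \<one>\<^bsub>PGL3\<^esub>"
    unfolding pr_power[OF psigma_unitary] pr_power[OF prho_unitary] psigma_7 prho_3 pmat_of_pone I_mat iota_1 pr_one by simp_all
  note torsion = this
  have bt: "pr bt [^]\<^bsub>PGL3\<^esub> (3 :: nat) = \<one>\<^bsub>PGL3\<^esub>"
    using pr_bt_cube beta_carrier by (simp add: numeral_3_eq_3 PGL3.m_assoc)
  show ?thesis
    using s unfolding gens_def
  proof (elim insertE emptyE)
    assume "s = pr sg"
    then show ?thesis using torsion(1) by (intro exI[of _ 7]) simp
  next
    assume "s = pr rh"
    then show ?thesis using torsion(2) by (intro exI[of _ 3]) simp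
  next
    assume "s = pr bt"
    then show ?thesis using bt by (intro exI[of _ 3]) simp
  qed
qed

section \<open>The intersection with the integral subgroup\<close>

text \<open>Conjugation by this element carries the stabilizer of \<open>v0\<close> to that of the
  standard vertex, which is the intersection with \<open>PGL3_int\<close>.\<close>

definition "gamma0 = (SOME g. g \<in> PGamma_M \<iota> \<and> vertex_map g v0 = vertex_of (mat 1))"

lemma vertex_of_1: "vertex_of (mat 1) \<in> building_vertices"
  using vertex_of_vertex[of "mat 1"] invertible_mat[of 1] by simp

lemma gamma0: "gamma0 \<in> PGamma_M \<iota>" "vertex_map gamma0 v0 = vertex_of (mat 1)" "gamma0 \<in> carrier PGL3"
proof -
  have "\<exists>g. g \<in> PGamma_M \<iota> \<and> vertex_map g v0 = vertex_of (mat 1)"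
    using vertex_transitive[OF vertex_of_1] generate_gens_PGamma by blast
  from someI_ex[OF this] show "gamma0 \<in> PGamma_M \<iota>" "vertex_map gamma0 v0 = vertex_of (mat 1)"
    unfolding gamma0_def by simp_all
  then show "gamma0 \<in> carrier PGL3" using PGamma_carrier by blast
qed

definition "conj0 f = gamma0 \<otimes>\<^bsub>PGL3\<^esub> f \<otimes>\<^bsub>PGL3\<^esub> inv\<^bsub>PGL3\<^esub> gamma0"

lemma gamma0_inv: "vertex_map (inv\<^bsub>PGL3\<^esub> gamma0) (vertex_of (mat 1)) = v0"
  unfolding gamma0(2)[symmetric]
  using vertex_map_mult[of "inv\<^bsub>PGL3\<^esub> gamma0" gamma0 v0] gamma0(3) v_vertices(1) vertex_map_one by simp

lemma conj0_inj: "f \<in> carrier PGL3 \<Longrightarrow> inv\<^bsub>PGL3\<^esub> gamma0 \<otimes>\<^bsub>PGL3\<^esub> conj0 f \<otimes>\<^bsub>PGL3\<^esub> gamma0 = f"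
  unfolding conj0_def using gamma0(3) by (simp add: PGL3.m_assoc) (simp add: PGL3.m_assoc[symmetric])

lemma PGamma_int: "PGamma_M \<iota> \<inter> PGL3_int = conj0 ` PIsom_M \<iota>"
proof (intro equalityI subsetI)
  fix g assume g: "g \<in> PGamma_M \<iota> \<inter> PGL3_int"
  then have gc: "g \<in> carrier PGL3" using PGamma_carrier by blast
  let ?i = "inv\<^bsub>PGL3\<^esub> gamma0"
  have ic: "?i \<in> carrier PGL3" using gamma0(3) by simp
  let ?f = "?i \<otimes>\<^bsub>PGL3\<^esub> (g \<otimes>\<^bsub>PGL3\<^esub> gamma0)"
  have "vertex_map ?f v0 = v0"
    using g gc ic gamma0 v_vertices(1) gamma0_inv vertex_of_1
    unfolding Int_iff PGL3_int_stabilizer by (simp add: vertex_map_mult)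
  moreover have "?f \<in> PGamma_M \<iota>"
    using g gamma0(1) subgroup.m_closed[OF subgroup_PGamma] subgroup.m_inv_closed[OF subgroup_PGamma] by simp
  ultimately have "?f \<in> PIsom_M \<iota>" using stabilizer_v0 by blast
  moreover have "g = conj0 ?f"
    unfolding conj0_def using gamma0(3) gc by (simp add: PGL3.m_assoc) (simp add: PGL3.m_assoc[symmetric])
  ultimately show "g \<in> conj0 ` PIsom_M \<iota>" by (rule rev_image_eqI)
next
  fix g assume "g \<in> conj0 ` PIsom_M \<iota>"
  then obtain f where f: "f \<in> PIsom_M \<iota>" "g = conj0 f" by blast
  have fc: "f \<in> carrier PGL3" using PIsom_carrier[OF f(1)] .
  have "vertex_map g (vertex_of (mat 1)) = vertex_of (mat 1)"
    unfolding f(2) conj0_def using fc gamma0 v_vertices(1) vertex_of_1 gamma0_inv PIsom_v0[OF f(1)]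
    by (simp add: vertex_map_mult)
  moreover have "g \<in> PGamma_M \<iota>"
    unfolding f(2) conj0_def using f(1) PIsom_subset gamma0(1) subgroup.m_closed[OF subgroup_PGamma]
      subgroup.m_inv_closed[OF subgroup_PGamma] by (simp add: subset_iff)
  ultimately show "g \<in> PGamma_M \<iota> \<inter> PGL3_int" unfolding Int_iff PGL3_int_stabilizer using PGamma_carrier by blast
qed

lemma card_PGamma_int: "card (PGamma_M \<iota> \<inter> PGL3_int) = 21"
proof -
  have "inj_on conj0 (PIsom_M \<iota>)"
    by (rule inj_on_inverseI[where g = "\<lambda>f. inv\<^bsub>PGL3\<^esub> gamma0 \<otimes>\<^bsub>PGL3\<^esub> f \<otimes>\<^bsub>PGL3\<^esub> gamma0"])
      (rule conj0_inj[OF PIsom_carrier])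
  then show ?thesis unfolding PGamma_int using card_image card_PIsom by metis
qed

text \<open>In basis coordinates such an \<open>f\<close> is congruent to 1 modulo 2 up to a scalar,
  and parities single out \<open>frob 0 0\<close> among the 21 matrices.\<close>

lemma frob_congruence:
  assumes f: "f \<in> PIsom_M \<iota>" and k: "inv\<^bsub>PGL3\<^esub> to_PGL3 h \<otimes>\<^bsub>PGL3\<^esub> f \<otimes>\<^bsub>PGL3\<^esub> to_PGL3 h \<in> congruence_subgroup 1"
  shows "f = \<one>\<^bsub>PGL3\<^esub>"
proof -
  obtain a i where ai: "a < 7" "i < 3" "f = pr (I (frob a i))" using f unfolding PIsom_frob by auto
  let ?F = "I (frob a i)"
  have "inv\<^bsub>PGL3\<^esub> to_PGL3 h \<otimes>\<^bsub>PGL3\<^esub> f \<otimes>\<^bsub>PGL3\<^esub> to_PGL3 h = to_PGL3 (matrix_inv h ** (h ** ?F ** matrix_inv h) ** h)"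
    unfolding ai(3) pr_def using invertible_h frob_invertible
    by (simp add: to_PGL3_inv to_PGL3_mult invertible_mult invertible_matrix_inv)
  also have "matrix_inv h ** (h ** ?F ** matrix_inv h) ** h = ?F"
    by (simp add: matrix_inv_cancel[OF invertible_h] matrix_inv_left[OF invertible_h] flip: matrix_mul_assoc)
  finally have "to_PGL3 ?F \<in> congruence_subgroup 1" using k by simp
  then obtain B where B: "B \<in> congruence_matrices 1" "to_PGL3 ?F = to_PGL3 (map_matrix of_adic2_int B)"
    unfolding congruence_subgroup_def by blast
  let ?C = "map_matrix of_adic2_int B"
  obtain c where c: "c \<noteq> 0" "?F = mat c ** ?C" using B(2) unfolding to_PGL3_eq_iff by blast
  have Bi: "invertible B" using B(1) by (simp add: congruence_matrices_def)
  have iC: "invertible ?C" using invertible_map_matrix_of_adic2_int[OF Bi] .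
  obtain P :: "adic2^3^3" where P: "\<forall>i j. P$i$j \<in> adic2_ints" "?C = mat 1 + mat (2 ^ 1) ** P"
    using congruence_matrixD[OF B(1)] by blast
  have "a = 0 \<and> i = 0"
  proof (rule frob_proportional[OF ai(1,2) _ _ c])
    show "?C$k$l \<in> adic2_ints" for k l by simp
    show "det ?C \<noteq> 0" using iC by (simp add: invertible_det_nz)
    show "val (det ?C) = 0" using image_Z3_eqD(3)[OF iC image_Z3_of_adic2_int[OF Bi]] .
    show "even2 (?C$k$l) \<longleftrightarrow> even2 (I (frob 0 0)$k$l)" for k l
    proof -
      have "even2 (2 * P$k$l)" using P(1) even2_iff_half by blast
      moreover have "2 * P$k$l \<in> adic2_ints" using P(1) by (intro adic2_ints_mult) simp_all
      moreover have "(mat 1 :: adic2^3^3)$k$l \<in> adic2_ints" by (simp add: mat_3)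
      ultimately show ?thesis unfolding P(2) frob_0_0 I_mat iota_1 by (simp add: mat_mult_nth even2_add)
    qed
  qed simp_all
  then show ?thesis unfolding ai(3) by (simp add: frob_0_0 I_mat iota_1 pr_one)
qed

text \<open>Elements in a deep congruence subgroup lie in \<open>PGL3_int\<close>, so they are
  conjugates \<open>conj0 f\<close>. Undoing \<open>gamma0\<close> and the base change
  \<open>h\<close> costs finitely many levels, and level 1 already excludes all but the
  identity.\<close>

lemma PGamma_discrete: "\<exists>n. PGamma_M \<iota> \<inter> congruence_subgroup n = {\<one>\<^bsub>PGL3\<^esub>}"
proof -
  let ?i = "inv\<^bsub>PGL3\<^esub> gamma0"
  let ?h = "to_PGL3 h"
  have c: "?h \<in> carrier PGL3" "gamma0 \<in> carrier PGL3" using invertible_h gamma0(3) by simp_all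
  let ?g = "inv\<^bsub>PGL3\<^esub> ?h \<otimes>\<^bsub>PGL3\<^esub> ?i"
  have gc: "?g \<in> carrier PGL3" using c by simp
  obtain m where m: "\<And>k. k \<in> congruence_subgroup m \<Longrightarrow>
      ?g \<otimes>\<^bsub>PGL3\<^esub> k \<otimes>\<^bsub>PGL3\<^esub> inv\<^bsub>PGL3\<^esub> ?g \<in> congruence_subgroup 1"
    using congruence_conj[OF gc] by blast
  have "PGamma_M \<iota> \<inter> congruence_subgroup m \<subseteq> {\<one>\<^bsub>PGL3\<^esub>}"
  proof
    fix k assume k: "k \<in> PGamma_M \<iota> \<inter> congruence_subgroup m"
    then have "k \<in> PGamma_M \<iota> \<inter> PGL3_int"
      using congruence_subgroup_mono[of 0 m] unfolding congruence_subgroup_0 by blast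
    then obtain f where f: "f \<in> PIsom_M \<iota>" "k = conj0 f" unfolding PGamma_int by blast
    have fc: "f \<in> carrier PGL3" using PIsom_carrier[OF f(1)] .
    have "?g \<otimes>\<^bsub>PGL3\<^esub> k \<otimes>\<^bsub>PGL3\<^esub> inv\<^bsub>PGL3\<^esub> ?g = inv\<^bsub>PGL3\<^esub> ?h \<otimes>\<^bsub>PGL3\<^esub> (?i \<otimes>\<^bsub>PGL3\<^esub> conj0 f \<otimes>\<^bsub>PGL3\<^esub> gamma0) \<otimes>\<^bsub>PGL3\<^esub> ?h"
      unfolding f(2) using c fc by (simp add: PGL3.inv_mult_group conj0_def PGL3.m_assoc) (simp add: PGL3.m_assoc[symmetric])
    then have "inv\<^bsub>PGL3\<^esub> ?h \<otimes>\<^bsub>PGL3\<^esub> f \<otimes>\<^bsub>PGL3\<^esub> ?h \<in> congruence_subgroup 1"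
      using m[of k] k unfolding conj0_inj[OF fc] by simp
    then have "f = \<one>\<^bsub>PGL3\<^esub>" by (rule frob_congruence[OF f(1)])
    then show "k \<in> {\<one>\<^bsub>PGL3\<^esub>}" unfolding f(2) conj0_def using c(2) by simp
  qed
  moreover have "\<one>\<^bsub>PGL3\<^esub> \<in> PGamma_M \<iota> \<inter> congruence_subgroup m"
    using subgroup.one_closed[OF subgroup_PGamma] subgroup.one_closed[OF subgroup_congruence] by blast
  ultimately show ?thesis by blast
qed

text \<open>By vertex transitivity some \<open>\<gamma>\<close> moves the standard vertex to its
  image under the inverse of \<open>g\<close>; the product then fixes the standard vertex.\<close>

lemma PGamma_cover:
  assumes g: "g \<in> carrier PGL3"
  shows "\<exists>\<gamma>\<in>PGamma_M \<iota>. g \<otimes>\<^bsub>PGL3\<^esub> \<gamma> \<in> PGL3_int"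
proof -
  let ?o = "vertex_of (mat 1)"
  have ic: "inv\<^bsub>PGL3\<^esub> g \<in> carrier PGL3" using g by simp
  interpret T: transitive_action "PGL3\<lparr>carrier := PGamma_M \<iota>\<rparr>" building_vertices vertex_action
    by (rule vertex_action_transitive)
  obtain \<gamma> where \<gamma>: "\<gamma> \<in> PGamma_M \<iota>" "vertex_map \<gamma> ?o = vertex_map (inv\<^bsub>PGL3\<^esub> g) ?o"
    using T.unique_orbit[OF vertex_of_1 vertex_map_closed[OF ic vertex_of_1]] vertex_of_1
    by (auto simp: vertex_action_def)
  have \<gamma>c: "\<gamma> \<in> carrier PGL3" using \<gamma>(1) PGamma_carrier by blast
  have "vertex_map (g \<otimes>\<^bsub>PGL3\<^esub> \<gamma>) ?o = vertex_map g (vertex_map (inv\<^bsub>PGL3\<^esub> g) ?o)"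
    using vertex_map_mult[OF g \<gamma>c vertex_of_1] \<gamma>(2) by simp
  also have "\<dots> = ?o" using vertex_map_mult[OF g ic vertex_of_1] g vertex_map_one[OF vertex_of_1] by simp
  finally show ?thesis using \<gamma>(1) \<gamma>c g by (intro bexI[of _ \<gamma>]) (simp_all add: PGL3_int_stabilizer)
qed

lemma PGamma_lattice:
  assumes haar: "haar_measure PGL3 PGL3_topology \<mu>" and mass: "emeasure \<mu> PGL3_int = 1"
  shows "lattice_subgroup PGL3 PGL3_topology \<mu> (PGamma_M \<iota>)"
    "has_covolume PGL3 PGL3_topology \<mu> (PGamma_M \<iota>) (1 / 21)"
proof -
  interpret F: filtered_group PGL3 PGL3_topology congruence_subgroup by (rule filtered_PGL3)
  \<comment> \<open>The countable group supplies the representatives modulo \<open>K 0\<close>: the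
    covering property is applied to the inverse of \<open>g\<close>.\<close>
  have "countable (lcosets\<^bsub>PGL3\<^esub> (congruence_subgroup n))" for n
  proof (rule F.countable_lcosets_K[OF countable_PGamma PGamma_carrier])
    fix g assume g: "g \<in> carrier PGL3"
    obtain \<gamma> where \<gamma>: "\<gamma> \<in> PGamma_M \<iota>" "inv\<^bsub>PGL3\<^esub> g \<otimes>\<^bsub>PGL3\<^esub> \<gamma> \<in> congruence_subgroup 0"
      using PGamma_cover[of "inv\<^bsub>PGL3\<^esub> g"] g unfolding congruence_subgroup_0 by auto
    have \<gamma>c: "\<gamma> \<in> carrier PGL3" using \<gamma>(1) PGamma_carrier by blast
    have "inv\<^bsub>PGL3\<^esub> (inv\<^bsub>PGL3\<^esub> g \<otimes>\<^bsub>PGL3\<^esub> \<gamma>) \<in> congruence_subgroup 0"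
      using subgroup.m_inv_closed[OF subgroup_congruence \<gamma>(2)] .
    moreover have "g = \<gamma> \<otimes>\<^bsub>PGL3\<^esub> inv\<^bsub>PGL3\<^esub> (inv\<^bsub>PGL3\<^esub> g \<otimes>\<^bsub>PGL3\<^esub> \<gamma>)"
      using g \<gamma>c by (simp add: PGL3.inv_mult_group PGL3.m_assoc[symmetric])
    ultimately show "\<exists>t\<in>PGamma_M \<iota>. g \<in> t <#\<^bsub>PGL3\<^esub> congruence_subgroup 0"
      using \<gamma>(1) F.mem_l_coset by blast
  qed
  then interpret H: haar_filtered_group PGL3 PGL3_topology congruence_subgroup \<mu>
    using haar mass by unfold_locales (simp_all add: congruence_subgroup_0)
  interpret L: haar_filtered_group_lattice PGL3 PGL3_topology congruence_subgroup \<mu> "PGamma_M \<iota>"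
  proof (intro haar_filtered_group_lattice.intro[OF H.haar_filtered_group_axioms] haar_filtered_group_lattice_axioms.intro)
    show "subgroup (PGamma_M \<iota>) PGL3" "countable (PGamma_M \<iota>)" by (rule subgroup_PGamma countable_PGamma)+
    show "H.modulus \<gamma> = 1" if "\<gamma> \<in> PGamma_M \<iota>" for \<gamma>
      using H.modulus_generate[OF gens_carrier gens_torsion] that PGamma_subset_generate by blast
    show "\<exists>\<gamma>\<in>PGamma_M \<iota>. g \<otimes>\<^bsub>PGL3\<^esub> \<gamma> \<in> congruence_subgroup 0" if "g \<in> carrier PGL3" for g
      using PGamma_cover[OF that] unfolding congruence_subgroup_0 .
    show "finite (PGamma_M \<iota> \<inter> congruence_subgroup 0)"
      unfolding congruence_subgroup_0 by (rule card_ge_0_finite) (simp add: card_PGamma_int)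
    show "\<exists>n. PGamma_M \<iota> \<inter> congruence_subgroup n = {\<one>\<^bsub>PGL3\<^esub>}" by (rule PGamma_discrete)
  qed
  have "L.q = 21" unfolding L.q_def congruence_subgroup_0 by (rule card_PGamma_int)
  then show "lattice_subgroup PGL3 PGL3_topology \<mu> (PGamma_M \<iota>)"
    "has_covolume PGL3 PGL3_topology \<mu> (PGamma_M \<iota>) (1 / 21)"
    using L.lattice L.covolume by simp_all
qed

end

theorem theorem3p1:
  fixes \<iota> :: "complex \<Rightarrow> adic2" and \<mu> :: "(adic2^3^3) set measure"
  assumes "adic2_embedding \<iota>"
    and "haar_measure PGL3 PGL3_topology \<mu>" and "emeasure \<mu> PGL3_int = 1"
  shows "lattice_subgroup PGL3 PGL3_topology \<mu> (PGamma_M \<iota>) \<and>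
    has_covolume PGL3 PGL3_topology \<mu> (PGamma_M \<iota>) (1 / 21) \<and>
    PGL3\<lparr>carrier := PIsom_M \<iota>\<rparr> \<cong> F21 \<and>
    PGamma_M \<iota> = generate PGL3 (PIsom_M \<iota> \<union> {to_PGL3 (map_matrix \<iota> beta_M)}) \<and>
    transitive_action (PGL3\<lparr>carrier := PGamma_M \<iota>\<rparr>) building_vertices vertex_action \<and>
    transitive_action (PGL3\<lparr>carrier := PGamma_M \<iota>\<rparr>) building_edges (simplex_action 1) \<and>
    transitive_action (PGL3\<lparr>carrier := PGamma_M \<iota>\<rparr>) building_triangles (simplex_action 2) \<and>
    (\<forall>v\<in>building_vertices.
      PGL3\<lparr>carrier := stabilizer (PGL3\<lparr>carrier := PGamma_M \<iota>\<rparr>) vertex_action v\<rparr> \<cong> F21) \<and>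
    (\<forall>\<sigma>\<in>building_edges.
      PGL3\<lparr>carrier := stabilizer (PGL3\<lparr>carrier := PGamma_M \<iota>\<rparr>) (simplex_action 1) \<sigma>\<rparr>
        \<cong> integer_mod_group 3) \<and>
    (\<forall>\<sigma>\<in>building_triangles.
      PGL3\<lparr>carrier := stabilizer (PGL3\<lparr>carrier := PGamma_M \<iota>\<rparr>) (simplex_action 2) \<sigma>\<rparr>
        \<cong> integer_mod_group 3)"
proof -
  interpret embedding \<iota> by unfold_locales (rule assms(1))
  have gen: "PGamma_M \<iota> = generate PGL3 (PIsom_M \<iota> \<union> {to_PGL3 (map_matrix \<iota> beta_M)})"
    unfolding to_PGL3_beta_M by (rule PGamma_eq_generate)
  show ?thesis
    by (intro conjI ballI PGamma_lattice[OF assms(2,3)] PIsom_iso gen vertex_action_transitive edge_action(1)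
        triangle_action(1) vertex_stabilizer_iso bspec[OF edge_action(2)] bspec[OF triangle_action(2)])
qed

end
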